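(* Let $N\ge2$, let $\Omega\subset\mathbb{R}^N$ be a bounded radially symmetric domain, let $p>1$ and $\alpha\ge 0$, and let $u\in H^1_0(\Omega)$ be a radial solution to the Hénon problem $$-\Delta u=|x|^\alpha|u|^{p-1}u\ \text{ in }\Omega,\qquad u=0\ \text{ on }\partial\Omega,$$ with $m$ nodal zones. Then $u$ has radial Morse index $m$ and is radially non-degenerate.
   Context: A bounded radially symmetric domain of $\mathbb{R}^N$ is a ball centered at the origin or an annulus $\{a<|x|<b\}$ with $0<a<b<\infty$. Solutions are understood in the weak sense: $\int_\Omega\nabla u\cdot\nabla\varphi\,dx=\int_\Omega|x|^\alpha|u|^{p-1}u\varphi\,dx$ for all $\varphi\in C^1_0(\Omega)$ ($C^1$ functions with compact support in $\Omega$). The nodal zones of $u$ are the connected components of $\{x\in\Omega:u(x)\ne0\}$; $m$ is their number (a positive integer). The linearized operator is $L_u(\psi)=-\Delta\psi-p|x|^\alpha|u|^{p-1}\psi$. The radial Morse index of $u$ is the number of negative eigenvalues of $L_u$ in $H^1_{0,\mathrm{rad}}(\Omega)$, the subspace of radial functions of $H^1_0(\Omega)$; equivalently the maximal dimension of a subspace of $H^1_{0,\mathrm{rad}}(\Omega)$ on which $\int_\Omega(|\nabla\psi|^2-p|x|^\alpha|u|^{p-1}\psi^2)\,dx$ is negative definite. The solution $u$ is radially degenerate if $L_u(\psi)=0$ admits a nontrivial radial solution $\psi\in H^1_0(\Omega)$, and radially non-degenerate otherwise. *)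

theory Defs
  imports "HOL-Analysis.Analysis"
begin

definition bounded_radial_domain :: "(real^'n) set \<Rightarrow> bool" where
  "bounded_radial_domain \<Omega> \<longleftrightarrow>
     (\<exists>R>0. \<Omega> = ball 0 R) \<or> (\<exists>a b. 0 < a \<and> a < b \<and> \<Omega> = {x. a < norm x \<and> norm x < b})"


text \<open>Functions on \<Omega> are total functions on the whole space, of which only the restriction to \<Omega>
  up to null sets matters. Test functions are extended by zero.\<close>

definition C1_0 :: "(real^'n) set \<Rightarrow> (real^'n \<Rightarrow> real) set" where
  "C1_0 \<Omega> = {\<phi>. (\<exists>g. continuous_on UNIV g \<and> (\<forall>x. GDERIV \<phi> x :> g x)) \<and>
                compact (closure {x. \<phi> x \<noteq> 0}) \<and> closure {x. \<phi> x \<noteq> 0} \<subseteq> \<Omega>}"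

definition grad :: "(real^'n \<Rightarrow> real) \<Rightarrow> real^'n \<Rightarrow> real^'n" where
  "grad \<phi> x = (THE g. GDERIV \<phi> x :> g)"

definition L2 :: "(real^'n) set \<Rightarrow> (real^'n \<Rightarrow> 'b::euclidean_space) set" where
  "L2 \<Omega> = {f. f \<in> borel_measurable (lebesgue_on \<Omega>) \<and> integrable (lebesgue_on \<Omega>) (\<lambda>x. (norm (f x))\<^sup>2)}"

definition has_weak_gradient ::
  "(real^'n) set \<Rightarrow> (real^'n \<Rightarrow> real) \<Rightarrow> (real^'n \<Rightarrow> real^'n) \<Rightarrow> bool" where
  "has_weak_gradient \<Omega> u g \<longleftrightarrow>
     (\<forall>\<phi>\<in>C1_0 \<Omega>. integrable (lebesgue_on \<Omega>) (\<lambda>x. u x *\<^sub>R grad \<phi> x) \<and>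
                  integrable (lebesgue_on \<Omega>) (\<lambda>x. \<phi> x *\<^sub>R g x) \<and>
                  (LINT x|lebesgue_on \<Omega>. u x *\<^sub>R grad \<phi> x) = - (LINT x|lebesgue_on \<Omega>. \<phi> x *\<^sub>R g x))"

text \<open>The weak gradient is unique almost everywhere, so the choice below is immaterial.\<close>

definition weak_grad :: "(real^'n) set \<Rightarrow> (real^'n \<Rightarrow> real) \<Rightarrow> real^'n \<Rightarrow> real^'n" where
  "weak_grad \<Omega> u = (SOME g. has_weak_gradient \<Omega> u g)"

definition H1 :: "(real^'n) set \<Rightarrow> (real^'n \<Rightarrow> real) set" where
  "H1 \<Omega> = {u \<in> L2 \<Omega>. \<exists>g \<in> L2 \<Omega>. has_weak_gradient \<Omega> u g}"

text \<open>The closure of the test functions in the norm of \<open>H1 \<Omega>\<close>. Taking compactly supported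
  functions of class \<open>C\<^sup>1\<close> or \<open>C\<^sup>\<infinity>\<close> yields the same space.\<close>

definition H1_0 :: "(real^'n) set \<Rightarrow> (real^'n \<Rightarrow> real) set" where
  "H1_0 \<Omega> = {u \<in> H1 \<Omega>. \<exists>\<phi>::nat \<Rightarrow> real^'n \<Rightarrow> real. (\<forall>n. \<phi> n \<in> C1_0 \<Omega>) \<and>
     (\<lambda>n. LINT x|lebesgue_on \<Omega>. (\<phi> n x - u x)\<^sup>2) \<longlonglongrightarrow> 0 \<and>
     (\<lambda>n. LINT x|lebesgue_on \<Omega>. (norm (grad (\<phi> n) x - weak_grad \<Omega> u x))\<^sup>2) \<longlonglongrightarrow> 0}"

definition H1_0_rad :: "(real^'n) set \<Rightarrow> (real^'n \<Rightarrow> real) set" where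
  "H1_0_rad \<Omega> = {u \<in> H1_0 \<Omega>. \<exists>f. AE x in lebesgue_on \<Omega>. u x = f (norm x)}"


text \<open>Since the Bochner integral of a non-integrable function is \<open>0\<close>, the integrability of the
  nonlinear term is demanded explicitly; that of the gradient term is automatic for \<open>u\<close> in \<open>H1 \<Omega>\<close>.
  The boundary condition is membership in \<open>H1_0 \<Omega>\<close>.\<close>

definition weak_henon_solution ::
  "(real^'n) set \<Rightarrow> real \<Rightarrow> real \<Rightarrow> (real^'n \<Rightarrow> real) \<Rightarrow> bool" where
  "weak_henon_solution \<Omega> \<alpha> p u \<longleftrightarrow> u \<in> H1_0 \<Omega> \<and>
     (\<forall>\<phi>\<in>C1_0 \<Omega>.
        integrable (lebesgue_on \<Omega>) (\<lambda>x. norm x powr \<alpha> * \<bar>u x\<bar> powr (p - 1) * u x * \<phi> x) \<and>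
        (LINT x|lebesgue_on \<Omega>. weak_grad \<Omega> u x \<bullet> grad \<phi> x) =
        (LINT x|lebesgue_on \<Omega>. norm x powr \<alpha> * \<bar>u x\<bar> powr (p - 1) * u x * \<phi> x))"

text \<open>Nodal zones depend on pointwise values, whereas an element of \<open>H1_0 \<Omega>\<close> is given only up to
  null sets. Pointwise values are those of the precise representative, the limit of the averages
  over shrinking balls (\<open>0\<close> where there is no limit). It depends only on the class of the function,
  and on an open set where the function has a continuous representative it is that representative.\<close>

definition ball_average :: "(real^'n \<Rightarrow> real) \<Rightarrow> real^'n \<Rightarrow> real \<Rightarrow> real" where
  "ball_average u x r = (LINT y|lebesgue_on (ball x r). u y) / measure lebesgue (ball x r)"

definition precise_rep :: "(real^'n \<Rightarrow> real) \<Rightarrow> real^'n \<Rightarrow> real" where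
  "precise_rep u x =
     (if \<exists>l. (ball_average u x \<longlongrightarrow> l) (at_right 0) then Lim (at_right 0) (ball_average u x) else 0)"

definition nodal_zones :: "(real^'n) set \<Rightarrow> (real^'n \<Rightarrow> real) \<Rightarrow> (real^'n) set set" where
  "nodal_zones \<Omega> u = components {x \<in> \<Omega>. precise_rep u x \<noteq> 0}"


text \<open>The radial weak solutions \<open>\<psi>\<close> of \<open>L\<^sub>u \<psi> = \<mu> \<psi>\<close>, including \<open>\<psi> = 0\<close>.\<close>

definition radial_eigenspace ::
  "(real^'n) set \<Rightarrow> real \<Rightarrow> real \<Rightarrow> (real^'n \<Rightarrow> real) \<Rightarrow> real \<Rightarrow> (real^'n \<Rightarrow> real) set" where
  "radial_eigenspace \<Omega> \<alpha> p u \<mu> = {\<psi> \<in> H1_0_rad \<Omega>. \<forall>\<phi>\<in>C1_0 \<Omega>.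
     integrable (lebesgue_on \<Omega>) (\<lambda>x. p * norm x powr \<alpha> * \<bar>u x\<bar> powr (p - 1) * \<psi> x * \<phi> x) \<and>
     (LINT x|lebesgue_on \<Omega>. weak_grad \<Omega> \<psi> x \<bullet> grad \<phi> x) -
     (LINT x|lebesgue_on \<Omega>. p * norm x powr \<alpha> * \<bar>u x\<bar> powr (p - 1) * \<psi> x * \<phi> x) =
     \<mu> * (LINT x|lebesgue_on \<Omega>. \<psi> x * \<phi> x)}"

definition radial_eigenvalue ::
  "(real^'n) set \<Rightarrow> real \<Rightarrow> real \<Rightarrow> (real^'n \<Rightarrow> real) \<Rightarrow> real \<Rightarrow> bool" where
  "radial_eigenvalue \<Omega> \<alpha> p u \<mu> \<longleftrightarrow>
     (\<exists>\<psi>\<in>radial_eigenspace \<Omega> \<alpha> p u \<mu>. \<not> (AE x in lebesgue_on \<Omega>. \<psi> x = 0))"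

text \<open>Linear independence modulo equality almost everywhere.\<close>

definition independent_AE :: "(real^'n) set \<Rightarrow> nat \<Rightarrow> (nat \<Rightarrow> real^'n \<Rightarrow> real) \<Rightarrow> bool" where
  "independent_AE \<Omega> k \<psi> \<longleftrightarrow>
     (\<forall>c::nat \<Rightarrow> real. (AE x in lebesgue_on \<Omega>. (\<Sum>i<k. c i * \<psi> i x) = 0) \<longrightarrow> (\<forall>i<k. c i = 0))"

definition radial_multiplicity ::
  "(real^'n) set \<Rightarrow> real \<Rightarrow> real \<Rightarrow> (real^'n \<Rightarrow> real) \<Rightarrow> real \<Rightarrow> enat" where
  "radial_multiplicity \<Omega> \<alpha> p u \<mu> =
     Sup {enat k | k. \<exists>\<psi>. (\<forall>i<k. \<psi> i \<in> radial_eigenspace \<Omega> \<alpha> p u \<mu>) \<and> independent_AE \<Omega> k \<psi>}"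

text \<open>The number of negative eigenvalues, each counted with its multiplicity; the supremum over
  finite sets of eigenvalues is the possibly infinite sum.\<close>

definition radial_Morse_index ::
  "(real^'n) set \<Rightarrow> real \<Rightarrow> real \<Rightarrow> (real^'n \<Rightarrow> real) \<Rightarrow> enat" where
  "radial_Morse_index \<Omega> \<alpha> p u =
     (SUP \<Lambda>\<in>{\<Lambda>. finite \<Lambda> \<and> \<Lambda> \<subseteq> {\<mu>. \<mu> < 0 \<and> radial_eigenvalue \<Omega> \<alpha> p u \<mu>}}.
        \<Sum>\<mu>\<in>\<Lambda>. radial_multiplicity \<Omega> \<alpha> p u \<mu>)"

definition radially_degenerate ::
  "(real^'n) set \<Rightarrow> real \<Rightarrow> real \<Rightarrow> (real^'n \<Rightarrow> real) \<Rightarrow> bool" where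
  "radially_degenerate \<Omega> \<alpha> p u \<longleftrightarrow>
     (\<exists>\<psi>\<in>radial_eigenspace \<Omega> \<alpha> p u 0. \<not> (AE x in lebesgue_on \<Omega>. \<psi> x = 0))"

end

theory Submission imports Defs
begin

text \<open>In the radial variable the solution and the eigenfunctions satisfy singular Sturm--Liouville
equations \<open>(r^n y')' + r^n Q y = 0\<close>, \<open>n = N - 1\<close>, with simple negative eigenvalues. The potential of the
linearization exceeds that of the equation of the profile \<open>w\<close>, so by Sturm comparison the linearized
equation has at least \<open>m\<close> negative eigenvalues. Conversely \<open>z = r w' + gamma w\<close>, \<open>gamma = (2 + alpha)/(p - 1)\<close>,
generated by the scaling invariance, solves the linearized equation. The energy of the Emden--Fowler
transform of \<open>w\<close> is positive, which forces \<open>z\<close> to vanish at most once in each nodal zone; comparison with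
\<open>z\<close> bounds the number of nonpositive eigenvalues by \<open>m\<close>. Since \<open>z\<close> does not vanish at the outer boundary,
zero is not an eigenvalue. Regularity of \<open>w\<close> at the origin of a ball comes from Pohozaev's identity.\<close>

text \<open>If \<open>w\<close> solves the equation, so does \<open>l powr gamma * w (l * r)\<close>
  for every \<open>l > 0\<close>; differentiation at \<open>l = 1\<close> gives \<open>z\<close>. No
  boundary condition survives this, so \<open>z\<close> can only be the function with the larger
  potential in a comparison, which needs none at \<open>b\<close> or at a positive \<open>a\<close>.
  Zeros are then passed along a chain: the \<open>k\<close>-th negative eigenfunction has at least
  \<open>k - 1\<close> interior zeros, so \<open>z\<close> has at least as many as there are
  negative eigenvalues; an eigenfunction for 0 would have \<open>m\<close> zeros by comparison with
  \<open>w\<close> and force \<open>m + 1\<close> zeros of \<open>z\<close>. The obstacle is the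
  origin of a ball. As \<open>p\<close> has no upper bound, membership in \<open>H1_0\<close> does
  not bound \<open>w\<close>, and the linearized potential might be singular where Wronskians have
  to vanish. Hence a solution is first reduced to a profile with finite energy and vanishing flux at
  the origin, and boundedness is derived from the ODE. At the boundary of the domain the only
  information is approximation by test functions; it is turned into an integral inequality with
  fields that need not vanish there.\<close>

lemmas deriv_cont = DERIV_continuous continuous_at_imp_continuous_on


section \<open>Sturm comparison for singular radial equations\<close>

lemma continuous_interval_bound:
 fixes f :: "real => real"
 assumes "continuous_on {c..d} f"
 obtains C where "!!r. r : {c..d} ==> \<bar>f r\<bar> <= C"
proof -
 have "bounded (f ` {c..d})"
  using assms by (intro compact_imp_bounded compact_continuous_image) auto
 thus thesis unfolding bounded_iff using that by fastforce
qed

text \<open>The unknowns are \<open>psi\<close> and its flux \<open>J = r ^ n * psi'\<close>, so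
  that the second-order equation becomes a first-order system. Continuity up to the endpoints leaves
  out the origin: for \<open>a = 0\<close> nothing is assumed there.\<close>

definition sl :: "real => real => nat => (real => real) => (real => real) => (real => real) => bool" where
 "sl a b n Q psi J \<longleftrightarrow> 0 <= a & a < b & continuous_on ({a..b} - {0}) Q &
  continuous_on ({a..b} - {0}) psi & continuous_on ({a..b} - {0}) J &
  (ALL r:{a<..<b}. (psi has_real_derivative J r / r ^ n) (at r) &
          (J has_real_derivative - (r ^ n * Q r * psi r)) (at r))"

lemma sl_uminus: "sl a b n Q psi J ==> sl a b n Q (%r. - psi r) (%r. - J r)"
 unfolding sl_def by (auto intro!: continuous_intros derivative_eq_intros)

lemma sl_lincomb:
 assumes "sl a b n Q psi J" "sl a b n Q phi K"
 shows "sl a b n Q (%r. c * psi r + d * phi r) (%r. c * J r + d * K r)"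
proof -
 have "((%r. c * psi r + d * phi r) has_real_derivative (c * J r + d * K r) / r ^ n) (at r) &
    ((%r. c * J r + d * K r) has_real_derivative - (r ^ n * Q r * (c * psi r + d * phi r))) (at r)"
  if "r : {a<..<b}" for r
 proof -
  from that assms have *: "(psi has_real_derivative J r / r ^ n) (at r)"
   "(J has_real_derivative - (r ^ n * Q r * psi r)) (at r)"
   "(phi has_real_derivative K r / r ^ n) (at r)"
   "(K has_real_derivative - (r ^ n * Q r * phi r)) (at r)"
   unfolding sl_def by auto
  have "((%r. c * psi r + d * phi r) has_real_derivative c * (J r / r ^ n) + d * (K r / r ^ n)) (at r)"
   "((%r. c * J r + d * K r) has_real_derivative
     c * - (r ^ n * Q r * psi r) + d * - (r ^ n * Q r * phi r)) (at r)"
   by (intro DERIV_add DERIV_cmult *)+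
  thus ?thesis by (simp add: algebra_simps add_divide_distrib)
 qed
 thus ?thesis using assms unfolding sl_def by (auto intro!: continuous_intros)
qed

text \<open>Gronwall argument: between \<open>t0\<close> and \<open>r\<close>, an interval that
  avoids the origin, \<open>e = psi^2 + J^2\<close> satisfies \<open>|e'| <= C * e\<close>, so
  \<open>e\<close> times a suitable exponential is monotone and vanishes at
  \<open>t0\<close>.\<close>

lemma sl_zero_data:
 assumes "sl a b n Q psi J" "t0 : {a..b} - {0}" "psi t0 = 0" "J t0 = 0" "r : {a..b} - {0}"
 shows "psi r = 0 & J r = 0"
proof -
 define c d where "c = min t0 r" and "d = max t0 r"
 have cd: "0 < c" "a <= c" "c <= d" "d <= b" "0 <= a" using assms by (auto simp: c_def d_def sl_def)
 have sub: "{c..d} <= {a..b} - {0}" using cd by auto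
 have cont: "continuous_on {c..d} Q" "continuous_on {c..d} psi" "continuous_on {c..d} J"
  using assms(1) sub unfolding sl_def by (auto intro: continuous_on_subset)
 have "continuous_on {c..d} (%r. 1 / r ^ n + r ^ n * \<bar>Q r\<bar>)"
  using cont cd by (auto intro!: continuous_intros)
 from continuous_interval_bound[OF this]
 obtain C where C: "!!r. r : {c..d} ==> \<bar>1 / r ^ n + r ^ n * \<bar>Q r\<bar>\<bar> <= C" by blast
 define e where "e = (%r. (psi r)^2 + (J r)^2)"
 define e' where "e' = (%r. 2 * psi r * (J r / r ^ n) - 2 * J r * (r ^ n * Q r * psi r))"
 have conte: "continuous_on {c..d} e" unfolding e_def using cont by (auto intro!: continuous_intros)
 have de: "(e has_real_derivative e' r) (at r)" if "r : {c<..<d}" for r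
 proof -
  have "r : {a<..<b}" using that cd by auto
  hence "(psi has_real_derivative J r / r ^ n) (at r)" "(J has_real_derivative - (r ^ n * Q r * psi r)) (at r)"
   using assms(1) unfolding sl_def by auto
  thus ?thesis unfolding e_def e'_def
   by (auto intro!: derivative_eq_intros simp: power2_eq_square algebra_simps)
 qed
 have e'_le: "\<bar>e' r\<bar> <= C * e r" if "r : {c<..<d}" for r
 proof -
  have r: "r > 0" "r : {c..d}" using that cd by auto
  have 1: "\<bar>2 * psi r * J r\<bar> <= e r"
   unfolding e_def using sum_squares_bound[of "\<bar>psi r\<bar>" "\<bar>J r\<bar>"] by (simp add: abs_mult)
  have "e' r = (2 * psi r * J r) * (1 / r ^ n - r ^ n * Q r)"
   unfolding e'_def by (simp add: algebra_simps)
  hence "\<bar>e' r\<bar> = \<bar>2 * psi r * J r\<bar> * \<bar>1 / r ^ n - r ^ n * Q r\<bar>" by (simp only: abs_mult)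
  also have "... <= e r * (1 / r ^ n + r ^ n * \<bar>Q r\<bar>)"
  proof (rule mult_mono)
   have "\<bar>1 / r ^ n - r ^ n * Q r\<bar> <= \<bar>1 / r ^ n\<bar> + \<bar>r ^ n * Q r\<bar>" by (rule abs_triangle_ineq4)
   also have "... = 1 / r ^ n + r ^ n * \<bar>Q r\<bar>" using r by (simp add: abs_mult)
   finally show "\<bar>1 / r ^ n - r ^ n * Q r\<bar> <= 1 / r ^ n + r ^ n * \<bar>Q r\<bar>" .
  qed (use 1 in "auto simp: e_def")
  also have "... <= e r * C" using C[OF r(2)] by (intro mult_left_mono) (auto simp: e_def)
  finally show ?thesis by (simp add: mult.commute)
 qed
 have e0: "e t0 = 0" using assms by (simp add: e_def)
 have "e r <= 0"
 proof (cases "t0 <= r")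
  case True
  hence cd': "c = t0" "d = r" by (auto simp: c_def d_def)
  have "- (e t0 * exp (- C * t0)) <= - (e r * exp (- C * r))"
  proof (rule DERIV_nonneg_imp_increasing_open[OF True, where f="%r. - (e r * exp (- C * r))"])
   fix x assume "t0 < x" "x < r"
   hence x: "x : {c<..<d}" using cd' by auto
   have "((%r. - (e r * exp (- C * r))) has_real_derivative (C * e x - e' x) * exp (- C * x)) (at x)"
    using de[OF x] by (auto intro!: derivative_eq_intros simp: algebra_simps)
   moreover have "(C * e x - e' x) * exp (- C * x) >= 0" using e'_le[OF x] by auto
   ultimately show "EX y. ((%r. - (e r * exp (- C * r))) has_real_derivative y) (at x) & 0 <= y" by blast
  qed (use conte cd' in "auto intro!: continuous_intros")
  thus ?thesis using e0 by (simp add: mult_le_0_iff)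
 next
  case False
  hence cd': "c = r" "d = t0" and "r <= t0" by (auto simp: c_def d_def)
  have "e r * exp (C * r) <= e t0 * exp (C * t0)"
  proof (rule DERIV_nonneg_imp_increasing_open[OF \<open>r <= t0\<close>, where f="%r. (e r * exp (C * r))"])
   fix x assume "r < x" "x < t0"
   hence x: "x : {c<..<d}" using cd' by auto
   have "((%r. (e r * exp (C * r))) has_real_derivative (C * e x + e' x) * exp (C * x)) (at x)"
    using de[OF x] by (auto intro!: derivative_eq_intros simp: algebra_simps)
   moreover have "(C * e x + e' x) * exp (C * x) >= 0" using e'_le[OF x] by auto
   ultimately show "EX y. ((%r. (e r * exp (C * r))) has_real_derivative y) (at x) & 0 <= y" by blast
  qed (use conte cd' in "auto intro!: continuous_intros")
  thus ?thesis using e0 by (simp add: mult_le_0_iff)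
 qed
 thus ?thesis unfolding e_def by (simp add: sum_power2_le_zero_iff)
qed

text \<open>Unique continuation: at an inner point of the interval \<open>psi\<close> and its
  derivative vanish, hence also the flux, and \<open>sl_zero_data\<close> applies.\<close>

lemma sl_zero_interval:
 assumes "sl a b n Q psi J" "a <= x" "x < y" "y <= b" "!!t. x < t ==> t < y ==> psi t = 0" "r : {a..b} - {0}"
 shows "psi r = 0"
proof -
 define t where "t = (x + y) / 2"
 have t: "x < t" "t < y" using assms by (auto simp: t_def)
 have t': "t : {a<..<b}" "t > 0" using assms t by (auto simp: sl_def)
 have "(psi has_real_derivative J t / t ^ n) (at t)" using assms t' by (auto simp: sl_def)
 moreover have "(psi has_real_derivative 0) (at t)"
 proof (rule DERIV_cong_ev[THEN iffD2, OF refl _ refl])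
  have "\<forall>\<^sub>F s in nhds t. s : {x<..<y}" using t by (intro eventually_nhds_in_open) auto
  thus "\<forall>\<^sub>F s in nhds t. psi s = 0" by eventually_elim (use assms in auto)
 qed auto
 ultimately have "J t / t ^ n = 0" by (rule DERIV_unique)
 hence "J t = 0" using t' by auto
 thus ?thesis using sl_zero_data[OF assms(1), of t r] assms t t' by auto
qed

lemma sl_sign_change:
 assumes sl: "sl a b n Q psi J" and y: "y : {a..b} - {0}" "psi y = 0" "J y > 0"
 shows "EX e>0. ALL t:{a..b} - {0}. \<bar>t - y\<bar> < e --> (t < y --> psi t < 0) & (y < t --> psi t > 0)"
proof -
 have a: "0 <= a" using sl by (auto simp: sl_def)
 have "continuous (at y within ({a..b} - {0})) J"
  using sl y by (auto simp: sl_def continuous_on_eq_continuous_within)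
 hence "\<forall>\<^sub>F t in at y within ({a..b} - {0}). J t > 0"
  using y by (auto simp: continuous_within intro: order_tendstoD)
 then obtain e where e: "e > 0" "!!t. t : {a..b} - {0} ==> t ~= y ==> dist t y < e ==> J t > 0"
  unfolding eventually_at by auto
 have inc: "psi s < psi t" if st: "s : {a..b} - {0}" "t : {a..b} - {0}" "s < t" "\<bar>s - y\<bar> < e" "\<bar>t - y\<bar> < e" "s = y | t = y" for s t
 proof (rule DERIV_pos_imp_increasing_open[where f=psi, OF st(3)])
  fix x assume x: "s < x" "x < t"
  hence x': "x : {a<..<b}" "x > 0" "dist x y < e" "x ~= y" using st a by (auto simp: dist_real_def)
  hence "J x > 0" using e(2)[of x] by auto
  thus "EX u. (psi has_real_derivative u) (at x) & 0 < u"
   using sl x' unfolding sl_def by (intro exI[of _ "J x / x ^ n"]) auto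
 next
  have "{s..t} <= {a..b} - {0}" using st a by auto
  thus "continuous_on {s..t} psi" using sl unfolding sl_def by (auto intro: continuous_on_subset)
 qed
 show ?thesis
 proof (intro exI[of _ e] conjI ballI impI)
  fix t assume t: "t : {a..b} - {0}" "\<bar>t - y\<bar> < e"
  show "psi t < 0" if "t < y" using inc[OF t(1) y(1) that t(2)] e(1) y by simp
  show "psi t > 0" if "y < t" using inc[OF y(1) t(1) that _ t(2)] e(1) y by simp
 qed (use e in simp)
qed

text \<open>One-dimensional Hopf lemma: a zero flux would make \<open>psi\<close> vanish identically
  by \<open>sl_zero_data\<close>, a positive one would make \<open>psi\<close> negative just to the
  left of \<open>y\<close>.\<close>

lemma sl_flux_right:
 assumes "sl a b n Q psi J" "a <= x" "x < y" "y <= b" "!!t. x < t ==> t < y ==> psi t > 0" "psi y = 0"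
 shows "J y < 0"
proof (rule ccontr)
 assume neg: "\<not> J y < 0"
 have y: "y : {a..b} - {0}" "0 <= a" using assms by (auto simp: sl_def)
 have "J y ~= 0"
 proof
  assume "J y = 0"
  hence "psi ((x+y)/2) = 0" using sl_zero_data[OF assms(1) y(1), of "(x+y)/2"] assms y by simp
  moreover have "psi ((x+y)/2) > 0" using assms by simp
  ultimately show False by simp
 qed
 with neg have "J y > 0" by simp
 then obtain e where e: "e > 0" "!!t. t : {a..b} - {0} ==> \<bar>t - y\<bar> < e ==> t < y ==> psi t < 0"
  using sl_sign_change[OF assms(1) y(1) assms(6)] by blast
 define s where "s = max ((x + y) / 2) (y - e / 2)"
 have s: "x < s" "s < y" "\<bar>s - y\<bar> < e" using e(1) \<open>x < y\<close> by (auto simp: s_def max_def min_def field_simps)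
 thus False using e(2)[of s] assms(5)[of s] assms y by force
qed

lemma sl_flux_left:
 assumes "sl a b n Q psi J" "a <= x" "0 < x" "x < y" "y <= b" "!!t. x < t ==> t < y ==> psi t > 0" "psi x = 0"
 shows "J x > 0"
proof (rule ccontr)
 assume neg: "\<not> J x > 0"
 have y: "x : {a..b} - {0}" "0 <= a" using assms by (auto simp: sl_def)
 have "J x ~= 0"
 proof
  assume "J x = 0"
  hence "psi ((x+y)/2) = 0" using sl_zero_data[OF assms(1) y(1), of "(x+y)/2"] assms y by simp
  moreover have "psi ((x+y)/2) > 0" using assms by simp
  ultimately show False by simp
 qed
 with neg have "- J x > 0" by simp
 then obtain e where e: "e > 0" "!!t. t : {a..b} - {0} ==> \<bar>t - x\<bar> < e ==> x < t ==> - psi t > 0"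
  using sl_sign_change[OF sl_uminus[OF assms(1)] y(1)] assms(7) by auto
 define s where "s = min ((x + y) / 2) (x + e / 2)"
 have s: "x < s" "s < y" "\<bar>s - x\<bar> < e" using e(1) \<open>x < y\<close> by (auto simp: s_def max_def min_def field_simps)
 thus False using e(2)[of s] assms(6)[of s] assms y by force
qed

text \<open>The condition under which the Wronskian starts with the right sign. At a positive point
  a zero of \<open>psi\<close> suffices; at the origin, where no values are prescribed, the
  Wronskian itself must tend to zero.\<close>

definition left_bc :: "real => (real => real) => (real => real) => (real => real) => (real => real) => bool" where
 "left_bc x psi J phi K \<longleftrightarrow> (0 < x & psi x = 0) | (x = 0 & ((%r. phi r * J r - psi r * K r) \<longlongrightarrow> 0) (at_right 0))"

text \<open>The Wronskian \<open>W = phi * J - psi * K\<close> has derivative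
  \<open>t ^ n * (Q2 - Q1) * psi * phi >= 0\<close>. It is nonnegative at the left end and
  nonpositive at \<open>y\<close>, where \<open>psi y = 0\<close> and \<open>J y < 0\<close>. So it
  vanishes throughout, and only the degenerate situation of the conclusion remains.\<close>

lemma sturm_pos:
 assumes psi: "sl a b n Q1 psi J" and phi: "sl a b n Q2 phi K" and xy: "a <= x" "x < y" "y <= b"
  and Q: "!!t. x < t ==> t < y ==> Q1 t <= Q2 t"
  and pos: "!!t. x < t ==> t < y ==> psi t > 0" "!!t. x < t ==> t < y ==> phi t > 0"
  and bc: "left_bc x psi J phi K" and right: "psi y = 0"
 shows "phi y = 0 & (ALL t. x < t & t < y --> Q1 t = Q2 t)"
proof -
 have a: "0 <= a" using psi by (auto simp: sl_def)
 define W where "W = (%r. phi r * J r - psi r * K r)"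
 have dW: "(W has_real_derivative t ^ n * (Q2 t - Q1 t) * psi t * phi t) (at t)" if "x < t" "t < y" for t
 proof -
  have "t : {a<..<b}" "t > 0" using that xy a by auto
  thus ?thesis using psi phi unfolding sl_def W_def
   by (auto intro!: derivative_eq_intros simp: field_simps)
 qed
 have dW0: "t ^ n * (Q2 t - Q1 t) * psi t * phi t >= 0" if "x < t" "t < y" for t
  using that Q[of t] pos(1)[of t] pos(2)[of t] xy a by auto
 have sub: "{s..y} <= {a..b} - {0}" if "x < s" for s using that xy a by auto
 have contW: "continuous_on {s..y} W" if "x < s" for s
  using psi phi sub[OF that] unfolding sl_def W_def
  by (auto intro!: continuous_intros intro: continuous_on_subset)
 have mono: "W s <= W t" if "x < s" "s <= t" "t <= y" for s t
 proof (rule DERIV_nonneg_imp_increasing_open[OF that(2)])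
  fix z assume z: "s < z" "z < t"
  thus "EX y. (W has_real_derivative y) (at z) & 0 <= y" using dW[of z] dW0[of z] that by (intro exI conjI) auto
 next
  show "continuous_on {s..t} W" using contW[OF that(1)] by (rule continuous_on_subset) (use that in auto)
 qed
 have "phi y >= 0"
 proof (rule ccontr)
  assume "\<not> phi y >= 0"
  have "continuous_on {(x+y)/2..y} phi"
   using phi sub[of "(x+y)/2"] xy unfolding sl_def by (auto intro: continuous_on_subset)
  hence "EX t>=(x+y)/2. t <= y & phi t = 0"
   using xy pos(2)[of "(x+y)/2"] \<open>\<not> phi y >= 0\<close> by (intro IVT2') auto
  then obtain t where t: "t >= (x+y)/2" "t <= y" "phi t = 0" by blast
  hence "t ~= y" using \<open>\<not> phi y >= 0\<close> by auto
  thus False using pos(2)[of t] t xy by auto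
 qed
 have Jy: "J y < 0" using sl_flux_right[OF psi xy pos(1) right] by blast
 have Wy: "W y <= 0" unfolding W_def using right \<open>phi y >= 0\<close> Jy by (simp add: mult_nonneg_nonpos)
 have W0: "W t >= 0" if "x < t" "t < y" for t
 proof (cases "x = 0")
  case True
  hence "(W \<longlongrightarrow> 0) (at_right 0)" using bc unfolding left_bc_def W_def by auto
  moreover have "\<forall>\<^sub>F s in at_right 0. W s <= W t"
   using mono[of _ t] that True unfolding eventually_at_right_field
   by (intro exI[of _ t]) auto
  ultimately show ?thesis by (intro tendsto_upperbound[of W 0]) auto
 next
  case False
  hence x0: "0 < x" "psi x = 0" using bc unfolding left_bc_def by auto
  have Jx: "J x > 0" using sl_flux_left[OF psi xy(1) x0(1) xy(2,3) pos(1) x0(2)] by blast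
  have sub': "{x..y} <= {a..b} - {0}" using x0 xy by auto
  have "continuous_on {x..y} W"
   using psi phi sub' unfolding sl_def W_def by (auto intro!: continuous_intros intro: continuous_on_subset)
  hence ct: "continuous_on {x..t} W" by (rule continuous_on_subset) (use that in auto)
  have "W x <= W t"
  proof (rule DERIV_nonneg_imp_increasing_open[OF _ _ ct])
   fix z assume z: "x < z" "z < t"
   thus "EX y. (W has_real_derivative y) (at z) & 0 <= y" using dW[of z] dW0[of z] that by (intro exI conjI) auto
  qed (use that in auto)
  moreover have "phi x >= 0"
  proof (rule ccontr)
   assume n: "\<not> phi x >= 0"
   have "continuous_on {x..(x+y)/2} phi"
    using phi xy unfolding sl_def by (elim conjE continuous_on_subset) (use sub' x0 xy in auto)
   hence "EX t>=x. t <= (x+y)/2 & phi t = 0"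
    using xy pos(2)[of "(x+y)/2"] n by (intro IVT') auto
   then obtain t where t: "t >= x" "t <= (x+y)/2" "phi t = 0" by blast
   hence "t ~= x" using n by auto
   thus False using pos(2)[of t] t xy by auto
  qed
  hence "W x >= 0" unfolding W_def using x0 Jx by simp
  ultimately show ?thesis by simp
 qed
 have Wz: "W t = 0" if "x < t" "t < y" for t using W0[OF that] mono[of t y] Wy that by auto
 have "W y = 0" using W0[of "(x+y)/2"] mono[of "(x+y)/2" y] Wy xy by auto
 hence "phi y = 0" using right Jy unfolding W_def by auto
 moreover have "Q1 t = Q2 t" if "x < t" "t < y" for t
 proof -
  have "(W has_real_derivative 0) (at t)"
  proof (rule DERIV_cong_ev[THEN iffD2, OF refl _ refl])
   have "\<forall>\<^sub>F s in nhds t. s : {x<..<y}" using that by (intro eventually_nhds_in_open) auto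
   thus "\<forall>\<^sub>F s in nhds t. W s = 0" by eventually_elim (use Wz in auto)
  qed auto
  with dW[OF that] have "t ^ n * (Q2 t - Q1 t) * psi t * phi t = 0" by (rule DERIV_unique)
  thus ?thesis using pos(1)[OF that] pos(2)[OF that] that xy a by auto
 qed
 ultimately show ?thesis by auto
qed


lemma connected_constant_sign:
 fixes f :: "real => real"
 assumes "connected S" "continuous_on S f" "!!x. x : S ==> f x ~= 0"
 shows "(ALL x:S. f x > 0) | (ALL x:S. f x < 0)"
proof (rule ccontr)
 assume "\<not> ?thesis"
 then obtain s t where "s : S" "t : S" "f s <= 0" "f t >= 0" by (auto simp: not_less)
 moreover have "connected (f ` S)" using assms by (intro connected_continuous_image)
 ultimately have "0 : f ` S" by (meson connectedD_interval imageI)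
 thus False using assms(3) by auto
qed

lemma left_bc_uminus1: "left_bc x psi J phi K ==> left_bc x (%r. - psi r) (%r. - J r) phi K"
 unfolding left_bc_def
 using tendsto_minus[of "%r. phi r * J r - psi r * K r" 0 "at_right 0"] by (auto simp: algebra_simps)

lemma left_bc_uminus2: "left_bc x psi J phi K ==> left_bc x psi J (%r. - phi r) (%r. - K r)"
 unfolding left_bc_def
 using tendsto_minus[of "%r. phi r * J r - psi r * K r" 0 "at_right 0"] by (auto simp: algebra_simps)

text \<open>If \<open>phi\<close> had no zero in the open interval, both functions could be made
  positive by sign changes, and \<open>sturm_pos\<close> would leave only a zero at \<open>y\<close>
  together with identical potentials; strictness rules this out.\<close>

lemma sturm_zone:
 assumes psi: "sl a b n Q1 psi J" and phi: "sl a b n Q2 phi K" and xy: "a <= x" "x < y" "y <= b"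
  and Q: "!!t. x < t ==> t < y ==> Q1 t <= Q2 t"
  and ne: "!!t. x < t ==> t < y ==> psi t ~= 0"
  and bc: "left_bc x psi J phi K" and right: "psi y = 0"
 shows "EX t. x < t & t <= y & phi t = 0 & ((ALL s. x < s & s < y --> Q1 s < Q2 s) --> t < y)"
proof (rule ccontr)
 assume con: "\<not> ?thesis"
 hence ne2: "phi t ~= 0" if "x < t" "t < y" for t using that by fastforce
 have sub: "{x<..<y} <= {a..b} - {0}" using xy psi by (auto simp: sl_def)
 have s1: "(ALL t:{x<..<y}. psi t > 0) | (ALL t:{x<..<y}. psi t < 0)"
  by (rule connected_constant_sign) (use psi sub ne in "auto simp: sl_def elim: continuous_on_subset")
 have s2: "(ALL t:{x<..<y}. phi t > 0) | (ALL t:{x<..<y}. phi t < 0)"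
  by (rule connected_constant_sign) (use phi sub ne2 in "auto simp: sl_def elim: continuous_on_subset")
 have "phi y = 0 & (ALL t. x < t & t < y --> Q1 t = Q2 t)"
  using s1 s2
 proof (elim disjE)
  assume "ALL t:{x<..<y}. psi t > 0" "ALL t:{x<..<y}. phi t > 0"
  thus ?thesis
   by (intro sturm_pos[OF psi phi xy Q _ _ bc right]) auto
 next
  assume "ALL t:{x<..<y}. psi t > 0" "ALL t:{x<..<y}. phi t < 0"
  thus ?thesis
   using sturm_pos[OF psi sl_uminus[OF phi] xy Q _ _ left_bc_uminus2[OF bc] right] by auto
 next
  assume "ALL t:{x<..<y}. psi t < 0" "ALL t:{x<..<y}. phi t > 0"
  thus ?thesis
   using sturm_pos[OF sl_uminus[OF psi] phi xy Q _ _ left_bc_uminus1[OF bc]] right by auto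
 next
  assume "ALL t:{x<..<y}. psi t < 0" "ALL t:{x<..<y}. phi t < 0"
  thus ?thesis
   using sturm_pos[OF sl_uminus[OF psi] sl_uminus[OF phi] xy Q _ _ left_bc_uminus1[OF left_bc_uminus2[OF bc]]] right
   by auto
 qed
 moreover have "x < (x+y)/2" "(x+y)/2 < y" using xy by auto
 ultimately show False using con xy by (metis less_irrefl order_refl)
qed

lemma next_zero:
 fixes f :: "real => real"
 assumes "continuous_on {t0..y} f" "f t0 ~= 0" "f y = 0" "t0 <= y"
 obtains y' where "t0 < y'" "y' <= y" "f y' = 0" "!!t. t0 <= t ==> t < y' ==> f t ~= 0"
proof -
 define y' where "y' = Inf {t\<in>{t0..y}. f t = 0}"
 have cl: "closed {t\<in>{t0..y}. f t = 0}"
  using assms(1) by (intro continuous_closed_preimage_constant) auto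
 have y': "y' : {t\<in>{t0..y}. f t = 0}" unfolding y'_def
  by (rule closed_contains_Inf[OF _ _ cl]) (use assms in "auto intro!: bdd_belowI[of _ t0]")
 have "f t ~= 0" if "t0 <= t" "t < y'" for t
 proof
  assume "f t = 0"
  hence "y' <= t" unfolding y'_def using that y'
   by (intro cInf_lower) (auto intro!: bdd_belowI[of _ t0])
  thus False using that by simp
 qed
 moreover have "t0 < y'" using y' assms by (cases "y' = t0") auto
 ultimately show thesis using that y' by auto
qed

lemma previous_zero:
 fixes f :: "real => real"
 assumes "continuous_on {x..t0} f" "f t0 ~= 0" "f x = 0" "x <= t0"
 obtains x' where "x <= x'" "x' < t0" "f x' = 0" "!!t. x' < t ==> t <= t0 ==> f t ~= 0"
proof -
 have "continuous_on {- t0..- x} (%t. f (- t))"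
  by (intro continuous_on_compose2[OF assms(1)]) (auto intro!: continuous_intros)
 then obtain y' where y': "- t0 < y'" "y' <= - x" "f (- y') = 0" "!!t. - t0 <= t ==> t < y' ==> f (- t) ~= 0"
  using next_zero[of "- t0" "- x" "%t. f (- t)"] assms by auto
 show thesis
 proof (rule that[of "- y'"])
  fix t assume "- y' < t" "t <= t0"
  thus "f t ~= 0" using y'(4)[of "- t"] by simp
 qed (use y' in auto)
qed

text \<open>As \<open>psi\<close> may have further zeros between \<open>x\<close> and
  \<open>y\<close>, the comparison takes place on one nodal interval around a point
  \<open>t0\<close> where \<open>psi\<close> is nonzero. Strictness is asked only where
  \<open>psi\<close> is nonzero because the two potentials compared for \<open>w\<close> coincide at
  its zeros.\<close>

lemma sturm_zero:
 assumes psi: "sl a b n Q1 psi J" and phi: "sl a b n Q2 phi K" and xy: "a <= x" "x < y" "y <= b"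
  and Q: "!!t. x < t ==> t < y ==> Q1 t <= Q2 t"
  and ne: "EX t:{a..b} - {0}. psi t ~= 0"
  and bc: "left_bc x psi J phi K" and right: "psi y = 0"
 shows "EX t. x < t & t <= y & phi t = 0 & ((ALL s. x < s & s < y & psi s ~= 0 --> Q1 s < Q2 s) --> t < y)"
proof -
 have a: "0 <= a" using psi by (auto simp: sl_def)
 obtain t0 where t0: "x < t0" "t0 < y" "psi t0 ~= 0"
  using sl_zero_interval[OF psi xy] ne by blast
 have cont: "continuous_on {s..y} psi" if "x < s" for s
  using psi that a xy by (auto simp: sl_def elim!: continuous_on_subset)
 obtain y' where ty: "t0 < y'" and y': "y' <= y" "psi y' = 0"
  and y'2: "!!t. t0 <= t ==> t < y' ==> psi t ~= 0"
  using next_zero[OF cont[OF t0(1)] t0(3) right] t0 by auto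
 obtain x' where x': "x <= x'" "x' < t0" "!!t. x' < t ==> t <= t0 ==> psi t ~= 0" "left_bc x' psi J phi K"
 proof (cases "EX t. x < t & t <= t0 & psi t = 0")
  case False
  thus thesis using that[of x] bc t0 by auto
 next
  case True
  then obtain t1 where t1: "x < t1" "t1 <= t0" "psi t1 = 0" by blast
  have "continuous_on {t1..t0} psi" using cont[OF t1(1)] by (rule continuous_on_subset) (use t0 in auto)
  from previous_zero[OF this t0(3) t1(3,2)] obtain x' where x': "t1 <= x'" "x' < t0" "psi x' = 0"
   "!!t. x' < t ==> t <= t0 ==> psi t ~= 0" by blast
  moreover have "left_bc x' psi J phi K" using x' t1 a xy unfolding left_bc_def by auto
  ultimately show thesis using that[of x'] t1 by auto
 qed
 have "EX t. x' < t & t <= y' & phi t = 0 & ((ALL s. x' < s & s < y' --> Q1 s < Q2 s) --> t < y')"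
 proof (rule sturm_zone[OF psi phi _ _ _ _ _ x'(4)])
  fix t assume "x' < t" "t < y'"
  thus "psi t ~= 0" using x'(3)[of t] y'2[of t] by (cases "t <= t0") auto
 qed (use x' y' xy ty Q in auto)
 then obtain t where t: "x' < t" "t <= y'" "phi t = 0" "(ALL s. x' < s & s < y' --> Q1 s < Q2 s) ==> t < y'" by blast
 have "t < y" if "ALL s. x < s & s < y & psi s ~= 0 --> Q1 s < Q2 s"
 proof -
  have "Q1 s < Q2 s" if s: "x' < s" "s < y'" for s
  proof -
   have "psi s ~= 0" using x'(3)[of s] y'2[of s] s by (cases "s <= t0") auto
   thus ?thesis using that \<open>ALL s. x < s & s < y & psi s ~= 0 --> Q1 s < Q2 s\<close> s x' y' by auto
  qed
  thus ?thesis using t(4) y' by auto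
 qed
 thus ?thesis using t x' y' by (intro exI[of _ t]) auto
qed

text \<open>At least \<open>k\<close> distinct zeros strictly between \<open>a\<close> and
  \<open>b\<close>: the chain has \<open>k + 2\<close> points, of which the first and the last are
  the endpoints, where nothing is said about \<open>psi\<close>. In this form zeros are handed from
  one comparison to the next without knowing that zero sets are finite.\<close>

definition has_zeros :: "real => real => nat => (real => real) => bool" where
 "has_zeros a b k psi \<longleftrightarrow> (EX x::nat => real. x 0 = a & x (Suc k) = b & (ALL i<=k. x i < x (Suc i)) &
  (ALL i. 1 <= i & i <= k --> psi (x i) = 0))"

lemma chain_less:
 fixes x :: "nat => real"
 assumes "ALL i<=k. x i < x (Suc i)" "i < j" "j <= Suc k"
 shows "x i < x j"
 using assms(2,3)
proof (induction j)
 case (Suc j)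
 hence "x j < x (Suc j)" using assms(1) by auto
 thus ?case using Suc by (cases "i = j") auto
qed auto

text \<open>Each of the \<open>k + 1\<close> intervals of the chain yields a zero of
  \<open>phi\<close> that lies right of \<open>x i\<close> and not beyond \<open>x (Suc i)\<close>,
  so these zeros are distinct. Only the last one could coincide with \<open>b\<close>;
  \<open>strict\<close> excludes this, either by a strict inequality of potentials or because
  \<open>phi b\<close> is nonzero.\<close>

lemma sturm_count:
 assumes psi: "sl a b n Q1 psi J" and phi: "sl a b n Q2 phi K"
  and Q: "!!t. a < t ==> t < b ==> Q1 t <= Q2 t"
  and strict: "(ALL t. a < t & t < b & psi t ~= 0 --> Q1 t < Q2 t) | phi b ~= 0"
  and ne: "EX t:{a..b} - {0}. psi t ~= 0"
  and bc: "left_bc a psi J phi K" and right: "psi b = 0"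
  and z: "has_zeros a b k psi"
 shows "has_zeros a b (Suc k) phi"
proof -
 have a: "0 <= a" using psi by (auto simp: sl_def)
 obtain x where x: "x 0 = a" "x (Suc k) = b" "ALL i<=k. x i < x (Suc i)" "!!i. 1 <= i ==> i <= k ==> psi (x i) = 0"
  using z unfolding has_zeros_def by blast
 have lt: "x i < x j" if "i < j" "j <= Suc k" for i j using chain_less[OF x(3) that] .
 have bnd: "a <= x i" "x i <= b" if "i <= Suc k" for i
  using lt[of 0 i] lt[of i "Suc k"] that x(1,2) by (cases "i = 0"; cases "i = Suc k"; force)+
 have "EX t. x i < t & t <= x (Suc i) & phi t = 0 & t < b" if i: "i <= k" for i
 proof -
  have bc': "left_bc (x i) psi J phi K"
  proof (cases "i = 0")
   case False
   thus ?thesis using x(4)[of i] i lt[of 0 i] x(1) a unfolding left_bc_def by auto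
  qed (use bc x in auto)
  have r: "psi (x (Suc i)) = 0" using x(2) x(4)[of "Suc i"] i right by (cases "i = k") auto
  have "EX t. x i < t & t <= x (Suc i) & phi t = 0 &
   ((ALL s. x i < s & s < x (Suc i) & psi s ~= 0 --> Q1 s < Q2 s) --> t < x (Suc i))"
   by (rule sturm_zero[OF psi phi _ _ _ _ ne bc' r])
    (use bnd[of i] bnd[of "Suc i"] i x(3) Q in auto)
  then obtain t where t: "x i < t" "t <= x (Suc i)" "phi t = 0"
   "(ALL s. x i < s & s < x (Suc i) & psi s ~= 0 --> Q1 s < Q2 s) ==> t < x (Suc i)" by blast
  have "t < b"
   using strict
  proof
   assume "ALL t. a < t & t < b & psi t ~= 0 --> Q1 t < Q2 t"
   hence "t < x (Suc i)" using bnd[of i] bnd[of "Suc i"] i by (intro t(4)) auto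
   thus ?thesis using bnd[of "Suc i"] i by auto
  next
   assume "phi b ~= 0"
   thus ?thesis using t bnd[of "Suc i"] i by (cases "t = b") auto
  qed
  thus ?thesis using t by blast
 qed
 then obtain t where t: "!!i. i <= k ==> x i < t i & t i <= x (Suc i) & phi (t i) = 0 & t i < b" by metis
 \<comment> \<open>The zero found in the \<open>i\<close>-th interval becomes the point number
   \<open>i + 1\<close> of the new chain.\<close>
 define y where "y = (%i. if i = 0 then a else if i <= Suc k then t (i - 1) else b)"
 have "y i < y (Suc i)" if "i <= Suc k" for i
 proof (cases i)
  case 0
  thus ?thesis using t[of 0] x by (auto simp: y_def)
 next
  case (Suc j)
  thus ?thesis using t[of j] t[of "Suc j"] that by (cases "i = Suc k") (auto simp: y_def)
 qed
 moreover have "phi (y i) = 0" if "1 <= i" "i <= Suc k" for i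
  using t[of "i - 1"] that by (auto simp: y_def)
 ultimately show ?thesis unfolding has_zeros_def
  by (intro exI[of _ y]) (auto simp: y_def)
qed

lemma has_zeros_0: "a < b ==> has_zeros a b 0 psi"
 unfolding has_zeros_def by (intro exI[of _ "%i. if i = 0 then a else b"]) auto

lemma has_zeros_card:
 assumes "has_zeros a b k psi" "finite {t\<in>{a<..<b}. psi t = 0}"
 shows "k <= card {t\<in>{a<..<b}. psi t = 0}"
proof -
 obtain x where x: "x 0 = a" "x (Suc k) = b" "ALL i<=k. x i < x (Suc i)" "!!i. 1 <= i ==> i <= k ==> psi (x i) = 0"
  using assms unfolding has_zeros_def by blast
 have lt: "x i < x j" if "i < j" "j <= Suc k" for i j using chain_less[OF x(3) that] .
 have "inj_on x {1..k}"
  by (intro linorder_inj_onI) (use lt in "auto, metis le_SucI less_irrefl")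
 moreover have "x ` {1..k} <= {t\<in>{a<..<b}. psi t = 0}"
  using x lt[of 0] lt[of _ "Suc k"] by auto
 ultimately show ?thesis using card_inj_on_le[OF _ _ assms(2), of x "{1..k}"] by simp
qed

lemma card_has_zeros:
 assumes "finite Z" "Z <= {t\<in>{a<..<b}. psi t = 0}" "a < b"
 shows "has_zeros a b (card Z) psi"
proof -
 define l where "l = sorted_list_of_set Z"
 have l: "length l = card Z" "set l = Z" "sorted_wrt (<) l"
  using assms by (auto simp: l_def)
 define y where "y = (%i. if i = 0 then a else if i <= card Z then l ! (i - 1) else b)"
 have in_Z: "l ! i : Z" if "i < card Z" for i using l that nth_mem by metis
 have "y i < y (Suc i)" if "i <= card Z" for i
 proof (cases i)
  case 0
  thus ?thesis using in_Z[of 0] assms by (auto simp: y_def)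
 next
  case (Suc j)
  show ?thesis
  proof (cases "i = card Z")
   case True
   hence "l ! j < b" using Suc in_Z[of j] assms(2) by auto
   moreover have "y i = l ! j" "y (Suc i) = b" using Suc True by (auto simp: y_def)
   ultimately show ?thesis by simp
  next
   case False
   hence "l ! j < l ! Suc j" using Suc that l(1) by (intro sorted_wrt_nth_less[OF l(3)]) simp_all
   thus ?thesis using Suc that False by (auto simp: y_def)
  qed
 qed
 moreover have "psi (y i) = 0" if "1 <= i" "i <= card Z" for i
 proof -
  have "l ! (i - 1) : Z" using that by (intro in_Z) auto
  hence "psi (l ! (i - 1)) = 0" using assms(2) by blast
  thus ?thesis using that by (simp add: y_def)
 qed
 ultimately show ?thesis unfolding has_zeros_def
  by (intro exI[of _ y]) (auto simp: y_def)
qed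


section \<open>The radial profile near the origin and its energy\<close>

definition spow :: "real => real => real" where "spow p x = \<bar>x\<bar> powr (p - 1) * x"

lemma spow_nonneg: "spow p x * x >= 0"
 by (simp add: spow_def mult.assoc)

lemma spow_uminus: "spow p (- x) = - spow p x" by (simp add: spow_def)

lemma spow_pos: "x > 0 ==> spow p x = x powr p"
 by (simp add: spow_def powr_mult_base mult.commute)

lemma continuous_spow: "p > 1 ==> continuous_on S (%x. \<bar>x::real\<bar> powr (p - 1))"
 by (intro continuous_on_powr' continuous_intros) auto

lemma has_derivative_spow:
 assumes "p > 1"
 shows "(spow p has_real_derivative p * \<bar>x\<bar> powr (p - 1)) (at x)"
proof -
 have pos: "(spow p has_real_derivative p * \<bar>x\<bar> powr (p - 1)) (at x)" if "x > 0" for x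
 proof (rule DERIV_cong_ev[THEN iffD2, OF refl _ refl])
  have "\<forall>\<^sub>F s in nhds x. s : {0<..}" using that by (intro eventually_nhds_in_open) auto
  thus "\<forall>\<^sub>F s in nhds x. spow p s = s powr p" by eventually_elim (auto simp: spow_pos)
  show "((%s. s powr p) has_real_derivative p * \<bar>x\<bar> powr (p - 1)) (at x)"
   using that by (auto intro!: derivative_eq_intros)
 qed
 consider "x > 0" | "x < 0" | "x = 0" by linarith
 thus ?thesis
 proof cases
  case 1
  thus ?thesis by (rule pos)
 next
  case 2
  have "((%s. - spow p (- s)) has_real_derivative - (p * \<bar>- x\<bar> powr (p - 1) * - 1)) (at x)"
   by (intro DERIV_minus DERIV_chain2[OF pos]) (use 2 in "auto intro!: derivative_eq_intros")
  thus ?thesis by (simp add: spow_uminus)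
 next
  case 3
  have "((%y. \<bar>y\<bar> powr (p - 1)) \<longlongrightarrow> 0) (at (0::real))"
   using continuous_spow[OF assms, of UNIV] assms unfolding continuous_on_def by (auto dest: spec[of _ 0])
  hence "((%y. (spow p y - spow p 0) / (y - 0)) \<longlongrightarrow> 0) (at 0)"
   by (rule Lim_transform_eventually) (auto simp: eventually_at_filter spow_def)
  thus ?thesis using 3 assms by (simp add: has_field_derivative_iff)
 qed
qed

text \<open>Pohozaev's identity in radial form, from multiplying the equation by
  \<open>r * w'\<close> and by \<open>w\<close>. Here \<open>R\<close>, \<open>A\<close> and
  \<open>f\<close> stand for \<open>r ^ n\<close>, \<open>r powr alpha\<close> and
  \<open>spow p (w r)\<close>; they enter only through their differentiation rules, which keeps the
  verification rational. With \<open>n = N - 1\<close> the constant on the right is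
  \<open>(N + alpha) / (p + 1) - (N - 2) / 2\<close>.\<close>

lemma pohozaev_derivative:
 fixes n :: real
 assumes R: "(R has_real_derivative n * R r / r) (at r)" and A: "(A has_real_derivative alpha * A r / r) (at r)"
  and f: "(f has_real_derivative G * (J r / R r)) (at r)" "G * w r = p * f r"
  and w: "(w has_real_derivative J r / R r) (at r)"
  and J: "(J has_real_derivative - (R r * (A r * f r))) (at r)"
  and ne: "R r > 0" "r > 0" "p > 1"
 shows "((%r. r * (J r)^2 / R r * (1 / 2) + r * (R r * (A r * (f r * w r))) * (1 / (p + 1)) + (n - 1) / 2 * (w r * J r))
  has_real_derivative ((n + 1 + alpha) / (p + 1) - (n - 1) / 2) * (R r * (A r * (f r * w r)))) (at r)"
proof -
 have G: "G * J r * w r = p * f r * J r" using f(2) by (metis mult.assoc mult.commute)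
 have D1: "((%r. r * (J r)^2 / R r) has_real_derivative (J r)^2 / R r * (1 - n) - 2 * r * J r * A r * f r) (at r)"
  by (rule derivative_eq_intros R J refl | use ne in simp; fail)+
   (use ne in "simp add: field_simps power2_eq_square")
 have D2: "((%r. f r * w r) has_real_derivative (p + 1) * f r * (J r / R r)) (at r)"
  by (rule derivative_eq_intros f w refl | use ne in simp; fail)+
   (use ne G in "simp add: field_simps")
 have D3: "((%r. r * (R r * (A r * (f r * w r)))) has_real_derivative
  (n + 1 + alpha) * (R r * (A r * (f r * w r))) + (p + 1) * r * A r * f r * J r) (at r)"
  by (rule derivative_eq_intros R A D2 refl | use ne in simp; fail)+
   (use ne in "simp add: field_simps")
 have D4: "((%r. w r * J r) has_real_derivative (J r)^2 / R r - R r * (A r * (f r * w r))) (at r)"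
  by (rule derivative_eq_intros w J refl | use ne in simp; fail)+
   (use ne in "simp add: field_simps power2_eq_square")
 have p1: "p + 1 ~= 0" using ne by simp
 have "(X * (1 - n) - 2 * Z) * (1 / 2) + ((n + 1 + alpha) * Y + (p + 1) * Z) * (1 / (p + 1)) + (n - 1) / 2 * (X - Y)
  = ((n + 1 + alpha) / (p + 1) - (n - 1) / 2) * Y" for X Y Z
  using p1 by (simp add: field_simps)
 from this[of "(J r)^2 / R r" "r * J r * A r * f r" "R r * (A r * (f r * w r))"]
 have alg: "((J r)^2 / R r * (1 - n) - 2 * r * J r * A r * f r) * (1 / 2) +
   ((n + 1 + alpha) * (R r * (A r * (f r * w r))) + (p + 1) * r * A r * f r * J r) * (1 / (p + 1)) +
   (n - 1) / 2 * ((J r)^2 / R r - R r * (A r * (f r * w r)))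
  = ((n + 1 + alpha) / (p + 1) - (n - 1) / 2) * (R r * (A r * (f r * w r)))"
  by (simp only: ac_simps)
 show ?thesis
  by (rule DERIV_cong[OF DERIV_add[OF DERIV_add[OF DERIV_cmult_right[OF D1] DERIV_cmult_right[OF D3]] DERIV_cmult[OF D4]]])
   (rule alg)
qed

text \<open>The numerator on the right is the flux of the scaling field, with the second derivative
  of \<open>w\<close> eliminated by the equation.\<close>

lemma scaling_field_derivative:
 assumes w: "(w has_real_derivative J r / R r) (at r)" and R: "(R has_real_derivative n * R r / r) (at r)"
  and J: "(J has_real_derivative - (R r * (A r * f r))) (at r)"
  and ne: "R r > 0" "r > 0"
 shows "((%r. r * J r / R r + g * w r) has_real_derivative ((g + 1 - n) * J r - r * (R r * (A r * f r))) / R r) (at r)"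
 by (rule derivative_eq_intros w J R refl | use ne in simp; fail)+
  (use ne in "simp add: field_simps power2_eq_square")

text \<open>The value of \<open>g\<close> is forced here: differentiation produces the coefficient
  \<open>g + 2 + alpha\<close> in front of the nonlinearity, and the linearized equation requires it
  to be \<open>p * g\<close>.\<close>

lemma scaling_field_flux_derivative:
 assumes R: "(R has_real_derivative n * R r / r) (at r)" and A: "(A has_real_derivative alpha * A r / r) (at r)"
  and f: "(f has_real_derivative p * G * (J r / R r)) (at r)" "G * w r = f r"
  and J: "(J has_real_derivative - (R r * (A r * f r))) (at r)"
  and ne: "R r > 0" "r > 0" and g: "(p - 1) * g = 2 + alpha"
 shows "((%r. (g + 1 - n) * J r - r * (R r * (A r * f r))) has_real_derivative
  - (R r * (p * (A r * G)) * (r * J r / R r + g * w r))) (at r)"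
proof -
 have "g + 2 + alpha = p * g" using g by (simp add: algebra_simps)
 hence e: "f r * (g + 2 + alpha) = p * g * (G * w r)" using f(2) by simp
 have D: "((%r. (g + 1 - n) * J r - r * (R r * (A r * f r))) has_real_derivative
   - (R r * A r * (f r * (g + 2 + alpha))) - r * A r * p * G * J r) (at r)"
  by (rule derivative_eq_intros f J R A refl | use ne in simp; fail)+
   (use ne in "simp add: field_simps power2_eq_square")
 show ?thesis by (rule DERIV_cong[OF D], unfold e) (use ne in "simp add: field_simps")
qed

text \<open>With \<open>t = ln r\<close> and \<open>v = r powr g * w\<close> the equation becomes
  autonomous, \<open>v'' + (n - 1 - 2 * g) * v' - g * (n - 1 - g) * v + |v| powr (p - 1) * v =
  0\<close>, and \<open>v' = r powr g * (r * w' + g * w)\<close>. The differentiated expression is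
  the energy \<open>v'^2 / 2 - g * (n - 1 - g) * v^2 / 2 + |v| powr (p + 1) / (p + 1)\<close>, with
  \<open>V\<close> in the place of \<open>r powr (2 * g)\<close>. The damping coefficient appears on
  the right.\<close>

lemma emden_fowler_energy_derivative:
 assumes R: "(R has_real_derivative n * R r / r) (at r)" and A: "(A has_real_derivative alpha * A r / r) (at r)"
  and V: "(V has_real_derivative 2 * g * V r / r) (at r)"
  and f: "(f has_real_derivative G * (J r / R r)) (at r)" "G * w r = p * f r"
  and w: "(w has_real_derivative J r / R r) (at r)"
  and J: "(J has_real_derivative - (R r * (A r * f r))) (at r)"
  and ne: "R r > 0" "r > 0" "p > 1" and g: "(p - 1) * g = 2 + alpha"
 shows "((%r. V r * ((r * J r / R r + g * w r)^2 * (1 / 2) - g * (n - 1 - g) * (w r)^2 * (1 / 2)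
   + r * r * A r * (f r * w r) * (1 / (p + 1))))
  has_real_derivative (2 * g + 1 - n) * V r / r * (r * J r / R r + g * w r)^2) (at r)"
proof -
 have G: "G * J r * w r = p * f r * J r" using f(2) by (metis mult.assoc mult.commute)
 have D2: "((%r. f r * w r) has_real_derivative (p + 1) * f r * (J r / R r)) (at r)"
  by (rule derivative_eq_intros f w refl | use ne in simp; fail)+
   (use ne G in "simp add: field_simps")
 have D3: "((%r. r * r * A r * (f r * w r)) has_real_derivative
   r * A r * (f r * w r) * (2 + alpha) + r * r * A r * ((p + 1) * f r * (J r / R r))) (at r)"
  by (rule derivative_eq_intros A D2 refl | use ne in simp; fail)+
   (use ne in "simp add: field_simps")
 note D1 = scaling_field_derivative[where w=w and R=R and J=J and A=A and f=f and r=r and n=n and g=g, OF w R J ne(1,2)]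
 define y where "y = r * J r / R r"
 have Jy: "J r / R r = y / r" using ne by (simp add: y_def)
 have D5: "((%r. (r * J r / R r + g * w r)^2 * (1 / 2) - g * (n - 1 - g) * (w r)^2 * (1 / 2)
   + r * r * A r * (f r * w r) * (1 / (p + 1))) has_real_derivative
  (y + g * w r) * (((g + 1 - n) * J r - r * (R r * (A r * f r))) / R r) - g * (n - 1 - g) * w r * (J r / R r)
   + (r * A r * (f r * w r) * (2 + alpha) + r * r * A r * ((p + 1) * f r * (J r / R r))) * (1 / (p + 1))) (at r)"
 proof -
  have gen: "((%r. (z r)^2 * (1 / 2) - c * (w r)^2 * (1 / 2) + h r * d) has_real_derivative
    z r * z' - c * w r * w' + h' * d) (at r)"
   if "(z has_real_derivative z') (at r)" "(w has_real_derivative w') (at r)" "(h has_real_derivative h') (at r)"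
   for z w h :: "real => real" and z' w' h' c d
   by (rule derivative_eq_intros that refl | simp; fail)+
  show ?thesis unfolding y_def by (rule gen[OF D1 w D3])
 qed
 define P where "P = ((g + 1 - n) * J r - r * (R r * (A r * f r))) / R r"
 define U where "U = J r / R r"
 define T where "T = (y + g * w r)^2 * (1 / 2) - g * (n - 1 - g) * (w r)^2 * (1 / 2) + r * r * A r * (f r * w r) * (1 / (p + 1))"
 define S where "S = (r * A r * (f r * w r) * (2 + alpha) + r * r * A r * ((p + 1) * f r * U)) * (1 / (p + 1))"
 have U: "r * U = y" by (simp add: U_def y_def)
 have P: "r * P = (g + 1 - n) * y - r * r * A r * f r"
  using ne by (simp add: P_def y_def field_simps)
 have p1: "p + 1 ~= 0" using ne by simp
 have "r * S = (r * r * A r * f r * w r * ((p - 1) * g) + (p + 1) * (r * r * A r * f r * (r * U))) / (p + 1)"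
  unfolding S_def g by (simp add: algebra_simps add_divide_distrib)
 hence S: "r * S = r * r * A r * f r * w r * g * ((p - 1) / (p + 1)) + r * r * A r * f r * y"
  unfolding U using p1 by (simp add: add_divide_distrib)
 have "r * ((y + g * w r) * P - g * (n - 1 - g) * w r * U + S) = (y + g * w r) * (r * P) - g * (n - 1 - g) * w r * (r * U) + r * S"
  by (simp add: algebra_simps)
 also have "... = (2 * g + 1 - n) * (y + g * w r)^2 - 2 * g * T
   + r * r * A r * f r * w r * g * (2 / (p + 1) - 1 + (p - 1) / (p + 1))"
  unfolding P U S T_def by (simp add: algebra_simps power2_eq_square)
 also have "2 / (p + 1) - 1 + (p - 1) / (p + 1) = 0" using p1 by (simp add: field_simps)
 finally have key: "(y + g * w r) * P - g * (n - 1 - g) * w r * U + S = ((2 * g + 1 - n) * (y + g * w r)^2 - 2 * g * T) / r"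
  using ne by (simp add: field_simps)
 have "2 * g * V r / r * T + ((y + g * w r) * P - g * (n - 1 - g) * w r * U + S) * V r
   = (2 * g + 1 - n) * V r / r * (y + g * w r)^2"
  unfolding key using ne by (simp add: field_simps)
 thus ?thesis
  unfolding T_def P_def U_def S_def y_def by (rule DERIV_cong[OF DERIV_mult[OF V D5[unfolded y_def]]])
qed

lemma increasing_from_limit:
 fixes f :: "real => real"
 assumes "(f \<longlongrightarrow> l) (at_right c)" "!!s. c < s ==> s < t ==> f s <= f t" "c < t"
 shows "l <= f t"
proof -
 have "\<forall>\<^sub>F s in at_right c. f s <= f t" using assms unfolding eventually_at_right_field by blast
 thus ?thesis using assms(1) by (intro tendsto_upperbound) auto
qed

lemma deriv_nonneg_mono:
 fixes f :: "real => real"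
 assumes "x <= y" "!!t. x <= t ==> t <= y ==> (f has_real_derivative f' t) (at t)"
  "!!t. x <= t ==> t <= y ==> f' t >= 0"
 shows "f x <= f y"
 by (rule DERIV_nonneg_imp_nondecreasing[OF assms(1)]) (use assms(2,3) in blast)

text \<open>What the ODE analysis needs to know about the solution. Since
  \<open>J^2 / r ^ n = r ^ n * w'^2\<close>, \<open>energy\<close> expresses finiteness of the
  Dirichlet integral through a bounded antiderivative. Boundedness of \<open>w\<close> at the origin
  is not assumed; it is proved below.\<close>

locale henon_profile =
 fixes a b alpha p :: real and n :: nat and w J :: "real => real"
 assumes n: "n >= 1" and p: "p > 1" and alpha: "alpha >= 0"
  and sl_w: "sl a b n (%r. r powr alpha * \<bar>w r\<bar> powr (p - 1)) w J"
  and w_b: "w b = 0" and w_a: "a > 0 ==> w a = 0"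
  and nontriv: "EX t:{a<..<b}. w t ~= 0"
  and fin_zeros: "finite {t\<in>{a<..<b}. w t = 0}"
  and flux_0: "a = 0 ==> (J \<longlongrightarrow> 0) (at_right 0)"
  and energy: "a = 0 ==> EX e M. ALL r:{0<..<b}. (e has_real_derivative (J r)^2 / r ^ n) (at r) & \<bar>e r\<bar> <= M"
begin

lemma a0: "0 <= a" and ab: "a < b" and b0: "0 < b"
 using sl_w by (auto simp: sl_def)

lemma dw: "r : {a<..<b} ==> (w has_real_derivative J r / r ^ n) (at r)"
 and dJ: "r : {a<..<b} ==> (J has_real_derivative - (r ^ n * (r powr alpha * spow p (w r)))) (at r)"
 using sl_w by (auto simp: sl_def spow_def mult.assoc)

lemma d_pow: "r : {a<..<b} ==> ((%r. r ^ n) has_real_derivative real n * r ^ n / r) (at r)"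
 using n a0 by (auto intro!: derivative_eq_intros simp: field_simps power_diff)

lemma d_powr: "r : {a<..<b} ==> ((%r. r powr c) has_real_derivative c * r powr c / r) (at r)"
 using a0 by (auto intro!: derivative_eq_intros simp: powr_diff)

lemma d_spow: "r : {a<..<b} ==>
  ((%r. spow p (w r)) has_real_derivative p * \<bar>w r\<bar> powr (p - 1) * (J r / r ^ n)) (at r)"
 by (rule DERIV_chain2[OF has_derivative_spow[OF p] dw])

lemma spow_G: "p * \<bar>x\<bar> powr (p - 1) * x = p * spow p x" by (simp add: spow_def)

lemma J_b: "J b ~= 0"
 using sl_zero_data[OF sl_w, of b] w_b nontriv ab a0 by fastforce

definition gamma :: real where "gamma = (2 + alpha) / (p - 1)"

lemma gamma: "gamma > 0" "(p - 1) * gamma = 2 + alpha" using p alpha by (auto simp: gamma_def)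

lemma flip: "henon_profile a b alpha p n (%r. - w r) (%r. - J r)"
proof
 show "sl a b n (%r. r powr alpha * \<bar>- w r\<bar> powr (p - 1)) (%r. - w r) (%r. - J r)"
  using sl_uminus[OF sl_w] by simp
 show "((%r. - J r) \<longlongrightarrow> 0) (at_right 0)" if "a = 0"
  using tendsto_minus[OF flux_0[OF that]] by simp
qed (use n p alpha w_b w_a nontriv fin_zeros energy in auto)

lemma sign_near_0:
 assumes "a = 0"
 obtains d where "0 < d" "d < b" "d <= 1" "(ALL r:{0<..d}. w r > 0) | (ALL r:{0<..d}. w r < 0)"
proof -
 \<comment> \<open>Including \<open>b\<close> and \<open>1\<close> among the zeros forces half of
   the minimum to lie below both.\<close>
 define Z where "Z = insert b (insert 1 {t\<in>{a<..<b}. w t = 0})"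
 have Z: "finite Z" "Z ~= {}" "!!t. t : Z ==> t > 0" using fin_zeros a0 b0 by (auto simp: Z_def)
 define d where "d = Min Z / 2"
 have "Min Z > 0" using Z by auto
 have le: "Min Z <= t" if "t : Z" for t using Z that by auto
 have d: "0 < d" "d < b" "d <= 1" "d < Min Z" using \<open>Min Z > 0\<close> le[of b] le[of 1] b0 by (auto simp: d_def Z_def)
 have "w r ~= 0" if "r : {0<..d}" for r
  using le[of r] that d assms by (auto simp: Z_def)
 moreover have "continuous_on {0<..d} w"
  using sl_w d assms by (auto simp: sl_def elim!: continuous_on_subset)
 ultimately have "(ALL r:{0<..d}. w r > 0) | (ALL r:{0<..d}. w r < 0)"
  by (intro connected_constant_sign) auto
 thus thesis using that d by blast
qed

text \<open>Pohozaev's identity excludes the supercritical range for solutions of finite energy.\<close>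

lemma subcritical_pos:
 assumes a: "a = 0" and d: "0 < d" "d < b" "!!r. 0 < r ==> r <= d ==> w r > 0"
  and Jneg: "!!r. 0 < r ==> r <= d ==> J r <= 0"
 shows "2 * gamma > real n - 1"
proof (rule ccontr)
 assume con: "\<not> ?thesis"
 obtain e M where e: "!!r. r : {0<..<b} ==> (e has_real_derivative (J r)^2 / r ^ n) (at r)" "!!r. r : {0<..<b} ==> \<bar>e r\<bar> <= M"
  using energy[OF a] by blast
 \<comment> \<open>The coefficient in Pohozaev's identity; it is nonpositive precisely when
   \<open>2 * gamma <= n - 1\<close>, so that \<open>D\<close> decreases.\<close>
 define c where "c = (real n + 1 + alpha) / (p + 1) - (real n - 1) / 2"
 have c: "c <= 0"
 proof -
  have "2 * (2 + alpha) <= (p - 1) * (real n - 1)"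
   using con mult_left_mono[of "2 * gamma" "real n - 1" "p - 1"] p gamma(2) by (simp add: algebra_simps)
  thus ?thesis using p by (simp add: c_def field_simps)
 qed
 define D where "D = (%r. r * (J r)^2 / r ^ n * (1 / 2) + r * (r ^ n * (r powr alpha * (spow p (w r) * w r))) * (1 / (p + 1))
  + (real n - 1) / 2 * (w r * J r))"
 have dD: "(D has_real_derivative c * (r ^ n * (r powr alpha * (spow p (w r) * w r)))) (at r)" if "r : {0<..<b}" for r
  unfolding D_def c_def using that a
  by (intro pohozaev_derivative[OF d_pow d_powr d_spow spow_G dw dJ]) (use p in auto)
 have contD: "continuous_on {r..b} D" if "0 < r" for r
 proof -
  have "{r..b} <= {a..b} - {0}" using that a by auto
  hence "continuous_on {r..b} w" "continuous_on {r..b} J"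
   using sl_w unfolding sl_def by (meson continuous_on_subset)+
  thus ?thesis unfolding D_def spow_def using that p
   by (intro continuous_intros continuous_on_powr' continuous_on_compose2[OF continuous_spow[of p UNIV]]) auto
 qed
 \<comment> \<open>At \<open>b\<close> only the term with \<open>J b ~= 0\<close> survives. As
   \<open>D\<close> is nonincreasing, it stays above this positive value down to the origin.\<close>
 have Db: "D b > 0" unfolding D_def using b0 J_b w_b by simp
 have D_ge: "D b <= D r" if "0 < r" "r < b" for r
 proof -
  have "- D r <= - D b"
  proof (rule DERIV_nonneg_imp_increasing_open[where f="%x. - D x"])
   fix x assume "r < x" "x < b"
   hence x: "x : {0<..<b}" "x > 0" using that by auto
   have "spow p (w x) * w x >= 0" by (rule spow_nonneg)
   thus "EX y. ((%x. - D x) has_real_derivative y) (at x) & 0 <= y"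
    using c x dD[OF x(1)]
    by (intro exI[of _ "- (c * (x ^ n * (x powr alpha * (spow p (w x) * w x))))"] conjI DERIV_minus)
     (auto simp: mult_nonpos_nonneg)
  qed (use that contD[of r] in "auto intro!: continuous_intros")
  thus ?thesis by simp
 qed
 \<comment> \<open>\<open>H' >= 0\<close> says that \<open>D b / t\<close> is at most the sum of
   \<open>J^2 / t ^ n\<close> and the nonlinear term, a consequence of \<open>D b <= D t\<close>.
   Towards the origin \<open>- D b * ln t\<close> is unbounded, while \<open>e\<close> is bounded
   and \<open>w * J <= 0\<close>: this contradicts \<open>H x <= H d\<close>.\<close>
 define H where "H = (%r. 2 * e r - w r * J r - D b * ln r)"
 have "H x <= H d" if x: "0 < x" "x <= d" for x
 proof (rule deriv_nonneg_mono[OF x(2)])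
  fix t assume t: "x <= t" "t <= d"
  hence t': "t : {0<..<b}" "t : {a<..<b}" "0 < t" using x d a by auto
  have D4: "((%r. w r * J r) has_real_derivative (J t)^2 / t ^ n - t ^ n * (t powr alpha * (spow p (w t) * w t))) (at t)"
   by (rule derivative_eq_intros dw[OF t'(2)] dJ[OF t'(2)] refl)+ (use t' in "simp add: field_simps power2_eq_square")
  show "(H has_real_derivative 2 * ((J t)^2 / t ^ n) - ((J t)^2 / t ^ n - t ^ n * (t powr alpha * (spow p (w t) * w t)))
    - D b * (1 / t)) (at t)"
   unfolding H_def
   by (intro DERIV_diff DERIV_cmult D4 e(1)[OF t'(1)]) (use t' in "auto intro!: derivative_eq_intros")
  have "D b <= D t" using D_ge t' by auto
  also have "D t <= t * ((J t)^2 / t ^ n) * (1/2) + t * (t ^ n * (t powr alpha * (spow p (w t) * w t))) * (1 / (p + 1))"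
  proof -
   have "(real n - 1) / 2 * (w t * J t) <= 0"
    using n d(3)[of t] Jneg[of t] t t' by (intro mult_nonneg_nonpos) auto
   thus ?thesis unfolding D_def by simp
  qed
  also have "... <= t * ((J t)^2 / t ^ n) * 1 + t * (t ^ n * (t powr alpha * (spow p (w t) * w t))) * 1"
   using t' p by (intro add_mono mult_left_mono) (auto simp: spow_def mult.assoc)
  finally show "0 <= 2 * ((J t)^2 / t ^ n) - ((J t)^2 / t ^ n - t ^ n * (t powr alpha * (spow p (w t) * w t))) - D b * (1 / t)"
   using t' by (simp add: field_simps)
 qed
 hence "- D b * ln x <= H d + 2 * M" if x: "0 < x" "x <= d" for x
 proof -
  have "w x * J x <= 0" using d(3)[OF x] Jneg[OF x] by (simp add: mult_nonneg_nonpos)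
  moreover have "\<bar>e x\<bar> <= M" using e(2)[of x] x d by auto
  moreover have "H x <= H d" using x by fact
  ultimately show ?thesis unfolding H_def[of] by (auto simp: H_def)
 qed
 note bound = this
 define x where "x = min d (exp (- (\<bar>H d + 2 * M\<bar> + 1) / D b))"
 have x: "0 < x" "x <= d" using d by (auto simp: x_def)
 have "ln x <= ln (exp (- (\<bar>H d + 2 * M\<bar> + 1) / D b))" using x(1) by (subst ln_le_cancel_iff) (auto simp: x_def)
 hence "\<bar>H d + 2 * M\<bar> + 1 <= - D b * ln x" using Db by (simp add: field_simps)
 thus False using bound[OF x] by linarith
qed

end


section \<open>Decay and boundedness at the origin\<close>

context henon_profile begin

text \<open>Where \<open>w\<close> is positive the flux decreases, and it starts from the limit 0 at
  the origin.\<close>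

lemma flux_nonpos:
 assumes a: "a = 0" and d: "d < b" "!!r. 0 < r ==> r <= d ==> w r > 0" and r: "0 < r" "r <= d"
 shows "J r <= 0"
proof -
 have "- 0 <= - J r"
 proof (rule increasing_from_limit[OF tendsto_minus[OF flux_0[OF a]]])
  fix s assume s: "0 < s" "s < r"
  show "- J s <= - J r"
  proof (rule deriv_nonneg_mono[where f="%t. - J t"])
   fix t assume t: "s <= t" "t <= r"
   show "((%t. - J t) has_real_derivative - (- (t ^ n * (t powr alpha * spow p (w t))))) (at t)"
    by (intro DERIV_minus dJ) (use t s r d a in auto)
   show "0 <= - (- (t ^ n * (t powr alpha * spow p (w t))))"
    using d(2)[of t] t s r by (simp add: spow_def)
  qed (use s in auto)
 qed (use r in auto)
 thus ?thesis by simp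
qed

text \<open>A Strauss-type bound with any exponent above \<open>(n - 1) / 2\<close>. In the manner
  of a weighted Cauchy-Schwarz inequality, \<open>- J / s ^ n\<close> is estimated by a combination
  of \<open>J^2 / s ^ n\<close>, whose antiderivative is bounded, and
  \<open>1 / s ^ n\<close>.\<close>

lemma energy_decay:
 assumes a: "a = 0" and d: "0 < d" "d < b" "d <= 1" "!!r. 0 < r ==> r <= d ==> w r > 0"
  and beta: "2 * beta > real n - 1" "beta > 0"
 shows "EX C>0. ALL r:{0<..d}. w r <= C * r powr - beta"
proof -
 obtain e M where e: "!!r. r : {0<..<b} ==> (e has_real_derivative (J r)^2 / r ^ n) (at r)" "!!r. r : {0<..<b} ==> \<bar>e r\<bar> <= M"
  using energy[OF a] by blast
 define k where "k = 2 * beta - real n + 1"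
 have k: "k > 0" using beta by (simp add: k_def)
 have M: "M >= 0" using e(2)[of d] d by auto
 have "w r <= (w d + M + d powr k / (2 * k)) * r powr - beta" if r: "r : {0<..d}" for r
 proof -
  define l where "l = r powr - beta"
  have l: "l >= 1" unfolding l_def using r d beta by (simp add: ge_one_powr_ge_zero powr_minus_divide powr_le1)
  \<comment> \<open>The weight \<open>l = r powr - beta\<close> is frozen at the radius of interest.
    The summand with \<open>s powr k\<close> dominates \<open>1 / (l * s ^ n)\<close> because
    \<open>1 / l^2 = r powr (2 * beta) <= s powr (k - 1) * s ^ n\<close>; \<open>k > 0\<close> keeps
    it bounded.\<close>
  define g where "g = (%s. w s + l * (e s * (1 / 2)) + l * (s powr k * (1 / (2 * k))))"
  have "g r <= g d"
  proof (rule deriv_nonneg_mono[where f=g])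
   fix s assume s: "r <= s" "s <= d"
   hence s': "s : {a<..<b}" "s : {0<..<b}" "s > 0" using r d a by auto
   show "(g has_real_derivative J s / s ^ n + l * ((J s)^2 / s ^ n * (1 / 2)) + l * (k * s powr k / s * (1 / (2 * k)))) (at s)"
    unfolding g_def
    by (intro DERIV_add DERIV_cmult DERIV_cmult_right dw[OF s'(1)] e(1)[OF s'(2)] d_powr[OF s'(1)])
   have "r powr beta <= s powr beta" using s r beta by (intro powr_mono2) auto
   hence "1 / l <= s powr beta" unfolding l_def by (simp add: powr_minus_divide)
   hence "1 / l * (1 / l) <= s powr beta * s powr beta" using l by (intro mult_mono) auto
   also have "s powr beta * s powr beta = s powr k / s * s ^ n"
   proof -
    have "s powr k = s powr (2 * beta) / s ^ n * s"
     using s' unfolding k_def by (simp add: powr_add powr_diff powr_realpow)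
    thus ?thesis using s' by (simp add: powr_add[symmetric])
   qed
   finally have "1 / l * (1 / s ^ n) <= l * (s powr k / s)"
    using l s' by (simp add: field_simps)
   moreover have "- 2 * J s <= l * (J s)^2 + 1 / l"
   proof -
    have "0 <= (l * J s + 1)^2" by simp
    hence "l * (- 2 * J s) <= l * (l * (J s)^2 + 1 / l)"
     using l by (simp add: power2_eq_square algebra_simps)
    thus ?thesis using l by (subst (asm) mult_le_cancel_left_pos) auto
   qed
   hence "(- 2 * J s) / s ^ n <= (l * (J s)^2 + 1 / l) / s ^ n" using s' by (intro divide_right_mono) auto
   hence "- 2 * (J s / s ^ n) <= l * ((J s)^2 / s ^ n) + 1 / l * (1 / s ^ n)"
    by (simp add: add_divide_distrib)
   moreover have "l * ((J s)^2 / s ^ n * (1 / 2)) = l * ((J s)^2 / s ^ n) / 2" by simp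
   moreover have "l * (k * s powr k / s * (1 / (2 * k))) = l * (s powr k / s) / 2" using k by simp
   ultimately show "0 <= J s / s ^ n + l * ((J s)^2 / s ^ n * (1 / 2)) + l * (k * s powr k / s * (1 / (2 * k)))"
   proof -
    have *: "0 <= X + A + B" if "c <= Z" "- 2 * X <= Y + c" "A = Y / 2" "B = Z / 2" for X A B Y Z c :: real
     using that by linarith
    assume "1 / l * (1 / s ^ n) <= l * (s powr k / s)"
     "- 2 * (J s / s ^ n) <= l * ((J s)^2 / s ^ n) + 1 / l * (1 / s ^ n)"
     "l * ((J s)^2 / s ^ n * (1 / 2)) = l * ((J s)^2 / s ^ n) / 2"
     "l * (k * s powr k / s * (1 / (2 * k))) = l * (s powr k / s) / 2"
    thus ?thesis by (rule *)
   qed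
  qed (use r in auto)
  moreover have "\<bar>e r\<bar> <= M" "\<bar>e d\<bar> <= M" using r d by (auto intro!: e(2))
  hence "l * (e d * (1 / 2)) - l * (e r * (1 / 2)) <= l * M"
   using l mult_left_mono[of "e d * (1 / 2) - e r * (1 / 2)" M l] by (simp add: right_diff_distrib)
  moreover have "l * (r powr k * (1 / (2 * k))) >= 0" using l k by simp
  moreover have "w d <= w d * l" using l d(4)[of d] d by simp
  ultimately show ?thesis unfolding g_def l_def[symmetric] by (simp add: algebra_simps)
 qed
 moreover have "w d + M + d powr k / (2 * k) > 0" using d(1) d(4)[of d] M k by (simp add: add_pos_nonneg)
 ultimately show ?thesis by blast
qed

text \<open>One bootstrap step: the decay of \<open>w\<close> and of the potential is integrated to
  bound the flux, which starts from 0 at the origin, and once more to bound \<open>w\<close>. Two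
  integrations would gain \<open>\<sigma>\<close> in the exponent; only \<open>\<sigma> / 2\<close>
  is claimed, so that the exponent \<open>q\<close> is never 0 and no logarithm occurs.\<close>

lemma decay_step:
 assumes a: "a = 0" and d: "0 < d" "d < b" "d <= 1" "!!r. 0 < r ==> r <= d ==> w r > 0"
  and pot: "!!r. 0 < r ==> r <= d ==> r powr alpha * w r powr (p - 1) <= K * r powr (\<sigma> - 2)" "K > 0" "\<sigma> > 0"
  and tau: "C > 0" "!!r. 0 < r ==> r <= d ==> w r <= C * r powr - tau" "real n - 1 + \<sigma> - tau > 0"
 shows "if tau > \<sigma> / 2 then EX C>0. ALL r:{0<..d}. w r <= C * r powr - (tau - \<sigma> / 2)
    else EX C. ALL r:{0<..d}. w r <= C"
proof -
 define k where "k = real n - 1 + \<sigma> - tau"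
 define L where "L = K * C / k"
 have k: "k > 0" using tau by (simp add: k_def)
 have L: "L > 0" using k pot tau by (simp add: L_def)
 have flux: "- J r <= L * r powr k" if r: "0 < r" "r <= d" for r
 proof -
  have "L * 0 + 0 <= L * r powr k + J r"
  proof (rule increasing_from_limit[where f="%r. L * r powr k + J r" and c=0])
   have "((%r. r powr k) \<longlongrightarrow> 0 powr k) (at_right 0)"
    by (rule tendsto_powr'[OF tendsto_ident_at tendsto_const]) (use k in "auto simp: eventually_at_filter")
   thus "((%r. L * r powr k + J r) \<longlongrightarrow> L * 0 + 0) (at_right 0)"
    by (intro tendsto_intros flux_0 a) simp
   fix s assume s: "0 < s" "s < r"
   show "L * s powr k + J s <= L * r powr k + J r"
   proof (rule deriv_nonneg_mono[where f="%t. L * t powr k + J t"])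
    fix t assume t: "s <= t" "t <= r"
    hence t': "t : {a<..<b}" "0 < t" "t <= d" using s r d a by auto
    show "((%t. L * t powr k + J t) has_real_derivative L * (k * t powr k / t) + - (t ^ n * (t powr alpha * spow p (w t)))) (at t)"
     by (intro DERIV_add DERIV_cmult d_powr dJ t')
    have "t powr alpha * spow p (w t) = (t powr alpha * w t powr (p - 1)) * w t"
     using d(4)[OF t'(2,3)] by (simp add: spow_def)
    also have "... <= (K * t powr (\<sigma> - 2)) * (C * t powr - tau)"
     by (rule mult_mono) (use pot tau t' d(4)[OF t'(2,3)] in auto)
    also have "... = L * k * t powr (\<sigma> - 2 - tau)"
     using k by (simp add: L_def powr_add[symmetric])
    finally have "t ^ n * (t powr alpha * spow p (w t)) <= t ^ n * (L * k * t powr (\<sigma> - 2 - tau))"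
     using t' by (intro mult_left_mono) auto
    also have "... = L * (k * t powr k / t)"
    proof -
     have "t ^ n * t powr (\<sigma> - 2 - tau) = t powr (k - 1)"
      using t' by (simp add: k_def powr_realpow[symmetric] powr_add[symmetric] algebra_simps)
     also have "... = t powr k / t" using t' by (simp add: powr_diff)
     finally have e: "t ^ n * t powr (\<sigma> - 2 - tau) = t powr k / t" .
     have "t ^ n * (L * k * t powr (\<sigma> - 2 - tau)) = L * k * (t ^ n * t powr (\<sigma> - 2 - tau))"
      by (simp only: ac_simps)
     thus ?thesis unfolding e by simp
    qed
    finally show "0 <= L * (k * t powr k / t) + - (t ^ n * (t powr alpha * spow p (w t)))" by simp
   qed (use s in auto)
  qed (use r in auto)
  thus ?thesis by simp
 qed
 have slope: "- (J s / s ^ n) <= L * s powr (q - 1)" if s: "0 < s" "s <= d" "q <= \<sigma> - tau" for s q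
 proof -
  have "- (J s / s ^ n) <= L * s powr k / s ^ n" using divide_right_mono[OF flux[OF s(1,2)], of "s ^ n"] s by simp
  also have "... = L * s powr (\<sigma> - tau - 1)" using s by (simp add: k_def powr_diff powr_add powr_realpow)
  also have "... <= L * s powr (q - 1)" using L s d by (intro mult_left_mono powr_mono') auto
  finally show ?thesis .
 qed
 have main: "w r + L * (r powr q * (1 / q)) <= w d + L * (d powr q * (1 / q))"
  if q: "q <= \<sigma> - tau" "q ~= 0" and r: "0 < r" "r <= d" for r q
 proof (rule deriv_nonneg_mono[where f="%r. w r + L * (r powr q * (1 / q))", OF r(2)])
  fix t assume t: "r <= t" "t <= d"
  hence t': "t : {a<..<b}" "0 < t" "t <= d" using r d a by auto
  show "((%r. w r + L * (r powr q * (1 / q))) has_real_derivative J t / t ^ n + L * (q * t powr q / t * (1 / q))) (at t)"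
   by (intro DERIV_add DERIV_cmult DERIV_cmult_right d_powr dw t')
  show "0 <= J t / t ^ n + L * (q * t powr q / t * (1 / q))"
   using slope[OF t'(2,3) q(1)] q t' by (simp add: powr_diff)
 qed
 show ?thesis
 proof (cases "tau > \<sigma> / 2")
  case True
  define q where "q = \<sigma> / 2 - tau"
  have q: "q < 0" using True by (simp add: q_def)
  have "w r <= (w d + L / (- q)) * r powr q" if r: "0 < r" "r <= d" for r
  proof -
   have "w r + L * (r powr q * (1 / q)) <= w d + L * (d powr q * (1 / q))"
    using main[of q r] r q pot by (auto simp: q_def)
   moreover have "L * (d powr q * (1 / q)) <= 0" using L q by (simp add: divide_nonneg_neg)
   moreover have "r powr q >= 1" using r d q powr_mono'[of q 0 r] by simp
   hence "w d <= w d * r powr q" using d(1) d(4)[of d] by simp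
   ultimately show ?thesis by (simp add: algebra_simps)
  qed
  moreover have "w d + L / (- q) > 0" using L q d(1) d(4)[of d] by (intro add_pos_pos divide_pos_pos) auto
  moreover have "- (tau - \<sigma> / 2) = q" by (simp add: q_def)
  ultimately show ?thesis using True by (metis greaterThanAtMost_iff)
 next
  case False
  define q where "q = \<sigma> / 2"
  have q: "q > 0" using pot by (simp add: q_def)
  have "w r <= w d + L * (d powr q * (1 / q))" if r: "0 < r" "r <= d" for r
  proof -
   have "w r + L * (r powr q * (1 / q)) <= w d + L * (d powr q * (1 / q))"
    using main[of q r] r q pot False by (auto simp: q_def)
   moreover have "L * (r powr q * (1 / q)) >= 0" using L q by simp
   ultimately show ?thesis by simp
  qed
  hence "EX C. ALL r:{0<..d}. w r <= C" by (meson greaterThanAtMost_iff)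
  thus ?thesis using False by simp
 qed
qed

lemma bounded_pos:
 assumes a: "a = 0" and d: "0 < d" "d < b" "d <= 1" "!!r. 0 < r ==> r <= d ==> w r > 0"
 shows "EX C. ALL r:{0<..d}. w r <= C"
proof -
 have sub: "2 * gamma > real n - 1" using subcritical_pos[OF a d(1,2,4) flux_nonpos[OF a d(2,4)]] by auto
 \<comment> \<open>Three constraints on the starting exponent: \<open>beta > (n - 1) / 2\<close> for
   \<open>energy_decay\<close>, \<open>beta < gamma\<close> for \<open>\<sigma> > 0\<close>, and
   \<open>beta < (n - 1 + (p - 1) * gamma) / p\<close> for a positive exponent of the flux. They are
   compatible because \<open>2 * gamma > n - 1\<close>; \<open>beta\<close> is the midpoint of the
   admissible range.\<close>
 define beta0 where "beta0 = min gamma ((real n - 1 + (p - 1) * gamma) / p)"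
 have "(real n - 1) / 2 < (real n - 1 + (p - 1) * gamma) / p"
 proof -
  have "(p - 1) * (real n - 1) < (p - 1) * (2 * gamma)" using sub p by (intro mult_strict_left_mono) auto
  moreover have "real n - 1 >= 0" using n by simp
  ultimately have "p * (real n - 1) < 2 * (real n - 1) + (p - 1) * (2 * gamma)" by (simp add: algebra_simps)
  thus ?thesis using p by (simp add: field_simps)
 qed
 hence b0: "(real n - 1) / 2 < beta0" using sub by (simp add: beta0_def)
 define beta where "beta = ((real n - 1) / 2 + beta0) / 2"
 have beta: "2 * beta > real n - 1" "beta > 0" "beta < beta0" using b0 n by (auto simp: beta_def field_simps)
 define \<sigma> where "\<sigma> = 2 + alpha - beta * (p - 1)"
 have \<sigma>: "\<sigma> > 0"
 proof -
  have "(p - 1) * beta < (p - 1) * gamma" using beta(3) p by (intro mult_strict_left_mono) (auto simp: beta0_def)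
  thus ?thesis using gamma by (simp add: \<sigma>_def algebra_simps)
 qed
 have kap: "real n - 1 + \<sigma> - beta > 0"
 proof -
  have "beta < (real n - 1 + (p - 1) * gamma) / p" using beta(3) by (simp add: beta0_def)
  hence "beta * p < real n - 1 + (2 + alpha)" using p gamma(2) by (simp add: pos_less_divide_eq)
  thus ?thesis unfolding \<sigma>_def by (simp add: algebra_simps)
 qed
 obtain C where C: "C > 0" "!!r. r : {0<..d} ==> w r <= C * r powr - beta"
  using energy_decay[OF a d beta(1,2)] by blast
 have pot: "r powr alpha * w r powr (p - 1) <= C powr (p - 1) * r powr (\<sigma> - 2)" if r: "0 < r" "r <= d" for r
 proof -
  have "w r powr (p - 1) <= (C * r powr - beta) powr (p - 1)"
   using C(2)[of r] d(4)[of r] r p by (intro powr_mono2) auto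
  also have "... = C powr (p - 1) * r powr (- beta * (p - 1))" using C by (simp add: powr_mult powr_powr)
  finally have "r powr alpha * w r powr (p - 1) <= r powr alpha * (C powr (p - 1) * r powr (- beta * (p - 1)))"
   by (intro mult_left_mono) auto
  also have "... = C powr (p - 1) * r powr (\<sigma> - 2)" by (simp add: \<sigma>_def powr_add[symmetric] algebra_simps)
  finally show ?thesis .
 qed
 \<comment> \<open>The bound on the potential stays fixed while the exponent of \<open>w\<close>
   drops by \<open>\<sigma> / 2\<close> at each step, so that \<open>w\<close> is bounded after
   finitely many steps.\<close>
 have step: "(EX C. ALL r:{0<..d}. w r <= C) \<or>
  (beta - real k * (\<sigma> / 2) > 0 & (EX C>0. ALL r:{0<..d}. w r <= C * r powr - (beta - real k * (\<sigma> / 2))))" for k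
 proof (induction k)
  case 0
  thus ?case using C beta by auto
 next
  case (Suc k)
  thus ?case
  proof (elim disjE conjE exE)
   fix C' assume *: "beta - real k * (\<sigma> / 2) > 0" "C' > 0" "ALL r:{0<..d}. w r <= C' * r powr - (beta - real k * (\<sigma> / 2))"
   define t where "t = beta - real k * (\<sigma> / 2)"
   have "t <= beta" using \<sigma> by (simp add: t_def)
   hence k: "real n - 1 + \<sigma> - t > 0" using kap by simp
   have "if t > \<sigma> / 2 then EX C>0. ALL r:{0<..d}. w r <= C * r powr - (t - \<sigma> / 2)
    else EX C. ALL r:{0<..d}. w r <= C"
    by (rule decay_step[OF a d pot _ \<sigma> *(2) _ k]) (use *(3) C in "auto simp: t_def")
   moreover have "t - \<sigma> / 2 = beta - real (Suc k) * (\<sigma> / 2)" by (simp add: t_def algebra_simps)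
   ultimately show ?thesis by (auto split: if_splits)
  qed auto
 qed
 obtain k :: nat where "real k > beta / (\<sigma> / 2)" using reals_Archimedean2 by blast
 hence "beta - real k * (\<sigma> / 2) < 0" using \<sigma> by (simp add: field_simps)
 thus ?thesis using step[of k] by auto
qed

text \<open>Near the origin \<open>w\<close> has a constant sign, and the bounds for positive
  profiles apply to \<open>w\<close> or, by \<open>flip\<close>, to \<open>- w\<close>. Boundedness
  of \<open>w\<close> is then integrated once in the flux equation; away from the origin continuity
  suffices.\<close>

lemma regular_near_0:
 assumes a: "a = 0"
 shows "2 * gamma > real n - 1" "EX C. ALL r:{0<..b}. \<bar>w r\<bar> <= C & \<bar>J r\<bar> <= C * r ^ Suc n"
proof -
 obtain d where d: "0 < d" "d < b" "d <= 1" "(ALL r:{0<..d}. w r > 0) | (ALL r:{0<..d}. w r < 0)"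
  using sign_near_0[OF a] by blast
 interpret neg: henon_profile a b alpha p n "%r. - w r" "%r. - J r" by (rule flip)
 have "2 * gamma > real n - 1 & (EX C. ALL r:{0<..d}. \<bar>w r\<bar> <= C)"
  using d(4)
 proof
  assume pos: "ALL r:{0<..d}. w r > 0"
  have "2 * gamma > real n - 1" "EX C. ALL r:{0<..d}. w r <= C"
   by (intro subcritical_pos[OF a d(1,2)] flux_nonpos[OF a d(2)] bounded_pos[OF a d(1-3)]; use pos in auto)+
  thus ?thesis using pos by (metis abs_of_pos)
 next
  assume pos: "ALL r:{0<..d}. w r < 0"
  have "2 * neg.gamma > real n - 1" "EX C. ALL r:{0<..d}. - w r <= C"
   by (intro neg.subcritical_pos[OF a d(1,2)] neg.flux_nonpos[OF a d(2)] neg.bounded_pos[OF a d(1-3)]; use pos in auto)+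
  thus ?thesis using pos unfolding neg.gamma_def gamma_def by (metis abs_of_neg)
 qed
 thus "2 * gamma > real n - 1" by blast
 obtain C where C: "!!r. r : {0<..d} ==> \<bar>w r\<bar> <= C"
  using \<open>_ & (EX C. ALL r:{0<..d}. \<bar>w r\<bar> <= C)\<close> by blast
 have C0: "C >= 0" using C[of d] d by auto
 have flux: "s * J r <= C powr (p - 1) * C * r ^ Suc n" if r: "r : {0<..d}" and s: "s = 1 | s = -1" for r s
 proof -
  have "C powr (p - 1) * C * 0 ^ Suc n - s * 0 <= C powr (p - 1) * C * r ^ Suc n - s * J r"
  proof (rule increasing_from_limit[where f="%r. C powr (p - 1) * C * r ^ Suc n - s * J r" and c=0])
   show "((%r. C powr (p - 1) * C * r ^ Suc n - s * J r) \<longlongrightarrow> C powr (p - 1) * C * 0 ^ Suc n - s * 0) (at_right 0)"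
    by (intro tendsto_intros flux_0 a)
   fix t assume t: "0 < t" "t < r"
   show "C powr (p - 1) * C * t ^ Suc n - s * J t <= C powr (p - 1) * C * r ^ Suc n - s * J r"
   proof (rule deriv_nonneg_mono[where f="%r. C powr (p - 1) * C * r ^ Suc n - s * J r"])
    fix x assume x: "t <= x" "x <= r"
    hence x': "x : {a<..<b}" "0 < x" "x <= 1" "x : {0<..d}" using t r d a by auto
    show "((%r. C powr (p - 1) * C * r ^ Suc n - s * J r) has_real_derivative
     C powr (p - 1) * C * (real (Suc n) * x ^ n) - s * - (x ^ n * (x powr alpha * spow p (w x)))) (at x)"
     using DERIV_pow[of "Suc n" x UNIV] by (intro DERIV_diff DERIV_cmult dJ x') simp
    have "\<bar>spow p (w x)\<bar> <= C powr (p - 1) * C"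
     unfolding spow_def abs_mult using C[OF x'(4)] p C0 by (intro mult_mono) (auto intro!: powr_mono2)
    hence "x powr alpha * \<bar>spow p (w x)\<bar> <= 1 * (C powr (p - 1) * C)"
     using x' alpha by (intro mult_mono) (auto intro!: powr_le1)
    also have "... <= C powr (p - 1) * C * real (Suc n)" 
     using mult_left_mono[of 1 "real (Suc n)" "C powr (p - 1) * C"] C0 by simp
    finally have "x ^ n * (x powr alpha * \<bar>spow p (w x)\<bar>) <= x ^ n * (C powr (p - 1) * C * real (Suc n))"
     using x' by (intro mult_left_mono) auto
    moreover have "\<bar>s * (x ^ n * (x powr alpha * spow p (w x)))\<bar> = x ^ n * (x powr alpha * \<bar>spow p (w x)\<bar>)"
     using s x' by (auto simp: abs_mult)
    ultimately show "0 <= C powr (p - 1) * C * (real (Suc n) * x ^ n) - s * - (x ^ n * (x powr alpha * spow p (w x)))"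
     by (simp add: algebra_simps)
   qed (use t in auto)
  qed (use r in auto)
  thus ?thesis by simp
 qed
 have flux': "\<bar>J r\<bar> <= C powr (p - 1) * C * r ^ Suc n" if "r : {0<..d}" for r
  using flux[OF that, of 1] flux[OF that, of "-1"] by auto
 have sub: "{d..b} <= {a..b} - {0}" using d a by auto
 hence "continuous_on {d..b} w" "continuous_on {d..b} (%r. J r / r ^ Suc n)"
  using sl_w d unfolding sl_def by (auto intro!: continuous_intros elim!: continuous_on_subset)
 from continuous_interval_bound[OF this(1)] continuous_interval_bound[OF this(2)]
 obtain C1 C2 where C1: "!!r. r : {d..b} ==> \<bar>w r\<bar> <= C1" and C2: "!!r. r : {d..b} ==> \<bar>J r / r ^ Suc n\<bar> <= C2" by metis
 define D where "D = max (max C (C powr (p - 1) * C)) (max C1 C2)"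
 have "\<bar>w r\<bar> <= D & \<bar>J r\<bar> <= D * r ^ Suc n" if r: "r : {0<..b}" for r
 proof (cases "r <= d")
  case True
  hence "\<bar>w r\<bar> <= C" "\<bar>J r\<bar> <= C powr (p - 1) * C * r ^ Suc n" using r C flux' by auto
  moreover have "C powr (p - 1) * C * r ^ Suc n <= D * r ^ Suc n"
   using r by (intro mult_right_mono) (auto simp: D_def)
  ultimately show ?thesis by (auto simp: D_def)
 next
  case False
  hence "\<bar>w r\<bar> <= C1" "\<bar>J r / r ^ Suc n\<bar> <= C2" using r C1[of r] C2[of r] by auto
  hence "\<bar>J r\<bar> <= C2 * r ^ Suc n" using r by (simp add: abs_mult field_simps)
  also have "... <= D * r ^ Suc n" using r by (intro mult_right_mono) (auto simp: D_def)
  finally show ?thesis using \<open>\<bar>w r\<bar> <= C1\<close> by (auto simp: D_def)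
 qed
 thus "EX C. ALL r:{0<..b}. \<bar>w r\<bar> <= C & \<bar>J r\<bar> <= C * r ^ Suc n" by blast
qed

end


section \<open>The scaling field and positivity of the Emden-Fowler energy\<close>

context henon_profile begin

definition q :: "real => real" where "q r = p * (r powr alpha * \<bar>w r\<bar> powr (p - 1))"

definition z :: "real => real" where "z r = r * J r / r ^ n + gamma * w r"

text \<open>The flux \<open>r ^ n * z'\<close>, freed of second derivatives by means of the
  equation.\<close>

definition zJ :: "real => real" where
 "zJ r = (gamma + 1 - n) * J r - r * (r ^ n * (r powr alpha * spow p (w r)))"

lemma cont_w: "continuous_on ({a..b} - {0}) w" and cont_J: "continuous_on ({a..b} - {0}) J"
 using sl_w by (auto simp: sl_def)

lemma cont_pot: "continuous_on ({a..b} - {0}) (%r. r powr alpha * \<bar>w r\<bar> powr (p - 1))"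
 using sl_w by (auto simp: sl_def)

lemma cont_q: "continuous_on ({a..b} - {0}) q"
 unfolding q_def by (intro continuous_intros cont_pot)

lemma cont_z: "continuous_on ({a..b} - {0}) z"
 unfolding z_def by (intro continuous_intros cont_w cont_J) auto

lemma sl_z: "sl a b n q z zJ"
 unfolding sl_def
proof (intro conjI ballI)
 have "continuous_on ({a..b} - {0}) (%r. r * (r ^ n * (r powr alpha * \<bar>w r\<bar> powr (p - 1) * w r)))"
  by (intro continuous_intros cont_w cont_pot)
 hence "continuous_on ({a..b} - {0}) (%r. r * (r ^ n * (r powr alpha * spow p (w r))))"
  by (simp add: spow_def mult.assoc)
 thus "continuous_on ({a..b} - {0}) zJ"
  unfolding zJ_def by (intro continuous_on_diff continuous_on_mult_left cont_J)
 fix r assume r: "r : {a<..<b}"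
 hence r0: "r > 0" using a0 by auto
 show "(z has_real_derivative zJ r / r ^ n) (at r)"
  unfolding z_def zJ_def
  by (rule scaling_field_derivative[where R="%r. r ^ n" and A="%r. r powr alpha" and f="%r. spow p (w r)", OF dw[OF r] d_pow[OF r] dJ[OF r]])
   (use r0 in auto)
 have "(zJ has_real_derivative - (r ^ n * (p * (r powr alpha * \<bar>w r\<bar> powr (p - 1))) * (r * J r / r ^ n + gamma * w r))) (at r)"
  unfolding zJ_def
  by (rule scaling_field_flux_derivative[where R="%r. r ^ n" and A="%r. r powr alpha" and f="%r. spow p (w r)" and w=w,
     OF d_pow[OF r] d_powr[OF r] d_spow[OF r] _ dJ[OF r]])
   (use r0 gamma in "auto simp: spow_def")
 thus "(zJ has_real_derivative - (r ^ n * q r * z r)) (at r)" by (simp add: q_def z_def mult.assoc)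
qed (use a0 ab cont_q cont_z in auto)

lemma z_b: "z b ~= 0" using J_b b0 w_b by (simp add: z_def)

definition E :: "real => real" where
 "E r = r powr (2 * gamma) * ((z r)^2 * (1 / 2) - gamma * (real n - 1 - gamma) * (w r)^2 * (1 / 2)
   + r * r * r powr alpha * (spow p (w r) * w r) * (1 / (p + 1)))"

lemma dE:
 assumes r: "r : {a<..<b}"
 shows "(E has_real_derivative (2 * gamma + 1 - n) * r powr (2 * gamma) / r * (z r)^2) (at r)"
proof -
 note D = emden_fowler_energy_derivative[where R="%r. r ^ n" and A="%r. r powr alpha" and f="%r. spow p (w r)"
   and V="%r. r powr (2 * gamma)" and w=w and J=J and n="real n" and r=r and g=gamma and p=p and alpha=alpha
   and G="p * \<bar>w r\<bar> powr (p - 1)",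
  OF d_pow[OF r] d_powr[OF r] d_powr[OF r] d_spow[OF r] spow_G dw[OF r] dJ[OF r]]
 have "r ^ n > 0" "r > 0" using r a0 by auto
 thus ?thesis unfolding E_def z_def by (rule D) (rule p, rule gamma)
qed

lemma cont_E: "continuous_on ({a..b} - {0}) E"
proof -
 define P where "P = (%r. r powr alpha * \<bar>w r\<bar> powr (p - 1))"
 have "continuous_on ({a..b} - {0}) P" unfolding P_def by (rule cont_pot)
 hence "continuous_on ({a..b} - {0}) (%r. r * r * P r * (w r * w r) * (1 / (p + 1)))"
  by (intro continuous_intros cont_w)
 hence *: "continuous_on ({a..b} - {0}) (%r. r * r * r powr alpha * (spow p (w r) * w r) * (1 / (p + 1)))"
  by (rule continuous_on_eq) (simp add: spow_def P_def)
 have V: "continuous_on ({a..b} - {0}) (%r. r powr (2 * gamma))"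
  using a0 by (intro continuous_on_powr' continuous_on_id continuous_on_const) auto
 have "continuous_on ({a..b} - {0}) (%r. (z r)^2 * (1 / 2) - gamma * (real n - 1 - gamma) * (w r)^2 * (1 / 2))"
  by (intro continuous_intros cont_w cont_z)
 from continuous_on_mult[OF V continuous_on_add[OF this *]] show ?thesis unfolding E_def .
qed

text \<open>The factor \<open>s\<close>, later \<open>1\<close> or \<open>- 1\<close>, treats both
  signs of the damping coefficient \<open>2 * gamma + 1 - n\<close> at once.\<close>

lemma E_mono:
 assumes "a <= x" "0 < x" "x <= y" "y <= b" "s * (2 * gamma + 1 - n) >= 0"
 shows "s * E x <= s * E y"
proof (rule DERIV_nonneg_imp_increasing_open[OF assms(3), where f="%t. s * E t"])
 fix t assume t: "x < t" "t < y"
 hence t': "t : {a<..<b}" "0 < t" using assms by auto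
 have "0 <= s * (2 * gamma + 1 - n) * (t powr (2 * gamma) / t * (z t)^2)"
  using t'(2) by (intro mult_nonneg_nonneg[OF assms(5)] divide_nonneg_pos) simp_all
 also have "... = s * ((2 * gamma + 1 - n) * t powr (2 * gamma) / t * (z t)^2)" by (simp only: times_divide_eq_right times_divide_eq_left mult.assoc)
 finally show "EX y. ((%t. s * E t) has_real_derivative y) (at t) & 0 <= y"
  using DERIV_cmult[OF dE[OF t'(1)], of s] by blast
next
 show "continuous_on {x..y} (%t. s * E t)"
  by (intro continuous_intros continuous_on_subset[OF cont_E]) (use assms in auto)
qed

lemma E_at_zero:
 assumes "r > 0" "w r = 0" "J r ~= 0"
 shows "E r > 0"
proof -
 have "z r ~= 0" using assms by (simp add: z_def)
 thus ?thesis using assms by (simp add: E_def)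
qed

text \<open>The sign of the damping coefficient tells from which end the energy is estimated. If
  \<open>E\<close> decreases, its value at \<open>b\<close> is positive since \<open>w b = 0\<close>
  and \<open>J b ~= 0\<close>. If it increases, the inner boundary of an annulus takes this part,
  and on a ball regularity gives a lower bound for \<open>E\<close> that tends to 0 at the
  origin.\<close>

lemma E_pos:
 assumes r: "r : {a..b} - {0}"
 shows "E r > 0"
proof (cases "2 * gamma + 1 - n <= 0")
 case True
 have "- 1 * E r <= - 1 * E b" using r a0 True by (intro E_mono) auto
 thus ?thesis using E_at_zero[OF b0 w_b J_b] by simp
next
 case False
 show ?thesis
 proof (cases "a = 0")
  case False
  hence a: "a > 0" using a0 by simp
  have "J a ~= 0"
   using sl_zero_data[OF sl_w, of a] w_a[OF a] nontriv ab a by fastforce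
  hence "E a > 0" using E_at_zero[OF a w_a[OF a]] by simp
  moreover have "1 * E a <= 1 * E r" using r a \<open>\<not> 2 * gamma + 1 - n <= 0\<close> by (intro E_mono) auto
  ultimately show ?thesis by simp
 next
  case True
  obtain C where C: "!!r. r : {0<..b} ==> \<bar>w r\<bar> <= C & \<bar>J r\<bar> <= C * r ^ Suc n" using regular_near_0(2)[OF True] by blast
  have C0: "C >= 0" using C[of b] b0 w_b by auto
  define B where "B = ((b * b + gamma) * C)^2 + \<bar>gamma * (real n - 1 - gamma)\<bar> * C^2"
  have lower: "- (B * s powr (2 * gamma)) <= E s" if s: "s : {0<..b}" for s
  proof -
   have "(w s)^2 <= C^2" using power_mono[of "\<bar>w s\<bar>" C 2] C[OF s] by simp
   hence "gamma * (real n - 1 - gamma) * (w s)^2 <= \<bar>gamma * (real n - 1 - gamma)\<bar> * C^2"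
    by (intro mult_mono) auto
   moreover have "0 <= ((b * b + gamma) * C)^2" "0 <= (z s)^2" "0 <= \<bar>gamma * (real n - 1 - gamma)\<bar> * C^2" by auto
   moreover have "s * s * s powr alpha * (spow p (w s) * w s) * (1 / (p + 1)) >= 0"
    using s p spow_nonneg by simp
   ultimately have "- B <= (z s)^2 * (1 / 2) - gamma * (real n - 1 - gamma) * (w s)^2 * (1 / 2)
   + s * s * s powr alpha * (spow p (w s) * w s) * (1 / (p + 1))"
    unfolding B_def by linarith
   hence "s powr (2 * gamma) * - B <= E s" unfolding E_def by (intro mult_left_mono) auto
   thus ?thesis by (simp add: mult.commute)
  qed
  have nonneg: "E r >= 0" if r: "r : {0<..b}" for r
  proof -
   have "((%s. s powr (2 * gamma)) \<longlongrightarrow> 0 powr (2 * gamma)) (at_right 0)"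
    by (rule tendsto_powr'[OF tendsto_ident_at tendsto_const]) (use gamma in "auto simp: eventually_at_filter")
   hence "((%s. - (B * s powr (2 * gamma))) \<longlongrightarrow> - (B * 0)) (at_right 0)"
    by (intro tendsto_intros) simp
   moreover have "\<forall>\<^sub>F s in at_right 0. - (B * s powr (2 * gamma)) <= E r"
    unfolding eventually_at_right_field
   proof (intro exI[of _ r] conjI allI impI)
    fix s assume "0 < s" "s < r"
    hence "1 * E s <= 1 * E r" using r True False by (intro E_mono) auto
    thus "- (B * s powr (2 * gamma)) <= E r" using lower[of s] \<open>0 < s\<close> \<open>s < r\<close> r by auto
   qed (use r in auto)
   ultimately have "- (B * 0) <= E r" by (intro tendsto_upperbound[where F="at_right 0"]) auto
   thus ?thesis by simp
  qed
  \<comment> \<open>A zero of the nonnegative increasing \<open>E\<close> would make it vanish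
    between 0 and \<open>r\<close>; then its derivative, hence \<open>z\<close>, would vanish there,
    and by unique continuation also \<open>z b\<close>.\<close>
  have "E r ~= 0"
  proof
   assume "E r = 0"
   have r': "0 < r" "r <= b" using r True by auto
   have Z: "z t = 0" if t: "0 < t" "t < r" for t
   proof -
    have zero: "E s = 0" if "0 < s" "s < r" for s
    proof -
     have "1 * E s <= 1 * E r" using that r' True False by (intro E_mono) auto
     thus ?thesis using nonneg[of s] \<open>E r = 0\<close> that r' by auto
    qed
    have "(E has_real_derivative 0) (at t)"
    proof (rule DERIV_cong_ev[THEN iffD2, OF refl _ refl])
     have "\<forall>\<^sub>F s in nhds t. s : {0<..<r}" using t by (intro eventually_nhds_in_open) auto
     thus "\<forall>\<^sub>F s in nhds t. E s = 0" by eventually_elim (use zero in auto)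
    qed auto
    moreover have "(E has_real_derivative (2 * gamma + 1 - n) * t powr (2 * gamma) / t * (z t)^2) (at t)"
     using t r' True by (intro dE) auto
    ultimately have "(2 * gamma + 1 - n) * t powr (2 * gamma) / t * (z t)^2 = 0" using DERIV_unique by blast
    thus ?thesis using False t by simp
   qed
   have "z b = 0" by (rule sl_zero_interval[OF sl_z _ r'(1) _ Z]) (use True r' b0 in auto)
   thus False using z_b by simp
  qed
  thus ?thesis using nonneg[of r] r True by simp
 qed
qed

text \<open>At a critical point of the Emden--Fowler profile \<open>r powr gamma * w r\<close> positivity of the energy
 forces a strict extremum, a maximum where \<open>w\<close> is positive.\<close>

lemma z_zero:
 assumes r: "r : {a<..<b}" and z0: "z r = 0"
 shows "w r * zJ r < 0"
proof -
 have r0: "r > 0" using r a0 by auto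
 \<comment> \<open>In Emden-Fowler variables \<open>B = |v| powr (p - 1)\<close>, and
   \<open>v'' = (k - B) * v\<close> at a critical point. Positivity of the energy says
   \<open>B > k * (p + 1) / 2\<close>, which exceeds \<open>k\<close> when \<open>k > 0\<close>, as
   \<open>p > 1\<close>.\<close>
 define k where "k = gamma * (real n - 1 - gamma)"
 define B where "B = r * r * r powr alpha * \<bar>w r\<bar> powr (p - 1)"
 have "E r > 0" using E_pos[of r] r a0 by auto
 hence *: "0 < - (k * (w r)^2 * (1 / 2)) + r * r * r powr alpha * (spow p (w r) * w r) * (1 / (p + 1))"
  unfolding E_def k_def z0 by (simp add: zero_less_mult_iff not_less[symmetric])
 also have "... = (w r)^2 * (B / (p + 1) - k / 2)"
  by (simp add: B_def spow_def power2_eq_square algebra_simps)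
 finally have "0 < (w r)^2 * (B / (p + 1) - k / 2)" .
 hence w: "w r ~= 0" and Bk: "B / (p + 1) > k / 2" by (auto simp: zero_less_mult_iff)
 have "B > 0" using w r0 by (simp add: B_def)
 have "B > k * (p + 1) / 2" using Bk p by (simp add: field_simps)
 hence "B > k"
 proof (cases "k > 0")
  case True
  hence "k * 2 <= k * (p + 1)" using p by (intro mult_left_mono) auto
  thus ?thesis using \<open>B > k * (p + 1) / 2\<close> by simp
 qed (use \<open>B > 0\<close> in auto)
 have J: "J r = - gamma * w r * r ^ n / r" using z0 r0 by (simp add: z_def field_simps)
 have "r * zJ r = r ^ n * (w r * (k - B))"
  unfolding zJ_def J B_def k_def spow_def using r0 by (simp add: field_simps)
 have "r * (w r * zJ r) = w r * (r * zJ r)" by simp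
 also have "... = r ^ n * (w r)^2 * (k - B)"
  unfolding \<open>r * zJ r = _\<close> by (simp add: power2_eq_square)
 also have "... < 0" using \<open>B > k\<close> r0 w by (intro mult_pos_neg) auto
 finally show ?thesis using r0 by (simp add: mult_less_0_iff)
qed

text \<open>On an interval where \<open>w\<close> keeps its sign, \<open>z_zero\<close> fixes the
  sign of \<open>zJ\<close> at every zero of \<open>z\<close>; but at the two ends of a nodal
  interval of \<open>z\<close> the fluxes have opposite signs.\<close>

lemma z_zeros_separated:
 assumes xy: "x : {a<..<b}" "y : {a<..<b}" "x < y" and z0: "z x = 0" "z y = 0"
 shows "EX t. x < t & t < y & w t = 0"
proof (rule ccontr)
 assume con: "\<not> ?thesis"
 have sub: "{x..y} <= {a..b} - {0}" using xy a0 by auto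
 have wx: "w x ~= 0" "w y ~= 0" using z_zero[OF xy(1) z0(1)] z_zero[OF xy(2) z0(2)] by auto
 hence ne: "w t ~= 0" if "t : {x..y}" for t using that con by (cases "t = x | t = y") auto
 have sgn: "(ALL t:{x..y}. w t > 0) | (ALL t:{x..y}. w t < 0)"
  by (rule connected_constant_sign) (use ne in "auto intro: continuous_on_subset[OF cont_w sub]")
 obtain t0 where t0: "x < t0" "t0 < y" "z t0 ~= 0"
  using sl_zero_interval[OF sl_z _ xy(3), of b] xy z_b b0 ab by force
 have cz: "continuous_on {x..y} z" by (rule continuous_on_subset[OF cont_z sub])
 have c1: "continuous_on {t0..y} z" "continuous_on {x..t0} z"
  using t0 by (auto intro: continuous_on_subset[OF cz])
 obtain y' where y': "t0 < y'" "y' <= y" "z y' = 0" "!!t. t0 <= t ==> t < y' ==> z t ~= 0"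
  using next_zero[OF c1(1) t0(3) z0(2)] t0 by auto
 obtain x' where x': "x <= x'" "x' < t0" "z x' = 0" "!!t. x' < t ==> t <= t0 ==> z t ~= 0"
  using previous_zero[OF c1(2) t0(3) z0(1)] t0 by auto
 have sgnz: "(ALL t:{x'<..<y'}. z t > 0) | (ALL t:{x'<..<y'}. z t < 0)"
 proof (rule connected_constant_sign)
  fix t assume "t : {x'<..<y'}"
  thus "z t ~= 0" using y'(4)[of t] x'(4)[of t] by (cases "t <= t0") auto
 qed (use x' y' in "auto intro!: continuous_on_subset[OF cz]")
 have flux: "zJ x' * zJ y' < 0"
  using sgnz
 proof
  assume pos: "ALL t:{x'<..<y'}. z t > 0"
  have "zJ y' < 0" by (rule sl_flux_right[OF sl_z, of x']) (use pos x' y' xy in auto)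
  moreover have "zJ x' > 0" by (rule sl_flux_left[OF sl_z, of x' y']) (use pos x' y' xy a0 in auto)
  ultimately show ?thesis by (simp add: mult_less_0_iff)
 next
  assume pos: "ALL t:{x'<..<y'}. z t < 0"
  have "- zJ y' < 0" by (rule sl_flux_right[OF sl_uminus[OF sl_z], of x']) (use pos x' y' xy in auto)
  moreover have "- zJ x' > 0" by (rule sl_flux_left[OF sl_uminus[OF sl_z], of x' y']) (use pos x' y' xy a0 in auto)
  ultimately show ?thesis by (simp add: mult_less_0_iff)
 qed
 have "w x' * zJ x' < 0" "w y' * zJ y' < 0" using x' y' xy by (auto intro!: z_zero)
 moreover have "x' : {x..y}" "y' : {x..y}" using x' y' by auto
 hence "w x' * w y' > 0" using sgn by (metis mult_pos_pos mult_neg_neg)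
 ultimately show False using flux by (auto simp: mult_less_0_iff zero_less_mult_iff)
qed

text \<open>The number of zeros of \<open>w\<close> to the left of a zero of \<open>z\<close>
  determines this zero by \<open>z_zeros_separated\<close>, and it ranges from 0 to the number of
  zeros of \<open>w\<close>.\<close>

lemma z_zeros:
 shows "finite {t\<in>{a<..<b}. z t = 0}" "card {t\<in>{a<..<b}. z t = 0} <= Suc (card {t\<in>{a<..<b}. w t = 0})"
proof -
 define Z where "Z = {t\<in>{a<..<b}. w t = 0}"
 define f where "f = (%r. card {t\<in>Z. t < r})"
 have fin: "finite Z" using fin_zeros by (simp add: Z_def)
 have inj: "inj_on f {t\<in>{a<..<b}. z t = 0}"
 proof (rule linorder_inj_onI)
  fix x y assume xy: "x < y" "x : {t\<in>{a<..<b}. z t = 0}" "y : {t\<in>{a<..<b}. z t = 0}"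
  obtain t where t: "x < t" "t < y" "w t = 0" using z_zeros_separated[of x y] xy by auto
  hence "t : Z" using xy by (auto simp: Z_def)
  have "{t\<in>Z. t < x} <= {t\<in>Z. t < y}" using xy(1) by (auto intro: less_trans)
  moreover have "t : {t\<in>Z. t < y}" "t ~: {t\<in>Z. t < x}" using t \<open>t : Z\<close> by simp_all
  ultimately have "{t\<in>Z. t < x} \<subset> {t\<in>Z. t < y}" by blast
  hence "f x < f y" unfolding f_def using fin by (intro psubset_card_mono) auto
  thus "f x ~= f y" by simp
 qed auto
 have sub: "f ` {t\<in>{a<..<b}. z t = 0} <= {..card Z}"
  unfolding f_def using fin by (auto intro!: card_mono)
 show "finite {t\<in>{a<..<b}. z t = 0}" using inj_on_finite[OF inj sub] by simp
 show "card {t\<in>{a<..<b}. z t = 0} <= Suc (card {t\<in>{a<..<b}. w t = 0})"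
  using card_inj_on_le[OF inj sub] by (simp add: Z_def)
qed

end


section \<open>Shooting and the Pruefer angle\<close>

lemma integral_exp_bound:
 fixes f :: "real => real"
 assumes "continuous_on {a..s} f" "a <= s" "l > 0" "C >= 0" "!!t. t : {a..s} ==> \<bar>f t\<bar> <= C * exp (l * (t - a))"
 shows "\<bar>integral {a..s} f\<bar> <= C * exp (l * (s - a)) / l"
proof -
 have I: "((%t. C * exp (l * (t - a))) has_integral (C * exp (l * (s - a)) / l - C * exp (l * (a - a)) / l)) {a..s}"
  using assms by (intro fundamental_theorem_of_calculus)
   (auto intro!: derivative_eq_intros simp flip: has_real_derivative_iff_has_vector_derivative)
 have "norm (integral {a..s} f) <= integral {a..s} (%t. C * exp (l * (t - a)))"
  using assms I
  by (intro integral_norm_bound_integral integrable_continuous_interval) (auto intro!: continuous_intros)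
 also have "... = C * exp (l * (s - a)) / l - C * exp (l * (a - a)) / l" using I by (rule integral_unique)
 also have "... <= C * exp (l * (s - a)) / l" using assms by simp
 finally show ?thesis by simp
qed

lemma continuous_on_patch_0:
 fixes f :: "real => real"
 assumes "continuous_on ({a..b} - {0}) f" "0 <= a" "!!t. t : {a..b} ==> \<bar>f t\<bar> <= B * t"
 shows "continuous_on {a..b} f"
 unfolding continuous_on_eq_continuous_within
proof
 fix x assume x: "x : {a..b}"
 show "continuous (at x within {a..b}) f"
 proof (cases "x = 0")
  case True
  have f0: "f 0 = 0" using assms(3)[of 0] x True by auto
  have "\<forall>\<^sub>F t in at 0 within {a..b}. norm (f t) <= B * t"
   using assms(3) by (auto simp: eventually_at_filter)
  moreover have "((%t. B * t) \<longlongrightarrow> B * 0) (at 0 within {a..b})" by (intro tendsto_intros)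
  hence "((%t. B * t) \<longlongrightarrow> 0) (at 0 within {a..b})" by simp
  ultimately have "(f \<longlongrightarrow> 0) (at 0 within {a..b})"
   by (rule Lim_null_comparison)
  thus ?thesis using True f0 by (simp add: continuous_within)
 next
  case False
  have "continuous (at x within ({a..b} - {0})) f"
   using assms(1) x False by (auto simp: continuous_on_eq_continuous_within)
  moreover have "at x within ({a..b} - {0}) = at x within {a..b}"
   using False by (intro at_within_nhd[of x "- {0}"]) auto
  ultimately show ?thesis by (simp add: continuous_within)
 qed
qed

text \<open>The potential is bounded and continuous off the origin. The regular solution is
  constructed from the integrated equation, which makes sense up to the singular endpoint.\<close>

locale shooting =
 fixes a b K :: real and n :: nat and q :: "real => real"
 assumes a0: "0 <= a" and ab: "a < b" and n: "n >= 1" and cont_q: "continuous_on ({a..b} - {0}) q"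
  and q_le: "!!r. r : {a..b} - {0} ==> \<bar>q r\<bar> <= K"
begin

lemma K0: "K >= 0" using q_le[of b] ab a0 by fastforce

lemma b0: "b > 0" using a0 ab by simp

definition V :: "real => (real => real) => real => real" where "V mu phi t = t ^ n * (q t + mu) * phi t"

lemma V_le: "t : {a..b} ==> \<bar>V mu phi t\<bar> <= t ^ n * ((K + \<bar>mu\<bar>) * \<bar>phi t\<bar>)"
proof (cases "t = 0")
 case False
 assume t: "t : {a..b}"
 have "\<bar>q t + mu\<bar> <= K + \<bar>mu\<bar>" using q_le[of t] t False by auto
 hence "t ^ n * \<bar>q t + mu\<bar> * \<bar>phi t\<bar> <= t ^ n * (K + \<bar>mu\<bar>) * \<bar>phi t\<bar>"
  using t a0 by (intro mult_right_mono mult_left_mono) auto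
 thus ?thesis using t a0 by (simp add: V_def abs_mult mult.assoc)
qed (use n in "simp add: V_def power_0_left")

lemma pow_le: "t : {a..b} ==> t ^ n <= b ^ (n - 1) * t"
 using n a0 by (cases n) (auto intro!: mult_mono power_mono simp: mult.commute[of t])

lemma cont_V:
 assumes "continuous_on {a..b} phi"
 shows "continuous_on {a..b} (V mu phi)"
proof -
 obtain C where C: "!!t. t : {a..b} ==> \<bar>phi t\<bar> <= C" using continuous_interval_bound[OF assms] by blast
 show ?thesis
 proof (rule continuous_on_patch_0[OF _ a0])
  show "continuous_on ({a..b} - {0}) (V mu phi)" unfolding V_def
   by (intro continuous_intros cont_q continuous_on_subset[OF assms]) auto
  fix t assume t: "t : {a..b}"
  have C0: "0 <= C" using C[OF t] by linarith
  have "\<bar>V mu phi t\<bar> <= t ^ n * ((K + \<bar>mu\<bar>) * \<bar>phi t\<bar>)" by (rule V_le[OF t])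
  also have "... <= (b ^ (n - 1) * t) * ((K + \<bar>mu\<bar>) * C)"
   using pow_le[OF t] C[OF t] K0 t a0 C0 b0 by (intro mult_mono) auto
  finally show "\<bar>V mu phi t\<bar> <= (b ^ (n - 1) * ((K + \<bar>mu\<bar>) * C)) * t" by (simp add: ac_simps)
 qed
qed

lemma integral_cont: "continuous_on {a..b} g ==> continuous_on {a..b} (%s. integral {a..s} g)"
 for g :: "real => real"
 by (intro indefinite_integral_continuous_1 integrable_continuous_interval)

text \<open>For \<open>s = 0\<close> division by zero gives 0, which is also the limit when
  \<open>g\<close> is bounded by a multiple of \<open>t ^ n\<close>.\<close>

definition flux :: "(real => real) => real => real" where "flux g s = integral {a..s} g / s ^ n"

text \<open>The inequality \<open>t ^ n <= s ^ n\<close> under the integral cancels the singular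
  factor \<open>1 / s ^ n\<close>; integrating the exponential weight contributes the gain
  \<open>1 / l\<close>.\<close>

lemma flux_bound:
 assumes "continuous_on {a..b} g" "l > 0" "C >= 0" "!!t. t : {a..b} ==> \<bar>g t\<bar> <= t ^ n * (C * exp (l * (t - a)))" "s : {a..b}"
 shows "\<bar>flux g s\<bar> <= C * exp (l * (s - a)) / l"
proof (cases "s = 0")
 case False
 hence s: "s > 0" using assms(5) a0 by auto
 have "\<bar>integral {a..s} g\<bar> <= (s ^ n * C) * exp (l * (s - a)) / l"
 proof (rule integral_exp_bound)
  fix t assume t: "t : {a..s}"
  have "\<bar>g t\<bar> <= t ^ n * (C * exp (l * (t - a)))" using t assms(4,5) by auto
  also have "... <= s ^ n * (C * exp (l * (t - a)))" using t a0 assms(3) by (intro mult_right_mono power_mono) auto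
  finally show "\<bar>g t\<bar> <= s ^ n * C * exp (l * (t - a))" by (simp add: mult.assoc)
 qed (use assms s in "auto elim: continuous_on_subset")
 thus ?thesis using s by (simp add: flux_def field_simps)
qed (use assms n in "simp add: flux_def power_0_left")

lemma cont_flux:
 assumes g: "continuous_on {a..b} g" and le: "C >= 0" "!!t. t : {a..b} ==> \<bar>g t\<bar> <= t ^ n * C"
 shows "continuous_on {a..b} (flux g)"
proof (rule continuous_on_patch_0[OF _ a0])
 have "continuous_on ({a..b} - {0}) (%s. integral {a..s} g)"
  by (rule continuous_on_subset[OF integral_cont[OF g]]) auto
 thus "continuous_on ({a..b} - {0}) (flux g)" unfolding flux_def by (intro continuous_intros) auto
 fix s assume s: "s : {a..b}"
 have "norm (integral {a..s} g) <= (s ^ n * C) * measure lborel (cbox a s)"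
 proof (rule has_integral_bound[where f=g])
  have "continuous_on {a..s} g" using g s by (auto elim: continuous_on_subset)
  thus "(g has_integral integral {a..s} g) (cbox a s)"
   by (simp add: integrable_continuous_interval integrable_integral)
  fix t assume t: "t : cbox a s"
  have "\<bar>g t\<bar> <= t ^ n * C" using t s le by auto
  also have "... <= s ^ n * C" using t a0 le s by (intro mult_right_mono power_mono) auto
  finally show "norm (g t) <= s ^ n * C" by simp
 qed (use le s a0 in auto)
 also have "... <= (s ^ n * C) * s" using s a0 le by (intro mult_left_mono) auto
 finally have "\<bar>integral {a..s} g\<bar> <= s ^ n * (C * s)" by (simp add: mult.assoc)
 thus "\<bar>flux g s\<bar> <= C * s" using s a0 n le
  unfolding flux_def by (cases "s = 0") (auto simp: power_0_left field_simps)
qed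

text \<open>Initial flux; together with \<open>psi0\<close>, the solution with vanishing potential,
  it normalizes the regular solution: value 1 and flux 0 at the origin, value 0 and flux 1 at a
  positive \<open>a\<close>.\<close>

definition j0 :: real where "j0 = (if a = 0 then 0 else 1)"

definition psi0 :: "real => real" where "psi0 r = (if a = 0 then 1 else integral {a..r} (%s. 1 / s ^ n))"

lemma cont_psi0: "continuous_on {a..b} psi0"
proof (cases "a = 0")
 case False
 hence "continuous_on {a..b} (%s. 1 / s ^ n)" using a0 by (auto intro!: continuous_intros)
 from integral_cont[OF this] False show ?thesis by (simp add: psi0_def)
next
 case True
 hence "psi0 = (%r. 1)" unfolding psi0_def by simp
 thus ?thesis by simp
qed

lemma deriv_psi0:
 assumes "r : {a<..<b}"
 shows "(psi0 has_real_derivative j0 / r ^ n) (at r)"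
proof (cases "a = 0")
 case False
 hence c: "continuous_on {a..b} (%s. 1 / s ^ n)" using a0 by (auto intro!: continuous_intros)
 have "((%r. integral {a..r} (%s. 1 / s ^ n)) has_real_derivative 1 / r ^ n) (at r within {a..b})"
  by (rule integral_has_real_derivative[OF c]) (use assms in auto)
 moreover have "psi0 = (%r. integral {a..r} (%s. 1 / s ^ n))" using False by (intro ext) (simp add: psi0_def)
 ultimately show ?thesis using False assms by (simp add: j0_def at_within_Icc_at)
next
 case True
 hence "psi0 = (%r. 1)" "j0 = 0" unfolding psi0_def j0_def by simp_all
 thus ?thesis by simp
qed

text \<open>The equation integrated twice: its fixed points are the regular solutions for the
  parameter \<open>mu\<close>.\<close>

definition T :: "real => (real => real) => real => real" where
 "T mu phi r = psi0 r - integral {a..r} (flux (V mu phi))"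

lemma cont_flux_V:
 assumes "continuous_on {a..b} phi"
 shows "continuous_on {a..b} (flux (V mu phi))"
proof -
 obtain C where C: "!!t. t : {a..b} ==> \<bar>phi t\<bar> <= C" using continuous_interval_bound[OF assms] by blast
 have C0: "0 <= C" using C[of a] ab by fastforce
 show ?thesis
 proof (rule cont_flux[OF cont_V[OF assms], of "(K + \<bar>mu\<bar>) * C"])
  fix t assume t: "t : {a..b}"
  have "t ^ n * ((K + \<bar>mu\<bar>) * \<bar>phi t\<bar>) <= t ^ n * ((K + \<bar>mu\<bar>) * C)"
   using C[OF t] K0 t a0 by (intro mult_left_mono) auto
  thus "\<bar>V mu phi t\<bar> <= t ^ n * ((K + \<bar>mu\<bar>) * C)" using V_le[OF t, of mu phi] by linarith
 qed (use K0 C0 in auto)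
qed

lemma cont_T: "continuous_on {a..b} phi ==> continuous_on {a..b} (T mu phi)"
 unfolding T_def by (intro continuous_intros cont_psi0 integral_cont cont_flux_V)

text \<open>Each of the two integrations gains a factor \<open>1 / l\<close>. Different parameters
  are allowed, so that the estimate yields both contraction and Lipschitz dependence on
  \<open>mu\<close>.\<close>

lemma T_diff:
 assumes "continuous_on {a..b} phi" "continuous_on {a..b} theta" "l > 0" "C >= 0"
  "!!t. t : {a..b} ==> \<bar>V mu phi t - V nu theta t\<bar> <= t ^ n * (C * exp (l * (t - a)))" "r : {a..b}"
 shows "\<bar>T mu phi r - T nu theta r\<bar> <= C / l^2 * exp (l * (r - a))"
proof -
 define g where "g = (%t. V mu phi t - V nu theta t)"
 have cg: "continuous_on {a..b} g" unfolding g_def by (intro continuous_intros cont_V assms)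
 have fl: "flux (V mu phi) s - flux (V nu theta) s = flux g s" if "s : {a..b}" for s
 proof -
  have "integral {a..s} g = integral {a..s} (V mu phi) - integral {a..s} (V nu theta)" unfolding g_def
   by (intro integral_diff integrable_continuous_interval continuous_on_subset[OF cont_V] assms) (use that in auto)
  thus ?thesis by (simp add: flux_def diff_divide_distrib)
 qed
 have sub: "{a..r} <= {a..b}" using assms(6) by auto
 have "T mu phi r - T nu theta r = - integral {a..r} (%s. flux (V mu phi) s - flux (V nu theta) s)"
  unfolding T_def
  by (subst integral_diff)
   (auto intro!: integrable_continuous_interval continuous_on_subset[OF cont_flux_V sub] assms)
 hence "\<bar>T mu phi r - T nu theta r\<bar> = \<bar>integral {a..r} (%s. flux (V mu phi) s - flux (V nu theta) s)\<bar>" by simp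
 also have "... <= (C / l) * exp (l * (r - a)) / l"
 proof (rule integral_exp_bound)
  show "continuous_on {a..r} (%s. flux (V mu phi) s - flux (V nu theta) s)"
   by (intro continuous_intros continuous_on_subset[OF cont_flux_V sub] assms)
  fix t assume t: "t : {a..r}"
  hence t': "t : {a..b}" using sub by auto
  show "\<bar>flux (V mu phi) t - flux (V nu theta) t\<bar> <= C / l * exp (l * (t - a))"
   using flux_bound[OF cg assms(3,4) _ t'] assms(5) unfolding fl[OF t'] g_def by simp
 qed (use assms in auto)
 finally show ?thesis by (simp add: power2_eq_square)
qed

lemma V_diff: "t : {a..b} ==>
 \<bar>V mu phi t - V nu theta t\<bar> <= t ^ n * ((K + \<bar>mu\<bar>) * \<bar>phi t - theta t\<bar> + \<bar>mu - nu\<bar> * \<bar>theta t\<bar>)"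
proof -
 assume t: "t : {a..b}"
 have "V mu phi t - V nu theta t = V mu (%t. phi t - theta t) t + t ^ n * ((mu - nu) * theta t)"
  by (simp add: V_def algebra_simps)
 moreover have "\<bar>V mu (%t. phi t - theta t) t\<bar> <= t ^ n * ((K + \<bar>mu\<bar>) * \<bar>phi t - theta t\<bar>)" by (rule V_le[OF t])
 moreover have "\<bar>t ^ n * ((mu - nu) * theta t)\<bar> = t ^ n * (\<bar>mu - nu\<bar> * \<bar>theta t\<bar>)"
  using t a0 by (simp add: abs_mult)
 ultimately show ?thesis unfolding distrib_left by linarith
qed

text \<open>The factor \<open>exp (l * (r - a))\<close> makes the Volterra operator a contraction in the supremum norm.\<close>

lemma fixed_point:
 assumes M: "M >= 0"
 shows "EX psi. ALL mu:{-M..M}. continuous_on {a..b} (psi mu) & (ALL r:{a..b}. psi mu r = T mu (psi mu) r) &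
  (EX D. ALL nu:{-M..M}. ALL r:{a..b}. \<bar>psi nu r - psi mu r\<bar> <= D * \<bar>nu - mu\<bar>)"
proof -
 \<comment> \<open>Large enough for \<open>(K + M) / l^2 <= 1 / 2\<close>, the contraction factor
   for parameters in \<open>{-M..M}\<close>.\<close>
 define l where "l = 1 + 2 * (K + M)"
 have l: "l >= 1" using K0 M by (simp add: l_def)
 have "l^2 >= l" using l by (simp add: power2_eq_square)
 hence l2: "(K + M) / l^2 <= 1 / 2" "1 / l^2 <= 1" "l^2 > 0" using l K0 M by (auto simp: l_def field_simps)
 \<comment> \<open>Clamping to \<open>{a..b}\<close> represents functions on the interval by bounded
   continuous functions on the whole line, which form a complete metric space.\<close>
 define c where "c = (%r. max a (min b r))"
 have c: "c r : {a..b}" "continuous_on UNIV c" for r using ab by (auto simp: c_def intro!: continuous_intros)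
 define lift where "lift = (%Phi :: real \<Rightarrow>\<^sub>C real. (%t. exp (l * (t - a)) * Phi t))"
 have cont_lift: "continuous_on {a..b} (lift Phi)" for Phi unfolding lift_def by (intro continuous_intros) auto
 have ld: "lift Phi t - lift Psi t = exp (l * (t - a)) * (Phi t - Psi t)" for Phi Psi t
  by (simp add: lift_def right_diff_distrib)
 have cancel: "exp (- x) * (d * exp x) = d" for x d :: real by (simp add: exp_minus)
 define G where "G = (%mu Phi. Bcontfun (%r. exp (- (l * (c r - a))) * T mu (lift Phi) (c r)))"
 have G: "apply_bcontfun (G mu Phi) r = exp (- (l * (c r - a))) * T mu (lift Phi) (c r)" for mu Phi r
 proof -
  have ce: "continuous_on {a..b} (%r. exp (- (l * (r - a))) * T mu (lift Phi) r)"
   by (intro continuous_intros cont_T cont_lift)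
  have "continuous_on UNIV (%r. exp (- (l * (c r - a))) * T mu (lift Phi) (c r))"
   by (rule continuous_on_compose2[OF ce c(2)]) (use c in auto)
  moreover have "bounded (range (%r. exp (- (l * (c r - a))) * T mu (lift Phi) (c r)))"
  proof (rule bounded_subset)
   show "bounded ((%r. exp (- (l * (r - a))) * T mu (lift Phi) r) ` {a..b})"
    by (intro compact_imp_bounded compact_continuous_image ce) auto
  qed (use c in auto)
  ultimately show ?thesis unfolding G_def by (subst Bcontfun_inverse) (auto simp: bcontfun_def)
 qed
 have Gd: "dist (G mu Phi) (G nu Psi) <= 1 / 2 * dist Phi Psi + \<bar>mu - nu\<bar> * norm Psi"
  if m: "mu : {-M..M}" for mu nu Phi Psi
 proof (rule dist_bound)
  fix r
  define C where "C = (K + M) * dist Phi Psi + \<bar>mu - nu\<bar> * norm Psi"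
  have C: "C >= 0" using K0 M by (simp add: C_def)
  have "\<bar>T mu (lift Phi) (c r) - T nu (lift Psi) (c r)\<bar> <= C / l^2 * exp (l * (c r - a))"
  proof (rule T_diff[OF cont_lift cont_lift _ C _ c(1)])
   fix t assume t: "t : {a..b}"
   have 1: "\<bar>lift Phi t - lift Psi t\<bar> <= exp (l * (t - a)) * dist Phi Psi"
    using dist_bounded[of Phi t Psi] unfolding ld abs_mult by (simp add: dist_real_def)
   have 2: "\<bar>lift Psi t\<bar> <= exp (l * (t - a)) * norm Psi"
    using norm_bounded[of Psi t] by (simp add: lift_def abs_mult)
   have "\<bar>V mu (lift Phi) t - V nu (lift Psi) t\<bar> \<le>
     t ^ n * ((K + \<bar>mu\<bar>) * \<bar>lift Phi t - lift Psi t\<bar> + \<bar>mu - nu\<bar> * \<bar>lift Psi t\<bar>)" by (rule V_diff[OF t])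
   also have "... <= t ^ n * ((K + M) * (exp (l * (t - a)) * dist Phi Psi) + \<bar>mu - nu\<bar> * (exp (l * (t - a)) * norm Psi))"
    using 1 2 K0 M m t a0 by (intro mult_left_mono add_mono mult_mono) auto
   also have "... = t ^ n * (C * exp (l * (t - a)))" by (simp add: C_def algebra_simps)
   finally show "\<bar>V mu (lift Phi) t - V nu (lift Psi) t\<bar> <= t ^ n * (C * exp (l * (t - a)))" .
  qed (use l in auto)
  hence "exp (- (l * (c r - a))) * \<bar>T mu (lift Phi) (c r) - T nu (lift Psi) (c r)\<bar>
    <= exp (- (l * (c r - a))) * (C / l^2 * exp (l * (c r - a)))" by (intro mult_left_mono) auto
  also have "... = C / l^2" by (rule cancel)
  also have "... = (K + M) / l^2 * dist Phi Psi + 1 / l^2 * (\<bar>mu - nu\<bar> * norm Psi)"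
   unfolding C_def add_divide_distrib[of "(K + M) * dist Phi Psi"] by simp
  also have "... <= 1 / 2 * dist Phi Psi + 1 * (\<bar>mu - nu\<bar> * norm Psi)"
   by (intro add_mono mult_right_mono l2) auto
  finally show "dist (G mu Phi r) (G nu Psi r) <= 1 / 2 * dist Phi Psi + \<bar>mu - nu\<bar> * norm Psi"
   by (simp add: G dist_real_def abs_mult right_diff_distrib[symmetric] del: right_diff_distrib)
 qed
 have "EX Phi. G mu Phi = Phi" if "mu : {-M..M}" for mu
 proof -
  have "\<exists>!x. G mu x = x"
   by (rule banach_fix_type[where c="1/2"]) (use Gd[OF that, of _ mu] in auto)
  thus ?thesis by blast
 qed
 then obtain Phi where Phi: "!!mu. mu : {-M..M} ==> G mu (Phi mu) = Phi mu" by metis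
 show ?thesis
 proof (intro exI[of _ "%mu. lift (Phi mu)"] ballI conjI)
  fix mu assume m: "mu : {-M..M}"
  show "continuous_on {a..b} (lift (Phi mu))" by (rule cont_lift)
  show "lift (Phi mu) r = T mu (lift (Phi mu)) r" if "r : {a..b}" for r
  proof -
   have "c r = r" using that by (auto simp: c_def)
   hence "Phi mu r = exp (- (l * (r - a))) * T mu (lift (Phi mu)) r"
    using G[of mu "Phi mu" r] Phi[OF m] by simp
   thus ?thesis by (simp add: lift_def exp_minus)
  qed
  show "EX D. ALL nu:{-M..M}. ALL r:{a..b}. \<bar>lift (Phi nu) r - lift (Phi mu) r\<bar> <= D * \<bar>nu - mu\<bar>"
  proof (intro exI[of _ "exp (l * (b - a)) * (2 * norm (Phi mu))"] ballI)
   fix nu r assume *: "nu : {-M..M}" "r : {a..b}"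
   \<comment> \<open>The term with factor \<open>1 / 2\<close> is absorbed on the left, which leaves
     Lipschitz dependence on the parameter.\<close>
   have "dist (Phi nu) (Phi mu) <= 1 / 2 * dist (Phi nu) (Phi mu) + \<bar>nu - mu\<bar> * norm (Phi mu)"
    using Gd[OF *(1), of "Phi nu" mu "Phi mu"] Phi[OF *(1)] Phi[OF m] by simp
   hence "dist (Phi nu) (Phi mu) <= 2 * (\<bar>nu - mu\<bar> * norm (Phi mu))" by linarith
   hence d: "dist (Phi nu) (Phi mu) <= 2 * norm (Phi mu) * \<bar>nu - mu\<bar>" by (simp add: ac_simps)
   have "\<bar>lift (Phi nu) r - lift (Phi mu) r\<bar> = exp (l * (r - a)) * \<bar>Phi nu r - Phi mu r\<bar>"
    unfolding ld abs_mult by simp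
   also have "... <= exp (l * (b - a)) * (2 * norm (Phi mu) * \<bar>nu - mu\<bar>)"
    using d dist_bounded[of "Phi nu" r "Phi mu"] * l by (intro mult_mono) (auto simp: dist_real_def)
   finally show "\<bar>lift (Phi nu) r - lift (Phi mu) r\<bar> <= exp (l * (b - a)) * (2 * norm (Phi mu)) * \<bar>nu - mu\<bar>"
    by (simp add: mult.assoc)
  qed
 qed
qed

text \<open>Joint continuity is split into continuity in \<open>r\<close> at the fixed parameter
  \<open>mu\<close> and a deviation of at most \<open>D * |nu - mu|\<close>, uniform in
  \<open>r\<close>.\<close>

lemma continuous_on_parameter:
 fixes f :: "real => real => real"
 assumes "!!mu. mu : S ==> continuous_on A (f mu)"
  "!!mu. mu : S ==> EX D. ALL nu:S. ALL r:A. \<bar>f nu r - f mu r\<bar> <= D * \<bar>nu - mu\<bar>"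
 shows "continuous_on (A \<times> S) (%x. f (snd x) (fst x))"
 unfolding continuous_on_def
proof
 fix x assume "x : A \<times> S"
 then obtain r mu where x: "x = (r, mu)" "r : A" "mu : S" by auto
 obtain D where D: "!!nu s. nu : S ==> s : A ==> \<bar>f nu s - f mu s\<bar> <= D * \<bar>nu - mu\<bar>"
  using assms(2)[OF x(3)] by blast
 have "continuous_on (A \<times> S) (%y. f mu (fst y))"
  by (rule continuous_on_compose2[OF assms(1)[OF x(3)]]) (auto intro!: continuous_intros)
 hence 1: "((%y. f mu (fst y)) \<longlongrightarrow> f mu r) (at x within A \<times> S)"
  using x unfolding continuous_on_def by fastforce
 have "((%y. D * \<bar>snd y - mu\<bar>) \<longlongrightarrow> D * \<bar>snd x - mu\<bar>) (at x within A \<times> S)"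
  by (intro tendsto_intros)
 hence 2: "((%y. D * \<bar>snd y - mu\<bar>) \<longlongrightarrow> 0) (at x within A \<times> S)" using x by simp
 have "\<forall>\<^sub>F y in at x within A \<times> S. norm (f (snd y) (fst y) - f mu (fst y)) <= D * \<bar>snd y - mu\<bar>"
  unfolding eventually_at_filter by (rule always_eventually) (use D in auto)
 from Lim_null_comparison[OF this 2] have "((%y. f (snd y) (fst y) - f mu (fst y)) \<longlongrightarrow> 0) (at x within A \<times> S)" .
 from tendsto_add[OF this 1] show "((%x. f (snd x) (fst x)) \<longlongrightarrow> f (snd x) (fst x)) (at x within A \<times> S)"
  using x by simp
qed

lemma shooting_family:
 assumes M: "M >= 0"
 obtains psi J :: "real => real => real"
 where "!!mu. mu : {-M..M} ==> sl a b n (%r. q r + mu) (psi mu) (J mu)"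
  "!!mu. mu : {-M..M} ==> continuous_on {a..b} (psi mu)"
  "continuous_on ({a..b} \<times> {-M..M}) (%x. psi (snd x) (fst x))"
  "continuous_on ({a..b} \<times> {-M..M}) (%x. J (snd x) (fst x))"
  "!!mu. mu : {-M..M} ==> psi mu a = (if a = 0 then 1 else 0)" "!!mu. mu : {-M..M} ==> J mu a = j0"
  "!!mu. mu : {-M..M} ==> a = 0 ==> EX D. ALL r:{0..b}. \<bar>psi mu r\<bar> <= D & \<bar>J mu r\<bar> <= D * r ^ Suc n"
proof -
 obtain psi where psi: "!!mu. mu : {-M..M} ==> continuous_on {a..b} (psi mu)"
  "!!mu r. mu : {-M..M} ==> r : {a..b} ==> psi mu r = T mu (psi mu) r"
  "!!mu. mu : {-M..M} ==> EX D. ALL nu:{-M..M}. ALL r:{a..b}. \<bar>psi nu r - psi mu r\<bar> <= D * \<bar>nu - mu\<bar>"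
  using fixed_point[OF M] by metis
 define J where "J = (%mu r. j0 - integral {a..r} (V mu (psi mu)))"
 have contJ: "continuous_on {a..b} (J mu)" if "mu : {-M..M}" for mu
  unfolding J_def by (intro continuous_intros integral_cont cont_V psi(1) that)
 have bound: "EX C>=0. ALL r:{a..b}. \<bar>psi mu r\<bar> <= C" if m: "mu : {-M..M}" for mu
 proof -
  obtain C where C: "!!t. t : {a..b} ==> \<bar>psi mu t\<bar> <= C" using continuous_interval_bound[OF psi(1)[OF m]] by blast
  moreover have "0 <= C" using C[of a] ab by fastforce
  ultimately show ?thesis by blast
 qed
 have sl: "sl a b n (%r. q r + mu) (psi mu) (J mu)" if m: "mu : {-M..M}" for mu
  unfolding sl_def
 proof (intro conjI ballI)
  show "continuous_on ({a..b} - {0}) (psi mu)" "continuous_on ({a..b} - {0}) (J mu)"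
   by (auto intro: continuous_on_subset[OF psi(1)[OF m]] continuous_on_subset[OF contJ[OF m]])
  show "continuous_on ({a..b} - {0}) (%r. q r + mu)" by (intro continuous_intros cont_q)
  fix r assume r: "r : {a<..<b}"
  have "((%r. integral {a..r} (flux (V mu (psi mu)))) has_real_derivative flux (V mu (psi mu)) r) (at r within {a..b})"
   by (rule integral_has_real_derivative[OF cont_flux_V[OF psi(1)[OF m]]]) (use r in auto)
  hence "(T mu (psi mu) has_real_derivative j0 / r ^ n - flux (V mu (psi mu)) r) (at r)"
   unfolding T_def using r by (intro DERIV_diff deriv_psi0) (auto simp: at_within_Icc_at)
  also have "j0 / r ^ n - flux (V mu (psi mu)) r = J mu r / r ^ n"
   by (simp add: flux_def J_def diff_divide_distrib)
  finally have d: "(T mu (psi mu) has_real_derivative J mu r / r ^ n) (at r)" .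
  show "(psi mu has_real_derivative J mu r / r ^ n) (at r)"
  proof (rule DERIV_cong_ev[THEN iffD2, OF refl _ refl d])
   have "\<forall>\<^sub>F s in nhds r. s : {a<..<b}" using r by (intro eventually_nhds_in_open) auto
   thus "\<forall>\<^sub>F s in nhds r. psi mu s = T mu (psi mu) s" by eventually_elim (use psi(2)[OF m] in auto)
  qed
  have "((%r. integral {a..r} (V mu (psi mu))) has_real_derivative V mu (psi mu) r) (at r within {a..b})"
   by (rule integral_has_real_derivative[OF cont_V[OF psi(1)[OF m]]]) (use r in auto)
  hence "(J mu has_real_derivative 0 - V mu (psi mu) r) (at r)"
   unfolding J_def using r by (intro DERIV_diff DERIV_const) (auto simp: at_within_Icc_at)
  thus "(J mu has_real_derivative - (r ^ n * (q r + mu) * psi mu r)) (at r)" by (simp add: V_def)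
 qed (use a0 ab in auto)
 have int_bound: "\<bar>integral {a..r} g\<bar> <= B * (b - a)"
  if g: "continuous_on {a..b} g" "!!t. t : {a..b} ==> \<bar>g t\<bar> <= B" "r : {a..b}" for g r B
 proof -
  have B0: "B >= 0" using g(2)[of a] ab by fastforce
  have "norm (integral {a..r} g) <= B * measure lborel (cbox a r)"
  proof (rule has_integral_bound[where f=g])
   have "continuous_on {a..r} g" using g by (auto elim: continuous_on_subset)
   thus "(g has_integral integral {a..r} g) (cbox a r)"
    by (simp add: integrable_continuous_interval integrable_integral)
  qed (use B0 g in auto)
  also have "... <= B * (b - a)" using B0 g by (intro mult_left_mono) auto
  finally show ?thesis by simp
 qed
 have lipJ: "EX D. ALL nu:{-M..M}. ALL r:{a..b}. \<bar>J nu r - J mu r\<bar> <= D * \<bar>nu - mu\<bar>" if m: "mu : {-M..M}" for mu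
 proof -
  obtain C where C: "C >= 0" "!!r. r : {a..b} ==> \<bar>psi mu r\<bar> <= C" using bound[OF m] by blast
  obtain D where D: "!!nu s. nu : {-M..M} ==> s : {a..b} ==> \<bar>psi nu s - psi mu s\<bar> <= D * \<bar>nu - mu\<bar>"
   using psi(3)[OF m] by blast
  have "\<bar>J nu r - J mu r\<bar> <= (b ^ n * ((K + M) * D + C)) * (b - a) * \<bar>nu - mu\<bar>" if nr: "nu : {-M..M}" "r : {a..b}" for nu r
  proof -
   have cV: "continuous_on {a..b} (V nu (psi nu))" "continuous_on {a..b} (V mu (psi mu))" using psi(1) nr m by (auto intro: cont_V)
   have "\<bar>J nu r - J mu r\<bar> = \<bar>integral {a..r} (%t. V nu (psi nu) t - V mu (psi mu) t)\<bar>"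
    unfolding J_def using cV nr
    by (subst integral_diff) (auto intro!: integrable_continuous_interval elim: continuous_on_subset)
   also have "... <= (b ^ n * (((K + M) * D + C) * \<bar>nu - mu\<bar>)) * (b - a)"
   proof (rule int_bound[OF continuous_on_diff[OF cV] _ nr(2)])
    fix t assume t: "t : {a..b}"
    have "\<bar>V nu (psi nu) t - V mu (psi mu) t\<bar> <= t ^ n * ((K + \<bar>nu\<bar>) * \<bar>psi nu t - psi mu t\<bar> + \<bar>nu - mu\<bar> * \<bar>psi mu t\<bar>)"
     by (rule V_diff[OF t])
    also have "... <= b ^ n * ((K + M) * (D * \<bar>nu - mu\<bar>) + \<bar>nu - mu\<bar> * C)"
     using D[OF nr(1) t] C(2)[OF t] nr K0 M t a0 b0
     by (intro mult_mono add_mono power_mono) auto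
    finally show "\<bar>V nu (psi nu) t - V mu (psi mu) t\<bar> <= b ^ n * (((K + M) * D + C) * \<bar>nu - mu\<bar>)"
     by (simp add: algebra_simps)
   qed
   finally show ?thesis by (simp add: ac_simps)
  qed
  thus ?thesis by blast
 qed
 show thesis
 proof (rule that[of psi J, OF sl psi(1)])
  show "continuous_on ({a..b} \<times> {-M..M}) (%x. psi (snd x) (fst x))"
   by (rule continuous_on_parameter[OF psi(1,3)])
  show "continuous_on ({a..b} \<times> {-M..M}) (%x. J (snd x) (fst x))"
   by (rule continuous_on_parameter[OF contJ lipJ])
  fix mu assume m: "mu : {-M..M}"
  show "psi mu a = (if a = 0 then 1 else 0)" using psi(2)[OF m, of a] ab unfolding T_def psi0_def by auto
  show "J mu a = j0" by (simp add: J_def)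
  assume a: "a = 0"
  obtain C where C: "C >= 0" "!!r. r : {a..b} ==> \<bar>psi mu r\<bar> <= C" using bound[OF m] by blast
  have "\<bar>J mu r\<bar> <= ((K + \<bar>mu\<bar>) * C) * r ^ Suc n" if r: "r : {0..b}" for r
  proof -
   have "norm (integral {a..r} (V mu (psi mu))) <= (r ^ n * ((K + \<bar>mu\<bar>) * C)) * measure lborel (cbox a r)"
   proof (rule has_integral_bound[where f="V mu (psi mu)"])
    have "continuous_on {a..r} (V mu (psi mu))"
     by (rule continuous_on_subset[OF cont_V[OF psi(1)[OF m]]]) (use r in auto)
    thus "(V mu (psi mu) has_integral integral {a..r} (V mu (psi mu))) (cbox a r)"
     by (simp add: integrable_continuous_interval integrable_integral)
    fix t assume t: "t : cbox a r"
    hence t': "t : {a..b}" using r by auto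
    have "\<bar>V mu (psi mu) t\<bar> <= t ^ n * ((K + \<bar>mu\<bar>) * \<bar>psi mu t\<bar>)" by (rule V_le[OF t'])
    also have "... <= r ^ n * ((K + \<bar>mu\<bar>) * C)"
     using t t' C K0 a by (intro mult_mono power_mono) auto
    finally show "norm (V mu (psi mu) t) <= r ^ n * ((K + \<bar>mu\<bar>) * C)" by simp
   qed (use C K0 r in auto)
   thus ?thesis using r a unfolding J_def j0_def by (simp add: ac_simps)
  qed
  moreover have "((K + \<bar>mu\<bar>) * C) * r ^ Suc n <= max C ((K + \<bar>mu\<bar>) * C) * r ^ Suc n" if "r : {0..b}" for r
   using that by (intro mult_right_mono) auto
  ultimately have "\<bar>J mu r\<bar> <= max C ((K + \<bar>mu\<bar>) * C) * r ^ Suc n" if "r : {0..b}" for r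
   using that by (meson order_trans)
  moreover have "\<bar>psi mu r\<bar> <= max C ((K + \<bar>mu\<bar>) * C)" if "r : {0..b}" for r
   using C(2)[of r] that a by auto
  ultimately have "ALL r:{0..b}. \<bar>psi mu r\<bar> <= max C ((K + \<bar>mu\<bar>) * C) & \<bar>J mu r\<bar> <= max C ((K + \<bar>mu\<bar>) * C) * r ^ Suc n"
   by blast
  thus "EX D. ALL r:{0..b}. \<bar>psi mu r\<bar> <= D & \<bar>J mu r\<bar> <= D * r ^ Suc n" by blast
 qed
qed

end


section \<open>The Pruefer angle and the shooting argument\<close>

lemma sl_cmult: "sl a b n Q psi J ==> sl a b n Q (%r. c * psi r) (%r. c * J r)"
 using sl_lincomb[of a b n Q psi J psi J c 0] by simp

lemma sin_shift: "sin (x - real k * pi) = (- 1) ^ k * sin x" "cos (x - real k * pi) = (- 1) ^ k * cos x"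
 by (simp_all add: sin_diff cos_diff sin_npi cos_npi)

lemma continuous_on_slice:
 assumes "continuous_on (A \<times> S) (%x. f (snd x) (fst x))" "mu : S"
 shows "continuous_on A (f mu)"
proof -
 have "continuous_on A (%r. (r, mu))" by (intro continuous_intros)
 from continuous_on_compose2[OF assms(1) this] show ?thesis using assms(2) by (simp add: image_subset_iff)
qed

text \<open>Where \<open>theta = k * pi\<close>, \<open>psi\<close> vanishes and \<open>J\<close>
  has the sign of \<open>(- 1) ^ k\<close>, so that \<open>(- 1) ^ k * psi\<close> changes from
  negative to positive: the angle crosses a multiple of \<open>pi\<close> only upwards.\<close>

lemma pruefer_crossing:
 assumes sl: "sl a b n Q psi J" and theta: "continuous_on {a..b} theta"
  and polar: "!!r. r : {a..b} ==> rho r > 0 & psi r = rho r * sin (theta r) & J r = rho r * cos (theta r)"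
  and r12: "r1 : {a..b}" "r2 : {a..b}" "r1 < r2" and ge: "theta r1 >= real k * pi" "theta r1 > real k * pi | r1 > 0"
 shows "theta r2 > real k * pi"
proof (rule ccontr)
 assume con: "\<not> theta r2 > real k * pi"
 have a0: "0 <= a" using sl by (auto simp: sl_def)
 define c where "c = (- 1 :: real) ^ k"
 have cc: "c * c = 1" by (simp add: c_def flip: power_mult_distrib)
 have sl': "sl a b n Q (%r. c * psi r) (%r. c * J r)" by (rule sl_cmult[OF sl])
 have loc: "EX e>0. ALL t:{a..b} - {0}. \<bar>t - y\<bar> < e --> (t < y --> theta t < real k * pi) & (y < t --> theta t > real k * pi)"
  if y: "y : {a..b} - {0}" "theta y = real k * pi" for y
 proof -
  have "sin (theta y - real k * pi) = 0" "cos (theta y - real k * pi) = 1" using y by auto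
  hence "c * sin (theta y) = 0" "c * cos (theta y) = 1" by (auto simp only: sin_shift c_def)
  moreover have "c * psi y = rho y * (c * sin (theta y))" "c * J y = rho y * (c * cos (theta y))" using polar[of y] y by auto
  ultimately have "c * psi y = 0" "c * J y = rho y" by (simp_all only: mult_zero_right mult_1_right)
  moreover have "rho y > 0" using polar[of y] y by blast
  ultimately have "c * psi y = 0" "c * J y > 0" by (simp_all only:)
  from sl_sign_change[OF sl' y(1) this] obtain e1 where e1: "e1 > 0"
   "!!t. t : {a..b} - {0} ==> \<bar>t - y\<bar> < e1 ==> (t < y --> c * psi t < 0) & (y < t --> c * psi t > 0)"
   by blast
  obtain e2 where e2: "e2 > 0" "!!t. t : {a..b} ==> \<bar>t - y\<bar> < e2 ==> \<bar>theta t - real k * pi\<bar> < pi"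
   using theta y pi_gt_zero unfolding continuous_on_iff dist_real_def by (metis DiffD1)
  have "(t < y --> theta t < real k * pi) & (y < t --> theta t > real k * pi)" if t: "t : {a..b} - {0}" "\<bar>t - y\<bar> < min e1 e2" for t
  proof -
   have near: "\<bar>theta t - real k * pi\<bar> < pi" using e2(2)[of t] t by auto
   have s: "c * psi t = rho t * sin (theta t - real k * pi)" "rho t > 0" using polar[of t] t by (auto simp: sin_shift c_def)
   have 1: "theta t < real k * pi" if "c * psi t < 0"
   proof (rule ccontr)
    assume "\<not> theta t < real k * pi"
    hence "sin (theta t - real k * pi) >= 0" using near by (intro sin_ge_zero) auto
    thus False using s that by (simp add: mult_less_0_iff)
   qed
   have 2: "theta t > real k * pi" if "c * psi t > 0"
   proof (rule ccontr)
    assume "\<not> theta t > real k * pi"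
    hence "sin (- (theta t - real k * pi)) >= 0" using near by (intro sin_ge_zero) auto
    hence "sin (theta t - real k * pi) <= 0" by (simp only: sin_minus)
    thus False using s that by (simp add: zero_less_mult_iff)
   qed
   show ?thesis using e1(2)[OF t(1)] t(2) 1 2 by auto
  qed
  thus ?thesis using e1(1) e2(1) by (intro exI[of _ "min e1 e2"]) auto
 qed
 obtain s where s: "r1 <= s" "s < r2" "theta s > real k * pi"
 proof (cases "theta r1 > real k * pi")
  case True
  thus thesis using that r12 by auto
 next
  case False
  hence "theta r1 = real k * pi" "r1 : {a..b} - {0}" using ge r12 by auto
  then obtain e where e: "e > 0" "!!t. t : {a..b} - {0} ==> \<bar>t - r1\<bar> < e ==> r1 < t ==> theta t > real k * pi"
   using loc by blast
  define s where "s = min ((r1 + r2) / 2) (r1 + e / 2)"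
  have "r1 < s" "s < r2" "\<bar>s - r1\<bar> < e" using e(1) r12 by (auto simp: s_def min_def field_simps)
  thus thesis using that[of s] e(2)[of s] r12 ge a0 by auto
 qed
 have cts: "continuous_on {x..y} (%t. theta t - real k * pi)" if "a <= x" "y <= b" for x y
  using that by (intro continuous_intros continuous_on_subset[OF theta]) auto
 \<comment> \<open>A return to the level \<open>k * pi\<close> would have a first instant
   \<open>y\<close>; just before it the angle would already be below the level, hence would have met
   it earlier.\<close>
 obtain y0 where y0: "s <= y0" "y0 <= r2" "theta y0 - real k * pi = 0"
  using IVT2'[of "%t. theta t - real k * pi" r2 0 s] cts[of s r2] con s r12 by auto
 obtain y where y: "s < y" "y <= y0" "theta y - real k * pi = 0" "!!t. s <= t ==> t < y ==> theta t - real k * pi ~= 0"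
  using next_zero[of s y0 "%t. theta t - real k * pi"] cts[of s y0] s y0 r12 by auto
 have "y : {a..b} - {0}" using y y0 s r12 a0 by auto
 then obtain e where e: "e > 0" "!!t. t : {a..b} - {0} ==> \<bar>t - y\<bar> < e ==> t < y ==> theta t < real k * pi"
  using loc[of y] y by auto
 define t where "t = max ((s + y) / 2) (y - e / 2)"
 have t: "s < t" "t < y" "\<bar>t - y\<bar> < e" using e(1) y by (auto simp: t_def max_def field_simps)
 hence "theta t < real k * pi" using e(2)[of t] y y0 s r12 a0 by auto
 then obtain v where "s <= v" "v <= t" "theta v - real k * pi = 0"
  using IVT2'[of "%t. theta t - real k * pi" t 0 s] cts[of s t] t y y0 s r12 by auto
 thus False using y(4)[of v] t by auto
qed

text \<open>The behaviour produced by shooting and shared by \<open>w\<close>. It is stronger than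
  \<open>admissible\<close>, which is what is shown for weak eigenfunctions.\<close>

definition regular_left :: "real => real => nat => (real => real) => (real => real) => bool" where
 "regular_left a b n psi J \<longleftrightarrow> (a > 0 --> psi a = 0) &
  (a = 0 --> (EX D. ALL r:{0<..b}. \<bar>psi r\<bar> <= D & \<bar>J r\<bar> <= D * r ^ Suc n))"

context shooting begin

definition theta0 :: real where "theta0 = (if a = 0 then pi / 2 else 0)"

text \<open>\<open>J + i * psi\<close> has no zero on the contractible rectangle, so it has a
  logarithm that is continuous jointly in \<open>r\<close> and \<open>mu\<close>. Subtracting its
  imaginary part at \<open>r = a\<close> and adding \<open>theta0\<close> changes the angle by a
  multiple of \<open>2 * pi\<close> and normalizes it for all \<open>mu\<close> at once.\<close>

lemma pruefer_angle:
 fixes psi J :: "real => real => real"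
 assumes sl: "!!mu. mu : {-M..M} ==> sl a b n (%r. q r + mu) (psi mu) (J mu)"
  and cont: "continuous_on ({a..b} \<times> {-M..M}) (%x. psi (snd x) (fst x))"
   "continuous_on ({a..b} \<times> {-M..M}) (%x. J (snd x) (fst x))"
  and init: "!!mu. mu : {-M..M} ==> psi mu a = (if a = 0 then 1 else 0)" "!!mu. mu : {-M..M} ==> J mu a = j0"
 obtains theta :: "real \<times> real => real" and rho where "continuous_on ({a..b} \<times> {-M..M}) theta"
  "!!r mu. r : {a..b} ==> mu : {-M..M} ==> rho (r, mu) > 0 & psi mu r = rho (r, mu) * sin (theta (r, mu)) & J mu r = rho (r, mu) * cos (theta (r, mu))"
  "!!mu. mu : {-M..M} ==> theta (a, mu) = theta0"
proof -
 define R where "R = {a..b} \<times> {-M..M}"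
 define f where "f = (%x. Complex (J (snd x) (fst x)) (psi (snd x) (fst x)))"
 \<comment> \<open>Off the origin a common zero would propagate by uniqueness: to \<open>a\<close>
   itself if \<open>a > 0\<close>, where \<open>J\<close> is 1, and otherwise to all points near the
   origin, where continuity demands \<open>psi\<close> close to 1.\<close>
 have nz: "f x ~= 0" if "x : R" for x
 proof
  assume "f x = 0"
  define r mu where "r = fst x" and "mu = snd x"
  have x: "x = (r, mu)" "r : {a..b}" "mu : {-M..M}"
   using that by (auto simp: R_def r_def mu_def)
  have z: "J mu r = 0" "psi mu r = 0" using \<open>f x = 0\<close> x by (auto simp: f_def complex_eq_iff)
  show False
  proof (cases "r = 0")
   case True
   thus False using x a0 z init(1)[OF x(3)] by auto
  next
   case False
   have zero: "psi mu t = 0 & J mu t = 0" if "t : {a..b} - {0}" for t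
    by (rule sl_zero_data[OF sl[OF x(3)] _ z(2,1) that]) (use False x in auto)
   show False
   proof (cases "a = 0")
    case False
    thus False using zero[of a] init(2)[OF x(3)] ab by (auto simp: j0_def)
   next
    case True
    have "continuous_on {a..b} (psi mu)" by (rule continuous_on_slice[OF cont(1) x(3)])
    hence "(psi mu \<longlongrightarrow> psi mu a) (at a within {a..b})" using ab unfolding continuous_on_def by auto
    hence "(psi mu \<longlongrightarrow> 1) (at_right a)" using init(1)[OF x(3)] True ab by (simp add: at_within_Icc_at_right)
    moreover have "(psi mu \<longlongrightarrow> 0) (at_right a)"
     by (rule tendsto_eventually) (use zero ab True in "auto simp: eventually_at_right_field intro!: exI[of _ b]")
    ultimately show False using tendsto_unique[of "at_right a"] by force
   qed
  qed
 qed
 have "continuous_on R f" unfolding f_def R_def by (intro continuous_on_Complex cont)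
 moreover have "contractible R" unfolding R_def by (intro convex_imp_contractible convex_Times) auto
 ultimately obtain g where g: "continuous_on R g" "!!x. x : R ==> f x = exp (g x)"
  using continuous_logarithm_on_contractible[of R f] nz by metis
 define theta where "theta = (%x. Im (g x) - Im (g (a, snd x)) + theta0)"
 define rho where "rho = (%x. exp (Re (g x)))"
 have polar: "psi mu r = rho (r, mu) * sin (Im (g (r, mu))) & J mu r = rho (r, mu) * cos (Im (g (r, mu)))"
  if "r : {a..b}" "mu : {-M..M}" for r mu
 proof -
  have "(r, mu) : R" using that by (simp add: R_def)
  from g(2)[OF this] have "Complex (J mu r) (psi mu r) = exp (g (r, mu))" by (simp add: f_def)
  thus ?thesis unfolding rho_def by (metis Re_exp Im_exp complex.sel)
 qed
 show thesis
 proof (rule that[of theta rho])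
  have "continuous_on R (%x. g (a, snd x))"
   by (rule continuous_on_compose2[OF g(1)]) (use ab in "auto simp: R_def intro!: continuous_intros")
  thus "continuous_on ({a..b} \<times> {-M..M}) theta"
   unfolding theta_def R_def[symmetric] by (intro continuous_intros g(1))
  fix mu assume m: "mu : {-M..M}"
  show "theta (a, mu) = theta0" by (simp add: theta_def)
  fix r assume r: "r : {a..b}"
  have A: "a : {a..b}" using ab by auto
  have pos: "rho x > 0" for x by (simp add: rho_def)
  have "sin (Im (g (a, mu))) = sin theta0 & cos (Im (g (a, mu))) = cos theta0"
  proof (cases "a = 0")
   case True
   hence *: "cos (Im (g (a, mu))) = 0" "rho (a, mu) * sin (Im (g (a, mu))) = 1"
    using polar[OF A m] init[OF m] pos[of "(a, mu)"] unfolding j0_def by auto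
   have "sin (Im (g (a, mu))) > 0" using *(2) pos[of "(a, mu)"] zero_less_mult_pos by (metis zero_less_one)
   moreover have "(sin (Im (g (a, mu))))^2 = 1" using sin_cos_squared_add[of "Im (g (a, mu))"] *(1) by simp
   ultimately have "sin (Im (g (a, mu))) = 1" by (auto simp: power2_eq_1_iff)
   thus ?thesis using True * unfolding theta0_def by simp
  next
   case False
   hence *: "sin (Im (g (a, mu))) = 0" "rho (a, mu) * cos (Im (g (a, mu))) = 1"
    using polar[OF A m] init[OF m] pos[of "(a, mu)"] unfolding j0_def by auto
   have "cos (Im (g (a, mu))) > 0" using *(2) pos[of "(a, mu)"] zero_less_mult_pos by (metis zero_less_one)
   moreover have "(cos (Im (g (a, mu))))^2 = 1" using sin_cos_squared_add[of "Im (g (a, mu))"] *(1) by simp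
   ultimately have "cos (Im (g (a, mu))) = 1" by (auto simp: power2_eq_1_iff)
   thus ?thesis using False * unfolding theta0_def by simp
  qed
  then obtain i :: int where i: "theta0 = Im (g (a, mu)) + 2 * pi * i" using sin_cos_eq_iff by metis
  have "theta (r, mu) = Im (g (r, mu)) + 2 * pi * i" using i by (simp add: theta_def)
  hence "sin (theta (r, mu)) = sin (Im (g (r, mu))) & cos (theta (r, mu)) = cos (Im (g (r, mu)))"
   using sin_cos_eq_iff by metis
  thus "rho (r, mu) > 0 & psi mu r = rho (r, mu) * sin (theta (r, mu)) & J mu r = rho (r, mu) * cos (theta (r, mu))"
   using polar[OF r m] pos by simp
 qed
qed

text \<open>Shooting from the left: \<open>psi mu\<close> meets the condition at \<open>b\<close>
  exactly when its angle there is a multiple of \<open>pi\<close>. The angle exceeds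
  \<open>m * pi\<close> for \<open>mu = 0\<close> and is below \<open>pi\<close> for very negative
  \<open>mu\<close>, so intermediate values give one parameter for each multiple from
  \<open>pi\<close> to \<open>m * pi\<close>.\<close>

lemma negative_eigenvalues:
 assumes zeros: "!!psi J. sl a b n q psi J ==> regular_left a b n psi J ==> has_zeros a b m psi"
 obtains Lambda where "finite Lambda" "card Lambda = m"
  "!!mu. mu : Lambda ==> mu < 0 & (EX psi J. sl a b n (%r. q r + mu) psi J & regular_left a b n psi J & psi b = 0 & J b ~= 0
    & continuous_on {a..b} psi)"
proof -
 define M where "M = K + 1"
 have M: "M > 0" "M >= 0" "- M : {-M..M}" "0 : {-M..M}" using K0 by (auto simp: M_def)
 show thesis
 proof (rule shooting_family[OF M(2)])
 fix psi J assume fam: "!!mu. mu : {-M..M} ==> sl a b n (%r. q r + mu) (psi mu) (J mu)"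
  "!!mu. mu : {-M..M} ==> continuous_on {a..b} (psi mu)"
  "continuous_on ({a..b} \<times> {-M..M}) (%x. psi (snd x) (fst x))"
  "continuous_on ({a..b} \<times> {-M..M}) (%x. J (snd x) (fst x))"
  "!!mu. mu : {-M..M} ==> psi mu a = (if a = 0 then 1 else 0)" "!!mu. mu : {-M..M} ==> J mu a = j0"
  "!!mu. mu : {-M..M} ==> a = 0 ==> EX D. ALL r:{0..b}. \<bar>psi mu r\<bar> <= D & \<bar>J mu r\<bar> <= D * r ^ Suc n"
 obtain theta rho where theta: "continuous_on ({a..b} \<times> {-M..M}) theta"
  "!!r mu. r : {a..b} ==> mu : {-M..M} ==> rho (r, mu) > 0 & psi mu r = rho (r, mu) * sin (theta (r, mu)) & J mu r = rho (r, mu) * cos (theta (r, mu))"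
  "!!mu. mu : {-M..M} ==> theta (a, mu) = theta0"
  using pruefer_angle[OF fam(1,3-6)] by blast
 have reg: "regular_left a b n (psi mu) (J mu)" if "mu : {-M..M}" for mu
  using fam(5)[OF that] fam(7)[OF that] unfolding regular_left_def by force
 have contr: "continuous_on {a..b} (%r. theta (r, mu))" if "mu : {-M..M}" for mu
  by (rule continuous_on_compose2[OF theta(1)]) (use that in "auto intro!: continuous_intros")
 have cross: "theta (r2, mu) > real k * pi"
  if "mu : {-M..M}" "r1 : {a..b}" "r2 : {a..b}" "r1 < r2" "theta (r1, mu) >= real k * pi" "theta (r1, mu) > real k * pi | r1 > 0" for mu r1 r2 k
  by (rule pruefer_crossing[OF fam(1)[OF that(1)] contr[OF that(1)], of "%r. rho (r, mu)" r1])
   (use that theta(2) in auto)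
 have start: "theta0 >= 0" "theta0 < pi" "theta0 > 0 | a > 0" using a0 by (auto simp: theta0_def)
 \<comment> \<open>At the \<open>j\<close>-th zero of \<open>psi 0\<close> the angle is a multiple
   of \<open>pi\<close> above \<open>(j - 1) * pi\<close>, hence at least \<open>j * pi\<close>; the
   passage to the endpoint \<open>b\<close> adds strictness.\<close>
 have top: "theta (b, 0) > real m * pi"
 proof -
  have "has_zeros a b m (psi 0)" using zeros[OF _ reg[OF M(4)]] fam(1)[OF M(4)] by simp
  then obtain x where x: "x 0 = a" "x (Suc m) = b" "ALL i<=m. x i < x (Suc i)" "!!i. 1 <= i ==> i <= m ==> psi 0 (x i) = 0"
   unfolding has_zeros_def by blast
  have lt: "x i < x j" if "i < j" "j <= Suc m" for i j using chain_less[OF x(3) that] .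
  have bnd: "x i : {a..b}" if "i <= Suc m" for i
   using lt[of 0 i] lt[of i "Suc m"] that x(1,2) by (cases "i = 0"; cases "i = Suc m"; force)
  have pos: "x i > 0" if "i ~= 0" "i <= Suc m" for i using lt[of 0 i] that x a0 by auto
  have next_gt: "theta (x (Suc j), 0) > real j * pi" if j: "j <= m" "theta (x j, 0) >= real j * pi" for j
  proof (rule cross[OF M(4) bnd bnd _ j(2)])
   show "theta (x j, 0) > real j * pi | x j > 0"
    using pos[of j] start theta(3)[OF M(4)] x(1) j by (cases "j = 0") auto
  qed (use j x(3) in auto)
  have "theta (x j, 0) >= real j * pi" if "j <= m" for j
   using that
  proof (induction j)
   case 0
   thus ?case using theta(3)[OF M(4)] start x by simp
  next
   case (Suc j)
   hence gt: "theta (x (Suc j), 0) > real j * pi" using next_gt[of j] by auto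
   have "psi 0 (x (Suc j)) = 0" using x(4)[of "Suc j"] Suc by auto
   hence "sin (theta (x (Suc j), 0)) = 0" using theta(2)[OF bnd[of "Suc j"] M(4)] Suc by auto
   then obtain i :: int where i: "theta (x (Suc j), 0) = of_int i * pi" using sin_zero_iff_int2 by blast
   hence "real j * pi < of_int i * pi" using gt by simp
   hence "of_int (int j) < (of_int i :: real)" by simp
   hence "int j < i" by (simp only: of_int_less_iff)
   hence "real (Suc j) <= of_int i" by linarith
   thus ?case unfolding i by (intro mult_right_mono) auto
  qed
  thus ?thesis using next_gt[of m] x by auto
 qed
 \<comment> \<open>For \<open>mu = - M\<close> with \<open>M = K + 1\<close> the potential is
   negative, so the flux increases from a nonnegative value as long as \<open>psi\<close> is
   positive; at a first return of \<open>psi\<close> to zero it would be negative.\<close>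
 have bot: "theta (b, - M) < pi"
 proof (rule ccontr)
  assume con: "\<not> theta (b, - M) < pi"
  define h where "h = (%r. theta (r, - M) - pi)"
  have ch: "continuous_on {a..b} h" unfolding h_def by (intro continuous_intros contr M)
  have ha: "h a < 0" using theta(3)[OF M(3)] start by (simp add: h_def)
  obtain y0 where y0: "a <= y0" "y0 <= b" "h y0 = 0"
   using IVT'[of h a 0 b] ch ha con ab by (auto simp: h_def)
  obtain y where y: "a < y" "y <= y0" "h y = 0" "!!t. a <= t ==> t < y ==> h t ~= 0"
   using next_zero[of a y0 h] continuous_on_subset[OF ch, of "{a..y0}"] ha y0 by auto
  have neg: "h t < 0" if t: "a <= t" "t < y" for t
  proof (rule ccontr)
   assume "\<not> h t < 0"
   then obtain v where "a <= v" "v <= t" "h v = 0"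
    using IVT'[of h a 0 t] continuous_on_subset[OF ch, of "{a..t}"] ha t y y0 by auto
   thus False using y(4)[of v] t by auto
  qed
  have psi_pos: "psi (- M) t > 0" if t: "a < t" "t < y" for t
  proof -
   have "theta (t, - M) > real 0 * pi"
    by (rule cross[OF M(3), of a]) (use t y y0 ab theta(3)[OF M(3)] start in auto)
   hence "sin (theta (t, - M)) > 0" using neg[of t] t by (intro sin_gt_zero) (auto simp: h_def)
   thus ?thesis using theta(2)[of t "- M"] t y y0 M by auto
  qed
  have psi_y: "psi (- M) y = 0" using theta(2)[of y "- M"] y y0 M by (auto simp: h_def)
  have "J (- M) a <= J (- M) y"
  proof (rule DERIV_nonneg_imp_increasing_open[where f="J (- M)"])
   fix t assume t: "a < t" "t < y"
   hence t': "t : {a<..<b}" "t > 0" "t : {a..b} - {0}" using y y0 a0 by auto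
   have "q t <= K" using q_le[OF t'(3)] by auto
   hence "- (t ^ n * (q t + - M) * psi (- M) t) >= 0"
    using psi_pos[OF t] t' by (simp add: M_def mult_nonneg_nonpos mult_nonpos_nonneg)
   thus "EX u. (J (- M) has_real_derivative u) (at t) & 0 <= u"
    using fam(1)[OF M(3)] t' unfolding sl_def by blast
  next
   have "continuous_on {a..b} (J (- M))" by (rule continuous_on_slice[OF fam(4) M(3)])
   thus "continuous_on {a..y} (J (- M))" by (rule continuous_on_subset) (use y y0 in auto)
  qed (use y in auto)
  moreover have "J (- M) a >= 0" unfolding fam(6)[OF M(3)] by (simp add: j0_def)
  moreover have "J (- M) y < 0"
   by (rule sl_flux_right[OF fam(1)[OF M(3)], of a]) (use psi_pos psi_y y y0 in auto)
  ultimately show False by simp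
 qed
 have cm: "continuous_on {- M..0} (%mu. theta (b, mu))"
  by (rule continuous_on_compose2[OF theta(1)]) (use M ab in "auto intro!: continuous_intros")
 have "EX mu. mu : {-M..M} & mu < 0 & theta (b, mu) = real j * pi" if j: "j : {1..m}" for j
 proof -
  have "1 * pi <= real j * pi" "real j * pi <= real m * pi" using j by (intro mult_right_mono; simp)+
  hence 1: "theta (b, - M) <= real j * pi" "real j * pi < theta (b, 0)" using bot top by linarith+
  then obtain mu where mu: "- M <= mu" "mu <= 0" "theta (b, mu) = real j * pi"
   using IVT'[of "%mu. theta (b, mu)" "- M" "real j * pi" 0] cm M by auto
  moreover have "mu ~= 0" using mu 1 by auto
  ultimately show ?thesis using M by (intro exI[of _ mu]) auto
 qed
 then obtain f where f: "!!j. j : {1..m} ==> f j : {-M..M} & f j < 0 & theta (b, f j) = real j * pi" by metis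
 have inj: "inj_on f {1..m}"
 proof (rule inj_onI)
  fix i j assume "i : {1..m}" "j : {1..m}" "f i = f j"
  hence "real i * pi = real j * pi" using f by metis
  thus "i = j" by simp
 qed
 show thesis
 proof (rule that[of "f ` {1..m}"])
  show "card (f ` {1..m}) = m" using inj by (simp add: card_image)
  fix mu assume "mu : f ` {1..m}"
  then obtain j where j: "mu = f j" "j : {1..m}" by auto
  hence m: "mu : {-M..M}" "mu < 0" "theta (b, mu) = real j * pi" using f by auto
  have B: "b : {a..b}" using ab by auto
  have "sin (real j * pi) = 0" by (rule sin_npi)
  hence "psi mu b = 0" using theta(2)[OF B m(1)] m(3) by simp
  moreover have "J mu b ~= 0" using theta(2)[OF B m(1)] m(3) by (simp add: cos_npi)
  ultimately show "mu < 0 & (EX psi J. sl a b n (%r. q r + mu) psi J & regular_left a b n psi J & psi b = 0 & J b ~= 0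
    & continuous_on {a..b} psi)"
   using m fam(1)[OF m(1)] fam(2)[OF m(1)] reg[OF m(1)] by blast
 qed simp
 qed
qed

end


text \<open>The decay that a radial function of class \<open>L^2\<close> and its flux have at the origin of \<open>\<real>\<^sup>n\<^sup>+\<^sup>1\<close>.
 It makes the Wronskian of two such solutions vanish there.\<close>

definition origin_decay :: "real => nat => (real => real) => (real => real) => bool" where
 "origin_decay b n psi J \<longleftrightarrow> (EX D. ALL r:{0<..b}. \<bar>psi r * r powr (real (Suc n) / 2)\<bar> <= D) &
  ((%r. J r / r powr (real (Suc n) / 2)) \<longlongrightarrow> 0) (at_right 0)"

definition admissible :: "real => real => nat => (real => real) => (real => real) => bool" where
 "admissible a b n psi J \<longleftrightarrow> (a > 0 --> psi a = 0) & (a = 0 --> origin_decay b n psi J)"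

lemma origin_decay_bounded:
 assumes b: "b > 0" and D: "!!r. r : {0<..b} ==> \<bar>psi r\<bar> <= D & \<bar>J r\<bar> <= D * r ^ Suc n"
 shows "origin_decay b n psi J"
proof -
 define h where "h = real (Suc n) / 2"
 have h: "h > 0" by (simp add: h_def)
 have D0: "D >= 0" using D[of b] b by fastforce
 have "\<bar>psi r * r powr h\<bar> <= D * b powr h" if r: "r : {0<..b}" for r
  using D[OF r] r h D0 by (auto simp: abs_mult intro!: mult_mono powr_mono2)
 moreover have "((%r. J r / r powr h) \<longlongrightarrow> 0) (at_right 0)"
 proof (rule Lim_null_comparison)
  have "((%r. D * r powr h) \<longlongrightarrow> D * 0 powr h) (at_right 0)"
   by (intro tendsto_mult tendsto_const tendsto_powr'[OF tendsto_ident_at tendsto_const]) (use h in "auto simp: eventually_at_filter")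
  thus "((%r. D * r powr h) \<longlongrightarrow> 0) (at_right 0)" by simp
  show "\<forall>\<^sub>F r in at_right 0. norm (J r / r powr h) <= D * r powr h"
   unfolding eventually_at_right_field
  proof (intro exI[of _ b] conjI allI impI)
   fix r assume r: "0 < r" "r < b"
   have "r powr h * r powr h = r ^ Suc n" using r by (simp add: h_def powr_add[symmetric] powr_realpow del: of_nat_Suc power_Suc)
   hence "\<bar>J r\<bar> <= D * r powr h * r powr h" using D[of r] r by (simp add: mult.assoc)
   thus "norm (J r / r powr h) <= D * r powr h" using r by (simp add: pos_divide_le_eq)
  qed (use b in auto)
 qed
 ultimately show ?thesis unfolding origin_decay_def h_def by blast
qed

text \<open>At the origin each product in the Wronskian splits as
  \<open>(phi * r powr h) * (J / r powr h)\<close> with \<open>h = (n + 1) / 2\<close>: a bounded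
  factor times one that tends to 0.\<close>

lemma admissible_left_bc:
 assumes "0 <= a" "0 < b" "admissible a b n psi J" "a = 0 ==> origin_decay b n phi K"
 shows "left_bc a psi J phi K"
proof (cases "a = 0")
 case False
 thus ?thesis using assms by (auto simp: left_bc_def admissible_def)
next
 case True
 define h where "h = real (Suc n) / 2"
 have prod: "((%r. phi r * J r) \<longlongrightarrow> 0) (at_right 0)" if "origin_decay b n phi J'" "origin_decay b n psi J" for phi psi J J'
 proof -
  obtain D where D: "!!r. r : {0<..b} ==> \<bar>phi r * r powr h\<bar> <= D"
   using \<open>origin_decay b n phi J'\<close> unfolding origin_decay_def h_def by blast
  have l: "((%r. J r / r powr h) \<longlongrightarrow> 0) (at_right 0)" using that(2) unfolding origin_decay_def h_def by blast
  show ?thesis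
  proof (rule Lim_null_comparison)
   from tendsto_mult[OF tendsto_const[of D] tendsto_rabs[OF l]]
   show "((%r. D * \<bar>J r / r powr h\<bar>) \<longlongrightarrow> 0) (at_right 0)" by simp
   show "\<forall>\<^sub>F r in at_right 0. norm (phi r * J r) <= D * \<bar>J r / r powr h\<bar>"
    unfolding eventually_at_right_field
   proof (intro exI[of _ b] conjI allI impI)
    fix r assume r: "0 < r" "r < b"
    have "\<bar>phi r * J r\<bar> = \<bar>phi r * r powr h\<bar> * \<bar>J r / r powr h\<bar>" using r by (simp add: abs_mult)
    also have "... <= D * \<bar>J r / r powr h\<bar>" using D[of r] r by (intro mult_right_mono) auto
    finally show "norm (phi r * J r) <= D * \<bar>J r / r powr h\<bar>" by simp
   qed (use assms in auto)
  qed
 qed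
 have "origin_decay b n psi J" using assms(3) True by (auto simp: admissible_def)
 hence "((%r. phi r * J r - psi r * K r) \<longlongrightarrow> 0 - 0) (at_right 0)"
  using assms(4)[OF True] by (intro tendsto_diff) (auto intro: prod)
 thus ?thesis using True by (simp add: left_bc_def)
qed

lemma admissible_regular:
 assumes "0 < b" "regular_left a b n psi J"
 shows "admissible a b n psi J"
 using assms origin_decay_bounded[OF assms(1)] unfolding admissible_def regular_left_def by blast

section \<open>Counting zeros and eigenvalues of the linearized equation\<close>

context henon_profile begin

lemma q_bounded: "EX K. ALL r:{a..b} - {0}. \<bar>q r\<bar> <= K"
proof (cases "a = 0")
 case False
 hence "{a..b} - {0} = {a..b}" using a0 by auto
 thus ?thesis using continuous_interval_bound[of a b q] cont_q by metis
next
 case True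
 obtain C where C: "!!r. r : {0<..b} ==> \<bar>w r\<bar> <= C" using regular_near_0(2)[OF True] by blast
 have "\<bar>q r\<bar> <= p * (b powr alpha * C powr (p - 1))" if "r : {a..b} - {0}" for r
  unfolding q_def using that True C[of r] p alpha by (auto simp: abs_mult intro!: mult_mono powr_mono2)
 thus ?thesis by blast
qed

lemma regular_w: "regular_left a b n w J"
 using w_a regular_near_0(2) unfolding regular_left_def by blast

lemma origin_decay_z:
 assumes a: "a = 0"
 shows "origin_decay b n z zJ"
proof -
 obtain C where C: "!!r. r : {0<..b} ==> \<bar>w r\<bar> <= C & \<bar>J r\<bar> <= C * r ^ Suc n"
  using regular_near_0(2)[OF a] by blast
 have C0: "C >= 0" using C[of b] b0 by fastforce
 define D1 where "D1 = b * b * C + gamma * C"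
 define D2 where "D2 = \<bar>gamma + 1 - n\<bar> * C + b powr alpha * (C powr (p - 1) * C)"
 have "\<bar>z r\<bar> <= max D1 D2 & \<bar>zJ r\<bar> <= max D1 D2 * r ^ Suc n" if r: "r : {0<..b}" for r
 proof
  have "\<bar>r * J r / r ^ n\<bar> = r * \<bar>J r\<bar> / r ^ n" using r by (simp add: abs_mult)
  also have "... <= r * (C * r ^ Suc n) / r ^ n" using r C[OF r] by (intro divide_right_mono mult_left_mono) auto
  also have "... = r * r * C" using r by simp
  also have "... <= b * b * C" using r C0 by (intro mult_mono) auto
  finally have "\<bar>r * J r / r ^ n\<bar> <= b * b * C" .
  moreover have "\<bar>gamma * w r\<bar> <= gamma * C" using gamma C[OF r] by (simp add: abs_mult)
  ultimately show "\<bar>z r\<bar> <= max D1 D2" unfolding z_def D1_def by linarith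
  have "\<bar>spow p (w r)\<bar> <= C powr (p - 1) * C"
   unfolding spow_def abs_mult using C[OF r] p C0 by (intro mult_mono) (auto intro!: powr_mono2)
  moreover have "r powr alpha <= b powr alpha" using r alpha by (intro powr_mono2) auto
  ultimately have "r powr alpha * \<bar>spow p (w r)\<bar> <= b powr alpha * (C powr (p - 1) * C)" by (intro mult_mono) auto
  hence "r ^ Suc n * (r powr alpha * \<bar>spow p (w r)\<bar>) <= r ^ Suc n * (b powr alpha * (C powr (p - 1) * C))"
   using r by (intro mult_left_mono) auto
  moreover have "\<bar>r * (r ^ n * (r powr alpha * spow p (w r)))\<bar> = r ^ Suc n * (r powr alpha * \<bar>spow p (w r)\<bar>)"
   using r by (simp add: abs_mult)
  moreover have "\<bar>(gamma + 1 - n) * J r\<bar> <= \<bar>gamma + 1 - n\<bar> * (C * r ^ Suc n)"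
   unfolding abs_mult using C[OF r] by (intro mult_left_mono) auto
  ultimately have "\<bar>zJ r\<bar> <= \<bar>gamma + 1 - n\<bar> * (C * r ^ Suc n) + r ^ Suc n * (b powr alpha * (C powr (p - 1) * C))"
   unfolding zJ_def by linarith
  also have "... = D2 * r ^ Suc n" by (simp add: D2_def algebra_simps)
  also have "... <= max D1 D2 * r ^ Suc n" using r by (intro mult_right_mono) auto
  finally show "\<bar>zJ r\<bar> <= max D1 D2 * r ^ Suc n" .
 qed
 thus ?thesis by (rule origin_decay_bounded[OF b0])
qed

definition zones :: nat where "zones = Suc (card {t\<in>{a<..<b}. w t = 0})"

text \<open>The ceiling that contradicts too many eigenvalues: both upper bounds below end with a
  chain of zeros of \<open>z\<close>.\<close>

lemma has_zeros_z: "has_zeros a b k z ==> k <= zones"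
 using has_zeros_card[OF _ z_zeros(1)] z_zeros(2) unfolding zones_def by (meson order_trans)

text \<open>\<open>w\<close> has \<open>zones - 1\<close> interior zeros and vanishes at
  \<open>b\<close>, and its potential lies strictly below \<open>q\<close> wherever \<open>w\<close>
  is nonzero, since \<open>p > 1\<close>. Comparison adds one zero.\<close>

lemma has_zeros_above_w:
 assumes "sl a b n q psi K" "a = 0 ==> origin_decay b n psi K"
 shows "has_zeros a b zones psi"
 unfolding zones_def
proof (rule sturm_count[OF sl_w assms(1)])
 have *: "q t = p * (t powr alpha * \<bar>w t\<bar> powr (p - 1))" for t by (rule q_def)
 show "t powr alpha * \<bar>w t\<bar> powr (p - 1) <= q t" if "a < t" "t < b" for t
  unfolding * using p mult_right_mono[of 1 p "t powr alpha * \<bar>w t\<bar> powr (p - 1)"] by simp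
 show "(ALL t. a < t & t < b & w t ~= 0 --> t powr alpha * \<bar>w t\<bar> powr (p - 1) < q t) | psi b ~= 0"
  unfolding * using p a0 by (auto intro!: mult_strict_right_mono[of 1 p, simplified])
 show "EX t:{a..b} - {0}. w t ~= 0" using nontriv a0 by force
 show "left_bc a w J psi K"
  by (rule admissible_left_bc[OF a0 b0 admissible_regular[OF b0 regular_w] assms(2)])
 show "has_zeros a b (card {t : {a<..<b}. w t = 0}) w"
  by (rule card_has_zeros[OF fin_zeros _ ab]) auto
qed (rule w_b)

text \<open>Two comparisons in a row: \<open>w\<close> against \<open>psi\<close> gives
  \<open>zones\<close> zeros of \<open>psi\<close>, and \<open>psi\<close> against \<open>z\<close>,
  with equal potentials and \<open>z b ~= 0\<close>, gives one zero of \<open>z\<close> more than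
  \<open>has_zeros_z\<close> permits.\<close>

lemma nondegenerate:
 assumes psi: "sl a b n q psi K" "admissible a b n psi K" "psi b = 0"
 shows "ALL t:{a..b} - {0}. psi t = 0"
proof (rule ccontr)
 assume "\<not> ?thesis"
 hence nt: "EX t:{a..b} - {0}. psi t ~= 0" by auto
 have "has_zeros a b zones psi"
  by (rule has_zeros_above_w[OF psi(1)]) (use psi(2) in "auto simp: admissible_def")
 hence "has_zeros a b (Suc zones) z"
  by (rule sturm_count[OF psi(1) sl_z _ _ nt admissible_left_bc[OF a0 b0 psi(2) origin_decay_z] psi(3), rotated -1])
   (use z_b in auto)
 thus False using has_zeros_z by fastforce
qed

text \<open>Induction over the eigenvalues in increasing order: a solution at a level above all of
  them has at least as many zeros as there are eigenvalues, since each eigenfunction inherits the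
  zeros forced by the lower ones and forces one more. The solution \<open>z\<close> at level 0
  concludes.\<close>

lemma negative_eigenvalues_le:
 assumes "finite Lambda" "!!mu. mu : Lambda ==> mu < 0 & (EX psi K. sl a b n (%r. q r + mu) psi K & admissible a b n psi K & psi b = 0
  & (EX t:{a..b} - {0}. psi t ~= 0))"
 shows "card Lambda <= zones"
proof -
 have "ALL nu phi K'. (ALL mu:Lambda. mu < nu) & sl a b n (%r. q r + nu) phi K' & (a = 0 --> origin_decay b n phi K') --> has_zeros a b (card Lambda) phi"
  using assms
 proof (induction Lambda rule: finite_linorder_max_induct)
  case empty
  thus ?case using has_zeros_0[OF ab] by simp
 next
  case (insert mu Lambda)
  show ?case
  proof (intro allI impI, elim conjE)
   fix nu phi K' assume *: "ALL mu:insert mu Lambda. mu < nu" "sl a b n (%r. q r + nu) phi K'" "a = 0 --> origin_decay b n phi K'"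
   obtain psi K where psi: "sl a b n (%r. q r + mu) psi K" "admissible a b n psi K" "psi b = 0" "EX t:{a..b} - {0}. psi t ~= 0"
    using insert.prems[of mu] by blast
   have "ALL nu phi K'. (ALL mu:Lambda. mu < nu) & sl a b n (%r. q r + nu) phi K' & (a = 0 --> origin_decay b n phi K') --> has_zeros a b (card Lambda) phi"
    by (rule insert.IH) (use insert.prems in blast)
   hence "has_zeros a b (card Lambda) psi" using insert.hyps psi unfolding admissible_def by blast
   hence "has_zeros a b (Suc (card Lambda)) phi"
    by (rule sturm_count[OF psi(1) *(2) _ _ psi(4) admissible_left_bc[OF a0 b0 psi(2)] psi(3), rotated -1])
     (use * in auto)
   moreover have "card (insert mu Lambda) = Suc (card Lambda)" using insert.hyps by (subst card_insert_disjoint) auto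
   ultimately show "has_zeros a b (card (insert mu Lambda)) phi" by simp
  qed
 qed
 hence "has_zeros a b (card Lambda) z" using sl_z origin_decay_z assms(2) by force
 thus ?thesis by (rule has_zeros_z)
qed

lemma negative_eigenvalues_ge:
 obtains Lambda where "finite Lambda" "card Lambda = zones"
  "!!mu. mu : Lambda ==> mu < 0 & (EX psi K. sl a b n (%r. q r + mu) psi K & regular_left a b n psi K & psi b = 0 & K b ~= 0
    & continuous_on {a..b} psi)"
proof -
 obtain K where K: "!!r. r : {a..b} - {0} ==> \<bar>q r\<bar> <= K" using q_bounded by blast
 interpret shooting a b K n q by unfold_locales (use a0 ab n cont_q K in auto)
 have "has_zeros a b zones psi" if "sl a b n q psi J" "regular_left a b n psi J" for psi J
  using has_zeros_above_w[OF that(1)] admissible_regular[OF b0 that(2)] unfolding admissible_def by blast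
 thus thesis using negative_eigenvalues[of zones] that by blast
qed

end


section \<open>Test functions and radial integration\<close>

lemma grad_eqI: "GDERIV phi x :> g ==> grad phi x = g"
 unfolding grad_def
proof (rule the_equality)
 fix g' assume "GDERIV phi x :> g" "GDERIV phi x :> g'"
 hence "(%h. inner h g) = (%h. inner h g')"
  unfolding gderiv_def by (rule has_derivative_unique)
 hence "inner (g' - g) (g' - g) = 0" by (metis inner_diff_right diff_self)
 thus "g' = g" by simp
qed

lemma C1_0_I:
 assumes "!!x. GDERIV phi x :> g x" "continuous_on UNIV g" "compact K" "K <= Omega" "!!x. x ~: K ==> phi x = 0"
 shows "phi : C1_0 Omega"
proof -
 have "{x. phi x ~= 0} <= K" using assms(5) by blast
 hence cl: "closure {x. phi x ~= 0} <= K"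
  using compact_imp_closed[OF assms(3)] by (simp add: closure_minimal)
 hence "compact (closure {x. phi x ~= 0})"
  using assms(3) by (meson closed_closure closed_subset compact_Int_closed compact_eq_bounded_closed bounded_subset compact_imp_bounded)
 thus ?thesis unfolding C1_0_def using assms(1,2,4) cl by blast
qed

lemma C1_0_D:
 assumes "phi : C1_0 Omega"
 shows C1_0_GDERIV: "GDERIV phi x :> grad phi x" and C1_0_grad: "continuous_on UNIV (grad phi)"
  and C1_0_continuous: "continuous_on UNIV phi"
proof -
 obtain g where g: "continuous_on UNIV g" "!!x. GDERIV phi x :> g x" using assms unfolding C1_0_def by blast
 hence "grad phi = g" by (intro ext grad_eqI)
 thus "GDERIV phi x :> grad phi x" "continuous_on UNIV (grad phi)" using g by auto
 show "continuous_on UNIV phi"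
  using g(2) unfolding gderiv_def
  by (meson continuous_at_imp_continuous_on has_derivative_continuous)
qed

lemma C1_0_support:
 assumes "phi : C1_0 Omega"
 shows "EX K. compact K & K <= Omega & (ALL x. x ~: K --> phi x = 0 & grad phi x = 0)"
proof (intro exI[of _ "closure {x. phi x ~= 0}"] conjI allI impI)
 show "compact (closure {x. phi x ~= 0})" "closure {x. phi x ~= 0} <= Omega"
  using assms unfolding C1_0_def by auto
 fix x assume x: "x ~: closure {x. phi x ~= 0}"
 have "GDERIV phi x :> 0"
  unfolding gderiv_def
 proof (rule has_derivative_transform_within_open[where s="- closure {x. phi x ~= 0}" and f="%x. 0"])
  fix y assume "y : - closure {x. phi x ~= 0}"
  hence "y ~: {x. phi x ~= 0}" using closure_subset[of "{x. phi x ~= 0}"] by blast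
  thus "0 = phi y" by simp
 qed (use x in auto)
 thus "grad phi x = 0" by (rule grad_eqI)
 have "x ~: {x. phi x ~= 0}" using closure_subset[of "{x. phi x ~= 0}"] x by blast
 thus "phi x = 0" by simp
qed

lemma continuous_compact_support_bounded:
 fixes f :: "'a::metric_space => 'b::real_normed_vector"
 assumes "continuous_on UNIV f" "compact K" "!!x. x ~: K ==> f x = 0"
 obtains B where "B >= 0" "!!x. norm (f x) <= B"
proof -
 have "bounded (f ` K)" using assms by (intro compact_imp_bounded compact_continuous_image) (auto elim: continuous_on_subset)
 then obtain B where B: "!!x. x : K ==> norm (f x) <= B" unfolding bounded_iff by auto
 show thesis
 proof (rule that[of "max B 0"])
  show "norm (f x) <= max B 0" for x using B[of x] assms(3)[of x] by (cases "x : K") auto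
 qed simp
qed

definition C1 :: "('a::euclidean_space => real) => bool" where
 "C1 phi \<longleftrightarrow> (EX g. continuous_on UNIV g & (ALL x. GDERIV phi x :> g x))"

lemma C1_continuous: "C1 phi ==> continuous_on UNIV phi"
 unfolding C1_def gderiv_def by (meson continuous_at_imp_continuous_on has_derivative_continuous)

lemma C1_mult:
 assumes "C1 phi" "C1 psi"
 shows "C1 (%x. phi x * psi x)"
proof -
 obtain g h where "continuous_on UNIV g" "!!x. GDERIV phi x :> g x" "continuous_on UNIV h" "!!x. GDERIV psi x :> h x"
  using assms unfolding C1_def by blast
 thus ?thesis using assms[THEN C1_continuous] unfolding C1_def
  by (intro exI[of _ "%x. phi x *\<^sub>R h x + psi x *\<^sub>R g x"]) (auto intro!: continuous_intros GDERIV_mult)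
qed

lemma C1_compose:
 assumes "C1 phi" "!!t. (f has_real_derivative f' t) (at t)" "continuous_on UNIV f'"
 shows "C1 (%x. f (phi x))"
proof -
 obtain g where g: "continuous_on UNIV g" "!!x. GDERIV phi x :> g x" using assms unfolding C1_def by blast
 have "continuous_on UNIV (%x. f' (phi x))"
  by (rule continuous_on_compose2[OF assms(3) C1_continuous[OF assms(1)]]) auto
 thus ?thesis using g unfolding C1_def
  by (intro exI[of _ "%x. f' (phi x) *\<^sub>R g x"]) (auto intro!: continuous_intros GDERIV_DERIV_compose[OF g(2) assms(2)])
qed

lemma C1_0_C1: "phi : C1_0 Omega ==> C1 phi"
 unfolding C1_0_def C1_def by blast

lemma C1_0_mult:
 assumes "phi : C1_0 Omega" "C1 psi"
 shows "(%x. phi x * psi x) : C1_0 Omega"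
proof -
 obtain K where K: "compact K" "K <= Omega" "!!x. x ~: K ==> phi x = 0 & grad phi x = 0" using C1_0_support[OF assms(1)] by blast
 obtain g where "continuous_on UNIV g" "!!x. GDERIV (%x. phi x * psi x) x :> g x"
  using C1_mult[OF C1_0_C1[OF assms(1)] assms(2)] unfolding C1_def by blast
 thus ?thesis using K by (intro C1_0_I[of _ g K]) auto
qed

lemma integrable_continuous_compact_support:
 fixes f :: "'a::euclidean_space => 'b::euclidean_space"
 assumes "continuous_on UNIV f" "compact K" "!!x. x ~: K ==> f x = 0"
 shows "integrable lborel f"
proof -
 have "integrable lborel (%x. indicator K x *\<^sub>R f x)"
  using assms by (intro borel_integrable_compact) (auto elim: continuous_on_subset)
 moreover have "(%x. indicator K x *\<^sub>R f x) = f" using assms(3) by (auto simp: indicator_def)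
 ultimately show ?thesis by simp
qed

text \<open>Difference quotients have integral zero by translation invariance.\<close>

lemma integral_gradient_zero:
 fixes F :: "'a::euclidean_space => real"
 assumes F: "!!x. GDERIV F x :> G x" and G: "continuous_on UNIV G"
  and K: "compact K" "!!x. x ~: K ==> F x = 0" "!!x. x ~: K ==> G x = 0"
 shows "integrable lborel (%x. G x \<bullet> e)" "(LINT x|lborel. G x \<bullet> e) = 0"
proof -
 obtain B where B: "B >= 0" "!!x. norm (G x) <= B" using continuous_compact_support_bounded[OF G K(1,3)] by blast
 have contF: "continuous_on UNIV F"
  using F unfolding gderiv_def by (meson continuous_at_imp_continuous_on has_derivative_continuous)
 obtain rho where "ALL x:K. norm x <= rho" using compact_imp_bounded[OF K(1)] unfolding bounded_iff by blast
 hence rho: "K <= cball 0 rho" by auto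
 \<comment> \<open>The quotients have steps of length at most \<open>norm e\<close>, so they vanish
   outside the distance \<open>norm e\<close> from \<open>K\<close>, hence outside this
   ball.\<close>
 define S where "S = cball (0::'a) (rho + norm e)"
 define D where "D = (%(k::nat) x. (F (x + (1 / real (Suc k)) *\<^sub>R e) - F x) * real (Suc k))"
 have lip: "\<bar>F y - F x\<bar> <= B * norm (y - x)" for x y
 proof -
  have "norm (F y - F x) <= B * norm (y - x)"
  proof (rule differentiable_bound[of UNIV F "%x h. h \<bullet> G x"])
   show "onorm (%h. h \<bullet> G z) <= B" for z
   proof (rule onorm_le)
    fix h have "norm (h \<bullet> G z) <= norm h * norm (G z)" using Cauchy_Schwarz_ineq2 by auto
    also have "... <= norm h * B" by (intro mult_left_mono B) auto
    finally show "norm (h \<bullet> G z) <= B * norm h" by (simp add: mult.commute)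
   qed
  qed (use F in "auto simp: gderiv_def")
  thus ?thesis by simp
 qed
 have Dbound: "norm (D k x) <= B * norm e * indicator S x" for k x
 proof (cases "x : S")
  case True
  have "\<bar>F (x + (1 / real (Suc k)) *\<^sub>R e) - F x\<bar> <= B * (1 / real (Suc k) * norm e)"
   using lip[of "x + (1 / real (Suc k)) *\<^sub>R e" x] by simp
  hence "\<bar>F (x + (1 / real (Suc k)) *\<^sub>R e) - F x\<bar> * real (Suc k) <= B * (1 / real (Suc k) * norm e) * real (Suc k)"
   by (rule mult_right_mono) simp
  thus ?thesis using True by (simp add: D_def abs_mult)
 next
  case False
  hence nx: "norm x > rho + norm e" by (simp add: S_def)
  have "norm x <= norm (x + (1 / real (Suc k)) *\<^sub>R e) + norm ((1 / real (Suc k)) *\<^sub>R e)"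
   using norm_triangle_ineq4[of "x + (1 / real (Suc k)) *\<^sub>R e" "(1 / real (Suc k)) *\<^sub>R e"] by simp
  moreover have "norm ((1 / real (Suc k)) *\<^sub>R e) <= norm e"
   using mult_right_mono[of "1 / real (Suc k)" 1 "norm e"] by simp
  ultimately have "norm (x + (1 / real (Suc k)) *\<^sub>R e) > rho" using nx by linarith
  moreover have "norm x > rho" using nx norm_ge_zero[of e] by linarith
  ultimately have "x ~: K" "x + (1 / real (Suc k)) *\<^sub>R e ~: K" using rho by force+
  thus ?thesis using False K(2) by (simp add: D_def)
 qed
 have meas: "D k : borel_measurable lborel" for k
 proof -
  have "continuous_on UNIV (%x. F (x + (1 / real (Suc k)) *\<^sub>R e))"
   by (rule continuous_on_compose2[OF contF]) (auto intro!: continuous_intros)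
  hence "continuous_on UNIV (D k)" unfolding D_def by (intro continuous_on_mult continuous_on_diff continuous_on_const contF)
  thus ?thesis using borel_measurable_continuous_onI by simp
 qed
 have Dlim: "(%k. D k x) \<longlonglongrightarrow> G x \<bullet> e" for x
 proof -
  have "((%t. F (x + t *\<^sub>R e)) has_real_derivative G (x + 0 *\<^sub>R e) \<bullet> e) (at 0)"
   unfolding has_field_derivative_def
  proof (rule has_derivative_eq_rhs[OF has_derivative_compose[where g=F]])
   show "((%t. x + t *\<^sub>R e) has_derivative (%h. h *\<^sub>R e)) (at 0)" by (auto intro!: derivative_eq_intros)
   show "(F has_derivative (%h. h \<bullet> G (x + 0 *\<^sub>R e))) (at (x + 0 *\<^sub>R e))" using F unfolding gderiv_def by blast
  qed (auto simp: inner_commute)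
  hence "((%t. (F (x + t *\<^sub>R e) - F x) / t) \<longlongrightarrow> G x \<bullet> e) (at 0)"
   by (simp add: has_field_derivative_iff)
  moreover have "filterlim (%k. 1 / real (Suc k)) (at 0) sequentially"
   unfolding filterlim_at using LIMSEQ_inverse_real_of_nat by (auto simp: divide_inverse)
  ultimately have "(%k. (F (x + (1 / real (Suc k)) *\<^sub>R e) - F x) / (1 / real (Suc k))) \<longlonglongrightarrow> G x \<bullet> e"
   by (rule filterlim_compose)
  thus ?thesis by (simp add: D_def)
 qed
 have Sint: "integrable lborel (%x. B * norm e * indicator S x)"
 proof (intro integrable_mult_right integrable_real_indicator)
  show "emeasure lborel S < \<infinity>" unfolding S_def by (rule emeasure_bounded_finite[OF bounded_cball])
 qed (simp add: S_def)
 have Gm: "(%x. G x \<bullet> e) : borel_measurable lborel"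
  using G by (auto intro!: borel_measurable_continuous_onI continuous_intros)
 show "integrable lborel (%x. G x \<bullet> e)"
  by (rule integrable_dominated_convergence[OF Gm meas Sint AE_I2[OF Dlim] AE_I2[OF Dbound]])
 have "(%k. LINT x|lborel. D k x) \<longlonglongrightarrow> (LINT x|lborel. G x \<bullet> e)"
  by (rule integral_dominated_convergence[OF Gm meas Sint AE_I2[OF Dlim] AE_I2[OF Dbound]])
 moreover have "(LINT x|lborel. D k x) = 0" for k
 proof -
  have intF: "integrable lborel F" by (rule integrable_continuous_compact_support[OF contF K(1,2)])
  define c where "c = (1 / real (Suc k)) *\<^sub>R e"
  have Fm: "F : borel_measurable borel" using contF by (rule borel_measurable_continuous_onI)
  have i2: "integrable lborel (%x. F (c + x))"
   using intF integrable_distr_eq[of "(+) c" lborel borel F] Fm by (simp add: lborel_distr_plus)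
  have "(LINT x|lborel. F (c + x)) = (LINT x|lborel. F x)"
   using integral_distr[of "(+) c" lborel borel F] Fm by (simp add: lborel_distr_plus)
  hence "(LINT x|lborel. F (c + x) - F x) = 0"
   using i2 intF by (simp add: Bochner_Integration.integral_diff)
  thus ?thesis unfolding D_def c_def by (simp add: add.commute)
 qed
 ultimately show "(LINT x|lborel. G x \<bullet> e) = 0" by (simp add: LIMSEQ_const_iff)
qed

section \<open>The fundamental lemma of the calculus of variations\<close>

lemma C1_const: "C1 (%x. c)"
 unfolding C1_def by (intro exI[of _ "%x. 0"]) (auto intro: GDERIV_const)

lemma C1_prod: "finite I ==> (!!i. i : I ==> C1 (f i)) ==> C1 (%x. \<Prod>i\<in>I. f i x)"
 by (induction I rule: finite_induct) (auto intro: C1_const C1_mult)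

text \<open>A function of class \<open>C1\<close> whose nonzero set is a half-line; the functions
  supported on boxes and the ramps below are built from it.\<close>

definition sqpos :: "real => real" where "sqpos t = (max 0 t)^2"

lemma sqpos_simps: "sqpos t >= 0" "sqpos t ~= 0 \<longleftrightarrow> t > 0" "t <= 0 ==> sqpos t = 0"
 by (auto simp: sqpos_def)

lemma deriv_sqpos: "(sqpos has_real_derivative 2 * max 0 t) (at t)"
proof -
 consider "t > 0" | "t < 0" | "t = 0" by linarith
 thus ?thesis
 proof cases
  case 1
  have "((%t. t^2) has_real_derivative 2 * max 0 t) (at t)" using 1 by (auto intro!: derivative_eq_intros)
  thus ?thesis
  proof (rule DERIV_cong_ev[THEN iffD1, OF refl _ refl, rotated])
   have "\<forall>\<^sub>F s in nhds t. s : {0<..}" using 1 by (intro eventually_nhds_in_open) auto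
   thus "\<forall>\<^sub>F s in nhds t. s^2 = sqpos s" by eventually_elim (auto simp: sqpos_def)
  qed
 next
  case 2
  have "((%t. 0) has_real_derivative 2 * max 0 t) (at t)" using 2 by (auto intro!: derivative_eq_intros)
  thus ?thesis
  proof (rule DERIV_cong_ev[THEN iffD1, OF refl _ refl, rotated])
   have "\<forall>\<^sub>F s in nhds t. s : {..<0}" using 2 by (intro eventually_nhds_in_open) auto
   thus "\<forall>\<^sub>F s in nhds t. 0 = sqpos s" by eventually_elim (auto simp: sqpos_def)
  qed
 next
  case 3
  have "((%y. max 0 y) \<longlongrightarrow> max 0 0) (at (0::real))" by (intro tendsto_intros)
  hence "((%y. max 0 y) \<longlongrightarrow> 0) (at (0::real))" by simp
  hence "((%y. (sqpos y - sqpos 0) / (y - 0)) \<longlongrightarrow> 0) (at 0)"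
   by (rule Lim_transform_eventually) (auto simp: eventually_at_filter sqpos_def max_def power2_eq_square)
  thus ?thesis using 3 by (simp add: has_field_derivative_iff)
 qed
qed

lemma C1_sqpos: "C1 phi ==> C1 (%x. sqpos (phi x))"
 by (rule C1_compose[OF _ deriv_sqpos]) (auto intro!: continuous_intros)

lemma C1_affine: "C1 (%x. s * (x \<bullet> i) + c)"
proof -
 have "GDERIV (%x. s * (x \<bullet> i) + c) x :> s *\<^sub>R i" for x
  unfolding gderiv_def by (auto intro!: derivative_eq_intros)
 thus ?thesis unfolding C1_def by (intro exI[of _ "%x. s *\<^sub>R i"]) auto
qed

lemma box_eq_nonzero: "EX phi. C1 phi & box a b = {x. phi x ~= 0}"
proof (intro exI conjI)
 let ?phi = "%x. \<Prod>i\<in>Basis. sqpos (1 * (x \<bullet> i) + - (a \<bullet> i)) * sqpos (- 1 * (x \<bullet> i) + b \<bullet> i)"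
 show "C1 ?phi" by (intro C1_prod C1_mult C1_sqpos C1_affine) auto
 show "box a b = {x. ?phi x ~= 0}" by (auto simp: box_def sqpos_simps)
qed

text \<open>The nonzero sets of \<open>C1\<close> functions form an intersection-stable generator of
  the Borel sets, and the indicator of \<open>phi ~= 0\<close> is the pointwise limit of
  \<open>k * phi^2 / (1 + k * phi^2)\<close>, which is of class \<open>C1\<close> and between 0 and
  1. Dynkin's argument extends the vanishing of the integral of \<open>f\<close> to all Borel
  sets.\<close>

lemma integral_tests_zero:
 fixes f :: "'a::euclidean_space => real"
 assumes int: "integrable lborel f"
  and zero: "!!phi. C1 phi ==> (!!x. \<bar>phi x\<bar> <= 1) ==> (LINT x|lborel. phi x * f x) = 0"
 shows "AE x in lborel. f x = 0"
proof -
 define \<E> where "\<E> = {{x::'a. phi x ~= 0} | phi. C1 phi}"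
 have fm: "f : borel_measurable borel" using int by auto
 have basic: "(LBINT x:{x. phi x ~= 0}. f x) = 0" if phi: "C1 phi" for phi
 proof -
  define g where "g = (%(k::nat) t::real. real k * t^2 / (1 + real k * t^2))"
  have pos: "1 + real k * t^2 > 0" for k t by (simp add: add_pos_nonneg)
  have dg: "(g k has_real_derivative 2 * real k * t / (1 + real k * t^2)^2) (at t)" for k t
   unfolding g_def using pos[of k t] by (auto intro!: derivative_eq_intros simp: field_simps power2_eq_square)
  have "continuous_on UNIV (%t. 2 * real k * t / (1 + real k * t^2)^2)" for k
   using pos[of k] by (intro continuous_intros) (metis less_irrefl power_eq_0_iff)
  hence C: "C1 (%x. g k (phi x))" for k by (intro C1_compose[OF phi dg])
  have gb: "0 <= g k t" "g k t <= 1" for k t using pos[of k t] by (auto simp: g_def field_simps)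
  have gl: "(%k. g k t) \<longlonglongrightarrow> (if t ~= 0 then 1 else 0)" for t
  proof (cases "t = 0")
   case False
   have "filterlim (%k. 1 + t^2 * real k) at_top sequentially"
    using False by (intro filterlim_tendsto_add_at_top[OF tendsto_const] filterlim_tendsto_pos_mult_at_top[OF tendsto_const] filterlim_real_sequentially) auto
   from tendsto_inverse_0_at_top[OF this] have "(%k. 1 - inverse (1 + t^2 * real k)) \<longlonglongrightarrow> 1 - 0" by (intro tendsto_intros)
   moreover have "1 - inverse (1 + t^2 * real k) = g k t" for k
    using pos[of k t] unfolding g_def by (simp add: field_simps)
   ultimately show ?thesis using False by simp
  qed (simp add: g_def)
  have "(%k. LINT x|lborel. g k (phi x) * f x) \<longlonglongrightarrow> (LINT x|lborel. indicator {x. phi x ~= 0} x *\<^sub>R f x)"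
  proof (rule integral_dominated_convergence[where w="%x. \<bar>f x\<bar>"])
   have "open {x. phi x ~= 0}" using C1_continuous[OF phi] by (intro open_Collect_neq) auto
   thus "(%x. indicator {x. phi x ~= 0} x *\<^sub>R f x) : borel_measurable lborel"
    using fm by (intro borel_measurable_scaleR borel_measurable_indicator) auto
   show "(%x. g k (phi x) * f x) : borel_measurable lborel" for k
    using borel_measurable_continuous_onI[OF C1_continuous[OF C[of k]]] fm by simp
   show "integrable lborel (%x. \<bar>f x\<bar>)" using int by simp
   show "AE x in lborel. (%k. g k (phi x) * f x) \<longlonglongrightarrow> indicator {x. phi x ~= 0} x *\<^sub>R f x"
   proof (rule AE_I2)
    fix x
    have "(%k. g k (phi x) * f x) \<longlonglongrightarrow> (if phi x ~= 0 then 1 else 0) * f x" by (rule tendsto_mult[OF gl tendsto_const])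
    thus "(%k. g k (phi x) * f x) \<longlonglongrightarrow> indicator {x. phi x ~= 0} x *\<^sub>R f x"
     by (cases "phi x = 0") simp_all
   qed
   show "AE x in lborel. norm (g k (phi x) * f x) <= \<bar>f x\<bar>" for k
    using gb[of k] by (intro AE_I2) (auto simp: abs_mult intro!: mult_left_le_one_le)
  qed
  moreover have "(LINT x|lborel. g k (phi x) * f x) = 0" for k
   using gb[of k] by (intro zero[OF C]) auto
  ultimately show ?thesis by (simp add: set_lebesgue_integral_def LIMSEQ_const_iff)
 qed
 have stable: "Int_stable \<E>"
 proof (rule Int_stableI)
  fix A B assume "A : \<E>" "B : \<E>"
  then obtain phi psi where "A = {x. phi x ~= 0}" "C1 phi" "B = {x. psi x ~= 0}" "C1 psi" unfolding \<E>_def by blast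
  thus "A \<inter> B : \<E>" unfolding \<E>_def using C1_mult[of phi psi]
   by (intro CollectI exI[of _ "%x. phi x * psi x"]) auto
 qed
 have sub: "sets borel <= sigma_sets UNIV \<E>"
 proof -
  have "box a b : \<E>" for a b unfolding \<E>_def using box_eq_nonzero[of a b] by blast
  hence "range (%(a, b). box a b) <= \<E>" by auto
  moreover have "sets (borel :: 'a measure) = sigma_sets UNIV (range (%(a, b). box a b))"
   by (subst borel_eq_box) simp
  ultimately show ?thesis by (simp add: sigma_sets_mono')
 qed
 have pow: "\<E> <= Pow UNIV" by simp
 have opn: "A : sets borel" if "A : sigma_sets UNIV \<E>" for A
 proof -
  have "\<E> <= sets borel"
  proof
   fix A assume "A : \<E>"
   then obtain phi where "A = {x. phi x ~= 0}" "C1 phi" unfolding \<E>_def by blast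
   hence "open A" using C1_continuous[of phi] by (auto intro: open_Collect_neq)
   thus "A : sets borel" by simp
  qed
  thus ?thesis using that sets.sigma_sets_subset[of \<E> "borel :: 'a measure"] by auto
 qed
 have si: "set_integrable lborel A f" if "A : sets borel" for A
  unfolding set_integrable_def using integrable_mult_indicator[OF _ int] that by simp
 have whole: "(LBINT x:UNIV. f x) = 0"
  using basic[OF C1_const[of 1]] by simp
 have "(LBINT x:A. f x) = 0" if "A : sets borel" for A
 proof -
  have "A : sigma_sets UNIV \<E>" using that sub by auto
  with stable pow show ?thesis
  proof (induction rule: sigma_sets_induct_disjoint)
   case (compl A)
   have "(LBINT x:UNIV. f x) = (LBINT x:A \<union> (UNIV - A). f x)" by simp
   also have "... = (LBINT x:A. f x) + (LBINT x:UNIV - A. f x)"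
    using opn[OF compl(1)] by (intro set_integral_Un si) auto
   finally show ?case using compl whole by simp
  next
   case (union A)
   have "(LBINT x:(\<Union>i. A i). f x) = (\<Sum>i. (LBINT x:(A i). f x))"
    using opn union by (intro lebesgue_integral_countable_add si) (auto simp: disjoint_family_on_def image_subset_iff)
   thus ?case using union by simp
  next
   case empty
   show ?case by (simp add: set_lebesgue_integral_def)
  qed (use basic in "auto simp: \<E>_def")
 qed
 thus ?thesis using int by (intro density_unique_real[of lborel f "%_. 0"]) auto
qed


section \<open>Polar coordinates and radial representatives\<close>

definition sphere_weight :: "'a::euclidean_space itself => real => real" where
 "sphere_weight _ r = real DIM('a) * unit_ball_vol (real DIM('a)) * r ^ (DIM('a) - 1) * indicator {0<..} r"

lemma sphere_weight_nonneg: "sphere_weight T r >= 0"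
 by (simp add: sphere_weight_def indicator_def)

lemma sphere_weight_measurable [measurable]: "sphere_weight T : borel_measurable borel"
 unfolding sphere_weight_def by measurable

text \<open>Both measures agree on the half-lines \<open>{..r}\<close>: there they give the volume
  of a ball, and \<open>sphere_weight\<close> is the derivative of this volume, the area of the
  sphere of radius \<open>r\<close>.\<close>

lemma distr_norm:
 assumes dim: "DIM('a::euclidean_space) >= 2"
 shows "distr lborel borel (norm :: 'a => real) = density lborel (%r. ennreal (sphere_weight TYPE('a) r))"
proof (rule measure_eqI_generator_eq[where E="range (%r::real. {..r})" and \<Omega>=UNIV and A="%i. {..real i}"])
 let ?v = "unit_ball_vol (real DIM('a))"
 have cb: "emeasure (distr lborel borel (norm :: 'a => real)) {..r} = ennreal (?v * max 0 r ^ DIM('a))" for r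
 proof -
  have "emeasure (distr lborel borel (norm :: 'a => real)) {..r} = emeasure lborel (cball (0::'a) r)"
   by (subst emeasure_distr) (auto intro!: arg_cong2[where f=emeasure])
  also have "... = ennreal (?v * max 0 r ^ DIM('a))"
  proof (cases "r >= 0")
   case True
   thus ?thesis by (simp add: emeasure_cball max_def)
  next
   case False
   thus ?thesis by (simp add: max_def power_0_left)
  qed
  finally show ?thesis .
 qed
 have dens: "emeasure (density lborel (%r. ennreal (sphere_weight TYPE('a) r))) {..r} = ennreal (?v * max 0 r ^ DIM('a))" for r
 proof -
  have "emeasure (density lborel (%r. ennreal (sphere_weight TYPE('a) r))) {..r}
    = (\<integral>\<^sup>+s. ennreal (sphere_weight TYPE('a) s) * indicator {..r} s \<partial>lborel)"
   by (rule emeasure_density) auto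
  also have "... = (\<integral>\<^sup>+s. ennreal (real DIM('a) * ?v * s ^ (DIM('a) - 1)) * indicator {0..max 0 r} s \<partial>lborel)"
  proof (rule nn_integral_cong)
   fix s
   show "ennreal (sphere_weight TYPE('a) s) * indicator {..r} s =
     ennreal (real DIM('a) * ?v * s ^ (DIM('a) - 1)) * indicator {0..max 0 r} s"
    using dim by (cases "s = 0") (auto simp: sphere_weight_def indicator_def)
  qed
  also have "... = ennreal (?v * max 0 r ^ DIM('a) - ?v * 0 ^ DIM('a))"
  proof (rule nn_integral_FTC_Icc[where F="%s. ?v * s ^ DIM('a)"])
   show "((%s. ?v * s ^ DIM('a)) has_real_derivative real DIM('a) * ?v * s ^ (DIM('a) - 1)) (at s)" for s
    by (auto intro!: derivative_eq_intros)
  qed auto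
  finally show ?thesis using dim by simp
 qed
 show "emeasure (distr lborel borel (norm :: 'a => real)) X = emeasure (density lborel (%r. ennreal (sphere_weight TYPE('a) r))) X"
  if "X : range (%r::real. {..r})" for X
  using that cb dens by auto
 show "emeasure (distr lborel borel (norm :: 'a => real)) {..real i} ~= \<infinity>" for i
  unfolding cb by simp
 show "Int_stable (range (%r::real. {..r}))"
 proof (rule Int_stableI)
  fix A B assume "A : range (%r::real. {..r})" "B : range (%r::real. {..r})"
  then obtain r s where "A = {..r}" "B = {..s}" by auto
  hence "A \<inter> B = {..min r s}" by auto
  thus "A \<inter> B : range (%r::real. {..r})" by blast
 qed
 have s: "sets borel = sigma_sets UNIV (range (%r::real. {..r}))"
  by (subst borel_eq_atMost) simp
 thus "sets (distr lborel borel (norm :: 'a => real)) = sigma_sets UNIV (range (%r::real. {..r}))"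
  "sets (density lborel (%r. ennreal (sphere_weight TYPE('a) r))) = sigma_sets UNIV (range (%r::real. {..r}))"
  by simp_all
 show "(\<Union>i. {..real i}) = UNIV" using real_arch_simple by fastforce
qed auto

lemma radial_integral:
 fixes F :: "real => real"
 assumes dim: "DIM('a::euclidean_space) >= 2" and F: "F : borel_measurable borel"
 shows "integrable lborel (%x::'a. F (norm x)) \<longleftrightarrow> integrable lborel (%r. sphere_weight TYPE('a) r * F r)"
  and "(LINT x|lborel. F (norm (x::'a))) = (LINT r|lborel. sphere_weight TYPE('a) r * F r)"
proof -
 have "integrable lborel (%x::'a. F (norm x)) \<longleftrightarrow> integrable (distr lborel borel (norm :: 'a => real)) F"
  using F by (subst integrable_distr_eq) auto
 also have "... \<longleftrightarrow> integrable lborel (%r. sphere_weight TYPE('a) r *\<^sub>R F r)"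
  unfolding distr_norm[OF dim] using F by (intro integrable_density) (auto simp: sphere_weight_nonneg)
 finally show "integrable lborel (%x::'a. F (norm x)) \<longleftrightarrow> integrable lborel (%r. sphere_weight TYPE('a) r * F r)" by simp
 have "(LINT x|lborel. F (norm (x::'a))) = (LINT r|distr lborel borel (norm :: 'a => real). F r)"
  using F by (subst integral_distr) auto
 also have "... = (LINT r|lborel. sphere_weight TYPE('a) r *\<^sub>R F r)"
  unfolding distr_norm[OF dim] using F by (intro integral_density) (auto simp: sphere_weight_nonneg)
 finally show "(LINT x|lborel. F (norm (x::'a))) = (LINT r|lborel. sphere_weight TYPE('a) r * F r)" by simp
qed

lemma radial_AE:
 assumes dim: "DIM('a::euclidean_space) >= 2" and P: "AE r in lborel. r > 0 --> P r"
 shows "AE x::'a in lborel. P (norm x)"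
proof -
 have "AE r in density lborel (%r. ennreal (sphere_weight TYPE('a) r)). P r"
  by (subst AE_density) (use P in "auto elim!: eventually_mono simp: sphere_weight_def indicator_def split: if_splits")
 hence "AE r in distr lborel borel (norm :: 'a => real). P r" unfolding distr_norm[OF dim] .
 thus ?thesis by (rule AE_distrD[rotated]) auto
qed

text \<open>A radial Lebesgue measurable set is the preimage of a Borel set of radii up to a null set: by
 inner regularity it contains a \<open>\<sigma>\<close>-compact set of full measure, whose image under the norm is Borel.\<close>

lemma radial_level_set:
 fixes E :: "'a::euclidean_space set"
 assumes E: "E : sets lebesgue" and eq: "AE x in lebesgue. x : E \<longleftrightarrow> norm x : A"
 shows "EX B:sets borel. AE x in lebesgue. x : E \<longleftrightarrow> norm x : B"
proof -
 obtain N where N: "N : null_sets lebesgue" "{x : space lebesgue. \<not> (x : E \<longleftrightarrow> norm x : A)} <= N"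
  using eq by (auto simp: eventually_ae_filter)
 define E0 where "E0 = {x::'a. norm x : A}"
 have "E0 = (E - N) \<union> (E0 \<inter> N)" using N(2) by (auto simp: E0_def)
 moreover have "E0 \<inter> N : null_sets lebesgue"
  using N(1) by (intro null_sets_completion_subset[of "E0 \<inter> N" N]) auto
 ultimately have "E0 : sets lebesgue" using E N(1) by (metis null_setsD2 sets.Diff sets.Un)
 from lebesgue_set_almost_fsigma[OF this] obtain C T where C: "fsigma C" "T : null_sets lebesgue" "C \<union> T = E0" by blast
 obtain F :: "nat => 'a set" where F: "!!k. closed (F k)" "C = (\<Union>k. F k)" using C(1) by (cases rule: fsigma.cases) auto
 define B where "B = (\<Union>k. \<Union>j::nat. norm ` (F k \<inter> cball 0 (real j)))"
 have "compact (norm ` (F k \<inter> cball 0 (real j)))" for k j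
  using F(1) by (intro compact_continuous_image closed_Int_compact) (auto intro: continuous_intros)
 hence B: "B : sets borel" unfolding B_def by (intro sets.countable_UN) (auto intro: borel_compact)
 have BC: "B = norm ` C"
  unfolding B_def F(2) using real_arch_simple by (fastforce simp: image_iff)
 have "AE x in lebesgue. x ~: N \<union> T" using N(1) C(2) by (intro AE_not_in) auto
 hence "AE x in lebesgue. x : E \<longleftrightarrow> norm x : B"
 proof eventually_elim
  case (elim x)
  hence "x : E \<longleftrightarrow> norm x : A" using N(2) by auto
  moreover have "norm x : B" if "norm x : A" using that elim C(3) unfolding BC by (auto simp: E0_def)
  moreover have "norm x : A" if nb: "norm x : B"
  proof -
   obtain y where "norm x = norm y" "y : C" using nb unfolding BC by auto
   thus ?thesis using C(3) by (auto simp: E0_def)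
  qed
  ultimately show ?case by blast
 qed
 with B show ?thesis by blast
qed

text \<open>A real number is recovered from the countably many statements \<open>c < u\<close> with
  rational \<open>c\<close>; this is how superlevel sets determine a representative.\<close>

lemma SUP_rat_below:
 "(SUP c\<in>(UNIV::rat set). if of_rat c < u then ereal (of_rat c) else - \<infinity>) = ereal u"
proof (rule antisym)
 show "(SUP c\<in>(UNIV::rat set). if of_rat c < u then ereal (of_rat c) else - \<infinity>) <= ereal u"
  by (rule SUP_least) auto
 show "ereal u <= (SUP c\<in>(UNIV::rat set). if of_rat c < u then ereal (of_rat c) else - \<infinity>)"
 proof (rule dense_le)
  fix z assume "z < ereal u"
  then obtain t where t: "z < ereal t" "t < u" by (metis ereal_dense2 less_ereal.simps(1))
  obtain c where c: "t < of_rat c" "of_rat c < u" using of_rat_dense[OF t(2)] by blast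
  have "z <= (if of_rat c < u then ereal (of_rat c) else - \<infinity>)"
   using less_imp_le[OF less_trans[OF t(1), of "ereal (of_rat c)"]] c by simp
  also have "... <= (SUP c\<in>(UNIV::rat set). if of_rat c < u then ereal (of_rat c) else - \<infinity>)"
   by (rule SUP_upper) auto
  finally show "z <= (SUP c\<in>(UNIV::rat set). if of_rat c < u then ereal (of_rat c) else - \<infinity>)" .
 qed
qed

text \<open>The profile \<open>f\<close> is an arbitrary function, possibly not measurable. Its
  superlevel sets are replaced, one for each rational level, by Borel sets of radii with the help of
  \<open>radial_level_set\<close>.\<close>

lemma radial_borel_representative:
 fixes u :: "'a::euclidean_space => real"
 assumes u: "u : borel_measurable lebesgue" and f: "AE x in lebesgue. u x = f (norm x)"
 shows "EX g:borel_measurable borel. AE x in lebesgue. u x = g (norm x)"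
proof -
 have ex: "EX B:sets borel. AE x in lebesgue. x : {x. of_rat c < u x} \<longleftrightarrow> norm x : B" for c
 proof (rule radial_level_set)
  show "{x. of_rat c < u x} : sets lebesgue"
   using borel_measurable_less[of "%_. of_rat c" lebesgue u] u by simp
  show "AE x in lebesgue. (x : {x. of_rat c < u x}) = (norm x : {r. of_rat c < f r})"
   using f by eventually_elim auto
 qed
 have "ALL c. EX B. B : sets borel & (AE x in lebesgue. of_rat c < u x \<longleftrightarrow> norm x : B)"
  using ex unfolding mem_Collect_eq by blast
 from choice[OF this] obtain B where
  B: "!!c. B c : sets borel" "!!c. AE x in lebesgue. of_rat c < u x \<longleftrightarrow> norm x : B c" by blast
 define g where "g = (%r. real_of_ereal (SUP c\<in>(UNIV::rat set). if r : B c then ereal (of_rat c) else - \<infinity>))"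
 have "g : borel_measurable borel"
  unfolding g_def using B(1) by (intro borel_measurable_real_of_ereal borel_measurable_SUP measurable_If_set) auto
 moreover have "AE x in lebesgue. ALL c. of_rat c < u x \<longleftrightarrow> norm x : B c"
  using B(2) by (simp add: AE_all_countable)
 hence "AE x in lebesgue. u x = g (norm x)"
 proof eventually_elim
  case (elim x)
  hence "(SUP c\<in>(UNIV::rat set). if norm x : B c then ereal (of_rat c) else - \<infinity>) = ereal (u x)"
   using SUP_rat_below[of "u x"] by simp
  thus ?case by (simp add: g_def)
 qed
 ultimately show ?thesis by blast
qed

lemma radial_GDERIV:
 fixes x :: "'a::euclidean_space"
 assumes eta: "!!r. (eta has_real_derivative eta' r) (at r)" and zero: "eta' 0 = 0"
 shows "GDERIV (%x. eta (norm x)) x :> eta' (norm x) *\<^sub>R sgn x"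
proof (cases "x = 0")
 case False
 thus ?thesis by (intro GDERIV_DERIV_compose[OF GDERIV_norm] eta)
next
 case True
 have "((%t. (eta (0 + t) - eta 0) / t) \<longlongrightarrow> 0) (at 0)" using eta[of 0] zero by (simp add: DERIV_def)
 moreover have "filterlim norm (at 0) (at (0::'a))"
  unfolding filterlim_at by (auto simp: eventually_at_filter intro: tendsto_norm_zero)
 ultimately have "((%h::'a. (eta (0 + norm h) - eta 0) / norm h) \<longlongrightarrow> 0) (at 0)" by (rule filterlim_compose)
 hence "((%h::'a. norm ((eta (0 + norm h) - eta 0) / norm h)) \<longlongrightarrow> 0) (at 0)" by (rule tendsto_norm_zero)
 hence "((%x. eta (norm x)) has_derivative (%h. 0)) (at (0::'a))"
  by (simp add: has_derivative_at)
 thus ?thesis using True zero by (simp add: gderiv_def)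
qed

lemma continuous_radial_field:
 fixes h :: "real => real"
 assumes h: "continuous_on UNIV h" and zero: "h 0 = 0"
 shows "continuous_on UNIV (%x::'a::euclidean_space. h (norm x) *\<^sub>R sgn x)"
 unfolding continuous_on_eq_continuous_at[OF open_UNIV]
proof
 fix x :: 'a
 have c: "continuous (at x) (%x. h (norm x))"
 proof -
  have "continuous_on UNIV (%x::'a. h (norm x))" by (rule continuous_on_compose2[OF h continuous_on_norm_id]) auto
  thus ?thesis by (simp add: continuous_on_eq_continuous_at)
 qed
 show "continuous (at x) (%x. h (norm x) *\<^sub>R sgn x)"
 proof (cases "x = 0")
  case False
  thus ?thesis unfolding sgn_div_norm using c by (intro continuous_intros) auto
 next
  case True
  have "((%x::'a. h (norm x) *\<^sub>R sgn x) \<longlongrightarrow> 0) (at 0)"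
  proof (rule Lim_null_comparison)
   show "\<forall>\<^sub>F x in at 0. norm (h (norm x) *\<^sub>R sgn x) <= \<bar>h (norm (x::'a))\<bar>"
    by (auto simp: eventually_at_filter norm_sgn)
   have "((%x::'a. h (norm x)) \<longlongrightarrow> 0) (at 0)" using c True zero by (simp add: continuous_at)
   thus "((%x::'a. \<bar>h (norm x)\<bar>) \<longlongrightarrow> 0) (at 0)" by (rule tendsto_rabs_zero)
  qed
  thus ?thesis using True by (simp add: continuous_at zero)
 qed
qed


section \<open>Weak gradients and limits of products\<close>

lemma lebesgue_on_integral:
 fixes f :: "'a::euclidean_space => 'b::euclidean_space"
 assumes "S : sets lebesgue"
 shows "integrable (lebesgue_on S) f \<longleftrightarrow> integrable lebesgue (%x. indicator S x *\<^sub>R f x)"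
  and "(LINT x|lebesgue_on S. f x) = (LINT x|lebesgue. indicator S x *\<^sub>R f x)"
 using assms by (simp_all add: integrable_restrict_space integral_restrict_space)

lemma AE_lebesgue_on: "S : sets lebesgue ==> (AE x in lebesgue_on S. P x) \<longleftrightarrow> (AE x in lebesgue. x : S --> P x)"
 by (subst AE_restrict_space_iff) auto

lemma lebesgue_on_continuous_support:
 fixes f :: "'a::euclidean_space => real"
 assumes "S : sets lebesgue" "continuous_on UNIV f" "compact K" "!!x. x ~: K ==> f x = 0" "K <= S"
 shows "integrable (lebesgue_on S) f" "(LINT x|lebesgue_on S. f x) = (LINT x|lborel. f x)"
proof -
 have eq: "(%x. indicator S x *\<^sub>R f x) = f" using assms(4,5) by (auto simp: indicator_def fun_eq_iff)
 have m: "f : borel_measurable lborel" using assms(2) borel_measurable_continuous_onI by auto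
 have i: "integrable lborel f" by (rule integrable_continuous_compact_support[OF assms(2-4)])
 show "integrable (lebesgue_on S) f"
  unfolding lebesgue_on_integral(1)[OF assms(1)] eq integrable_completion[OF m] by (rule i)
 show "(LINT x|lebesgue_on S. f x) = (LINT x|lborel. f x)"
  unfolding lebesgue_on_integral(2)[OF assms(1)] eq by (rule integral_completion[OF m])
qed

text \<open>The difference of two weak gradients is annihilated by all test functions. Multiplied by
  a cutoff \<open>omega\<close> it becomes globally integrable, so that
  \<open>integral_tests_zero\<close> applies. Countably many boxes, on whose interiors suitable
  \<open>omega\<close> are nonzero, cover \<open>S\<close>, and their boundaries are null
  sets.\<close>

lemma weak_gradient_unique:
 assumes S: "open S" and g: "has_weak_gradient S u g" and g': "has_weak_gradient S u g'"
 shows "AE x in lebesgue_on S. g x = g' x"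
proof -
 have Sm: "S : sets lebesgue" using S by auto
 have zero: "AE x in lebesgue. x : S --> omega x *\<^sub>R (g x - g' x) = 0" if omega: "omega : C1_0 S" for omega
 proof -
  have "AE x in lebesgue. indicator S x *\<^sub>R (omega x *\<^sub>R (g x - g' x)) \<bullet> i = 0" for i
  proof -
   define f where "f = (%x. indicator S x *\<^sub>R (omega x *\<^sub>R (g x - g' x)) \<bullet> i)"
   have int: "integrable (lebesgue_on S) (%x. phi x *\<^sub>R (g x - g' x))"
    and zero: "(LINT x|lebesgue_on S. phi x *\<^sub>R (g x - g' x)) = 0" if "phi : C1_0 S" for phi
    using g g' that unfolding has_weak_gradient_def scaleR_diff_right by (auto simp: Bochner_Integration.integral_diff)
   have "integrable lebesgue (%x. indicator S x *\<^sub>R (omega x *\<^sub>R (g x - g' x)))"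
    using int[OF omega] unfolding lebesgue_on_integral(1)[OF Sm] .
   hence fi: "integrable lebesgue f" unfolding f_def by (intro integrable_inner_left)
   then obtain h where h: "h : borel_measurable lborel" "AE x in lborel. f x = h x"
    using completion_ex_borel_measurable_real[of f lborel] by auto
   have ae: "AE x in lebesgue. f x = h x" using h(2) by (rule AE_completion)
   have hm: "h : borel_measurable lebesgue" using h(1) by (rule measurable_completion)
   have hi: "integrable lborel h"
    using integrable_cong_AE[of f lebesgue h] fi ae hm integrable_completion[OF h(1)] by auto
   have "AE x in lborel. h x = 0"
   proof (rule integral_tests_zero[OF hi])
    fix phi :: "real^'a => real" assume phi: "C1 phi"
    have phim: "phi : borel_measurable lborel" using C1_continuous[OF phi] borel_measurable_continuous_onI by auto
    have m: "(%x. phi x * h x) : borel_measurable lborel" using phim h(1) by simp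
    have "(LINT x|lborel. phi x * h x) = (LINT x|lebesgue. phi x * h x)" using integral_completion[OF m] by simp
    also have "... = (LINT x|lebesgue. phi x * f x)"
    proof (rule integral_cong_AE)
     have pm: "phi : borel_measurable lebesgue" by (rule measurable_completion[OF phim])
     show "(%x. phi x * h x) : borel_measurable lebesgue" "(%x. phi x * f x) : borel_measurable lebesgue"
      by (intro borel_measurable_times pm hm borel_measurable_integrable[OF fi])+
     show "AE x in lebesgue. phi x * h x = phi x * f x" using ae by eventually_elim simp
    qed
    also have "... = (LINT x|lebesgue. (indicator S x *\<^sub>R ((omega x * phi x) *\<^sub>R (g x - g' x))) \<bullet> i)"
     unfolding f_def by (intro Bochner_Integration.integral_cong) (auto simp: indicator_def ac_simps)
    also have "... = (LINT x|lebesgue. indicator S x *\<^sub>R ((omega x * phi x) *\<^sub>R (g x - g' x))) \<bullet> i"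
     using int[OF C1_0_mult[OF omega phi]] unfolding lebesgue_on_integral(1)[OF Sm] by (intro integral_inner_left) auto
    also have "... = 0" using zero[OF C1_0_mult[OF omega phi]] unfolding lebesgue_on_integral(2)[OF Sm] by (simp only: inner_zero_left)
    finally show "(LINT x|lborel. phi x * h x) = 0" .
   qed
   hence "AE x in lebesgue. h x = 0" by (rule AE_completion)
   with ae show ?thesis unfolding f_def by eventually_elim simp
  qed
  hence "AE x in lebesgue. ALL i:Basis. indicator S x *\<^sub>R (omega x *\<^sub>R (g x - g' x)) \<bullet> i = 0"
   by (subst AE_ball_countable) (auto simp: countable_finite)
  thus ?thesis
  proof eventually_elim
   case (elim x)
   hence "indicator S x *\<^sub>R (omega x *\<^sub>R (g x - g' x)) = 0" unfolding euclidean_all_zero_iff .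
   thus ?case by (cases "x : S") simp_all
  qed
 qed
 obtain D where D: "countable D" "D <= Pow S" "!!X. X : D ==> EX c d. X = cbox c d" "\<Union>D = S"
  using open_countable_Union_open_cbox[OF S] by metis
 have "AE x in lebesgue. x : X --> g x = g' x" if XD: "X : D" for X
 proof -
  obtain c d where X: "X = cbox c d" using D(3)[OF XD] by blast
  have sub: "cbox c d <= S" using D(2) XD X by auto
  obtain omega where omega: "C1 omega" "box c d = {x. omega x ~= 0}" using box_eq_nonzero[of c d] by blast
  have "omega : C1_0 S"
   using omega(1) unfolding C1_def
  proof (elim exE conjE)
   fix G assume G: "continuous_on UNIV G" "ALL x. GDERIV omega x :> G x"
   show ?thesis
    by (rule C1_0_I[of omega G "cbox c d"]) (use G sub omega(2) box_subset_cbox[of c d] in auto)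
  qed
  from zero[OF this] have "AE x in lebesgue. x : S --> omega x *\<^sub>R (g x - g' x) = 0" .
  moreover have "cbox c d - box c d : null_sets lebesgue"
   using negligible_frontier_interval[of c d] by (simp add: negligible_iff_null_sets)
  from AE_not_in[OF this] have "AE x in lebesgue. x ~: cbox c d - box c d" .
  ultimately show ?thesis
  proof eventually_elim
   case (elim x)
   show ?case
   proof
    assume x: "x : X"
    hence "x : box c d" using elim(2) X by auto
    hence "omega x ~= 0" using omega(2) by auto
    moreover have "x : S" using x X sub by auto
    ultimately show "g x = g' x" using elim(1) by auto
   qed
  qed
 qed
 hence "AE x in lebesgue. ALL X:D. x : X --> g x = g' x" unfolding AE_ball_countable[OF D(1)] by blast
 hence "AE x in lebesgue. x : S --> g x = g' x" by eventually_elim (use D(4) in blast)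
 thus ?thesis using AE_lebesgue_on[OF Sm] by blast
qed

text \<open>The weighted inequality \<open>2 * |f * g| <= f^2 / t + t * g^2\<close> with small
  \<open>t\<close> takes the place of the Cauchy-Schwarz inequality.\<close>

lemma integral_mult_null:
 fixes f :: "nat => 'a => real"
 assumes f: "!!k. f k : borel_measurable M" "!!k. integrable M (%x. (f k x)^2)"
  and lim: "(%k. LINT x|M. (f k x)^2) \<longlonglongrightarrow> 0" and g: "g : borel_measurable M" "integrable M (%x. (g x)^2)"
 shows "integrable M (%x. f k x * g x)" "(%k. LINT x|M. f k x * g x) \<longlonglongrightarrow> 0"
proof -
 have amgm: "2 * \<bar>x * y\<bar> <= x^2 / t + t * y^2" if "t > 0" for x y t :: real
 proof -
  have "0 <= (\<bar>x\<bar> - t * \<bar>y\<bar>)^2" by simp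
  hence "t * (2 * \<bar>x * y\<bar>) <= t * (x^2 / t + t * y^2)" using that
   by (simp add: power2_eq_square algebra_simps abs_mult)
  thus ?thesis using that by (simp only: mult_le_cancel_left_pos)
 qed
 have int: "integrable M (%x. f k x * g x)" for k
 proof (rule Bochner_Integration.integrable_bound[of _ "%x. (f k x)^2 + (g x)^2"])
  show "AE x in M. norm (f k x * g x) <= norm ((f k x)^2 + (g x)^2)"
   using amgm[of 1] by (intro AE_I2) (smt (verit) abs_ge_zero div_by_1 mult_1 real_norm_def)
 qed (use f g in auto)
 thus "integrable M (%x. f k x * g x)" .
 define B where "B = (LINT x|M. (g x)^2)"
 have B: "B >= 0" by (simp add: B_def)
 have bound: "2 * \<bar>LINT x|M. f k x * g x\<bar> <= (LINT x|M. (f k x)^2) / t + t * B" if t: "t > 0" for k t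
 proof -
  have "2 * \<bar>LINT x|M. f k x * g x\<bar> = \<bar>LINT x|M. 2 * (f k x * g x)\<bar>" by (simp add: abs_mult)
  also have "... <= (LINT x|M. \<bar>2 * (f k x * g x)\<bar>)" by (rule integral_abs_bound)
  also have "... <= (LINT x|M. (f k x)^2 / t + t * (g x)^2)"
  proof (rule integral_mono)
   show "integrable M (%x. \<bar>2 * (f k x * g x)\<bar>)" by (intro integrable_abs integrable_mult_right int)
   show "\<bar>2 * (f k x * g x)\<bar> <= (f k x)^2 / t + t * (g x)^2" for x using amgm[OF t, of "f k x" "g x"] by (simp add: abs_mult)
  qed (use f(2)[of k] g in auto)
  also have "... = (LINT x|M. (f k x)^2) / t + t * B" using f(2)[of k] g by (simp add: B_def)
  finally show ?thesis .
 qed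
 show "(%k. LINT x|M. f k x * g x) \<longlonglongrightarrow> 0"
 proof (rule LIMSEQ_I)
  fix e :: real assume e: "e > 0"
  define t where "t = e / (B + 1)"
  have t: "t > 0" using e B by (simp add: t_def)
  obtain K where K: "!!k. k >= K ==> norm ((LINT x|M. (f k x)^2) - 0) < t * e"
   using LIMSEQ_D[OF lim, of "t * e"] t e by auto
  have "norm ((LINT x|M. f k x * g x) - 0) < e" if "k >= K" for k
  proof -
   have "(LINT x|M. (f k x)^2) / t < e" using K[OF that] t by (simp add: divide_less_eq mult.commute)
   moreover have "t * B <= e" using e B by (simp add: t_def field_simps)
   ultimately show ?thesis using bound[OF t, of k] by simp
  qed
  thus "EX K. ALL k>=K. norm ((LINT x|M. f k x * g x) - 0) < e" by blast
 qed
qed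

lemma C1_0_square_integrable:
 assumes "S : sets lebesgue" "phi : C1_0 S"
 shows "integrable (lebesgue_on S) (%x. (phi x)^2)" "integrable (lebesgue_on S) (%x. (norm (grad phi x))^2)"
  "phi : borel_measurable (lebesgue_on S)" "grad phi : borel_measurable (lebesgue_on S)"
proof -
 obtain K where K: "compact K" "K <= S" "!!x. x ~: K ==> phi x = 0 & grad phi x = 0" using C1_0_support[OF assms(2)] by blast
 show "integrable (lebesgue_on S) (%x. (phi x)^2)"
  by (rule lebesgue_on_continuous_support(1)[OF assms(1) _ K(1) _ K(2)])
   (use K(3) C1_0_continuous[OF assms(2)] in "auto intro!: continuous_intros")
 show "integrable (lebesgue_on S) (%x. (norm (grad phi x))^2)"
  by (rule lebesgue_on_continuous_support(1)[OF assms(1) _ K(1) _ K(2)])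
   (use K(3) C1_0_grad[OF assms(2)] in "auto intro!: continuous_intros")
 have "phi : borel_measurable borel" "grad phi : borel_measurable borel"
  using C1_0_continuous[OF assms(2)] C1_0_grad[OF assms(2)] by (auto intro: borel_measurable_continuous_onI)
 thus "phi : borel_measurable (lebesgue_on S)" "grad phi : borel_measurable (lebesgue_on S)"
  by (auto intro!: measurable_restrict_space1 measurable_completion)
qed

text \<open>\<open>weak_grad\<close> is an arbitrary choice with no square integrability built in;
  it inherits this from the gradient supplied by \<open>H1\<close>, with which it agrees almost
  everywhere.\<close>

lemma H1_0_weak_grad:
 assumes S: "open S" and u: "u : H1_0 S"
 shows "has_weak_gradient S u (weak_grad S u)"
  and "integrable (lebesgue_on S) (%x. (norm (weak_grad S u x))^2)" "weak_grad S u : borel_measurable (lebesgue_on S)"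
proof -
 obtain g where g: "g : L2 S" "has_weak_gradient S u g" using u unfolding H1_0_def H1_def by blast
 show wg: "has_weak_gradient S u (weak_grad S u)" unfolding weak_grad_def by (rule someI[of _ g]) (rule g(2))
 have ae: "AE x in lebesgue_on S. g x = weak_grad S u x" by (rule weak_gradient_unique[OF S g(2) wg])
 have gm: "g : borel_measurable (lebesgue_on S)" and gi: "integrable (lebesgue_on S) (%x. (norm (g x))^2)"
  using g(1) unfolding L2_def by auto
 have Sm: "S : sets lebesgue" using S by auto
 show m: "weak_grad S u : borel_measurable (lebesgue_on S)"
 proof -
  have ae': "AE x in lebesgue. (if x : S then g x else 0) = (if x : S then weak_grad S u x else 0)"
   using ae unfolding AE_lebesgue_on[OF Sm] by eventually_elim auto
  have "(%x. if x : S then g x else 0) : borel_measurable lebesgue"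
   using gm Sm by (simp add: borel_measurable_if_I)
  hence "(%x. if x : S then weak_grad S u x else 0) : borel_measurable lebesgue"
   using ae' by (rule borel_measurable_AE)
  thus ?thesis by (rule borel_measurable_if_D)
 qed
 show "integrable (lebesgue_on S) (%x. (norm (weak_grad S u x))^2)"
 proof (rule integrable_cong_AE[THEN iffD1, OF _ _ _ gi])
  show "AE x in lebesgue_on S. (norm (g x))^2 = (norm (weak_grad S u x))^2" using ae by eventually_elim simp
 qed (use gm m in auto)
qed


text \<open>\<open>a = 0\<close> stands for the ball, to which the origin belongs, and
  \<open>a > 0\<close> for the annulus; the disjunction covers both in one formula.\<close>

locale radial_domain =
 fixes Omega :: "(real^'n) set" and a b :: real
 assumes dim: "CARD('n) >= 2" and a0: "0 <= a" and ab: "a < b"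
  and Omega: "Omega = {x. norm x < b & (a = 0 | a < norm x)}"
begin

definition n :: nat where "n = CARD('n) - 1"

text \<open>Area of the unit sphere.\<close>

definition \<sigma> :: real where "\<sigma> = real CARD('n) * unit_ball_vol (real CARD('n))"

abbreviation leb where "leb \<equiv> lebesgue_on Omega"

lemma n: "n >= 1" "CARD('n) = Suc n" using dim by (auto simp: n_def)

lemma \<sigma>: "\<sigma> > 0" using dim by (simp add: \<sigma>_def)

lemma b0: "b > 0" using a0 ab by simp

lemma open_Omega: "open Omega"
proof (cases "a = 0")
 case True
 hence "Omega = {x. norm x < b}" using Omega by auto
 thus ?thesis by (auto intro!: open_Collect_less continuous_intros)
next
 case False
 hence "Omega = {x. norm x < b} \<inter> {x. a < norm x}" using Omega by auto
 thus ?thesis by (auto intro!: open_Int open_Collect_less continuous_intros)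
qed

lemma sets_Omega: "Omega : sets lebesgue" using open_Omega by auto

lemma mem_Omega: "x ~= 0 ==> x : Omega \<longleftrightarrow> norm x : {a<..<b}"
 using Omega a0 by auto

lemma mem_OmegaI: "norm x : {a<..<b} ==> x : Omega"
 using Omega by auto

lemma sphere_weight_eq: "sphere_weight TYPE(real^'n) r = \<sigma> * r ^ n * indicator {0<..} r"
 by (simp add: sphere_weight_def \<sigma>_def n_def)

lemma AE_nonzero: "AE x::real^'n in lebesgue. x ~= 0"
 using AE_not_in[of "{0::real^'n}" lebesgue] negligible_sing[of "0::real^'n"] by (simp add: negligible_iff_null_sets)

lemma radial_lint:
 assumes F: "F : borel_measurable borel" and f: "f : borel_measurable (leb)"
  and ae: "AE x in leb. f x = F (norm x)"
 shows "integrable (leb) f \<longleftrightarrow> set_integrable lborel {a<..<b} (%r. r ^ n * F r)"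
  and "(LINT x|leb. f x) = \<sigma> * (LBINT r:{a<..<b}. r ^ n * F r)"
proof -
 define G where "G = (%r. indicator {a<..<b} r * F r)"
 have G: "G : borel_measurable borel" unfolding G_def using F by simp
 have Gn: "(%x::real^'n. G (norm x)) : borel_measurable lborel" using G by simp
 have fm: "(%x. indicator Omega x *\<^sub>R f x) : borel_measurable lebesgue"
  using f sets_Omega by (simp add: borel_measurable_restrict_space_iff)
 have eq: "AE x in lebesgue. indicator Omega x *\<^sub>R f x = G (norm x)"
  using ae[unfolded AE_lebesgue_on[OF sets_Omega]] AE_nonzero
 proof eventually_elim
  case (elim x)
  thus ?case using mem_Omega[of x] by (auto simp: G_def indicator_def)
 qed
 have W: "(%r. sphere_weight TYPE(real^'n) r * G r) = (%r. \<sigma> * (indicator {a<..<b} r *\<^sub>R (r ^ n * F r)))"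
  using a0 by (auto simp: sphere_weight_eq G_def indicator_def fun_eq_iff)
 have D: "DIM(real^'n) >= 2" using dim by simp
 have "integrable (leb) f \<longleftrightarrow> integrable lebesgue (%x. indicator Omega x *\<^sub>R f x)"
  by (rule lebesgue_on_integral(1)[OF sets_Omega])
 also have "... \<longleftrightarrow> integrable lebesgue (%x::real^'n. G (norm x))"
  by (rule integrable_cong_AE[OF fm measurable_completion[OF Gn] eq])
 also have "... \<longleftrightarrow> integrable lborel (%x::real^'n. G (norm x))" by (rule integrable_completion[OF Gn])
 also have "... \<longleftrightarrow> integrable lborel (%r. sphere_weight TYPE(real^'n) r * G r)" by (rule radial_integral(1)[OF D G])
 also have "... \<longleftrightarrow> set_integrable lborel {a<..<b} (%r. r ^ n * F r)"
  unfolding W set_integrable_def using \<sigma> by (subst integrable_mult_left_iff) auto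
 finally show "integrable (leb) f \<longleftrightarrow> set_integrable lborel {a<..<b} (%r. r ^ n * F r)" .
 have "(LINT x|leb. f x) = (LINT x|lebesgue. indicator Omega x *\<^sub>R f x)"
  by (rule lebesgue_on_integral(2)[OF sets_Omega])
 also have "... = (LINT x|lebesgue. G (norm (x::real^'n)))"
  by (rule integral_cong_AE[OF fm measurable_completion[OF Gn] eq])
 also have "... = (LINT x|lborel. G (norm (x::real^'n)))" by (rule integral_completion[OF Gn])
 also have "... = (LINT r|lborel. sphere_weight TYPE(real^'n) r * G r)" by (rule radial_integral(2)[OF D G])
 also have "... = \<sigma> * (LBINT r:{a<..<b}. r ^ n * F r)"
  unfolding W set_lebesgue_integral_def by simp
 finally show "(LINT x|leb. f x) = \<sigma> * (LBINT r:{a<..<b}. r ^ n * F r)" .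
qed

text \<open>The component along \<open>i\<close> of the radial vector field \<open>kappa (norm x) *\<^sub>R x\<close> and its gradient.\<close>

definition fld :: "(real => real) => real^'n => real^'n => real" where "fld kappa i x = kappa (norm x) * (x \<bullet> i)"

definition fld_grad :: "(real => real) => (real => real) => real^'n => real^'n => real^'n" where
 "fld_grad kappa kappa' i x = kappa (norm x) *\<^sub>R i + (x \<bullet> i) *\<^sub>R (kappa' (norm x) *\<^sub>R sgn x)"

text \<open>Divergence of the vector field \<open>kappa (norm x)\<close> times \<open>x\<close>; the
  factor \<open>Suc n\<close> is the dimension.\<close>

definition dvg :: "(real => real) => (real => real) => real => real" where
 "dvg kappa kappa' r = real (Suc n) * kappa r + r * kappa' r"

lemma fld_GDERIV:
 assumes "!!r. (kappa has_real_derivative kappa' r) (at r)" "kappa' 0 = 0"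
 shows "GDERIV (fld kappa i) x :> fld_grad kappa kappa' i x"
proof -
 have "GDERIV (%x. x \<bullet> i) x :> i" unfolding gderiv_def by (auto intro!: derivative_eq_intros)
 from GDERIV_mult[OF radial_GDERIV[OF assms] this] show ?thesis unfolding fld_def[abs_def] fld_grad_def .
qed

lemma fld_grad_continuous:
 assumes "continuous_on UNIV kappa" "continuous_on UNIV kappa'" "kappa' 0 = 0"
 shows "continuous_on UNIV (fld_grad kappa kappa' i)"
 unfolding fld_grad_def
 by (intro continuous_intros continuous_radial_field assms continuous_on_compose2[OF assms(1) continuous_on_norm_id]) auto

lemma fld_dvg: "(\<Sum>i\<in>Basis. fld_grad kappa kappa' i x \<bullet> i) = dvg kappa kappa' (norm x)"
proof -
 have "(\<Sum>i\<in>Basis. fld_grad kappa kappa' i x \<bullet> i) = (\<Sum>i\<in>Basis. kappa (norm x) * (i \<bullet> i) + kappa' (norm x) * ((x \<bullet> i) * (sgn x \<bullet> i)))"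
  by (intro sum.cong) (auto simp: fld_grad_def inner_add_left ac_simps)
 also have "... = (\<Sum>i\<in>Basis. kappa (norm x) * ((i::real^'n) \<bullet> i)) + kappa' (norm x) * (\<Sum>i\<in>Basis. (x \<bullet> i) * (sgn x \<bullet> i))"
  by (simp add: sum.distrib sum_distrib_left)
 also have "(\<Sum>i\<in>Basis. (x \<bullet> i) * (sgn x \<bullet> i)) = x \<bullet> sgn x" by (simp add: euclidean_inner[symmetric])
 also have "x \<bullet> sgn x = norm x" by (cases "x = 0") (auto simp: sgn_div_norm dot_square_norm power2_eq_square)
 also have "(\<Sum>i\<in>Basis. kappa (norm x) * ((i::real^'n) \<bullet> i)) = real (Suc n) * kappa (norm x)"
  using n by (simp add: inner_Basis)
 finally show ?thesis by (simp add: dvg_def mult.commute)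
qed

text \<open>The product of \<open>phi\<close> with each component of the radial field has compact
  support, so its partial derivatives integrate to 0; summation over \<open>Basis\<close> gives the
  identity.\<close>

lemma divergence_by_parts:
 assumes phi: "phi : C1_0 Omega" and kappa: "!!r. (kappa has_real_derivative kappa' r) (at r)" "continuous_on UNIV kappa'" "kappa' 0 = 0"
 shows "(LINT x|leb. phi x * dvg kappa kappa' (norm x)) = - (LINT x|leb. kappa (norm x) * (grad phi x \<bullet> x))"
  and "integrable (leb) (%x. kappa (norm x) * (grad phi x \<bullet> x))"
  and "integrable (leb) (%x. phi x * dvg kappa kappa' (norm x))"
proof -
 obtain K where K: "compact K" "K <= Omega" "!!x. x ~: K ==> phi x = 0 & grad phi x = 0" using C1_0_support[OF phi] by blast
 have ckappa: "continuous_on UNIV kappa" using kappa(1) by (meson deriv_cont)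
 have cn: "continuous_on UNIV (%x::real^'n. kappa (norm x))" "continuous_on UNIV (%x::real^'n. kappa' (norm x))"
  by (rule continuous_on_compose2[OF ckappa continuous_on_norm_id] continuous_on_compose2[OF kappa(2) continuous_on_norm_id]; simp)+
 note cg = C1_0_grad[OF phi] and cp = C1_0_continuous[OF phi]
 let ?A = "%x. phi x * dvg kappa kappa' (norm x)" and ?B = "%x. kappa (norm x) * (grad phi x \<bullet> x)"
 have cA: "continuous_on UNIV ?A" unfolding dvg_def by (intro continuous_intros cn cp)
 have cB: "continuous_on UNIV ?B" by (intro continuous_intros cn cg)
 have zA: "?A x = 0" and zB: "?B x = 0" if "x ~: K" for x using K(3)[OF that] by auto
 show "integrable (leb) ?B" by (rule lebesgue_on_continuous_support(1)[OF sets_Omega cB K(1) zB K(2)])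
 show "integrable (leb) ?A" by (rule lebesgue_on_continuous_support(1)[OF sets_Omega cA K(1) zA K(2)])
 have iA: "integrable lborel ?A" and iB: "integrable lborel ?B"
  by (rule integrable_continuous_compact_support[OF cA K(1) zA] integrable_continuous_compact_support[OF cB K(1) zB]; assumption)+
 let ?G = "%i x. phi x *\<^sub>R fld_grad kappa kappa' i x + fld kappa i x *\<^sub>R grad phi x"
 have G: "integrable lborel (%x. ?G i x \<bullet> i) & (LINT x|lborel. ?G i x \<bullet> i) = 0" for i
 proof -
  have GG: "GDERIV (%x. phi x * fld kappa i x) x :> ?G i x" for x
   by (rule GDERIV_mult[OF C1_0_GDERIV[OF phi] fld_GDERIV[OF kappa(1,3)]])
  have GC: "continuous_on UNIV (?G i)"
   unfolding fld_def by (intro continuous_intros cp cg cn fld_grad_continuous ckappa kappa)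
  have GZ: "phi x * fld kappa i x = 0" "?G i x = 0" if "x ~: K" for x using K(3)[OF that] by auto
  show ?thesis
   using integral_gradient_zero[where F="%x. phi x * fld kappa i x" and G="?G i", OF GG GC K(1)] GZ by blast
 qed
 have sum: "(\<Sum>i\<in>Basis. ?G i x \<bullet> i) = ?A x + ?B x" for x
 proof -
  have "(\<Sum>i\<in>Basis. ?G i x \<bullet> i) = phi x * (\<Sum>i\<in>Basis. fld_grad kappa kappa' i x \<bullet> i) + kappa (norm x) * (\<Sum>i\<in>Basis. (grad phi x \<bullet> i) * (x \<bullet> i))"
   by (simp add: inner_add_left sum.distrib sum_distrib_left fld_def ac_simps)
  thus ?thesis unfolding fld_dvg by (simp add: euclidean_inner[symmetric])
 qed
 have "(LINT x|lborel. (\<Sum>i\<in>Basis. ?G i x \<bullet> i)) = 0" using G by (subst Bochner_Integration.integral_sum) auto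
 hence "(LINT x|lborel. ?A x) + (LINT x|lborel. ?B x) = 0"
  unfolding sum using iA iB by (simp add: Bochner_Integration.integral_add)
 thus "(LINT x|leb. ?A x) = - (LINT x|leb. ?B x)"
  using lebesgue_on_continuous_support(2)[OF sets_Omega cB K(1) zB K(2)] lebesgue_on_continuous_support(2)[OF sets_Omega cA K(1) zA K(2)]
  by simp
qed

lemma finite_measure_Omega: "emeasure (leb) (space (leb)) < \<infinity>"
proof -
 have "Omega <= cball 0 b" using Omega by auto
 hence "emeasure lebesgue Omega <= emeasure lebesgue (cball (0::real^'n) b)" by (intro emeasure_mono) auto
 also have "... < \<infinity>" using emeasure_bounded_finite[OF bounded_cball, of "0::real^'n" b] by simp
 finally show ?thesis using sets_Omega by (simp add: emeasure_restrict_space space_restrict_space)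
qed

lemma integrable_bounded_Omega:
 fixes f :: "real^'n => 'b::euclidean_space"
 assumes "f : borel_measurable (leb)" "!!x. x : Omega ==> norm (f x) <= B"
 shows "integrable (leb) f"
proof -
 interpret finite_measure "leb" by (rule finite_measureI) (use finite_measure_Omega in auto)
 show ?thesis by (rule integrable_const_bound[of _ B]) (use assms in auto)
qed

lemma continuous_measurable_Omega: "continuous_on UNIV f ==> f : borel_measurable (leb)"
 for f :: "real^'n => 'b::euclidean_space"
 by (intro measurable_restrict_space1 measurable_completion) (simp add: borel_measurable_continuous_onI)

lemma continuous_bounded_Omega:
 fixes f :: "real^'n => 'b::euclidean_space"
 assumes "continuous_on UNIV f"
 obtains B where "!!x. x : Omega ==> norm (f x) <= B"
proof -
 have "bounded (f ` cball 0 b)"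
  using assms by (intro compact_imp_bounded compact_continuous_image) (auto elim: continuous_on_subset)
 then obtain B where "ALL x:cball 0 b. norm (f x) <= B" unfolding bounded_iff by auto
 moreover have "Omega <= cball 0 b" using Omega by auto
 ultimately show thesis using that by blast
qed

lemma integrable_continuous_Omega:
 fixes f :: "real^'n => 'b::euclidean_space"
 assumes "continuous_on UNIV f"
 shows "integrable (leb) f"
proof -
 obtain B where "!!x. x : Omega ==> norm (f x) <= B" using continuous_bounded_Omega[OF assms] by blast
 thus ?thesis by (rule integrable_bounded_Omega[OF continuous_measurable_Omega[OF assms]])
qed

text \<open>Membership in \<open>H1_0\<close> enters only through this inequality, in which \<open>kappa\<close> need not vanish
 at the boundary of \<open>Omega\<close>.\<close>

lemma H1_0_divergence_bound:
 assumes u: "u : H1_0 Omega"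
 shows "EX C>=0. ALL kappa kappa'. (ALL r. (kappa has_real_derivative kappa' r) (at r)) & continuous_on UNIV kappa' & kappa' 0 = 0 -->
  \<bar>LINT x|leb. u x * dvg kappa kappa' (norm x)\<bar> <= C + (LINT x|leb. (norm x * kappa (norm x))^2)"
proof -
 let ?M = "leb" and ?g = "weak_grad Omega u"
 note wg = H1_0_weak_grad[OF open_Omega u]
 have um: "u : borel_measurable ?M" and u2: "integrable ?M (%x. (u x)^2)"
  using u unfolding H1_0_def H1_def L2_def by auto
 obtain phi where phi: "!!k. phi k : C1_0 Omega" and lim: "(%k. LINT x|?M. (phi k x - u x)^2) \<longlonglongrightarrow> 0"
  "(%k. LINT x|?M. (norm (grad (phi k) x - ?g x))^2) \<longlonglongrightarrow> 0"
  using u unfolding H1_0_def by blast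
 note sq = C1_0_square_integrable[OF sets_Omega phi]
 define C where "C = (LINT x|?M. (norm (?g x))^2) + 1"
 have C: "C >= 0" by (simp add: C_def add_nonneg_nonneg)
 have par: "(norm (v + w))^2 <= 2 * (norm v)^2 + 2 * (norm w)^2" for v w :: "real^'n"
 proof -
  have "(norm (v + w))^2 <= (norm v + norm w)^2" by (intro power_mono norm_triangle_ineq) auto
  thus ?thesis using sum_squares_bound[of "norm v" "norm w"] by (simp add: power2_sum)
 qed
 have gd: "integrable ?M (%x. (norm (grad (phi k) x - ?g x))^2)" for k
 proof (rule Bochner_Integration.integrable_bound[of _ "%x. 2 * (norm (grad (phi k) x))^2 + 2 * (norm (?g x))^2"])
  show "AE x in ?M. norm ((norm (grad (phi k) x - ?g x))^2) <= norm (2 * (norm (grad (phi k) x))^2 + 2 * (norm (?g x))^2)"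
  proof (rule AE_I2)
   fix x
   show "norm ((norm (grad (phi k) x - ?g x))^2) <= norm (2 * (norm (grad (phi k) x))^2 + 2 * (norm (?g x))^2)"
    using par[of "grad (phi k) x" "- ?g x"] by simp
  qed
 qed (use sq wg in auto)
 have "\<forall>\<^sub>F k in sequentially. (LINT x|?M. (norm (grad (phi k) x - ?g x))^2) < 1"
  by (rule order_tendstoD(2)[OF lim(2)]) simp
 hence gb: "\<forall>\<^sub>F k in sequentially. (LINT x|?M. (norm (grad (phi k) x))^2) <= 2 * C"
 proof eventually_elim
  case (elim k)
  have "(LINT x|?M. (norm (grad (phi k) x))^2) <= (LINT x|?M. 2 * (norm (grad (phi k) x - ?g x))^2 + 2 * (norm (?g x))^2)"
   proof (rule integral_mono)
   show "(norm (grad (phi k) x))^2 <= 2 * (norm (grad (phi k) x - ?g x))^2 + 2 * (norm (?g x))^2" for x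
    using par[of "grad (phi k) x - ?g x" "?g x"] by simp
  qed (use sq(2) gd wg(2) in auto)
  also have "... = 2 * (LINT x|?M. (norm (grad (phi k) x - ?g x))^2) + 2 * (LINT x|?M. (norm (?g x))^2)"
   using gd wg(2) by simp
  finally show ?case using elim by (simp add: C_def)
 qed
 have ud: "integrable ?M (%x. (phi k x - u x)^2)" for k
 proof (rule Bochner_Integration.integrable_bound[of _ "%x. 2 * (phi k x)^2 + 2 * (u x)^2"])
  show "AE x in ?M. norm ((phi k x - u x)^2) <= norm (2 * (phi k x)^2 + 2 * (u x)^2)"
  proof (rule AE_I2)
   fix x
   have "0 <= (phi k x + u x)^2" by simp
   hence "(phi k x - u x)^2 <= 2 * (phi k x)^2 + 2 * (u x)^2" unfolding power2_sum power2_diff by linarith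
   thus "norm ((phi k x - u x)^2) <= norm (2 * (phi k x)^2 + 2 * (u x)^2)" by simp
  qed
 qed (use sq um u2 in auto)
 show ?thesis
 proof (intro exI[of _ C] conjI allI impI C, elim conjE)
  fix kappa kappa' assume kappa: "ALL r. (kappa has_real_derivative kappa' r) (at r)" "continuous_on UNIV kappa'" "kappa' 0 = 0"
  have ckappa: "continuous_on UNIV kappa" using kappa(1) by (meson deriv_cont)
  define D where "D = (%x::real^'n. dvg kappa kappa' (norm x))"
  define X where "X = (LINT x::real^'n|?M. (norm x * kappa (norm x))^2)"
  have X0: "X >= 0" by (simp add: X_def)
  have cn: "continuous_on UNIV (%x::real^'n. kappa (norm x))" "continuous_on UNIV (%x::real^'n. kappa' (norm x))"
   by (rule continuous_on_compose2[OF ckappa continuous_on_norm_id] continuous_on_compose2[OF kappa(2) continuous_on_norm_id]; simp)+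
  have cD: "continuous_on UNIV D" unfolding D_def dvg_def by (intro continuous_intros cn)
  have Xi: "integrable ?M (%x. (norm x * kappa (norm x))^2)"
   by (intro integrable_continuous_Omega continuous_intros cn)
  have D2: "D : borel_measurable ?M" "integrable ?M (%x. (D x)^2)"
   by (intro continuous_measurable_Omega integrable_continuous_Omega continuous_intros cD)+
  have dm: "(%x. phi k x - u x) : borel_measurable ?M" for k using sq(3) um by auto
  note conv = integral_mult_null[OF dm ud lim(1) D2]
  have phiD: "integrable ?M (%x. phi k x * D x)" for k
   using divergence_by_parts(3)[OF phi] kappa unfolding D_def by blast
  have uD: "integrable ?M (%x. u x * D x)"
   using Bochner_Integration.integrable_diff[OF phiD[of 0] conv(1)[of 0]] by (simp add: algebra_simps)
  have "(LINT x|?M. (phi k x - u x) * D x) = (LINT x|?M. phi k x * D x) - (LINT x|?M. u x * D x)" for k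
   using phiD uD by (simp add: left_diff_distrib)
  with conv(2) have "(%k. (LINT x|?M. phi k x * D x) - (LINT x|?M. u x * D x)) \<longlonglongrightarrow> 0" by simp
  hence l: "(%k. \<bar>LINT x|?M. phi k x * D x\<bar>) \<longlonglongrightarrow> \<bar>LINT x|?M. u x * D x\<bar>"
   by (intro tendsto_rabs) (simp add: LIM_zero_iff)
  have "\<forall>\<^sub>F k in sequentially. \<bar>LINT x|?M. phi k x * D x\<bar> <= C + X"
   using gb
  proof eventually_elim
   case (elim k)
   \<comment> \<open>The compact support of \<open>phi k\<close> removes boundary terms although
     \<open>kappa\<close> need not vanish on the boundary. Young's inequality separates the
     gradient, whose square integral is bounded uniformly in \<open>k\<close>, from the field, and
     the bound survives the limit.\<close>
   have i: "integrable ?M (%x. kappa (norm x) * (grad (phi k) x \<bullet> x))"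
    using divergence_by_parts(2)[OF phi] kappa by blast
   have "\<bar>LINT x|?M. phi k x * D x\<bar> = \<bar>LINT x|?M. kappa (norm x) * (grad (phi k) x \<bullet> x)\<bar>"
    using divergence_by_parts(1)[OF phi, of kappa kappa'] kappa unfolding D_def by simp
   also have "... <= (LINT x|?M. \<bar>kappa (norm x) * (grad (phi k) x \<bullet> x)\<bar>)" by (rule integral_abs_bound)
   also have "... <= (LINT x|?M. (norm (grad (phi k) x))^2 / 2 + (norm x * kappa (norm x))^2 / 2)"
   proof (rule integral_mono)
    show "integrable ?M (%x. \<bar>kappa (norm x) * (grad (phi k) x \<bullet> x)\<bar>)" using i by (rule integrable_abs)
    show "integrable ?M (%x. (norm (grad (phi k) x))^2 / 2 + (norm x * kappa (norm x))^2 / 2)" using sq(2) Xi by simp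
    fix x :: "real^'n"
    have "\<bar>kappa (norm x) * (grad (phi k) x \<bullet> x)\<bar> <= \<bar>kappa (norm x)\<bar> * (norm (grad (phi k) x) * norm x)"
     unfolding abs_mult by (intro mult_left_mono Cauchy_Schwarz_ineq2) auto
    also have "... = norm (grad (phi k) x) * \<bar>norm x * kappa (norm x)\<bar>" by (simp add: abs_mult)
    also have "... <= (norm (grad (phi k) x))^2 / 2 + (norm x * kappa (norm x))^2 / 2"
     using sum_squares_bound[of "norm (grad (phi k) x)" "\<bar>norm x * kappa (norm x)\<bar>"] by simp
    finally show "\<bar>kappa (norm x) * (grad (phi k) x \<bullet> x)\<bar> <= (norm (grad (phi k) x))^2 / 2 + (norm x * kappa (norm x))^2 / 2" .
   qed
   also have "... = (LINT x|?M. (norm (grad (phi k) x))^2) / 2 + X / 2" using sq(2) Xi by (simp add: X_def)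
   also have "... <= C + X" using elim X0 by linarith
   finally show ?case .
  qed
  with l have "\<bar>LINT x|?M. u x * D x\<bar> <= C + X" by (rule tendsto_upperbound) simp
  thus "\<bar>LINT x|?M. u x * dvg kappa kappa' (norm x)\<bar> <= C + (LINT x|?M. (norm x * kappa (norm x))^2)"
   unfolding D_def X_def .
 qed
qed

text \<open>The components of \<open>kappa (norm x)\<close> times \<open>x\<close> are themselves
  test functions, and this field is the gradient of \<open>eta (norm x)\<close> since
  \<open>eta' = r * kappa\<close>. Summing the definition of the weak gradient over them trades the
  gradient of \<open>u\<close> for a divergence.\<close>

lemma weak_grad_radial_test:
 assumes wg: "has_weak_gradient Omega u g"
  and kappa: "!!r. (kappa has_real_derivative kappa' r) (at r)" "continuous_on UNIV kappa'"
  and cd: "a < c" "c < d" "d < b" "!!r. r ~: {c..d} ==> kappa r = 0 & kappa' r = 0"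
  and eta: "!!r. (eta has_real_derivative r * kappa r) (at r)" "!!r. r >= d ==> eta r = 0" "!!r. a > 0 ==> r <= c ==> eta r = 0"
 shows "(%x. eta (norm x)) : C1_0 Omega"
  and "(LINT x|leb. u x * dvg kappa kappa' (norm x)) = - (LINT x|leb. g x \<bullet> grad (%x. eta (norm x)) x)"
proof -
 have ckappa: "continuous_on UNIV kappa" using kappa(1) by (meson deriv_cont)
 have c0: "c > 0" using a0 cd by simp
 have k0: "kappa' 0 = 0" using cd(4)[of 0] c0 by auto
 have G: "GDERIV (%x. eta (norm x)) x :> kappa (norm x) *\<^sub>R x" for x :: "real^'n"
 proof -
  have "(norm x * kappa (norm x)) *\<^sub>R sgn x = kappa (norm x) *\<^sub>R x"
   by (cases "x = 0") (auto simp: sgn_div_norm)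
  thus ?thesis using radial_GDERIV[of eta "%r. r * kappa r" x] eta(1) by simp
 qed
 hence gr: "grad (%x. eta (norm x)) x = kappa (norm x) *\<^sub>R x" for x :: "real^'n" by (rule grad_eqI)
 have cn: "continuous_on UNIV (%x::real^'n. kappa (norm x))"
  by (rule continuous_on_compose2[OF ckappa continuous_on_norm_id]) simp
 have Kc: "compact {x::real^'n. norm x : {c..d}}"
 proof -
  have "{x::real^'n. norm x : {c..d}} = cball 0 d - ball 0 c" by auto
  thus ?thesis by (simp add: compact_diff)
 qed
 have Ks: "{x. norm x : {c..d}} <= Omega" using cd by (auto intro!: mem_OmegaI)
 show "(%x. eta (norm x)) : C1_0 Omega"
 proof (cases "a = 0")
  case True
  show ?thesis
   by (rule C1_0_I[OF G _ compact_cball[of 0 d]]) (use True cd eta(2) in "auto simp: Omega intro!: continuous_intros cn")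
 next
  case False
  thus ?thesis
   by (intro C1_0_I[OF G _ Kc Ks]) (use a0 eta(2,3) in "auto intro!: continuous_intros cn simp: not_le")
 qed
 have X: "fld kappa i : C1_0 Omega" for i
  by (rule C1_0_I[OF fld_GDERIV[OF kappa(1) k0] fld_grad_continuous[OF ckappa kappa(2) k0] Kc Ks]) (use cd(4) in "auto simp: fld_def")
 have gX: "grad (fld kappa i) = fld_grad kappa kappa' i" for i by (rule ext, rule grad_eqI, rule fld_GDERIV[OF kappa(1) k0])
 have w: "integrable (leb) (%x. u x *\<^sub>R fld_grad kappa kappa' i x)"
  "integrable (leb) (%x. fld kappa i x *\<^sub>R g x)"
  "(LINT x|leb. u x *\<^sub>R fld_grad kappa kappa' i x) = - (LINT x|leb. fld kappa i x *\<^sub>R g x)" for i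
  using wg X[of i] gX[of i] unfolding has_weak_gradient_def by auto
 have comp: "integrable (leb) (%x. u x * (fld_grad kappa kappa' i x \<bullet> i))"
  "integrable (leb) (%x. fld kappa i x * (g x \<bullet> i))"
  "(LINT x|leb. u x * (fld_grad kappa kappa' i x \<bullet> i)) = - (LINT x|leb. fld kappa i x * (g x \<bullet> i))" for i
  using integrable_inner_left[OF w(1)[of i], of i] integrable_inner_left[OF w(2)[of i], of i]
   integral_inner_left[OF w(1)[of i], of i] integral_inner_left[OF w(2)[of i], of i] w(3)[of i] by auto
 have "(LINT x|leb. u x * dvg kappa kappa' (norm x)) = (LINT x|leb. (\<Sum>i\<in>Basis. u x * (fld_grad kappa kappa' i x \<bullet> i)))"
  by (simp add: fld_dvg[symmetric] sum_distrib_left)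
 also have "... = (\<Sum>i\<in>Basis. LINT x|leb. u x * (fld_grad kappa kappa' i x \<bullet> i))"
  by (intro Bochner_Integration.integral_sum comp)
 also have "... = - (\<Sum>i\<in>Basis. LINT x|leb. fld kappa i x * (g x \<bullet> i))" by (simp add: comp(3) sum_negf)
 also have "(\<Sum>i\<in>Basis. LINT x|leb. fld kappa i x * (g x \<bullet> i)) = (LINT x|leb. (\<Sum>i\<in>Basis. fld kappa i x * (g x \<bullet> i)))"
  by (rule Bochner_Integration.integral_sum[symmetric]) (rule comp)
 also have "... = (LINT x|leb. g x \<bullet> grad (%x. eta (norm x)) x)"
 proof (rule Bochner_Integration.integral_cong)
  fix x
  have "g x \<bullet> grad (%x. eta (norm x)) x = kappa (norm x) * (g x \<bullet> x)" unfolding gr by simp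
  also have "g x \<bullet> x = (\<Sum>i\<in>Basis. (g x \<bullet> i) * (x \<bullet> i))" by (rule euclidean_inner)
  also have "kappa (norm x) * ... = (\<Sum>i\<in>Basis. fld kappa i x * (g x \<bullet> i))"
   by (simp add: fld_def sum_distrib_left ac_simps)
  finally show "(\<Sum>i\<in>Basis. fld kappa i x * (g x \<bullet> i)) = g x \<bullet> grad (%x. eta (norm x)) x" by simp
 qed simp
 finally show "(LINT x|leb. u x * dvg kappa kappa' (norm x)) = - (LINT x|leb. g x \<bullet> grad (%x. eta (norm x)) x)" .
qed

end


section \<open>Radial weak equations on an interval\<close>

lemma antiderivative_open:
 fixes g :: "real => real" and a b :: ereal
 assumes "a < b" "!!x::real. a < x ==> x < b ==> isCont g x"
 shows "EX G. ALL x::real. a < x --> x < b --> (G has_real_derivative g x) (at x)"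
 using einterval_antiderivative[OF assms] by (simp add: has_real_derivative_iff_has_vector_derivative)

lemma antiderivative_UNIV:
 fixes g :: "real => real"
 assumes "continuous_on UNIV g"
 shows "EX G. G c = y & (ALL x. (G has_real_derivative g x) (at x))"
proof -
 have "EX G. ALL x::real. - \<infinity> < ereal x --> ereal x < \<infinity> --> (G has_real_derivative g x) (at x)"
  using assms by (intro antiderivative_open) (auto simp: continuous_on_eq_continuous_at)
 then obtain G where "!!x. (G has_real_derivative g x) (at x)" by auto
 hence "ALL x. ((%x. G x - G c + y) has_real_derivative g x) (at x)" by (auto intro!: derivative_eq_intros)
 thus ?thesis by (intro exI[of _ "%x. G x - G c + y"]) simp
qed

lemma continuous_on_open_intervalI:
 fixes g :: "real => 'b::topological_space"
 assumes "!!c d. a < c ==> c < d ==> d < b ==> continuous_on {c..d} g"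
 shows "continuous_on {a<..<b} g"
 unfolding continuous_on_eq_continuous_at[OF open_greaterThanLessThan]
proof
 fix x assume x: "x : {a<..<b}"
 obtain c where c: "a < c" "c < x" using dense x by auto
 obtain d where d: "x < d" "d < b" using dense x by auto
 have "continuous_on {c<..<d} g"
  by (rule continuous_on_subset[OF assms[of c d]]) (use c d in auto)
 thus "isCont g x" using c d by (auto simp: continuous_on_eq_continuous_at)
qed

text \<open>The ramp is \<open>A / (A + B)\<close> with the squared positive parts of
  \<open>r - c\<close> and \<open>d - r\<close>, which never vanish together.\<close>

lemma ramp_exists:
 fixes c d :: real
 assumes cd: "c < d"
 shows "EX zeta theta. continuous_on UNIV theta & (ALL r. (zeta has_real_derivative theta r) (at r)) & (ALL r. 0 <= theta r & 0 <= zeta r & zeta r <= 1) &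
  (ALL r<=c. zeta r = 0 & theta r = 0) & (ALL r>=d. zeta r = 1 & theta r = 0)"
proof -
 define A where "A = (%r. sqpos (r - c))"
 define B where "B = (%r. sqpos (d - r))"
 define A' where "A' = (%r. 2 * max 0 (r - c))"
 define B' where "B' = (%r. - (2 * max 0 (d - r)))"
 define theta where "theta = (%r. (A' r * (A r + B r) - A r * (A' r + B' r)) / ((A r + B r) * (A r + B r)))"
 have dA: "(A has_real_derivative A' r) (at r)" and dB: "(B has_real_derivative B' r) (at r)" for r
 proof -
  have "((%r. r - c) has_real_derivative 1) (at r)" "((%r. d - r) has_real_derivative - 1) (at r)"
   by (auto intro!: derivative_eq_intros)
  from DERIV_chain2[OF deriv_sqpos this(1)] DERIV_chain2[OF deriv_sqpos this(2)]
  show "(A has_real_derivative A' r) (at r)" "(B has_real_derivative B' r) (at r)"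
   unfolding A_def B_def A'_def B'_def by simp_all
 qed
 have nz: "A r + B r > 0" for r using sqpos_simps[of "r - c"] sqpos_simps[of "d - r"] cd
  by (cases "c < r") (auto simp: A_def B_def less_le add_nonneg_eq_0_iff)
 have n0: "A r >= 0" "B r >= 0" for r by (auto simp: A_def B_def sqpos_simps)
 have "((%r. A r / (A r + B r)) has_real_derivative theta r) (at r)" for r
  unfolding theta_def using nz[of r] by (intro DERIV_divide DERIV_add dA dB) auto
 moreover have "continuous_on UNIV theta"
 proof -
  have "continuous_on UNIV A" "continuous_on UNIV B"
   using dA dB by (meson deriv_cont)+
  moreover have "continuous_on UNIV A'" "continuous_on UNIV B'" unfolding A'_def B'_def by (intro continuous_intros)+
  ultimately show ?thesis unfolding theta_def using nz by (intro continuous_intros) (auto simp: less_imp_neq[symmetric])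
 qed
 moreover have "0 <= theta r" for r
 proof -
  have "A' r * (A r + B r) - A r * (A' r + B' r) = A' r * B r + A r * (- B' r)" by (simp add: algebra_simps)
  also have "... >= 0" using n0 by (intro add_nonneg_nonneg mult_nonneg_nonneg) (auto simp: A'_def B'_def)
  finally show ?thesis unfolding theta_def using nz[of r] by (intro divide_nonneg_pos) auto
 qed
 moreover have "0 <= A r / (A r + B r) & A r / (A r + B r) <= 1" for r using n0[of r] nz[of r] by simp
 moreover have "A r / (A r + B r) = 0 & theta r = 0" if "r <= c" for r
  using that by (simp add: theta_def A_def A'_def sqpos_simps)
 moreover have "A r / (A r + B r) = 1 & theta r = 0" if "r >= d" for r
  using that nz[of r] by (simp add: theta_def B_def B'_def sqpos_simps)
 ultimately show ?thesis by (intro exI[of _ "%r. A r / (A r + B r)"] exI[of _ theta]) blast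
qed

lemma set_integrable_mult_continuous:
 fixes f g :: "real => real"
 assumes f: "set_integrable lborel {c..d} f" and g: "continuous_on {c..d} g"
 shows "set_integrable lborel {c..d} (%r. f r * g r)"
proof -
 obtain B where B: "!!r. r : {c..d} ==> \<bar>g r\<bar> <= B"
 proof -
  have "bounded (g ` {c..d})" by (rule compact_imp_bounded[OF compact_continuous_image[OF g compact_Icc]])
  then obtain B where "ALL y:g ` {c..d}. norm y <= B" unfolding bounded_iff by blast
  thus thesis by (intro that[of B]) auto
 qed
 have gm: "(%r. indicator {c..d} r *\<^sub>R g r) : borel_measurable borel"
  by (rule borel_measurable_continuous_on_indicator[OF _ g]) simp
 have eq: "(%r. indicator {c..d} r *\<^sub>R (f r * g r)) = (%r. (indicator {c..d} r *\<^sub>R f r) * (indicator {c..d} r *\<^sub>R g r))"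
  by (auto simp: indicator_def)
 have fi: "integrable lborel (%r. indicator {c..d} r *\<^sub>R f r)" using f by (simp add: set_integrable_def)
 show ?thesis unfolding set_integrable_def
 proof (rule Bochner_Integration.integrable_bound[of _ "%r. \<bar>B\<bar> * (indicator {c..d} r *\<^sub>R f r)"])
  show "integrable lborel (%r. \<bar>B\<bar> * (indicator {c..d} r *\<^sub>R f r))" using fi by (rule integrable_mult_right)
  show "(%r. indicator {c..d} r *\<^sub>R (f r * g r)) : borel_measurable lborel"
   unfolding eq using borel_measurable_integrable[OF fi] gm by simp
  show "AE r in lborel. norm (indicator {c..d} r *\<^sub>R (f r * g r)) <= norm (\<bar>B\<bar> * (indicator {c..d} r *\<^sub>R f r))"
  proof (rule AE_I2)
   fix r show "norm (indicator {c..d} r *\<^sub>R (f r * g r)) <= norm (\<bar>B\<bar> * (indicator {c..d} r *\<^sub>R f r))"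
    using B[of r] mult_left_mono[of "\<bar>g r\<bar>" "\<bar>B\<bar>" "\<bar>f r\<bar>"]
    by (cases "r : {c..d}") (auto simp: abs_mult mult.commute)
  qed
 qed
qed

lemma set_lint_support:
 fixes F :: "real => real"
 assumes "S <= T" "!!r. r : T ==> r ~: S ==> F r = 0"
 shows "(LINT r:T|M. F r) = (LINT r:S|M. F r)" "set_integrable M T F \<longleftrightarrow> set_integrable M S F"
proof -
 have "(%r. indicator T r *\<^sub>R F r) = (%r. indicator S r *\<^sub>R F r)" using assms by (auto simp: indicator_def fun_eq_iff)
 thus "(LINT r:T|M. F r) = (LINT r:S|M. F r)" "set_integrable M T F \<longleftrightarrow> set_integrable M S F"
  unfolding set_lebesgue_integral_def set_integrable_def by auto
qed

lemma lint_parts_smooth: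
 fixes F G :: "real => real"
 assumes cd: "c <= d" and F: "!!r. r : {c..d} ==> (F has_real_derivative F' r) (at r)" "continuous_on {c..d} F'"
  and G: "!!r. r : {c..d} ==> (G has_real_derivative G' r) (at r)" "continuous_on {c..d} G'"
  and 0: "F c * G c = 0" "F d * G d = 0"
 shows "(LBINT r:{c..d}. F r * G' r) = - (LBINT r:{c..d}. F' r * G r)"
proof -
 have cF: "continuous_on {c..d} F" and cG: "continuous_on {c..d} G"
  using F(1) G(1) by (meson deriv_cont)+
 have i: "set_integrable lborel {c..d} (%r. F r * G' r)" "set_integrable lborel {c..d} (%r. F' r * G r)"
  by (intro borel_integrable_atLeastAtMost' continuous_intros cF cG F G)+
 have "((%r. F r * G' r + F' r * G r) has_integral (F d * G d - F c * G c)) {c..d}"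
 proof (rule fundamental_theorem_of_calculus[OF cd])
  fix r assume "r : {c..d}"
  thus "((%r. F r * G r) has_vector_derivative F r * G' r + F' r * G r) (at r within {c..d})"
   unfolding has_real_derivative_iff_has_vector_derivative[symmetric]
   by (auto intro!: derivative_eq_intros has_field_derivative_at_within[OF F(1)] has_field_derivative_at_within[OF G(1)])
 qed
 hence "integral {c..d} (%r. F r * G' r + F' r * G r) = 0" using 0 by (simp add: integral_unique)
 hence "(LBINT r:{c..d}. F r * G' r + F' r * G r) = 0"
  using set_borel_integral_eq_integral(2)[OF set_integral_add(1)[OF i]] by simp
 thus ?thesis using set_integral_add(2)[OF i] by simp
qed

lemma lint_derivative:
 fixes F :: "real => real"
 assumes "c <= d" "!!r. r : {c..d} ==> (F has_real_derivative F' r) (at r)" "continuous_on {c..d} F'"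
 shows "(LBINT r:{c..d}. F' r) = F d - F c"
proof -
 have "(F' has_integral (F d - F c)) {c..d}"
  using assms(2) by (intro fundamental_theorem_of_calculus[OF assms(1)])
   (auto simp: has_real_derivative_iff_has_vector_derivative[symmetric] intro: has_field_derivative_at_within)
 thus ?thesis
  using set_borel_integral_eq_integral(2)[OF borel_integrable_atLeastAtMost'[OF assms(3)]] by (simp add: integral_unique)
qed

text \<open>Integration by parts for a merely integrable \<open>k\<close>: Fubini's theorem on the
  triangle \<open>r <= s\<close>.\<close>

lemma indefinite_integral_parts:
 fixes k omega :: "real => real"
 assumes k: "set_integrable lborel {c..d} k" and omega: "continuous_on {c..d} omega"
 shows "(LBINT r:{c..d}. k r * (LBINT s:{r..d}. omega s)) = (LBINT s:{c..d}. (LBINT r:{c..s}. k r) * omega s)"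
proof -
 define k1 where "k1 = (%r. indicator {c..d} r *\<^sub>R k r)"
 define w1 where "w1 = (%r. indicator {c..d} r *\<^sub>R omega r)"
 have ki: "integrable lborel k1" using k by (simp add: k1_def set_integrable_def)
 have wi: "integrable lborel w1"
  using borel_integrable_atLeastAtMost'[OF omega] by (simp add: w1_def set_integrable_def)
 have km [measurable]: "k1 : borel_measurable borel" and wm [measurable]: "w1 : borel_measurable borel"
  using borel_measurable_integrable[OF ki] borel_measurable_integrable[OF wi] by auto
 define P where "P = (%(r::real, s::real). if r <= s then k1 r * w1 s else 0)"
 have P: "P (r, s) = (if r <= s then k1 r * w1 s else 0)" for r s by (simp add: P_def)
 have Pm: "P : borel_measurable (lborel \<Otimes>\<^sub>M lborel)" unfolding P_def by measurable
 have Pi: "integrable (lborel \<Otimes>\<^sub>M lborel) P"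
 proof (rule Bochner_Integration.integrable_bound[OF _ Pm])
  show "integrable (lborel \<Otimes>\<^sub>M lborel) (%(r, s). k1 r * w1 s)"
  proof (rule lborel_pair.Fubini_integrable)
   show "integrable lborel (%r. LINT s|lborel. norm (case (r, s) of (r, s) => k1 r * w1 s))"
    using ki by (simp add: abs_mult)
   show "AE r in lborel. integrable lborel (%s. case (r, s) of (r, s) => k1 r * w1 s)"
    using wi by simp
  qed measurable
 qed (auto simp: P_def)
 have "(LBINT r:{c..d}. k r * (LBINT s:{r..d}. omega s)) = (LINT r|lborel. (LINT s|lborel. P (r, s)))"
  unfolding set_lebesgue_integral_def
 proof (rule Bochner_Integration.integral_cong)
  fix r
  have "(LINT s|lborel. P (r, s)) = (LINT s|lborel. k1 r * (indicator {r..d} s *\<^sub>R omega s))"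
   by (intro Bochner_Integration.integral_cong) (auto simp: P k1_def w1_def indicator_def)
  thus "indicator {c..d} r *\<^sub>R (k r * (LINT s|lborel. indicator {r..d} s *\<^sub>R omega s)) = (LINT s|lborel. P (r, s))"
   by (simp add: k1_def)
 qed simp
 also have "... = (LINT s|lborel. (LINT r|lborel. P (r, s)))"
  using lborel_pair.Fubini_integral[of "%r s. P (r, s)"] Pi by simp
 also have "... = (LBINT s:{c..d}. (LBINT r:{c..s}. k r) * omega s)"
  unfolding set_lebesgue_integral_def
 proof (rule Bochner_Integration.integral_cong)
  fix s
  have "(LINT r|lborel. P (r, s)) = (LINT r|lborel. (indicator {c..s} r *\<^sub>R k r) * w1 s)"
   by (intro Bochner_Integration.integral_cong) (auto simp: P k1_def w1_def indicator_def)
  thus "(LINT r|lborel. P (r, s)) = indicator {c..d} s *\<^sub>R ((LINT r|lborel. indicator {c..s} r *\<^sub>R k r) * omega s)"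
   by (simp add: w1_def)
 qed simp
 finally show ?thesis .
qed


lemma antiderivative_support:
 fixes F :: "real => real"
 assumes F: "!!r. (F has_real_derivative F' r) (at r)" "!!r. r ~: {c<..<d} ==> F' r = 0" and 0: "F c = 0" "F d = 0" and r: "r ~: {c<..<d}"
 shows "F r = 0"
proof -
 have cont: "continuous_on S F" for S using F(1) by (meson deriv_cont)
 consider "r < c" | "r > d" | "r = c" | "r = d" using r by fastforce
 thus ?thesis
 proof cases
  case 1
  have "F c = F r" by (rule DERIV_isconst_end[OF 1 cont]) (use F(1) F(2) in "metis greaterThanLessThan_iff less_asym")
  thus ?thesis using 0 by simp
 next
  case 2
  have "F r = F d" by (rule DERIV_isconst_end[OF 2 cont]) (use F(1) F(2) in "metis greaterThanLessThan_iff less_asym")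
  thus ?thesis using 0 by simp
 qed (use 0 in auto)
qed

text \<open>A weak equation in one variable, with \<open>f\<close> the profile of the solution and
  \<open>h\<close> that of the right-hand side. For \<open>zeta = r ^ n * eta'\<close> and
  \<open>theta = zeta'\<close>, \<open>E\<close> is the equation tested with \<open>eta\<close>. In
  \<open>H10\<close> the function \<open>zeta\<close> has to vanish near the origin, but not at
  \<open>b\<close> or at a positive \<open>a\<close>; this is how the boundary condition is
  encoded.\<close>

locale radial_weak =
 fixes a b C :: real and n :: nat and f h :: "real => real"
 assumes n: "n >= 1" and a0: "0 <= a" and ab: "a < b" and C: "C >= 0"
  and f_meas: "f : borel_measurable borel"
  and f_int: "set_integrable lborel {a<..<b} (%r. r ^ n * f r)"
  and h_int: "!!c d. a < c ==> c < d ==> d < b ==> set_integrable lborel {c..d} (%r. r ^ n * h r)"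
  and h_int0: "!!d. a = 0 ==> 0 < d ==> d < b ==> set_integrable lborel {0..d} (%r. r ^ n * h r)"
  and H10: "!!zeta theta delta. (!!r. (zeta has_real_derivative theta r) (at r)) ==> continuous_on UNIV theta ==> delta > 0 ==>
   (!!r. r <= delta ==> zeta r = 0 & theta r = 0) ==>
   \<bar>LBINT r:{a<..<b}. f r * theta r\<bar> <= C + (LBINT r:{a<..<b}. (zeta r)^2 / r ^ n)"
  and E: "!!zeta theta eta c d. (!!r. (zeta has_real_derivative theta r) (at r)) ==> continuous_on UNIV theta ==>
   a < c ==> c < d ==> d < b ==> (!!r. r ~: {c<..<d} ==> zeta r = 0 & theta r = 0) ==>
   (!!r. (eta has_real_derivative zeta r / r ^ n) (at r)) ==> (!!r. r ~: {c<..<d} ==> eta r = 0) ==>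
   (LBINT r:{a<..<b}. f r * theta r) = - (LBINT r:{a<..<b}. r ^ n * h r * eta r)"
begin

lemma pos: "r : {a<..<b} ==> r > 0" using a0 by auto

lemma f_loc:
 assumes "a < c" "d < b"
 shows "set_integrable lborel {c..d} f"
proof -
 have "set_integrable lborel {c..d} (%r. r ^ n * f r)"
  by (rule set_integrable_subset[OF f_int]) (use assms in auto)
 hence "set_integrable lborel {c..d} (%r. r ^ n * f r * (1 / r ^ n))"
  by (rule set_integrable_mult_continuous) (use assms a0 in "auto intro!: continuous_intros")
 moreover have "(%r. indicator {c..d} r *\<^sub>R (r ^ n * f r * (1 / r ^ n))) = (%r. indicator {c..d} r *\<^sub>R f r)"
  using assms a0 by (auto simp: indicator_def fun_eq_iff)
 ultimately show ?thesis by (simp add: set_integrable_def)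
qed

definition k :: "real => real" where "k r = r ^ n * h r"

lemma k_int:
 assumes "a < c" "d < b"
 shows "k integrable_on {c..d}"
proof (cases "c < d")
 case True
 thus ?thesis using set_borel_integral_eq_integral(1)[OF h_int[of c d]] assms by (simp add: k_def[abs_def])
next
 case False
 thus ?thesis using integrable_on_refl[of k d] by (cases "c = d") auto
qed

lemma primitive_exists:
 "EX H. ALL c r. a < c --> c <= r --> r < b --> H r = H c + integral {c..r} k"
proof -
 define c0 where "c0 = (a + b) / 2"
 have c0: "a < c0" "c0 < b" using ab by (auto simp: c0_def)
 define H where "H = (%r. if c0 <= r then integral {c0..r} k else - integral {r..c0} k)"
 have add: "integral {c..d} k = integral {c..t} k + integral {t..d} k" if "a < c" "c <= t" "t <= d" "d < b" for c t d
  using Henstock_Kurzweil_Integration.integral_combine[OF that(2,3) k_int[OF that(1,4)]] by simp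
 have "H r = H c + integral {c..r} k" if cr: "a < c" "c <= r" "r < b" for c r
 proof -
  consider "c0 <= c" | "c < c0" "c0 <= r" | "r < c0" by linarith
  thus ?thesis
  proof cases
   case 1 thus ?thesis using add[of c0 c r] cr c0 by (simp add: H_def)
  next
   case 2 thus ?thesis using add[of c c0 r] cr c0 by (simp add: H_def)
  next
   case 3 thus ?thesis using add[of c r c0] cr c0 by (simp add: H_def)
  qed
 qed
 thus ?thesis by blast
qed

definition H :: "real => real" where
 "H = (SOME H. ALL c r. a < c --> c <= r --> r < b --> H r = H c + integral {c..r} k)"

lemma H: "a < c ==> c <= r ==> r < b ==> H r = H c + integral {c..r} k"
 using someI_ex[OF primitive_exists] unfolding H_def[symmetric] by blast

lemma H_cont: "continuous_on {a<..<b} H"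
proof (rule continuous_on_open_intervalI)
 fix c d assume cd: "a < c" "c < d" "d < b"
 have "continuous_on {c..d} (%r. H c + integral {c..r} k)"
  using cd k_int by (intro continuous_intros indefinite_integral_continuous_1) auto
 thus "continuous_on {c..d} H"
 proof (rule continuous_on_eq)
  fix r assume "r : {c..d}"
  thus "H c + integral {c..r} k = H r" using H[of c r] cd by simp
 qed
qed

lemma H_deriv:
 assumes k': "continuous_on {a<..<b} k'" and ae: "AE r in lborel. r : {a<..<b} --> k r = k' r" and r: "r : {a<..<b}"
 shows "(H has_real_derivative k' r) (at r)"
proof -
 obtain c where c: "a < c" "c < r" using dense r by auto
 obtain d where d: "r < d" "d < b" using dense r by auto
 have ae': "AE r in lebesgue. r : {a<..<b} --> k r = k' r" using ae by (rule AE_completion)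
 obtain N where N: "N : null_sets lebesgue" "{r. \<not> (r : {a<..<b} --> k r = k' r)} <= N"
  using ae' by (auto simp: eventually_ae_filter)
 have neg: "negligible N" using N(1) by (simp add: negligible_iff_null_sets)
 have kk: "k' x = k x" if "x ~: N" "x : {a<..<b}" for x using subsetD[OF N(2), of x] that by force
 have eq: "H t = H c + integral {c..t} k'" if "t : {c..d}" for t
 proof -
  have "integral {c..t} k = integral {c..t} k'"
   by (rule integral_spike[OF neg]) (use kk that c d in auto)
  thus ?thesis using H[of c t] that c d by simp
 qed
 have "continuous_on {c..d} k'" by (rule continuous_on_subset[OF k']) (use c d in auto)
 hence "((%t. integral {c..t} k') has_real_derivative k' r) (at r within {c..d})"
  by (rule integral_has_real_derivative) (use c d in auto)
 hence "((%t. H c + integral {c..t} k') has_real_derivative k' r) (at r within {c..d})"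
  by (auto intro!: derivative_eq_intros)
 hence "(H has_real_derivative k' r) (at r within {c..d})"
 proof (rule has_field_derivative_transform_within[OF _ zero_less_one])
  show "r : {c..d}" using c d by simp
  show "H c + integral {c..x} k' = H x" if "x : {c..d}" for x using eq[OF that] by simp
 qed
 thus ?thesis using c d by (simp add: at_within_Icc_at)
qed

lemma k_lint: "a < c ==> c <= s ==> s < b ==> (LBINT r:{c..s}. k r) = H s - H c"
proof -
 assume cs: "a < c" "c <= s" "s < b"
 show ?thesis
 proof (cases "c < s")
  case True
  hence "set_integrable lborel {c..s} k" using h_int[of c s] cs by (simp add: k_def[abs_def])
  thus ?thesis using set_borel_integral_eq_integral(2) H[of c s] cs by simp
 next
  case False
  hence "c = s" using cs by simp
  moreover have "(LBINT r:{s}. k r) = 0"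
   unfolding set_lebesgue_integral_def
   by (rule integral_eq_zero_AE) (use AE_lborel_singleton[of s] in "auto elim!: eventually_mono")
  ultimately show ?thesis by simp
 qed
qed

text \<open>A particular solution of the integrated equation, \<open>r ^ n * w0' = - H\<close>; the
  constants and \<open>G\<close> below span the homogeneous solutions.\<close>

definition w0 :: "real => real" where
 "w0 = (SOME w. ALL r. a < r --> r < b --> (w has_real_derivative - H r / r ^ n) (at r))"

definition G :: "real => real" where
 "G = (SOME w. ALL r. a < r --> r < b --> (w has_real_derivative 1 / r ^ n) (at r))"

lemma w0: "r : {a<..<b} ==> (w0 has_real_derivative - H r / r ^ n) (at r)"
proof -
 assume r: "r : {a<..<b}"
 have "continuous_on {a<..<b} (%r. - H r / r ^ n)" using pos by (intro continuous_intros H_cont) fastforce+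
 hence "EX w. ALL r. ereal a < ereal r --> ereal r < ereal b --> (w has_real_derivative - H r / r ^ n) (at r)"
  using ab by (intro antiderivative_open) (auto simp: continuous_on_eq_continuous_at)
 hence "EX w. ALL r. a < r --> r < b --> (w has_real_derivative - H r / r ^ n) (at r)" by simp
 from someI_ex[OF this] r show ?thesis unfolding w0_def[symmetric] by auto
qed

lemma G: "r : {a<..<b} ==> (G has_real_derivative 1 / r ^ n) (at r)"
proof -
 assume r: "r : {a<..<b}"
 have "continuous_on {a<..<b} (%r. 1 / r ^ n)" using pos by (intro continuous_intros) fastforce+
 hence "EX w. ALL r. ereal a < ereal r --> ereal r < ereal b --> (w has_real_derivative 1 / r ^ n) (at r)"
  using ab by (intro antiderivative_open) (auto simp: continuous_on_eq_continuous_at)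
 hence "EX w. ALL r. a < r --> r < b --> (w has_real_derivative 1 / r ^ n) (at r)" by simp
 from someI_ex[OF this] r show ?thesis unfolding G_def[symmetric] by auto
qed

text \<open>The two vanishing moments make \<open>theta\<close> the derivative of a compactly
  supported \<open>zeta\<close>, and \<open>zeta / r ^ n\<close> the derivative of a compactly
  supported \<open>eta\<close>, so that \<open>E\<close> applies. Integrating by parts twice moves
  the equation onto \<open>w0\<close>.\<close>

lemma weak_identity:
 assumes theta: "continuous_on UNIV theta" "a < c" "c < d" "d < b" "!!r. r ~: {c<..<d} ==> theta r = 0"
  and m0: "(LBINT r:{c..d}. theta r) = 0" and m1: "(LBINT r:{c..d}. G r * theta r) = 0"
 shows "(LBINT r:{a<..<b}. f r * theta r) = (LBINT r:{c..d}. w0 r * theta r)"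
proof -
 have c0: "c > 0" using theta a0 by simp
 have sub: "{c..d} <= {a<..<b}" using theta by auto
 note in_ab = subsetD[OF sub]
 obtain zeta where zeta: "zeta c = 0" "!!r. (zeta has_real_derivative theta r) (at r)" using antiderivative_UNIV[OF theta(1), of c 0] by blast
 have czeta: "continuous_on S zeta" for S using zeta(2) by (meson deriv_cont)
 have ctheta: "continuous_on S theta" for S using theta(1) by (rule continuous_on_subset) simp
 have zetad: "zeta d = 0" using lint_derivative[of c d zeta theta] zeta theta ctheta m0 by simp
 have zeta0: "zeta r = 0 & theta r = 0" if "r ~: {c<..<d}" for r
  using antiderivative_support[OF zeta(2) theta(5) zeta(1) zetad that] theta(5)[OF that] by simp
 \<comment> \<open>The maximum only prevents a division by zero; \<open>zeta\<close> vanishes below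
   \<open>c\<close>.\<close>
 define omega where "omega = (%r. zeta r / (max c r) ^ n)"
 have omega: "omega r = zeta r / r ^ n" for r using zeta0[of r] by (cases "r < c") (auto simp: omega_def max_def)
 have comega: "continuous_on S omega" for S unfolding omega_def using c0 by (intro continuous_intros czeta) (auto simp: max_def)
 obtain eta where eta: "eta c = 0" "!!r. (eta has_real_derivative omega r) (at r)" using antiderivative_UNIV[OF comega, of c 0] by blast
 have ceta: "continuous_on S eta" for S using eta(2) by (meson deriv_cont)
 have cinv: "continuous_on {c..d} (%r. 1 / r ^ n)" using c0 by (intro continuous_intros) auto
 have cG: "continuous_on {c..d} G" using G in_ab by (meson deriv_cont)
 have cw0: "continuous_on {c..d} w0" using w0 in_ab by (meson deriv_cont)
 have cH: "continuous_on {c..d} H" by (rule continuous_on_subset[OF H_cont sub])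
 have "(LBINT r:{c..d}. zeta r * (1 / r ^ n)) = - (LBINT r:{c..d}. theta r * G r)"
  by (rule lint_parts_smooth) (use theta zeta(2) G in_ab ctheta cinv zeta0[of c] zeta0[of d] in auto)
 hence iomega: "(LBINT r:{c..d}. omega r) = 0" using m1 by (simp add: omega mult.commute)
 hence etad: "eta d = 0" using lint_derivative[of c d eta omega] eta theta comega by simp
 have eta0: "eta r = 0" if "r ~: {c<..<d}" for r
  by (rule antiderivative_support[OF eta(2) _ eta(1) etad that]) (use zeta0 omega in auto)
 \<comment> \<open>Adding a multiple of \<open>G\<close> replaces the primitive \<open>H\<close> by
   \<open>H - H c\<close>, the one that starts from 0 at \<open>c\<close>.\<close>
 define W where "W = (%r. w0 r + H c * G r)"
 have dW: "(W has_real_derivative - ((H r - H c) / r ^ n)) (at r)" if "r : {c..d}" for r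
  unfolding W_def using w0[OF in_ab[OF that]] G[OF in_ab[OF that]]
  by (auto intro!: derivative_eq_intros simp: diff_divide_distrib)
 have kl: "set_integrable lborel {c..d} k" using h_int[of c d] theta by (simp add: k_def[abs_def])
 have "(LBINT r:{a<..<b}. f r * theta r) = - (LBINT r:{a<..<b}. r ^ n * h r * eta r)"
  by (rule E[OF zeta(2) theta(1-4) zeta0]) (use eta(2) omega eta0 in auto)
 also have "(LBINT r:{a<..<b}. r ^ n * h r * eta r) = (LBINT r:{c..d}. k r * eta r)"
  unfolding k_def by (rule set_lint_support[OF sub]) (use eta0 in auto)
 also have "... = (LBINT r:{c..d}. - (k r * (LBINT s:{r..d}. omega s)))"
  using lint_derivative[of _ d eta omega] eta(2) comega etad by (intro set_lebesgue_integral_cong) auto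
 also have "... = - (LBINT r:{c..d}. k r * (LBINT s:{r..d}. omega s))"
  unfolding set_lebesgue_integral_def by simp
 also have "(LBINT r:{c..d}. k r * (LBINT s:{r..d}. omega s)) = (LBINT s:{c..d}. (LBINT r:{c..s}. k r) * omega s)"
  by (rule indefinite_integral_parts[OF kl comega])
 also have "... = (LBINT s:{c..d}. - (- ((H s - H c) / s ^ n) * zeta s))"
  using k_lint[of c] theta by (intro set_lebesgue_integral_cong) (auto simp: omega)
 also have "... = - (LBINT s:{c..d}. - ((H s - H c) / s ^ n) * zeta s)"
  unfolding set_lebesgue_integral_def by simp
 also have "... = (LBINT s:{c..d}. W s * theta s)"
 proof (rule lint_parts_smooth[symmetric, OF _ dW _ zeta(2) ctheta])
  show "continuous_on {c..d} (%r. - ((H r - H c) / r ^ n))" using c0 by (intro continuous_intros cH) auto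
 qed (use theta zeta0[of c] zeta0[of d] in auto)
 also have "... = (LBINT s:{c..d}. w0 s * theta s + H c * (G s * theta s))"
  by (simp add: W_def algebra_simps)
 also have "... = (LBINT s:{c..d}. w0 s * theta s) + (LBINT s:{c..d}. H c * (G s * theta s))"
  by (intro set_integral_add borel_integrable_atLeastAtMost' continuous_intros cw0 cG ctheta)
 also have "... = (LBINT s:{c..d}. w0 s * theta s)" using m1 by simp
 finally show ?thesis by simp
qed

definition test :: "(real => real) => bool" where
 "test theta \<longleftrightarrow> continuous_on UNIV theta & (EX c d. a < c & c < d & d < b & (ALL r. r ~: {c<..<d} --> theta r = 0))"

lemma test_int:
 assumes theta: "test theta" and F: "!!c d. a < c ==> d < b ==> set_integrable lborel {c..d} F"
 shows "set_integrable lborel {a<..<b} (%r. F r * theta r)"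
proof -
 obtain c d where cd: "a < c" "c < d" "d < b" "!!r. r ~: {c<..<d} ==> theta r = 0" and cont: "continuous_on UNIV theta"
  using theta unfolding test_def by blast
 have "set_integrable lborel {c..d} (%r. F r * theta r)"
  by (rule set_integrable_mult_continuous[OF F]) (use cd continuous_on_subset[OF cont] in auto)
 thus ?thesis by (subst set_lint_support(2)[of "{c..d}"]) (use cd in auto)
qed

lemma test_diff:
 assumes "test theta" "test theta1" "test theta2"
 shows "test (%r. theta r - s1 * theta1 r - s2 * theta2 r)"
proof -
 obtain c d where 1: "a < c" "c < d" "d < b" "!!r. r ~: {c<..<d} ==> theta r = 0" using assms(1) unfolding test_def by blast
 obtain c' d' where 2: "a < c'" "c' < d'" "d' < b" "!!r. r ~: {c'<..<d'} ==> theta1 r = 0" using assms(2) unfolding test_def by blast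
 obtain c'' d'' where 3: "a < c''" "c'' < d''" "d'' < b" "!!r. r ~: {c''<..<d''} ==> theta2 r = 0" using assms(3) unfolding test_def by blast
 have "theta r - s1 * theta1 r - s2 * theta2 r = 0" if "r ~: {min c (min c' c'')<..<max d (max d' d'')}" for r
 proof -
  have "theta r = 0" "theta1 r = 0" "theta2 r = 0" using that by (intro 1(4) 2(4) 3(4); auto)+
  thus ?thesis by simp
 qed
 thus ?thesis
  unfolding test_def using assms 1 2 3
  by (intro conjI exI[of _ "min c (min c' c'')"] exI[of _ "max d (max d' d'')"]) (auto simp: test_def intro!: continuous_intros)
qed

lemma test_lint_diff:
 assumes F: "!!c d. a < c ==> d < b ==> set_integrable lborel {c..d} F" and t: "test theta" "test theta1" "test theta2"
 shows "(LBINT r:{a<..<b}. F r * (theta r - s1 * theta1 r - s2 * theta2 r)) =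
  (LBINT r:{a<..<b}. F r * theta r) - s1 * (LBINT r:{a<..<b}. F r * theta1 r) - s2 * (LBINT r:{a<..<b}. F r * theta2 r)"
proof -
 note i = test_int[OF t(1) F] test_int[OF t(2) F] test_int[OF t(3) F]
 have j: "set_integrable lborel {a<..<b} (%r. s1 * (F r * theta1 r))" "set_integrable lborel {a<..<b} (%r. s2 * (F r * theta2 r))"
  using i by auto
 have "(LBINT r:{a<..<b}. F r * (theta r - s1 * theta1 r - s2 * theta2 r)) =
  (LBINT r:{a<..<b}. F r * theta r - s1 * (F r * theta1 r) - s2 * (F r * theta2 r))" by (simp add: algebra_simps)
 also have "... = (LBINT r:{a<..<b}. F r * theta r) - (LBINT r:{a<..<b}. s1 * (F r * theta1 r)) - (LBINT r:{a<..<b}. s2 * (F r * theta2 r))"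
  using i j by (simp add: set_integral_diff)
 finally show ?thesis by simp
qed

lemma loc:
 assumes "a < c" "d < b"
 shows "set_integrable lborel {c..d} (%r. f r - w0 r)" "set_integrable lborel {c..d} (%_. 1::real)" "set_integrable lborel {c..d} G"
  "set_integrable lborel {c..d} w0"
proof -
 have sub: "{c..d} <= {a<..<b}" using assms by auto
 have "continuous_on {c..d} w0" "continuous_on {c..d} G"
  using w0 G subsetD[OF sub] by (meson deriv_cont)+
 thus w: "set_integrable lborel {c..d} w0" and "set_integrable lborel {c..d} G"
  by (simp_all add: borel_integrable_atLeastAtMost')
 show "set_integrable lborel {c..d} (%r. f r - w0 r)" by (rule set_integral_diff(1)[OF f_loc[OF assms] w])
 show "set_integrable lborel {c..d} (%_. 1::real)" by (rule borel_integrable_atLeastAtMost') simp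
qed

lemma weak_identity_test:
 assumes t: "test theta" and 0: "(LBINT r:{a<..<b}. 1 * theta r) = 0" "(LBINT r:{a<..<b}. G r * theta r) = 0"
 shows "(LBINT r:{a<..<b}. (f r - w0 r) * theta r) = 0"
proof -
 obtain c d where cd: "a < c" "c < d" "d < b" "!!r. r ~: {c<..<d} ==> theta r = 0" and cont: "continuous_on UNIV theta"
  using t unfolding test_def by blast
 have supp: "(LBINT r:{a<..<b}. F r * theta r) = (LBINT r:{c..d}. F r * theta r)" for F
  by (rule set_lint_support) (use cd in auto)
 have "(LBINT r:{a<..<b}. f r * theta r) = (LBINT r:{c..d}. w0 r * theta r)"
  by (rule weak_identity[OF cont cd]) (use 0 supp[of "%_. 1"] supp[of G] in auto)
 hence "(LBINT r:{a<..<b}. f r * theta r) - (LBINT r:{a<..<b}. w0 r * theta r) = 0" using supp[of w0] by simp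
 moreover have "(LBINT r:{a<..<b}. f r * theta r - w0 r * theta r) = (LBINT r:{a<..<b}. f r * theta r) - (LBINT r:{a<..<b}. w0 r * theta r)"
  by (intro set_integral_diff test_int[OF t] f_loc loc)
 ultimately show ?thesis by (simp add: left_diff_distrib)
qed

lemma ramp_test:
 assumes "a < c" "c < d" "d < b"
 shows "EX theta. test theta & (ALL r. theta r >= 0) & (ALL r. r ~: {c..d} --> theta r = 0) & (LBINT r:{a<..<b}. 1 * theta r) = 1"
proof -
 obtain zeta theta where R: "continuous_on UNIV theta" "!!r. (zeta has_real_derivative theta r) (at r)" "!!r. 0 <= theta r"
  "!!r. r <= c ==> zeta r = 0 & theta r = 0" "!!r. r >= d ==> zeta r = 1 & theta r = 0" using ramp_exists[OF assms(2)] by blast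
 have "test theta" unfolding test_def using assms R by (intro conjI exI[of _ c] exI[of _ d]) (auto simp: not_less)
 moreover have "(LBINT r:{a<..<b}. 1 * theta r) = (LBINT r:{c..d}. 1 * theta r)"
  by (rule set_lint_support) (use assms R in "auto simp: not_le")
 moreover have "(LBINT r:{c..d}. 1 * theta r) = 1"
  using lint_derivative[of c d zeta theta] assms R continuous_on_subset[OF R(1)] by simp
 ultimately show ?thesis using R by (intro exI[of _ theta]) (auto simp: not_le)
qed

lemma G_mono: "r : {a<..<b} ==> s : {a<..<b} ==> r < s ==> G r < G s"
proof -
 assume rs: "r : {a<..<b}" "s : {a<..<b}" "r < s"
 show "G r < G s"
 proof (rule DERIV_pos_imp_increasing[OF rs(3)])
  fix x assume "r <= x" "x <= s"
  hence "x : {a<..<b}" using rs by auto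
  thus "EX y. (G has_real_derivative y) (at x) & y > 0" using G[of x] pos[of x] by (intro exI[of _ "1 / x ^ n"]) auto
 qed
qed

text \<open>Subtracting two fixed bumps turns an arbitrary test function into one that is annihilated
 by the two functionals of \<open>weak_identity_test\<close>.\<close>

lemma f_identity: "EX c1 c2. ALL theta. test theta -->
 (LBINT r:{a<..<b}. (f r - w0 r) * theta r) =
 c1 * (LBINT r:{a<..<b}. 1 * theta r) + c2 * (LBINT r:{a<..<b}. G r * theta r)"
proof -
 let ?L = "%F theta. LBINT r:{a<..<b}. F r * theta r"
 define p where "p = (%i. a + i * (b - a) / 5)"
 have p: "a < p 1" "p 1 < p 2" "p 2 < p 3" "p 3 < p 4" "p 4 < b" using ab by (auto simp: p_def field_simps)
 obtain theta1 where t1: "test theta1" "!!r. theta1 r >= 0" "!!r. r ~: {p 1..p 2} ==> theta1 r = 0" "?L (%_. 1) theta1 = 1"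
  using ramp_test[of "p 1" "p 2"] p by auto
 obtain theta2 where t2: "test theta2" "!!r. theta2 r >= 0" "!!r. r ~: {p 3..p 4} ==> theta2 r = 0" "?L (%_. 1) theta2 = 1"
  using ramp_test[of "p 3" "p 4"] p by auto
 note i1 = test_int[OF t1(1) loc(3)] test_int[OF t1(1) loc(2)] and i2 = test_int[OF t2(1) loc(3)] test_int[OF t2(1) loc(2)]
 \<comment> \<open>As \<open>G\<close> is strictly increasing and the first bump lies to the left of
   the second, their moments against \<open>G\<close> differ. This makes the system for the two
   coefficients solvable.\<close>
 have "?L G theta1 <= (LBINT r:{a<..<b}. G (p 2) * (1 * theta1 r))"
 proof (rule set_integral_mono[OF i1(1)])
  show "set_integrable lborel {a<..<b} (%r. G (p 2) * (1 * theta1 r))" using i1(2) by simp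
  fix r assume r: "r : {a<..<b}"
  show "G r * theta1 r <= G (p 2) * (1 * theta1 r)"
  proof (cases "r : {p 1..p 2}")
   case True
   hence "G r <= G (p 2)" using G_mono[of r "p 2"] r p by (cases "r = p 2") auto
   thus ?thesis using t1(2)[of r] by (simp add: mult_right_mono)
  qed (use t1(3)[of r] in simp)
 qed
 also have "... = G (p 2)" using t1(4) by simp
 also have "... < G (p 3)" using G_mono[of "p 2" "p 3"] p by auto
 also have "G (p 3) = (LBINT r:{a<..<b}. G (p 3) * (1 * theta2 r))" using t2(4) by simp
 also have "... <= ?L G theta2"
 proof (rule set_integral_mono[OF _ i2(1)])
  show "set_integrable lborel {a<..<b} (%r. G (p 3) * (1 * theta2 r))" using i2(2) by simp
  fix r assume r: "r : {a<..<b}"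
  show "G (p 3) * (1 * theta2 r) <= G r * theta2 r"
  proof (cases "r : {p 3..p 4}")
   case True
   hence "G (p 3) <= G r" using G_mono[of "p 3" r] r p by (cases "r = p 3") auto
   thus ?thesis using t2(2)[of r] by (simp add: mult_right_mono)
  qed (use t2(3)[of r] in simp)
 qed
 finally have B: "?L G theta2 - ?L G theta1 > 0" by simp
 define B1 where "B1 = ?L G theta1"
 define B2 where "B2 = ?L G theta2"
 define D1 where "D1 = ?L (%r. f r - w0 r) theta1"
 define D2 where "D2 = ?L (%r. f r - w0 r) theta2"
 define c2 where "c2 = (D2 - D1) / (B2 - B1)"
 have "?L (%r. f r - w0 r) theta = (D1 - c2 * B1) * ?L (%_. 1) theta + c2 * ?L G theta" if t: "test theta" for theta
 proof -
  define A where "A = ?L (%_. 1) theta"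
  define B where "B = ?L G theta"
  \<comment> \<open>\<open>A - s2\<close> and \<open>s2\<close> solve the two linear equations that
    cancel the moments of \<open>theta\<close> against 1 and \<open>G\<close>.\<close>
  define s2 where "s2 = (B - B1 * A) / (B2 - B1)"
  have nz: "B2 - B1 ~= 0" using \<open>?L G theta2 - ?L G theta1 > 0\<close> by (simp add: B1_def B2_def)
  have s2: "s2 * (B2 - B1) = B - B1 * A" using nz by (simp add: s2_def)
  have c2: "c2 * (B2 - B1) = D2 - D1" using nz by (simp add: c2_def)
  define theta' where "theta' = (%r. theta r - (A - s2) * theta1 r - s2 * theta2 r)"
  note lin = test_lint_diff[OF _ t t1(1) t2(1), of _ "A - s2" s2, folded theta'_def]
  have "?L (%_. 1) theta' = A - (A - s2) - s2" using lin[of "%_. 1"] loc t1(4) t2(4) by (simp add: theta'_def A_def)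
  moreover have "?L G theta' = B - (A - s2) * B1 - s2 * B2"
   unfolding theta'_def B_def B1_def B2_def by (rule test_lint_diff[OF loc(3) t t1(1) t2(1)])
  moreover have "... = 0" using s2 by (simp add: algebra_simps)
  ultimately have "?L (%r. f r - w0 r) theta' = 0"
   by (intro weak_identity_test) (auto simp: theta'_def intro: test_diff t t1 t2)
  moreover have "?L (%r. f r - w0 r) theta' = ?L (%r. f r - w0 r) theta - (A - s2) * D1 - s2 * D2"
   unfolding theta'_def D1_def D2_def by (rule test_lint_diff[OF loc(1) t t1(1) t2(1)])
  moreover have "(A - s2) * D1 + s2 * D2 = A * D1 + s2 * (D2 - D1)" by (simp add: algebra_simps)
  moreover have "... = A * D1 + c2 * (s2 * (B2 - B1))" unfolding c2[symmetric] by simp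
  moreover have "... = (D1 - c2 * B1) * A + c2 * B" unfolding s2 by (simp add: algebra_simps)
  ultimately show ?thesis unfolding A_def B_def by linarith
 qed
 thus ?thesis by blast
qed

text \<open>The remainder \<open>f - w0 - c1 - c2 * G\<close> is orthogonal to all test functions;
  multiplied by the cutoff \<open>rho\<close> it is integrable on the line, so that
  \<open>integral_tests_zero\<close> applies. Countably many inner intervals exhaust the open
  interval.\<close>

lemma f_AE: "EX c1 c2. AE r in lborel. r : {a<..<b} --> f r = w0 r + c1 + c2 * G r"
proof -
 obtain c1 c2 where id: "!!theta. test theta ==> (LBINT r:{a<..<b}. (f r - w0 r) * theta r) =
  c1 * (LBINT r:{a<..<b}. 1 * theta r) + c2 * (LBINT r:{a<..<b}. G r * theta r)" using f_identity by blast
 have main: "AE r in lborel. r : {c<..<d} --> f r = w0 r + c1 + c2 * G r" if cd: "a < c" "c < d" "d < b" for c d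
 proof -
  define rho where "rho = (%r. max 0 ((r - c) * (d - r)))"
  have crho: "continuous_on UNIV rho" unfolding rho_def by (intro continuous_intros)
  have rho0: "rho r = 0" if "r ~: {c<..<d}" for r
  proof -
   have "(r - c) * (d - r) <= 0" using that cd by (cases "r <= c") (auto intro: mult_nonpos_nonneg mult_nonneg_nonpos)
   thus ?thesis by (simp add: rho_def)
  qed
  define F where "F = (%r. f r - w0 r - c1 * 1 - c2 * G r)"
  have tt: "test (%r. rho r * phi r)" if "continuous_on UNIV phi" for phi
   unfolding test_def using cd rho0 that by (intro conjI exI[of _ c] exI[of _ d]) (auto intro!: continuous_intros crho)
  have Fl: "set_integrable lborel {c..d} F" if "a < c" "d < b" for c d
   unfolding F_def by (intro set_integral_diff(1) set_integrable_mult_right loc[OF that])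
  have FL: "(LBINT r:{a<..<b}. F r * theta r) = 0" if t: "test theta" for theta
  proof -
   note i = test_int[OF t loc(1)] test_int[OF t loc(2)] test_int[OF t loc(3)]
   have "(LBINT r:{a<..<b}. F r * theta r) = (LBINT r:{a<..<b}. (f r - w0 r) * theta r - c1 * (1 * theta r) - c2 * (G r * theta r))"
    by (simp add: F_def algebra_simps)
   also have "... = (LBINT r:{a<..<b}. (f r - w0 r) * theta r) - (LBINT r:{a<..<b}. c1 * (1 * theta r)) - (LBINT r:{a<..<b}. c2 * (G r * theta r))"
   proof -
    have j: "set_integrable lborel {a<..<b} (%r. c1 * (1 * theta r))" "set_integrable lborel {a<..<b} (%r. c2 * (G r * theta r))"
     using i by (intro set_integrable_mult_right; simp)+
    show ?thesis
     by (simp only: set_integral_diff(2)[OF set_integral_diff(1)[OF i(1) j(1)] j(2)] set_integral_diff(2)[OF i(1) j(1)])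
   qed
   also have "... = 0" using id[OF t] by simp
   finally show ?thesis .
  qed
  have "AE r in lborel. indicator {a<..<b} r *\<^sub>R (F r * rho r) = 0"
  proof (rule integral_tests_zero)
   show "integrable lborel (%r. indicator {a<..<b} r *\<^sub>R (F r * rho r))"
    using test_int[OF tt[of "%_. 1"] Fl] by (simp add: set_integrable_def)
   fix phi :: "real => real" assume "C1 phi"
   hence "(LBINT r:{a<..<b}. F r * (rho r * phi r)) = 0" by (intro FL tt C1_continuous)
   thus "(LINT r|lborel. phi r * (indicator {a<..<b} r *\<^sub>R (F r * rho r))) = 0"
    by (simp add: set_lebesgue_integral_def ac_simps)
  qed
  thus ?thesis
  proof eventually_elim
   case (elim r)
   show ?case
   proof
    assume r: "r : {c<..<d}"
    hence "rho r > 0" by (simp add: rho_def max_def)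
    thus "f r = w0 r + c1 + c2 * G r" using elim r cd by (auto simp: F_def)
   qed
  qed
 qed
 define t where "t = (%j::nat. (b - a) / real (j + 3))"
 have t: "a < a + t j" "a + t j < b - t j" "b - t j < b" for j
 proof -
  have "t j > 0" using ab by (simp add: t_def)
  moreover have "t j <= (b - a) / 3" unfolding t_def using ab by (intro divide_left_mono) auto
  ultimately show "a < a + t j" "a + t j < b - t j" "b - t j < b" using ab by auto
 qed
 have "AE r in lborel. ALL j. r : {a + t j<..<b - t j} --> f r = w0 r + c1 + c2 * G r"
  unfolding AE_all_countable using main t by blast
 hence "AE r in lborel. r : {a<..<b} --> f r = w0 r + c1 + c2 * G r"
 proof eventually_elim
  case (elim r)
  show ?case
  proof
   assume r: "r : {a<..<b}"
   have "t \<longlonglongrightarrow> 0" unfolding t_def by (rule real_tendsto_divide_at_top[OF tendsto_const filterlim_compose[OF filterlim_real_sequentially filterlim_add_const_nat_at_top]])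
   hence "\<forall>\<^sub>F j in sequentially. t j < min (r - a) (b - r)" by (rule order_tendstoD) (use r in auto)
   then obtain j where "t j < min (r - a) (b - r)" by (auto simp: eventually_sequentially)
   thus "f r = w0 r + c1 + c2 * G r" using elim[rule_format, of j] by auto
  qed
 qed
 thus ?thesis by blast
qed

end


text \<open>Extending \<open>k\<close> by its boundary values makes the primitive continuous up to
  \<open>b\<close>, and up to \<open>a\<close> if it is positive.\<close>

lemma antiderivative_closed:
 fixes k :: "real => real"
 assumes ab: "0 <= a" "a < b" and k: "continuous_on ({a..b} - {0}) k"
 shows "EX K. continuous_on ({a..b} - {0}) K & (ALL r:{a<..<b}. (K has_real_derivative k r) (at r))"
proof -
 define g where "g = (%r. k (max a (min r b)))"
 have "continuous_on {0<..} g"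
  unfolding g_def by (rule continuous_on_compose2[OF k]) (use ab in "auto intro!: continuous_intros")
 hence "EX K. ALL r. ereal 0 < ereal r --> ereal r < \<infinity> --> (K has_real_derivative g r) (at r)"
  by (intro antiderivative_open) (auto simp: continuous_on_eq_continuous_at)
 then obtain K where K: "!!r. r > 0 ==> (K has_real_derivative g r) (at r)" by auto
 have "continuous_on ({a..b} - {0}) K" using ab by (intro continuous_at_imp_continuous_on ballI DERIV_isCont[OF K]) auto
 moreover have "(K has_real_derivative k r) (at r)" if "r : {a<..<b}" for r
  using K[of r] that ab by (simp add: g_def max_def min_def)
 ultimately show ?thesis by blast
qed

lemma continuous_on_half_openI:
 fixes g :: "real => 'b::topological_space"
 assumes "!!c. a < c ==> c < b ==> continuous_on {c..b} g"
 shows "continuous_on {a<..b} g"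
 unfolding continuous_on_eq_continuous_within
proof
 fix x assume x: "x : {a<..b}"
 obtain c where c: "a < c" "c < x" using dense x by auto
 have "continuous (at x within {c..b}) g" using assms[of c] c x by (simp add: continuous_on_eq_continuous_within)
 moreover have "at x within {c..b} = at x within {a<..b}"
  by (rule at_within_nhd[of _ "{c<..}"]) (use c x in auto)
 ultimately show "continuous (at x within {a<..b}) g" by simp
qed

section \<open>Pointwise and energy bounds\<close>

context radial_weak
begin

text \<open>\<open>H10\<close> is not homogeneous; rescaling \<open>zeta\<close> by
  \<open>1 / sqrt K\<close> turns it into an estimate by the weighted norm of
  \<open>zeta\<close>.\<close>

lemma H10_scaled:
 assumes "!!r. (zeta has_real_derivative theta r) (at r)" "continuous_on UNIV theta" "delta > 0" "!!r. r <= delta ==> zeta r = 0 & theta r = 0"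
  and K: "K > 0" "(LBINT r:{a<..<b}. (zeta r)^2 / r ^ n) <= K"
 shows "\<bar>LBINT r:{a<..<b}. f r * theta r\<bar> <= (C + 1) * sqrt K"
proof -
 define l where "l = 1 / sqrt K"
 have l: "l > 0" "l^2 * K = 1" using K by (auto simp: l_def power_divide)
 have "\<bar>LBINT r:{a<..<b}. f r * (l * theta r)\<bar> <= C + (LBINT r:{a<..<b}. (l * zeta r)^2 / r ^ n)"
  by (rule H10[OF _ _ assms(3)]) (use assms(4) in "auto intro!: DERIV_cmult assms continuous_intros")
 moreover have "(LBINT r:{a<..<b}. f r * (l * theta r)) = l * (LBINT r:{a<..<b}. f r * theta r)"
  by (subst set_integral_mult_right[symmetric]) (simp add: ac_simps)
 moreover have "(LBINT r:{a<..<b}. (l * zeta r)^2 / r ^ n) = l^2 * (LBINT r:{a<..<b}. (zeta r)^2 / r ^ n)"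
  by (subst set_integral_mult_right[symmetric]) (simp add: power_mult_distrib)
 moreover have "l^2 * (LBINT r:{a<..<b}. (zeta r)^2 / r ^ n) <= 1"
  using mult_left_mono[OF K(2), of "l^2"] l by simp
 ultimately have "l * \<bar>LBINT r:{a<..<b}. f r * theta r\<bar> <= C + 1" using l by (simp add: abs_mult)
 thus ?thesis using K by (simp add: l_def divide_le_eq)
qed

lemma weight_bound:
 assumes cd: "a <= c" "c <= d" "d <= b" "c > 0" and zeta: "continuous_on UNIV zeta" "!!r. r : {c<..<d} ==> \<bar>zeta r\<bar> <= 1" "!!r. r : {a<..<b} ==> r ~: {c<..<d} ==> zeta r = 0"
 shows "(LBINT r:{a<..<b}. (zeta r)^2 / r ^ n) <= (d - c) / c ^ n"
proof -
 have "(LBINT r:{a<..<b}. (zeta r)^2 / r ^ n) = (LBINT r:{c<..<d}. (zeta r)^2 / r ^ n)"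
  by (rule set_lint_support) (use cd zeta in auto)
 also have "... <= (LBINT r:{c<..<d}. 1 / c ^ n)"
 proof (rule set_integral_mono)
  have "set_integrable lborel {c..d} (%r. (zeta r)^2 / r ^ n)"
   using cd by (intro borel_integrable_atLeastAtMost' continuous_intros continuous_on_subset[OF zeta(1)]) auto
  thus "set_integrable lborel {c<..<d} (%r. (zeta r)^2 / r ^ n)" by (rule set_integrable_subset) auto
  have "set_integrable lborel {c..d} (%r. 1 / c ^ n)" by (intro borel_integrable_atLeastAtMost') simp
  thus "set_integrable lborel {c<..<d} (%r. 1 / c ^ n)" by (rule set_integrable_subset) auto
  fix r assume r: "r : {c<..<d}"
  have "(zeta r)^2 <= 1" using zeta(2)[OF r] by (simp add: abs_square_le_1)
  moreover have "c ^ n <= r ^ n" using r cd by (intro power_mono) auto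
  ultimately show "(zeta r)^2 / r ^ n <= 1 / c ^ n" using cd by (intro frac_le) auto
 qed
 also have "... = (d - c) / c ^ n" using cd by (simp add: set_lebesgue_integral_def)
 finally show ?thesis .
qed

text \<open>Ramps that rise from \<open>0\<close> to \<open>1\<close> on \<open>{c..d}\<close>, and on the left of an annulus fall from \<open>1\<close> to
 \<open>0\<close>, turn the inequality of the locale into pointwise bounds.\<close>

lemma bump_right:
 assumes "a < c" "c < d" "d < b"
 shows "EX theta. test theta & (ALL r. theta r >= 0) & (ALL r. r ~: {c..d} --> theta r = 0) & (LBINT r:{a<..<b}. 1 * theta r) = 1 &
  \<bar>LBINT r:{a<..<b}. f r * theta r\<bar> <= (C + 1) * sqrt ((b - c) / c ^ n)"
  "a > 0 ==> EX theta. test theta & (ALL r. theta r >= 0) & (ALL r. r ~: {c..d} --> theta r = 0) & (LBINT r:{a<..<b}. 1 * theta r) = 1 &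
  \<bar>LBINT r:{a<..<b}. f r * theta r\<bar> <= (C + 1) * sqrt ((d - a) / a ^ n)"
proof -
 obtain zeta theta where R: "continuous_on UNIV theta" "!!r. (zeta has_real_derivative theta r) (at r)" "!!r. 0 <= theta r & 0 <= zeta r & zeta r <= 1"
  "!!r. r <= c ==> zeta r = 0 & theta r = 0" "!!r. r >= d ==> zeta r = 1 & theta r = 0" using ramp_exists[OF assms(2)] by blast
 have czeta: "continuous_on UNIV zeta" using R(2) by (meson deriv_cont)
 have c0: "c > 0" using assms a0 by simp
 have t: "test theta" unfolding test_def using assms R by (intro conjI exI[of _ c] exI[of _ d]) (auto simp: not_less)
 have "(LBINT r:{a<..<b}. 1 * theta r) = (LBINT r:{c..d}. 1 * theta r)"
  by (rule set_lint_support) (use assms R in "auto simp: not_le")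
 moreover have "(LBINT r:{c..d}. 1 * theta r) = 1"
  using lint_derivative[of c d zeta theta] assms R continuous_on_subset[OF R(1)] by simp
 ultimately have one: "(LBINT r:{a<..<b}. 1 * theta r) = 1" by simp
 have s: "theta r = 0" if "r ~: {c..d}" for r using R(4,5)[of r] that by (cases "r <= c") auto
 have "(LBINT r:{a<..<b}. (zeta r)^2 / r ^ n) <= (b - c) / c ^ n"
  by (rule weight_bound[OF _ _ _ c0 czeta]) (use assms R in "auto simp: not_less")
 hence "\<bar>LBINT r:{a<..<b}. f r * theta r\<bar> <= (C + 1) * sqrt ((b - c) / c ^ n)"
  by (intro H10_scaled[OF R(2,1) c0 R(4)]) (use assms c0 in auto)
 thus "EX theta. test theta & (ALL r. theta r >= 0) & (ALL r. r ~: {c..d} --> theta r = 0) & (LBINT r:{a<..<b}. 1 * theta r) = 1 &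
  \<bar>LBINT r:{a<..<b}. f r * theta r\<bar> <= (C + 1) * sqrt ((b - c) / c ^ n)"
  using t one s R(3) by (intro exI[of _ theta]) auto
 assume a: "a > 0"
 \<comment> \<open>A second ramp, placed below \<open>a\<close>, equals 1 on the whole interval and
   vanishes near the origin. The difference \<open>xi - zeta\<close> falls from 1 to 0 across
   \<open>{c..d}\<close> and is admissible in \<open>H10\<close>.\<close>
 obtain xi omega where Q: "continuous_on UNIV omega" "!!r. (xi has_real_derivative omega r) (at r)" "!!r. 0 <= omega r & 0 <= xi r & xi r <= 1"
  "!!r. r <= a / 3 ==> xi r = 0 & omega r = 0" "!!r. r >= 2 * a / 3 ==> xi r = 1 & omega r = 0"
  using ramp_exists[of "a / 3" "2 * a / 3"] a by auto
 have cxi: "continuous_on UNIV xi" using Q(2) by (meson deriv_cont)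
 have d: "((%r. xi r - zeta r) has_real_derivative omega r - theta r) (at r)" for r by (intro DERIV_diff Q R)
 have "(LBINT r:{a<..<b}. (xi r - zeta r)^2 / r ^ n) <= (d - a) / a ^ n"
 proof (rule weight_bound[OF _ _ _ a])
  show "continuous_on UNIV (%r. xi r - zeta r)" by (intro continuous_intros cxi czeta)
  show "\<bar>xi r - zeta r\<bar> <= 1" for r using Q(3)[of r] R(3)[of r] by auto
  show "xi r - zeta r = 0" if "r : {a<..<b}" "r ~: {a<..<d}" for r using Q(5)[of r] R(5)[of r] that a by auto
 qed (use assms in auto)
 hence "\<bar>LBINT r:{a<..<b}. f r * (omega r - theta r)\<bar> <= (C + 1) * sqrt ((d - a) / a ^ n)"
  by (intro H10_scaled[OF d, of "a / 3"]) (use assms a Q R in "auto intro!: continuous_intros")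
 moreover have "(LBINT r:{a<..<b}. f r * (omega r - theta r)) = (LBINT r:{a<..<b}. (- 1) * (f r * theta r))"
  using Q(5) a by (intro set_lebesgue_integral_cong) auto
 ultimately have "\<bar>LBINT r:{a<..<b}. f r * theta r\<bar> <= (C + 1) * sqrt ((d - a) / a ^ n)"
  unfolding set_integral_mult_right by simp
 thus "EX theta. test theta & (ALL r. theta r >= 0) & (ALL r. r ~: {c..d} --> theta r = 0) & (LBINT r:{a<..<b}. 1 * theta r) = 1 &
  \<bar>LBINT r:{a<..<b}. f r * theta r\<bar> <= (C + 1) * sqrt ((d - a) / a ^ n)"
  using t one s R(3) by (intro exI[of _ theta]) auto
qed

text \<open>A weighted mean of a continuous function over \<open>{c..d}\<close> is one of its values
  there; this passes from integrals of \<open>f\<close> to values of \<open>w\<close>.\<close>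

lemma bump_value:
 assumes w: "continuous_on {a<..<b} w" and ae: "AE r in lborel. r : {a<..<b} --> f r = w r" and cd: "a < c" "c < d" "d < b"
  and theta: "test theta" "!!r. theta r >= 0" "!!r. r ~: {c..d} ==> theta r = 0" "(LBINT r:{a<..<b}. 1 * theta r) = 1"
  and le: "\<bar>LBINT r:{a<..<b}. f r * theta r\<bar> <= M"
 shows "EX x:{c..d}. \<bar>w x\<bar> <= M"
proof -
 have cw: "continuous_on {c..d} w" by (rule continuous_on_subset[OF w]) (use cd in auto)
 obtain x1 where x1: "x1 : {c..d}" "!!y. y : {c..d} ==> w x1 <= w y"
  using continuous_attains_inf[OF compact_Icc _ cw] cd by auto
 obtain x2 where x2: "x2 : {c..d}" "!!y. y : {c..d} ==> w y <= w x2"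
  using continuous_attains_sup[OF compact_Icc _ cw] cd by auto
 define I where "I = (LBINT r:{a<..<b}. w r * theta r)"
 have wl: "set_integrable lborel {c..d} w" if "a < c" "d < b" for c d
  by (rule borel_integrable_atLeastAtMost') (rule continuous_on_subset[OF w], use that in auto)
 note iw = test_int[OF theta(1) wl] and i1 = test_int[OF theta(1) loc(2)] and if' = test_int[OF theta(1) f_loc]
 have fI: "(LBINT r:{a<..<b}. f r * theta r) = I"
  unfolding I_def set_lebesgue_integral_def
 proof (rule integral_cong_AE)
  show "AE r in lborel. indicator {a<..<b} r *\<^sub>R (f r * theta r) = indicator {a<..<b} r *\<^sub>R (w r * theta r)"
   using ae by eventually_elim (auto simp: indicator_def)
 qed (use iw if' in "auto simp: set_integrable_def")
 have "(LBINT r:{a<..<b}. w x1 * (1 * theta r)) <= I" unfolding I_def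
 proof (rule set_integral_mono[OF set_integrable_mult_right[OF i1] iw])
  fix r show "w x1 * (1 * theta r) <= w r * theta r"
   using theta(2,3)[of r] x1(2)[of r] by (cases "r : {c..d}") (auto intro: mult_right_mono)
 qed
 hence l: "w x1 <= I" using theta(4) by simp
 have "I <= (LBINT r:{a<..<b}. w x2 * (1 * theta r))" unfolding I_def
 proof (rule set_integral_mono[OF iw set_integrable_mult_right[OF i1]])
  fix r show "w r * theta r <= w x2 * (1 * theta r)"
   using theta(2,3)[of r] x2(2)[of r] by (cases "r : {c..d}") (auto intro: mult_right_mono)
 qed
 hence u: "I <= w x2" using theta(4) by simp
 have "connected (w ` {c..d})" by (intro connected_continuous_image cw) simp
 from connected_contains_Icc[OF this] have "{w x1..w x2} <= w ` {c..d}" using x1 x2 by blast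
 hence "I : w ` {c..d}" using l u by auto
 then obtain x where "x : {c..d}" "I = w x" by auto
 thus ?thesis using le fI by auto
qed

text \<open>Bumps shrinking to \<open>r\<close> turn the bound for means into a bound for values.
  The right-hand sides tend to 0 at \<open>b\<close> and at a positive \<open>a\<close>, which
  yields the boundary condition.\<close>

lemma pointwise_bound:
 assumes w: "continuous_on {a<..<b} w" and ae: "AE r in lborel. r : {a<..<b} --> f r = w r" and r: "r : {a<..<b}"
 shows "\<bar>w r\<bar> <= (C + 1) * sqrt ((b - r) / r ^ n)"
  and "a > 0 ==> \<bar>w r\<bar> <= (C + 1) * sqrt ((r - a) / a ^ n)"
proof -
 have close: "\<bar>w r\<bar> <= M" if *: "!!e. e > 0 ==> EX x. \<bar>x - r\<bar> < e & \<bar>w x\<bar> <= M" for M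
 proof (rule ccontr)
  assume "\<not> \<bar>w r\<bar> <= M"
  hence M: "M < \<bar>w r\<bar>" by simp
  have "isCont w r" using w r by (simp add: continuous_on_eq_continuous_at)
  hence "\<forall>\<^sub>F x in at r. M < \<bar>w x\<bar>" unfolding isCont_def by (intro order_tendstoD(1)[OF _ M] tendsto_rabs)
  then obtain e where e: "e > 0" "!!x. x ~= r ==> dist x r < e ==> M < \<bar>w x\<bar>" unfolding eventually_at by auto
  obtain x where "\<bar>x - r\<bar> < e" "\<bar>w x\<bar> <= M" using *[OF e(1)] by blast
  thus False using e(2)[of x] M by (cases "x = r") (auto simp: dist_real_def)
 qed
 show "\<bar>w r\<bar> <= (C + 1) * sqrt ((b - r) / r ^ n)"
 proof (rule close)
  fix e :: real assume e: "e > 0"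
  define d where "d = min (r + e / 2) ((r + b) / 2)"
  have d: "r < d" "d < b" "d < r + e" using e r by (auto simp: d_def min_def field_simps)
  obtain theta where theta: "test theta" "!!r. theta r >= 0" "!!s. s ~: {r..d} ==> theta s = 0" "(LBINT r:{a<..<b}. 1 * theta r) = 1"
   "\<bar>LBINT r:{a<..<b}. f r * theta r\<bar> <= (C + 1) * sqrt ((b - r) / r ^ n)" using bump_right(1)[of r d] r d by auto
  have "EX x:{r..d}. \<bar>w x\<bar> <= (C + 1) * sqrt ((b - r) / r ^ n)"
   by (rule bump_value[OF w ae _ _ _ theta]) (use r d in auto)
  thus "EX x. \<bar>x - r\<bar> < e & \<bar>w x\<bar> <= (C + 1) * sqrt ((b - r) / r ^ n)" using d by force
 qed
 show "\<bar>w r\<bar> <= (C + 1) * sqrt ((r - a) / a ^ n)" if a: "a > 0"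
 proof (rule close)
  fix e :: real assume e: "e > 0"
  define c where "c = max (r - e / 2) ((r + a) / 2)"
  have c: "c < r" "a < c" "r - e < c" using e r by (auto simp: c_def max_def field_simps)
  obtain theta where theta: "test theta" "!!r. theta r >= 0" "!!s. s ~: {c..r} ==> theta s = 0" "(LBINT r:{a<..<b}. 1 * theta r) = 1"
   "\<bar>LBINT r:{a<..<b}. f r * theta r\<bar> <= (C + 1) * sqrt ((r - a) / a ^ n)" using bump_right(2)[of c r] r c a by auto
  have "EX x:{c..r}. \<bar>w x\<bar> <= (C + 1) * sqrt ((r - a) / a ^ n)"
   by (rule bump_value[OF w ae _ _ _ theta]) (use r c in auto)
  thus "EX x. \<bar>x - r\<bar> < e & \<bar>w x\<bar> <= (C + 1) * sqrt ((r - a) / a ^ n)" using c by force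
 qed
qed

text \<open>The energy estimate tests with the flux itself, cut off at both ends.\<close>

lemma energy_bound:
 assumes a: "a = 0" and w: "!!r. r : {a<..<b} ==> (w has_real_derivative J r / r ^ n) (at r)"
  and J: "!!r. r : {a<..<b} ==> (J has_real_derivative J' r) (at r)" "continuous_on {a<..<b} J'"
  and ae: "AE r in lborel. r : {a<..<b} --> f r = w r" and cd: "0 < c" "c <= d" "d < b"
 shows "(LBINT r:{c..d}. (J r)^2 / r ^ n) <= 4 * C"
proof -
 define m where "m = c / 2"
 define M where "M = (d + b) / 2"
 have mM: "0 < m" "m < c" "d < M" "M < b" using cd by (auto simp: m_def M_def)
 obtain xi omega where Q: "continuous_on UNIV omega" "!!r. (xi has_real_derivative omega r) (at r)" "!!r. 0 <= omega r & 0 <= xi r & xi r <= 1"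
  "!!r. r <= m ==> xi r = 0 & omega r = 0" "!!r. r >= c ==> xi r = 1 & omega r = 0" using ramp_exists[of m c] mM by blast
 obtain xi2 omega2 where R: "continuous_on UNIV omega2" "!!r. (xi2 has_real_derivative omega2 r) (at r)" "!!r. 0 <= omega2 r & 0 <= xi2 r & xi2 r <= 1"
  "!!r. r <= d ==> xi2 r = 0 & omega2 r = 0" "!!r. r >= M ==> xi2 r = 1 & omega2 r = 0" using ramp_exists[of d M] mM by blast
 define rho where "rho = (%r. xi r * (1 - xi2 r))"
 define rho' where "rho' = (%r. omega r * (1 - xi2 r) - xi r * omega2 r)"
 have cxi: "continuous_on S xi" "continuous_on S xi2" for S using Q(2) R(2) by (meson deriv_cont)+
 have drho: "(rho has_real_derivative rho' r) (at r)" for r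
  unfolding rho_def rho'_def by (rule derivative_eq_intros Q(2) R(2) refl)+ simp
 have crho': "continuous_on S rho'" for S
  unfolding rho'_def using Q(1) R(1) by (intro continuous_intros cxi) (auto intro: continuous_on_subset)
 have crho: "continuous_on S rho" for S unfolding rho_def by (intro continuous_intros cxi)
 have rho: "0 <= rho r" "rho r <= 1" for r using Q(3)[of r] R(3)[of r] by (auto simp: rho_def mult_le_one)
 have rho0: "rho r = 0" "rho' r = 0" if "r ~: {m<..<M}" for r
  using that Q(4)[of r] R(5)[of r] by (cases "r <= m"; simp add: rho_def rho'_def)+
 have rho1: "rho r = 1" if "r : {c..d}" for r using Q(5)[of r] R(4)[of r] that by (simp add: rho_def)
 define zeta where "zeta = (%r. if r : {a<..<b} then J r * rho r else 0)"
 define theta where "theta = (%r. if r : {a<..<b} then J' r * rho r + J r * rho' r else 0)"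
 have cJ: "continuous_on {a<..<b} J" using J(1) by (meson deriv_cont)
 have op: "open ({..<m} \<union> {M<..})" by auto
 have cov: "r : {a<..<b} | r : {..<m} \<union> {M<..}" for r using mM a by auto
 have z: "zeta r = 0" "theta r = 0" if "r ~: {m<..<M}" for r using rho0[OF that] by (auto simp: zeta_def theta_def)
 have dzeta: "(zeta has_real_derivative theta r) (at r)" for r
 proof (cases "r : {a<..<b}")
  case True
  have "((%r. J r * rho r) has_real_derivative theta r) (at r)"
   using DERIV_mult[OF J(1)[OF True] drho[of r]] True by (simp add: theta_def add.commute mult.commute)
  thus ?thesis
   by (rule has_field_derivative_transform_within_open[OF _ open_greaterThanLessThan True]) (simp add: zeta_def)
 next
  case False
  hence r: "r : {..<m} \<union> {M<..}" using cov by blast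
  have "((%_. 0) has_real_derivative theta r) (at r)" using z(2)[of r] r by auto
  thus ?thesis by (rule has_field_derivative_transform_within_open[OF _ op r]) (use z(1) in auto)
 qed
 have ctheta: "continuous_on UNIV theta"
 proof -
  have "continuous_on {a<..<b} theta"
   by (rule continuous_on_eq[of _ "%r. J' r * rho r + J r * rho' r"]) (auto simp: theta_def intro!: continuous_intros J cJ crho crho')
  moreover have "continuous_on ({..<m} \<union> {M<..}) theta"
   by (rule continuous_on_eq[of _ "%_. 0"]) (use z(2) in auto)
  ultimately have "continuous_on ({a<..<b} \<union> ({..<m} \<union> {M<..})) theta"
   by (rule continuous_on_open_Un[OF open_greaterThanLessThan op])
  moreover have "{a<..<b} \<union> ({..<m} \<union> {M<..}) = UNIV" by (rule UNIV_eq_I[symmetric]) (use cov in blast)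
  ultimately show ?thesis by simp
 qed
 define X where "X = (LBINT r:{m..M}. (J r)^2 * rho r / r ^ n)"
 have sub: "{m..M} <= {a<..<b}" using mM a by auto
 note in_ab = subsetD[OF sub]
 have cJm: "continuous_on {m..M} J" by (rule continuous_on_subset[OF cJ sub])
 have cw: "continuous_on {a<..<b} w" using w by (meson deriv_cont)
 have iX: "set_integrable lborel {m..M} (%r. (J r)^2 * rho r / r ^ n)"
  using mM by (intro borel_integrable_atLeastAtMost' continuous_intros cJm crho) auto
 \<comment> \<open>Testing with half of the cut-off flux: integration by parts gives
   \<open>- X / 2\<close>, while the quadratic term of \<open>H10\<close> is at most
   \<open>X / 4\<close>. The latter is absorbed, which yields \<open>X <= 4 * C\<close>.\<close>
 have "(LBINT r:{a<..<b}. f r * (theta r / 2)) = (LBINT r:{a<..<b}. w r * (theta r / 2))"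
  unfolding set_lebesgue_integral_def
 proof (rule integral_cong_AE)
  have t: "test (%r. theta r / 2)"
   unfolding test_def using mM z(2) a cd by (intro conjI exI[of _ m] exI[of _ M]) (auto intro!: continuous_intros ctheta)
  have wl: "set_integrable lborel {c..d} w" if "a < c" "d < b" for c d
   by (rule borel_integrable_atLeastAtMost') (rule continuous_on_subset[OF cw], use that in auto)
  show "(%r. indicator {a<..<b} r *\<^sub>R (f r * (theta r / 2))) : borel_measurable lborel"
   "(%r. indicator {a<..<b} r *\<^sub>R (w r * (theta r / 2))) : borel_measurable lborel"
   using test_int[OF t f_loc] test_int[OF t wl] unfolding set_integrable_def by auto
  show "AE r in lborel. indicator {a<..<b} r *\<^sub>R (f r * (theta r / 2)) = indicator {a<..<b} r *\<^sub>R (w r * (theta r / 2))"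
   using ae by eventually_elim (auto simp: indicator_def)
 qed
 also have "... = (LBINT r:{m..M}. w r * (theta r / 2))"
  by (rule set_lint_support[OF sub]) (use z in auto)
 also have "... = - (LBINT r:{m..M}. J r / r ^ n * (zeta r / 2))"
 proof (rule lint_parts_smooth)
  show "((%r. zeta r / 2) has_real_derivative theta r / 2) (at r)" for r by (intro DERIV_cdivide dzeta)
  show "continuous_on {m..M} (%r. J r / r ^ n)" using mM by (intro continuous_intros cJm) auto
  show "continuous_on {m..M} (%r. theta r / 2)" by (intro continuous_intros continuous_on_subset[OF ctheta]) auto
 qed (use mM cd w in_ab z in auto)
 also have "(LBINT r:{m..M}. J r / r ^ n * (zeta r / 2)) = (LBINT r:{m..M}. (1 / 2) * ((J r)^2 * rho r / r ^ n))"
  by (rule set_lebesgue_integral_cong) (use in_ab in "auto simp: zeta_def power2_eq_square")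
 also have "... = X / 2" unfolding set_integral_mult_right X_def by simp
 finally have lhs: "(LBINT r:{a<..<b}. f r * (theta r / 2)) = - (X / 2)" by simp
 have X0: "X >= 0" unfolding X_def set_lebesgue_integral_def
  by (rule Bochner_Integration.integral_nonneg) (use mM rho in "auto simp: indicator_def")
 have "\<bar>LBINT r:{a<..<b}. f r * (theta r / 2)\<bar> <= C + (LBINT r:{a<..<b}. (zeta r / 2)^2 / r ^ n)"
  by (rule H10[OF _ _ mM(1)]) (use z in "auto intro!: DERIV_cdivide dzeta continuous_intros ctheta")
 also have "(LBINT r:{a<..<b}. (zeta r / 2)^2 / r ^ n) = (LBINT r:{m..M}. (zeta r / 2)^2 / r ^ n)"
  by (rule set_lint_support[OF sub]) (use z in auto)
 also have "... <= (LBINT r:{m..M}. (1 / 4) * ((J r)^2 * rho r / r ^ n))"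
 proof (rule set_integral_mono)
  show "set_integrable lborel {m..M} (%r. (zeta r / 2)^2 / r ^ n)"
   using mM DERIV_continuous[OF dzeta] by (intro borel_integrable_atLeastAtMost' continuous_intros continuous_at_imp_continuous_on) auto
  show "set_integrable lborel {m..M} (%r. (1 / 4) * ((J r)^2 * rho r / r ^ n))" using iX by (rule set_integrable_mult_right)
  fix r assume r: "r : {m..M}"
  have "(rho r)^2 <= rho r" using rho[of r] by (simp add: power2_eq_square mult_left_le)
  hence "(J r)^2 * (rho r)^2 / r ^ n <= (J r)^2 * rho r / r ^ n"
   using r mM by (intro divide_right_mono mult_left_mono) auto
  thus "(zeta r / 2)^2 / r ^ n <= (1 / 4) * ((J r)^2 * rho r / r ^ n)"
   using in_ab[OF r] by (simp add: zeta_def power_mult_distrib power_divide)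
 qed
 also have "... = X / 4" unfolding set_integral_mult_right X_def by simp
 finally have "X <= 4 * C" using lhs X0 by simp
 moreover have "(LBINT r:{c..d}. (J r)^2 / r ^ n) <= X"
 proof -
  have "(LBINT r:{c..d}. (J r)^2 / r ^ n) = (LBINT r:{c..d}. (J r)^2 * rho r / r ^ n)"
   by (rule set_lebesgue_integral_cong) (use rho1 in auto)
  also have "... <= X" unfolding X_def set_lebesgue_integral_def
  proof (rule integral_mono)
   show "integrable lborel (%r. indicator {c..d} r *\<^sub>R ((J r)^2 * rho r / r ^ n))"
    using set_integrable_subset[OF iX, of "{c..d}"] mM by (simp add: set_integrable_def)
  qed (use iX mM rho in "auto simp: indicator_def set_integrable_def")
  finally show ?thesis .
 qed
 ultimately show ?thesis by simp
qed

end


section \<open>The classical representative of a radial weak solution\<close>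

context radial_weak
begin

text \<open>A nonzero limit would give \<open>J^2 / r ^ n >= q / r\<close> near the origin, as
  \<open>n >= 1\<close>, and the energy would diverge logarithmically.\<close>

lemma flux_limit_zero:
 assumes a: "a = 0" and J: "continuous_on {a<..<b} J" "(J \<longlongrightarrow> L) (at_right 0)"
  and e: "!!r. r : {0<..<b} ==> (e has_real_derivative (J r)^2 / r ^ n) (at r) & \<bar>e r\<bar> <= M"
 shows "L = 0"
proof (rule ccontr)
 assume L: "L ~= 0"
 define q where "q = L^2 / 4"
 have q: "q > 0" using L by (simp add: q_def)
 have "((%r. (J r)^2) \<longlongrightarrow> L^2) (at_right 0)" by (intro tendsto_power J)
 hence "\<forall>\<^sub>F r in at_right 0. q < (J r)^2" by (rule order_tendstoD) (use L in "simp add: q_def")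
 then obtain c0 where c0: "c0 > 0" "!!r. 0 < r ==> r < c0 ==> q < (J r)^2"
  unfolding eventually_at_right_field by auto
 define c where "c = min (c0 / 2) (min (b / 2) (1 / 2))"
 have c: "0 < c" "c < c0" "c < b" "c < 1" using c0 ab a by (auto simp: c_def)
 have "e r - q * ln r <= e c - q * ln c" if r: "0 < r" "r <= c" for r
 proof (rule DERIV_nonneg_imp_nondecreasing[OF r(2), of "%r. e r - q * ln r"])
  fix x assume x: "r <= x" "x <= c"
  have "((%r. e r - q * ln r) has_real_derivative (J x)^2 / x ^ n - q * (1 / x)) (at x)"
   using e[of x] x r c by (auto intro!: derivative_eq_intros simp: field_simps)
  moreover have "q * (1 / x) <= (J x)^2 / x ^ n"
  proof -
   have "x ^ n <= x ^ 1" using x r c n by (intro power_decreasing) auto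
   hence "1 / x <= 1 / x ^ n" using x r by (intro frac_le) auto
   hence "q * (1 / x) <= (J x)^2 * (1 / x ^ n)"
    using c0(2)[of x] x r c q by (intro mult_mono) auto
   thus ?thesis by simp
  qed
  ultimately show "EX y. ((%r. e r - q * ln r) has_real_derivative y) (at x) & 0 <= y" by auto
 qed
 hence *: "q * (ln c - ln r) <= 2 * M" if "0 < r" "r <= c" for r
  using that e[of r] e[of c] c by (fastforce simp: right_diff_distrib abs_le_iff)
 define K where "K = (\<bar>M\<bar> + 1) * 2 / q"
 have "q * K = (\<bar>M\<bar> + 1) * 2" using q by (simp add: K_def)
 hence K: "K > 0" "q * K > 2 * M" using q by (auto simp: K_def)
 have "q * (ln c - ln (c * exp (- K))) <= 2 * M"
  by (rule *) (use c K in auto)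
 thus False using K c by (simp add: ln_mult)
qed

text \<open>Once \<open>f\<close> agrees almost everywhere with a continuous \<open>w\<close>,
  continuity of \<open>hh\<close> makes the right-hand side continuous, so that the primitive
  \<open>H\<close> is differentiable and the system holds classically. Boundary values come from
  \<open>pointwise_bound\<close>, the vanishing flux at the origin from the finite energy.\<close>

theorem representative:
 assumes hh: "continuous_on (({a..b} - {0}) \<times> UNIV) (%(r, y). hh r y)"
  and ae: "AE r in lborel. r : {a<..<b} --> h r = hh r (f r)"
 shows "EX w J. (AE r in lborel. r : {a<..<b} --> f r = w r) &
  continuous_on ({a..b} - {0}) w & continuous_on ({a..b} - {0}) J &
  (ALL r:{a<..<b}. (w has_real_derivative J r / r ^ n) (at r) & (J has_real_derivative - (r ^ n * hh r (w r))) (at r)) &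
  w b = 0 & (a > 0 --> w a = 0) &
  (a = 0 --> (J \<longlongrightarrow> 0) (at_right 0) &
   (EX e M. ALL r:{0<..<b}. (e has_real_derivative (J r)^2 / r ^ n) (at r) & \<bar>e r\<bar> <= M) &
   (EX D. ALL r:{0<..b}. \<bar>w r\<bar> * sqrt (r ^ n) <= D))"
proof -
 obtain c1 c2 where fw: "AE r in lborel. r : {a<..<b} --> f r = w0 r + c1 + c2 * G r" using f_AE by blast
 define w where "w = (%r. if r : {a<..<b} then w0 r + c1 + c2 * G r else 0)"
 define J1 where "J1 = (%r. c2 - H r)"
 have fw: "AE r in lborel. r : {a<..<b} --> f r = w r" using fw by eventually_elim (auto simp: w_def)
 have dw: "(w has_real_derivative J1 r / r ^ n) (at r)" if r: "r : {a<..<b}" for r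
 proof (rule has_field_derivative_transform_within_open[OF _ open_greaterThanLessThan r])
  show "((%r. w0 r + c1 + c2 * G r) has_real_derivative J1 r / r ^ n) (at r)"
   using w0[OF r] G[OF r] by (auto intro!: derivative_eq_intros simp: J1_def diff_divide_distrib)
 qed (simp add: w_def)
 have cw: "continuous_on {a<..<b} w" using dw by (meson deriv_cont)
 note pb = pointwise_bound[OF cw fw]
 have lim_b: "(w \<longlongrightarrow> w b) (at_left b)"
 proof -
  have "((%r. (C + 1) * sqrt ((b - r) / r ^ n)) \<longlongrightarrow> (C + 1) * sqrt ((b - b) / b ^ n)) (at_left b)"
   using a0 ab by (intro tendsto_intros) auto
  hence l: "((%r. (C + 1) * sqrt ((b - r) / r ^ n)) \<longlongrightarrow> 0) (at_left b)" by simp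
  have "\<forall>\<^sub>F r in at_left b. norm (w r) <= (C + 1) * sqrt ((b - r) / r ^ n)"
   unfolding eventually_at_left_field using ab pb(1) by (intro exI[of _ a]) auto
  from Lim_null_comparison[OF this l] show ?thesis by (simp add: w_def)
 qed
 have lim_a: "(w \<longlongrightarrow> w a) (at_right a)" if a: "a > 0"
 proof -
  have "((%r. (C + 1) * sqrt ((r - a) / a ^ n)) \<longlongrightarrow> (C + 1) * sqrt ((a - a) / a ^ n)) (at_right a)"
   using a by (intro tendsto_intros) auto
  hence l: "((%r. (C + 1) * sqrt ((r - a) / a ^ n)) \<longlongrightarrow> 0) (at_right a)" by simp
  have "\<forall>\<^sub>F r in at_right a. norm (w r) <= (C + 1) * sqrt ((r - a) / a ^ n)"
   unfolding eventually_at_right_field using ab pb(2) a by (intro exI[of _ b]) auto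
  from Lim_null_comparison[OF this l] show ?thesis by (simp add: w_def)
 qed
 have wt: "(w \<longlongrightarrow> w r) (at r)" if "r : {a<..<b}" for r
  using cw that by (simp add: continuous_on_eq_continuous_at isCont_def)
 have wcont: "continuous_on ({a..b} - {0}) w"
 proof (cases "a = 0")
  case True
  have "continuous_on {0<..b} w"
  proof (rule continuous_on_half_openI)
   fix c assume c: "0 < c" "c < b"
   have "(w \<longlongrightarrow> w c) (at_right c)" by (rule tendsto_mono[OF _ wt[of c]]) (use c True in "auto simp: at_le")
   thus "continuous_on {c..b} w"
    using c wt lim_b True by (intro continuous_on_IccI) auto
  qed
  moreover have "{a..b} - {0} = {0<..b}" using True by auto
  ultimately show ?thesis by simp
 next
  case False
  hence "continuous_on {a..b} w" using ab a0 wt lim_a lim_b by (intro continuous_on_IccI) auto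
  thus ?thesis by (rule continuous_on_subset) auto
 qed
 define k' where "k' = (%r. r ^ n * hh r (w r))"
 have ck': "continuous_on ({a..b} - {0}) k'"
 proof -
  have "continuous_on ({a..b} - {0}) (%r. (%(r, y). hh r y) (r, w r))"
   by (rule continuous_on_compose2[OF hh]) (auto intro!: continuous_intros wcont)
  thus ?thesis unfolding k'_def by (intro continuous_intros) simp
 qed
 have sub: "{a<..<b} <= {a..b} - {0}" using a0 by auto
 have kk: "AE r in lborel. r : {a<..<b} --> k r = k' r" using ae fw by eventually_elim (auto simp: k_def k'_def)
 have dJ1: "(J1 has_real_derivative - k' r) (at r)" if "r : {a<..<b}" for r
  unfolding J1_def using H_deriv[OF continuous_on_subset[OF ck' sub] kk that] by (auto intro!: derivative_eq_intros)
 obtain K where K: "continuous_on ({a..b} - {0}) K" "!!r. r : {a<..<b} ==> (K has_real_derivative k' r) (at r)"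
  using antiderivative_closed[OF a0 ab ck'] by blast
 define c0 where "c0 = (a + b) / 2"
 have c0: "c0 : {a<..<b}" using ab by (auto simp: c0_def)
 \<comment> \<open>\<open>J1\<close> is controlled on the open interval only. Written through the
   primitive \<open>K\<close> of the continuous right-hand side, the flux extends continuously to
   the endpoints.\<close>
 define J where "J = (%r. J1 c0 + K c0 - K r)"
 have "J1 r + K r = J1 c0 + K c0" if r: "r : {a<..<b}" for r
 proof -
  have "((%r. J1 r + K r) has_real_derivative 0) (at x)" if "x : {a<..<b}" for x
   using DERIV_add[OF dJ1[OF that] K(2)[OF that]] by simp
  thus ?thesis
   using has_field_derivative_zero_constant[of "{a<..<b}" "%r. J1 r + K r"] r c0
   by (metis convex_real_interval(8) has_field_derivative_at_within)
 qed
 hence JJ1: "J r = J1 r" if "r : {a<..<b}" for r using that by (fastforce simp: J_def)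
 have Jcont: "continuous_on ({a..b} - {0}) J" unfolding J_def by (intro continuous_intros K)
 have dJ: "(J has_real_derivative - k' r) (at r)" if r: "r : {a<..<b}" for r
  unfolding J_def using K(2)[OF r] by (auto intro!: derivative_eq_intros)
 have dw: "(w has_real_derivative J r / r ^ n) (at r)" if "r : {a<..<b}" for r
  using dw[OF that] JJ1[OF that] by simp
 have ball: "(J \<longlongrightarrow> 0) (at_right 0) &
   (EX e M. ALL r:{0<..<b}. (e has_real_derivative (J r)^2 / r ^ n) (at r) & \<bar>e r\<bar> <= M) &
   (EX D. ALL r:{0<..b}. \<bar>w r\<bar> * sqrt (r ^ n) <= D)" if a: "a = 0"
 proof (intro conjI)
  have cJ: "continuous_on {a<..<b} J" by (rule continuous_on_subset[OF Jcont sub])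
  have cq: "continuous_on {a<..<b} (%r. (J r)^2 / r ^ n)" using a by (intro continuous_intros cJ) auto
  have ck: "continuous_on {a<..<b} (%r. - k' r)" by (intro continuous_intros continuous_on_subset[OF ck' sub])
  have "EX e. ALL r. ereal a < ereal r --> ereal r < ereal b --> (e has_real_derivative (J r)^2 / r ^ n) (at r)"
   using ab cq by (intro antiderivative_open) (auto simp: continuous_on_eq_continuous_at)
  then obtain e where e: "!!r. r : {a<..<b} ==> (e has_real_derivative (J r)^2 / r ^ n) (at r)" by auto
  have diff: "\<bar>e d - e c\<bar> <= 4 * C" if cd: "0 < c" "c <= d" "d < b" for c d
  proof -
   have "(LBINT r:{c..d}. (J r)^2 / r ^ n) = e d - e c"
    by (rule lint_derivative[OF cd(2)]) (use e cd a in "auto intro: continuous_on_subset[OF cq]")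
   moreover have "(LBINT r:{c..d}. (J r)^2 / r ^ n) <= 4 * C" by (rule energy_bound[OF a dw dJ ck fw cd])
   moreover have "(LBINT r:{c..d}. (J r)^2 / r ^ n) >= 0"
    unfolding set_lebesgue_integral_def by (rule Bochner_Integration.integral_nonneg) (use cd in "auto simp: indicator_def")
   ultimately show ?thesis by simp
  qed
  have E: "((%r. e r - e c0) has_real_derivative (J r)^2 / r ^ n) (at r) & \<bar>e r - e c0\<bar> <= 4 * C" if r: "r : {0<..<b}" for r
   using e[of r] diff[of r c0] diff[of c0 r] r c0 a
   by (cases "r <= c0") (auto intro!: derivative_eq_intros simp: abs_minus_commute)
  thus "EX e M. ALL r:{0<..<b}. (e has_real_derivative (J r)^2 / r ^ n) (at r) & \<bar>e r\<bar> <= M"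
   by (intro exI[of _ "%r. e r - e c0"] exI[of _ "4 * C"]) blast
  \<comment> \<open>Integrability of \<open>k\<close> down to 0 gives the flux a limit at the
    origin; \<open>flux_limit_zero\<close> then identifies it as 0.\<close>
  have k0: "k integrable_on {0..c0}"
   using set_borel_integral_eq_integral(1)[OF h_int0[of c0]] a c0 by (simp add: k_def[abs_def])
  have "continuous_on {0..c0} (%r. integral {0..r} k)" by (rule indefinite_integral_continuous_1[OF k0])
  hence "((%r. integral {0..r} k) \<longlongrightarrow> integral {0..0} k) (at 0 within {0..c0})"
   unfolding continuous_on_def by (rule bspec) (use c0 a in auto)
  hence l: "((%r. integral {0..r} k) \<longlongrightarrow> 0) (at_right 0)" using c0 a by (simp add: at_within_Icc_at_right)
  have Hl: "c2 - (H c0 - integral {0..c0} k) - integral {0..r} k = J r" if r: "0 < r" "r < c0" for r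
  proof -
   have "integral {0..r} k + integral {r..c0} k = integral {0..c0} k"
    by (rule Henstock_Kurzweil_Integration.integral_combine[OF _ _ k0]) (use r in auto)
   moreover have "H c0 = H r + integral {r..c0} k" by (rule H) (use r c0 a in auto)
   ultimately show ?thesis using JJ1[of r] r c0 a by (simp add: J1_def)
  qed
  define L where "L = c2 - (H c0 - integral {0..c0} k)"
  have "((%r. L - integral {0..r} k) \<longlongrightarrow> L - 0) (at_right 0)" by (intro tendsto_diff tendsto_const l)
  moreover have "\<forall>\<^sub>F r in at_right 0. L - integral {0..r} k = J r"
   unfolding eventually_at_right_field using Hl c0 a by (intro exI[of _ c0]) (auto simp: L_def)
  ultimately have JL: "(J \<longlongrightarrow> L) (at_right 0)" using Lim_transform_eventually by fastforce
  from flux_limit_zero[OF a cJ JL E] JL show "(J \<longlongrightarrow> 0) (at_right 0)" by simp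
  show "EX D. ALL r:{0<..b}. \<bar>w r\<bar> * sqrt (r ^ n) <= D"
  proof (intro exI ballI)
   fix r assume r: "r : {0<..b}"
   show "\<bar>w r\<bar> * sqrt (r ^ n) <= (C + 1) * sqrt b"
   proof (cases "r = b")
    case False
    hence r': "r : {a<..<b}" using r a by auto
    have "\<bar>w r\<bar> * sqrt (r ^ n) <= (C + 1) * sqrt ((b - r) / r ^ n) * sqrt (r ^ n)"
     using r by (intro mult_right_mono pb(1)[OF r']) auto
    also have "... = (C + 1) * sqrt (b - r)" using r by (simp add: real_sqrt_divide)
    also have "... <= (C + 1) * sqrt b" using r C by (intro mult_left_mono) auto
    finally show ?thesis .
   qed (use C r in "simp add: w_def")
  qed
 qed
 have wb: "w b = 0" "w a = 0" by (simp_all add: w_def)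
 have der: "ALL r:{a<..<b}. (w has_real_derivative J r / r ^ n) (at r) & (J has_real_derivative - (r ^ n * hh r (w r))) (at r)"
  using dw dJ by (simp add: k'_def)
 show ?thesis
  by (rule exI[of _ w], rule exI[of _ J]) (use fw wcont Jcont der wb ball in blast)
qed

end


section \<open>From the weak equation on the domain to one variable\<close>

context radial_domain
begin

lemma C1_0_radial:
 assumes eta: "!!r. (eta has_real_derivative eta' r) (at r)" "continuous_on UNIV eta'" "eta' 0 = 0"
  and M: "M < b" "!!r. r > M ==> eta r = 0 & eta' r = 0" and m: "a > 0 ==> a < m & (ALL r<m. eta r = 0 & eta' r = 0)"
 shows "(%x. eta (norm x)) : C1_0 Omega"
proof -
 note G = radial_GDERIV[OF eta(1,3)] and cG = continuous_radial_field[OF eta(2,3)]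
 show ?thesis
 proof (cases "a = 0")
  case True
  show ?thesis
   by (rule C1_0_I[OF G cG compact_cball[of 0 M]]) (use True M in "auto simp: Omega not_le")
 next
  case False
  have "{x::real^'n. norm x : {m..M}} = cball 0 M - ball 0 m" by auto
  hence K: "compact {x::real^'n. norm x : {m..M}}" by (simp add: compact_diff)
  show ?thesis
   by (rule C1_0_I[OF G cG K]) (use False a0 M m in "auto simp: Omega not_le")
 qed
qed

lemma H1_0_integrable:
 assumes "u : H1_0 Omega"
 shows "u : borel_measurable (leb)" "integrable (leb) u"
proof -
 have um: "u : borel_measurable (leb)" and u2: "integrable (leb) (%x. (u x)^2)"
  using assms unfolding H1_0_def H1_def L2_def by auto
 show "u : borel_measurable (leb)" by (rule um)
 have i1: "integrable (leb) (%_. 1::real)" by (rule integrable_continuous_Omega) simp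
 show "integrable (leb) u"
 proof (rule Bochner_Integration.integrable_bound[OF Bochner_Integration.integrable_add[OF u2 i1] um])
  show "AE x in leb. norm (u x) <= norm ((u x)^2 + 1)"
  proof (rule AE_I2)
   fix x
   have "0 <= (\<bar>u x\<bar> - 1)^2" by simp
   hence "2 * \<bar>u x\<bar> <= (u x)^2 + 1" unfolding power2_diff by simp
   thus "norm (u x) <= norm ((u x)^2 + 1)" by simp
  qed
 qed
qed

lemma radial_borel_representative_Omega:
 assumes u: "u : H1_0_rad Omega"
 shows "EX f:borel_measurable borel. AE x in leb. u x = f (norm x)"
proof -
 obtain f0 where f0: "AE x in leb. u x = f0 (norm x)" and uH: "u : H1_0 Omega" using u unfolding H1_0_rad_def by blast
 define u' where "u' = (%x. if x : Omega then u x else 0)"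
 define F where "F = (%r. if r : {a<..<b} then f0 r else 0)"
 have "u' : borel_measurable lebesgue"
  unfolding u'_def using H1_0_integrable(1)[OF uH] sets_Omega by (simp add: borel_measurable_if_I)
 moreover have "AE x in lebesgue. u' x = F (norm x)"
  using f0[unfolded AE_lebesgue_on[OF sets_Omega]] AE_nonzero
  by eventually_elim (auto simp: u'_def F_def mem_Omega)
 ultimately obtain g where g: "g : borel_measurable borel" "AE x in lebesgue. u' x = g (norm x)"
  using radial_borel_representative by blast
 have "AE x in leb. u x = g (norm x)"
  unfolding AE_lebesgue_on[OF sets_Omega] using g(2) by eventually_elim (auto simp: u'_def)
 with g(1) show ?thesis by blast
qed

text \<open>The field with \<open>kappa = zeta / r ^ Suc n\<close> satisfies
  \<open>r ^ n * (r * kappa) = zeta\<close>, so \<open>r ^ n\<close> times its divergence is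
  \<open>zeta' = theta\<close>. That \<open>zeta\<close> vanishes near the origin makes the field of
  class \<open>C1\<close> there.\<close>

lemma field_of_profile:
 assumes zeta: "!!r. (zeta has_real_derivative theta r) (at r)" "continuous_on UNIV theta" and delta: "delta > 0" "!!r. r <= delta ==> zeta r = 0 & theta r = 0"
 defines "kappa \<equiv> %r. zeta r / r ^ Suc n" and "kappa' \<equiv> %r. theta r / r ^ Suc n - real (Suc n) * zeta r / r ^ Suc (Suc n)"
 shows "(kappa has_real_derivative kappa' r) (at r)" "continuous_on UNIV kappa'" "kappa' 0 = 0" "r > 0 ==> r ^ n * dvg kappa kappa' r = theta r"
  "r > 0 ==> r ^ n * (r * kappa r)^2 = (zeta r)^2 / r ^ n"
proof -
 have z: "kappa r = 0" "kappa' r = 0" if "r < delta" for r using delta(2)[of r] that by (auto simp: kappa_def kappa'_def)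
 show "kappa' 0 = 0" using z delta by simp
 show "(kappa has_real_derivative kappa' r) (at r)"
 proof (cases "r < delta")
  case True
  hence r: "r : {..<delta}" by simp
  have "((%_. 0) has_real_derivative kappa' r) (at r)" using z[OF True] by simp
  thus ?thesis by (rule has_field_derivative_transform_within_open[OF _ open_lessThan r]) (use z in auto)
 next
  case False
  hence r: "r > 0" using delta by simp
  have "((%r. zeta r / r ^ Suc n) has_real_derivative (theta r * r ^ Suc n - zeta r * (real (Suc n) * r ^ n)) / (r ^ Suc n * r ^ Suc n)) (at r)"
   using r by (intro DERIV_divide zeta) (auto intro!: derivative_eq_intros simp del: power_Suc)
  moreover have "(theta r * r ^ Suc n - zeta r * (real (Suc n) * r ^ n)) / (r ^ Suc n * r ^ Suc n) = kappa' r"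
   unfolding kappa'_def diff_divide_distrib using r by (simp add: field_simps)
  ultimately show ?thesis by (simp add: kappa_def)
 qed
 have czeta: "continuous_on S zeta" for S using zeta(1) by (meson deriv_cont)
 have "continuous_on ({..<delta} \<union> {0<..}) kappa'"
 proof (rule continuous_on_open_Un)
  show "continuous_on {..<delta} kappa'" by (rule continuous_on_eq[of _ "%_. 0"]) (use z in auto)
  show "continuous_on {0<..} kappa'"
   unfolding kappa'_def by (intro continuous_intros czeta continuous_on_subset[OF zeta(2)]) auto
 qed auto
 moreover have "{..<delta} \<union> {0<..} = UNIV" using delta by auto
 ultimately show "continuous_on UNIV kappa'" by simp
 show "r ^ n * dvg kappa kappa' r = theta r" if r: "r > 0"
 proof -
  have "dvg kappa kappa' r = theta r / r ^ n" unfolding dvg_def kappa_def kappa'_def using r by (simp add: right_diff_distrib)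
  thus ?thesis using r by simp
 qed
 show "r ^ n * (r * kappa r)^2 = (zeta r)^2 / r ^ n" if r: "r > 0"
 proof -
  have "r * kappa r = zeta r / r ^ n" unfolding kappa_def using r by simp
  thus ?thesis using r by (simp add: power2_eq_square)
 qed
qed

lemma field_of_profile_exists:
 assumes zeta: "!!r. (zeta has_real_derivative theta r) (at r)" "continuous_on UNIV theta" and delta: "delta > 0" "!!r. r <= delta ==> zeta r = 0 & theta r = 0"
 shows "EX kappa kappa'. (ALL r. (kappa has_real_derivative kappa' r) (at r)) & continuous_on UNIV kappa' & kappa' 0 = 0 &
  (ALL r>0. r ^ n * dvg kappa kappa' r = theta r) & (ALL r>0. r ^ n * (r * kappa r)^2 = (zeta r)^2 / r ^ n) &
  (ALL r. kappa r = zeta r / r ^ Suc n) & (ALL r. zeta r = 0 & theta r = 0 --> kappa' r = 0)"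
proof (rule exI[of _ "%r. zeta r / r ^ Suc n"], rule exI[of _ "%r. theta r / r ^ Suc n - real (Suc n) * zeta r / r ^ Suc (Suc n)"], intro conjI allI impI)
 note F = field_of_profile[OF zeta delta(1)]
 fix r
 show "((%r. zeta r / r ^ Suc n) has_real_derivative theta r / r ^ Suc n - real (Suc n) * zeta r / r ^ Suc (Suc n)) (at r)" by (rule F(1)) (rule delta(2))
 show "continuous_on UNIV (%r. theta r / r ^ Suc n - real (Suc n) * zeta r / r ^ Suc (Suc n))" by (rule F(2)) (rule delta(2))
 show "theta 0 / 0 ^ Suc n - real (Suc n) * zeta 0 / 0 ^ Suc (Suc n) = 0" by simp
 show "r ^ n * dvg (%r. zeta r / r ^ Suc n) (%r. theta r / r ^ Suc n - real (Suc n) * zeta r / r ^ Suc (Suc n)) r = theta r" if "r > 0"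
  by (rule F(4)[OF _ that]) (rule delta(2))
 show "r ^ n * (r * (zeta r / r ^ Suc n))^2 = (zeta r)^2 / r ^ n" if "r > 0" by (rule F(5)[OF _ that]) (rule delta(2))
qed auto

text \<open>\<open>H1_0_divergence_bound\<close> becomes \<open>H10\<close>, and
  \<open>weak_grad_radial_test\<close> combined with the equation becomes \<open>E\<close>. The
  factor \<open>\<sigma>\<close> from polar coordinates cancels except in the constant.\<close>

theorem radial_weak_equation:
 assumes u: "u : H1_0 Omega" and f: "f : borel_measurable borel" "AE x in leb. u x = f (norm x)"
  and h: "h : borel_measurable borel" "AE x in leb. g x = h (norm x)"
  and int: "!!phi. phi : C1_0 Omega ==> integrable (leb) (%x. g x * phi x)"
  and eq: "!!phi. phi : C1_0 Omega ==> (LINT x|leb. weak_grad Omega u x \<bullet> grad phi x) = (LINT x|leb. g x * phi x)"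
 shows "EX C. radial_weak a b C n f h"
proof -
 let ?M = "leb"
 note um = H1_0_integrable(1)[OF u] and ui = H1_0_integrable(2)[OF u]
 obtain C where C: "C >= 0" and Cb: "!!kappa kappa'. (ALL r. (kappa has_real_derivative kappa' r) (at r)) & continuous_on UNIV kappa' & kappa' 0 = 0 ==>
  \<bar>LINT x|?M. u x * dvg kappa kappa' (norm x)\<bar> <= C + (LINT x|?M. (norm x * kappa (norm x))^2)"
  using H1_0_divergence_bound[OF u] by blast
 have cnorm: "continuous_on UNIV (%x::real^'n. F (norm x))" if "continuous_on UNIV F" for F :: "real => real"
  by (rule continuous_on_compose2[OF that continuous_on_norm_id]) simp
 have radial_test: "set_integrable lborel {a<..<b} (%r. r ^ n * (h r * eta r))"
  "(LINT x|?M. g x * eta (norm x)) = \<sigma> * (LBINT r:{a<..<b}. r ^ n * (h r * eta r))"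
  if eta: "continuous_on UNIV eta" "(%x. eta (norm x)) : C1_0 Omega" for eta
 proof -
  have Fm: "(%r. h r * eta r) : borel_measurable borel"
   using h(1) borel_measurable_continuous_onI[OF eta(1)] by simp
  have i: "integrable ?M (%x. g x * eta (norm x))" by (rule int[OF eta(2)])
  have ae: "AE x in ?M. g x * eta (norm x) = h (norm x) * eta (norm x)" using h(2) by eventually_elim simp
  note L = radial_lint[OF Fm borel_measurable_integrable[OF i] ae]
  show "set_integrable lborel {a<..<b} (%r. r ^ n * (h r * eta r))" using L(1) i by simp
  show "(LINT x|?M. g x * eta (norm x)) = \<sigma> * (LBINT r:{a<..<b}. r ^ n * (h r * eta r))" by (rule L(2))
 qed
 have dvg_lint: "(LINT x|?M. u x * dvg kappa kappa' (norm x)) = \<sigma> * (LBINT r:{a<..<b}. f r * theta r)"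
  if c: "continuous_on UNIV kappa" "continuous_on UNIV kappa'" and theta: "!!r. r > 0 ==> r ^ n * dvg kappa kappa' r = theta r" for kappa kappa' theta
 proof -
  have cd: "continuous_on UNIV (dvg kappa kappa')" unfolding dvg_def by (intro continuous_intros c)
  have "(LINT x|?M. u x * dvg kappa kappa' (norm x)) = \<sigma> * (LBINT r:{a<..<b}. r ^ n * (f r * dvg kappa kappa' r))"
  proof (rule radial_lint(2))
   show "(%r. f r * dvg kappa kappa' r) : borel_measurable borel" using f(1) borel_measurable_continuous_onI[OF cd] by simp
   show "(%x. u x * dvg kappa kappa' (norm x)) : borel_measurable ?M"
    using um continuous_measurable_Omega[OF cnorm[OF cd]] by simp
   show "AE x in ?M. u x * dvg kappa kappa' (norm x) = f (norm x) * dvg kappa kappa' (norm x)" using f(2) by eventually_elim simp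
  qed
  also have "(LBINT r:{a<..<b}. r ^ n * (f r * dvg kappa kappa' r)) = (LBINT r:{a<..<b}. f r * theta r)"
  proof (rule set_lebesgue_integral_cong)
   show "ALL r. r : {a<..<b} --> r ^ n * (f r * dvg kappa kappa' r) = f r * theta r"
    using theta a0 by (auto simp: mult.left_commute)
  qed simp
  finally show ?thesis .
 qed
 have "radial_weak a b (C / \<sigma>) n f h"
 proof
  show "n >= 1" by (rule n)
  show "0 <= a" "a < b" by (rule a0 ab)+
  show "C / \<sigma> >= 0" using C \<sigma> by simp
  show "f : borel_measurable borel" by (rule f)
  show "set_integrable lborel {a<..<b} (%r. r ^ n * f r)" using radial_lint(1)[OF f(1) um f(2)] ui by simp
 next
  fix c d assume cd: "a < c" "c < d" "d < b"
  define m where "m = (a + c) / 2"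
  define M where "M = (d + b) / 2"
  have mM: "a < m" "m < c" "d < M" "M < b" using cd by (auto simp: m_def M_def)
  obtain xi omega where Q: "continuous_on UNIV omega" "!!r. (xi has_real_derivative omega r) (at r)"
   "!!r. r <= m ==> xi r = 0 & omega r = 0" "!!r. r >= c ==> xi r = 1 & omega r = 0" using ramp_exists[of m c] mM by blast
  obtain xi2 omega2 where R: "continuous_on UNIV omega2" "!!r. (xi2 has_real_derivative omega2 r) (at r)"
   "!!r. r <= d ==> xi2 r = 0 & omega2 r = 0" "!!r. r >= M ==> xi2 r = 1 & omega2 r = 0" using ramp_exists[of d M] mM by blast
  define eta where "eta = (%r. xi r * (1 - xi2 r))"
  define eta' where "eta' = (%r. omega r * (1 - xi2 r) - xi r * omega2 r)"
  have cxi: "continuous_on UNIV xi" "continuous_on UNIV xi2" using Q(2) R(2) by (meson deriv_cont)+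
  have deta: "(eta has_real_derivative eta' r) (at r)" for r
   unfolding eta_def eta'_def by (rule derivative_eq_intros Q(2) R(2) refl)+ simp
  have ceta': "continuous_on UNIV eta'" unfolding eta'_def using Q(1) R(1) by (intro continuous_intros cxi)
  have ceta: "continuous_on UNIV eta" unfolding eta_def by (intro continuous_intros cxi)
  have z: "r < m ==> eta r = 0 & eta' r = 0" "r > M ==> eta r = 0 & eta' r = 0" for r
   using Q(3)[of r] R(4)[of r] by (simp_all add: eta_def eta'_def)
  have "(%x. eta (norm x)) : C1_0 Omega"
   by (rule C1_0_radial[OF deta ceta' _ mM(4)]) (use z mM a0 in auto)
  from radial_test(1)[OF ceta this]
  have "set_integrable lborel {c..d} (%r. r ^ n * (h r * eta r))" by (rule set_integrable_subset) (use cd in auto)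
  moreover have "(%r. indicator {c..d} r *\<^sub>R (r ^ n * (h r * eta r))) = (%r. indicator {c..d} r *\<^sub>R (r ^ n * h r))"
   using Q(4) R(3) by (auto simp: eta_def indicator_def fun_eq_iff)
  ultimately show "set_integrable lborel {c..d} (%r. r ^ n * h r)" by (simp add: set_integrable_def)
 next
  fix d assume a: "a = 0" and d: "0 < d" "d < b"
  define M where "M = (d + b) / 2"
  have M: "d < M" "M < b" using d by (auto simp: M_def)
  obtain xi2 omega2 where R: "continuous_on UNIV omega2" "!!r. (xi2 has_real_derivative omega2 r) (at r)"
   "!!r. r <= d ==> xi2 r = 0 & omega2 r = 0" "!!r. r >= M ==> xi2 r = 1 & omega2 r = 0" using ramp_exists[of d M] M by blast
  define eta where "eta = (%r. 1 - xi2 r)"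
  have deta: "(eta has_real_derivative - omega2 r) (at r)" for r
   unfolding eta_def by (rule derivative_eq_intros R(2) refl)+ simp
  have ceta: "continuous_on UNIV eta" using deta by (meson deriv_cont)
  have "(%x. eta (norm x)) : C1_0 Omega"
  proof (rule C1_0_radial[OF deta _ _ M(2)])
   show "continuous_on UNIV (%r. - omega2 r)" by (intro continuous_intros R)
   show "- omega2 0 = 0" using R(3)[of 0] d by simp
   show "eta r = 0 & - omega2 r = 0" if "r > M" for r using R(4)[of r] that by (simp add: eta_def)
   show "a > 0 ==> a < 0 & (ALL r<0. eta r = 0 & - omega2 r = 0)" using a by simp
  qed
  from radial_test(1)[OF ceta this]
  have "set_integrable lborel {0<..d} (%r. r ^ n * (h r * eta r))" by (rule set_integrable_subset) (use d a in auto)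
  moreover have "(%r. indicator {0<..d} r *\<^sub>R (r ^ n * (h r * eta r))) = (%r. indicator {0..d} r *\<^sub>R (r ^ n * h r))"
   using R(3) n(1) by (auto simp: eta_def indicator_def fun_eq_iff)
  ultimately show "set_integrable lborel {0..d} (%r. r ^ n * h r)" by (simp add: set_integrable_def)
 next
  fix zeta theta delta assume zeta: "!!r. (zeta has_real_derivative theta r) (at r)" "continuous_on UNIV theta" "(delta::real) > 0" "!!r. r <= delta ==> zeta r = 0 & theta r = 0"
  obtain kappa kappa' where K: "!!r. (kappa has_real_derivative kappa' r) (at r)" "continuous_on UNIV kappa'" "kappa' 0 = 0"
   "!!r. r > 0 ==> r ^ n * dvg kappa kappa' r = theta r" "!!r. r > 0 ==> r ^ n * (r * kappa r)^2 = (zeta r)^2 / r ^ n"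
   using field_of_profile_exists[OF zeta] by blast
  have ckappa: "continuous_on UNIV kappa" using K(1) by (meson deriv_cont)
  have "(LINT x|?M. (norm x * kappa (norm x))^2) = \<sigma> * (LBINT r:{a<..<b}. r ^ n * (r * kappa r)^2)"
  proof (rule radial_lint(2)[where F="%r. (r * kappa r)^2"])
   have c2: "continuous_on UNIV (%r. (r * kappa r)^2)" by (intro continuous_intros ckappa)
   show "(%r. (r * kappa r)^2) : borel_measurable borel" by (rule borel_measurable_continuous_onI[OF c2])
   show "(%x. (norm x * kappa (norm x))^2) : borel_measurable ?M" by (rule continuous_measurable_Omega[OF cnorm[OF c2]])
  qed simp
  also have "(LBINT r:{a<..<b}. r ^ n * (r * kappa r)^2) = (LBINT r:{a<..<b}. (zeta r)^2 / r ^ n)"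
   by (rule set_lebesgue_integral_cong) (use K(5) a0 in auto)
  finally have X: "(LINT x|?M. (norm x * kappa (norm x))^2) = \<sigma> * (LBINT r:{a<..<b}. (zeta r)^2 / r ^ n)" .
  have "\<bar>\<sigma> * (LBINT r:{a<..<b}. f r * theta r)\<bar> <= C + \<sigma> * (LBINT r:{a<..<b}. (zeta r)^2 / r ^ n)"
  proof -
   have D: "(LINT x|?M. u x * dvg kappa kappa' (norm x)) = \<sigma> * (LBINT r:{a<..<b}. f r * theta r)"
    by (rule dvg_lint[OF ckappa K(2)]) (rule K(4))
   show ?thesis using Cb[of kappa kappa'] K(1-3) unfolding X D by blast
  qed
  hence "\<sigma> * \<bar>LBINT r:{a<..<b}. f r * theta r\<bar> <= \<sigma> * (C / \<sigma> + (LBINT r:{a<..<b}. (zeta r)^2 / r ^ n))"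
   using \<sigma> by (simp add: abs_mult distrib_left)
  thus "\<bar>LBINT r:{a<..<b}. f r * theta r\<bar> <= C / \<sigma> + (LBINT r:{a<..<b}. (zeta r)^2 / r ^ n)"
   using \<sigma> by (simp only: mult_le_cancel_left_pos)
 next
  fix zeta theta eta c d
  assume zeta: "!!r. (zeta has_real_derivative theta r) (at r)" "continuous_on UNIV theta" and cd: "a < c" "c < d" "d < b"
   and z: "!!r. r ~: {c<..<d} ==> zeta r = 0 & theta r = 0"
   and eta: "!!r. (eta has_real_derivative zeta r / r ^ n) (at r)" "!!r. r ~: {c<..<d} ==> eta r = 0"
  have c0: "c > 0" using a0 cd by simp
  have zc: "zeta r = 0 & theta r = 0" if "r <= c" for r using z[of r] that by simp
  obtain kappa kappa' where K: "!!r. (kappa has_real_derivative kappa' r) (at r)" "continuous_on UNIV kappa'" "kappa' 0 = 0"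
   "!!r. r > 0 ==> r ^ n * dvg kappa kappa' r = theta r" and kappa: "!!r. kappa r = zeta r / r ^ Suc n" "!!r. zeta r = 0 & theta r = 0 ==> kappa' r = 0"
   using field_of_profile_exists[OF zeta c0 zc] by blast
  have ckappa: "continuous_on UNIV kappa" using K(1) by (meson deriv_cont)
  have zk: "kappa r = 0 & kappa' r = 0" if "r ~: {c..d}" for r 
  proof -
   have "zeta r = 0 & theta r = 0" by (rule z) (use that in auto)
   thus ?thesis using kappa[of r] by simp
  qed
  have e: "(eta has_real_derivative r * kappa r) (at r)" for r
   using eta(1)[of r] zc[of 0] c0 by (cases "r = 0") (auto simp: kappa)
  note W = weak_grad_radial_test[OF H1_0_weak_grad(1)[OF open_Omega u] K(1,2) cd zk e]
  have t: "(%x. eta (norm x)) : C1_0 Omega" by (rule W(1)) (use eta(2) in auto)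
  have ceta: "continuous_on UNIV eta" using e by (meson deriv_cont)
  have "\<sigma> * (LBINT r:{a<..<b}. f r * theta r) = (LINT x|?M. u x * dvg kappa kappa' (norm x))"
   by (rule dvg_lint[OF ckappa K(2), symmetric]) (rule K(4))
  also have "... = - (LINT x|?M. weak_grad Omega u x \<bullet> grad (%x. eta (norm x)) x)" by (rule W(2)) (use eta(2) in auto)
  also have "... = - (LINT x|?M. g x * eta (norm x))" using eq[OF t] by simp
  also have "... = \<sigma> * (- (LBINT r:{a<..<b}. r ^ n * (h r * eta r)))" using radial_test(2)[OF ceta t] by simp
  finally have "\<sigma> * (LBINT r:{a<..<b}. f r * theta r) = \<sigma> * (- (LBINT r:{a<..<b}. r ^ n * (h r * eta r)))" .
  hence "(LBINT r:{a<..<b}. f r * theta r) = - (LBINT r:{a<..<b}. r ^ n * (h r * eta r))"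
   using \<sigma> by (subst (asm) mult_left_cancel) auto
  thus "(LBINT r:{a<..<b}. f r * theta r) = - (LBINT r:{a<..<b}. r ^ n * h r * eta r)" by (simp only: mult.assoc)
 qed
 thus ?thesis by blast
qed

end


section \<open>Radial profiles in the Sobolev space\<close>

text \<open>A \<open>C1\<close> version of soft thresholding: composed with \<open>eta\<close>, a
  continuous function that vanishes at the boundary becomes 0 near the boundary, at the price of an
  error of at most \<open>2 * e\<close>.\<close>

lemma cutoff_exists:
 fixes e :: real
 assumes e: "e > 0"
 shows "EX eta eta'. (ALL t. (eta has_real_derivative eta' t) (at t)) & continuous_on UNIV eta' & (ALL t. 0 <= eta' t & eta' t <= 1) &
  (ALL t. \<bar>t\<bar> < e --> eta t = 0 & eta' t = 0) & (ALL t. 2 * e <= \<bar>t\<bar> --> eta' t = 1) & (ALL t. \<bar>eta t - t\<bar> <= 2 * e)"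
proof -
 define eta' where "eta' = (%t. min 1 (max 0 (\<bar>t\<bar> / e - 1)))"
 have c: "continuous_on UNIV eta'" unfolding eta'_def using e by (intro continuous_intros) auto
 obtain eta where eta: "eta 0 = 0" "!!t. (eta has_real_derivative eta' t) (at t)" using antiderivative_UNIV[OF c, of 0 0] by blast
 have b: "0 <= eta' t" "eta' t <= 1" for t by (auto simp: eta'_def)
 have z: "eta' t = 0" if "\<bar>t\<bar> <= e" for t using that e by (simp add: eta'_def)
 have o: "eta' t = 1" if "2 * e <= \<bar>t\<bar>" for t using that e by (simp add: eta'_def min_def max_def field_simps)
 have cont: "continuous_on S eta" for S using eta(2) by (meson deriv_cont)
 have etaz: "eta t = 0" if "\<bar>t\<bar> < e" for t
 proof -
  consider "t = 0" | "0 < t" | "t < 0" by linarith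
  thus ?thesis
  proof cases
   case 2
   have "eta t = eta 0" by (rule DERIV_isconst_end[OF 2 cont]) (use eta(2) z that in "metis abs_of_pos less_imp_le less_trans")
   thus ?thesis using eta by simp
  next
   case 3
   have "eta 0 = eta t"
   proof (rule DERIV_isconst_end[OF 3 cont])
    fix x assume "t < x" "x < 0"
    thus "(eta has_real_derivative 0) (at x)" using eta(2)[of x] z[of x] that by simp
   qed
   thus ?thesis using eta by simp
  qed (use eta in simp)
 qed
 define F where "F = (%t. t - eta t)"
 have dF: "(F has_real_derivative 1 - eta' t) (at t)" for t unfolding F_def by (intro DERIV_diff DERIV_ident eta)
 have cF: "continuous_on S F" for S unfolding F_def by (intro continuous_intros cont)
 have up: "F s <= F t" if "s <= t" for s t
  by (rule DERIV_nonneg_imp_nondecreasing[OF that, of F]) (use dF b in "metis diff_ge_0_iff_ge")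
 have F0: "F 0 = 0" using eta by (simp add: F_def)
 have le: "eta s <= eta t" if "s <= t" for s t
  by (rule DERIV_nonneg_imp_nondecreasing[OF that, of eta]) (use eta(2) b in metis)
 have F2: "\<bar>F t\<bar> <= 2 * e" for t
 proof -
  have small: "\<bar>F s\<bar> <= 2 * e" if "\<bar>s\<bar> <= 2 * e" for s
   using up[of 0 s] up[of s 0] le[of 0 s] le[of s 0] F0 eta(1) that by (cases "s >= 0") (auto simp: F_def)
  consider "\<bar>t\<bar> <= 2 * e" | "t > 2 * e" | "t < - (2 * e)" by linarith
  thus ?thesis
  proof cases
   case 2
   have "F t = F (2 * e)"
   proof (rule DERIV_isconst_end[OF 2 cF])
    fix x assume "2 * e < x" "x < t"
    thus "(F has_real_derivative 0) (at x)" using dF[of x] o[of x] e by simp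
   qed
   thus ?thesis using small[of "2 * e"] e by simp
  next
   case 3
   have "F (- (2 * e)) = F t"
   proof (rule DERIV_isconst_end[OF 3 cF])
    fix x assume "t < x" "x < - (2 * e)"
    thus "(F has_real_derivative 0) (at x)" using dF[of x] o[of x] e by simp
   qed
   thus ?thesis using small[of "- (2 * e)"] e by simp
  qed (rule small)
 qed
 show ?thesis
  by (rule exI[of _ eta], rule exI[of _ eta'])
   (use eta(2) c b z o etaz F2 in "auto simp: F_def abs_minus_commute")
qed

text \<open>Zeros with nonvanishing derivative are isolated, hence finite in number on compact
  subintervals and countable altogether.\<close>

lemma AE_zero_deriv_zero:
 fixes psi :: "real => real"
 assumes d: "!!r. r : {a<..<b} ==> (psi has_real_derivative d r) (at r)" "continuous_on {a<..<b} d"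
  and nz: "!!r. r : {a<..<b} ==> psi r = 0 ==> d r ~= 0"
 shows "AE r in lborel. r : {a<..<b} --> psi r ~= 0"
proof -
 have fin: "finite {t\<in>{c..e}. psi t = 0}" if ce: "a < c" "e < b" for c e
 proof (rule ccontr)
  assume inf: "infinite {t\<in>{c..e}. psi t = 0}"
  obtain x where x: "x : {c..e}" "x islimpt {t\<in>{c..e}. psi t = 0}"
   using Heine_Borel_imp_Bolzano_Weierstrass[OF compact_Icc inf] by blast
  have xab: "x : {a<..<b}" using x ce by auto
  have "isCont psi x" by (rule DERIV_isCont[OF d(1)[OF xab]])
  have "psi x = 0"
  proof (rule ccontr)
   assume "psi x ~= 0"
   hence "\<forall>\<^sub>F y in at x. psi y ~= 0" using \<open>isCont psi x\<close> unfolding isCont_def by (rule tendsto_imp_eventually_ne[rotated])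
   hence "\<forall>\<^sub>F y in at x. y ~: {t\<in>{c..e}. psi t = 0}" by eventually_elim auto
   thus False using x(2) islimpt_iff_eventually by blast
  qed
  have "((%y. (psi y - psi x) / (y - x)) \<longlongrightarrow> d x) (at x)" using d(1)[OF xab] by (simp add: has_field_derivative_iff)
  hence "\<forall>\<^sub>F y in at x. (psi y - psi x) / (y - x) ~= 0" using nz[OF xab \<open>psi x = 0\<close>] by (rule tendsto_imp_eventually_ne)
  hence "\<forall>\<^sub>F y in at x. y ~: {t\<in>{c..e}. psi t = 0}" by eventually_elim (use \<open>psi x = 0\<close> in auto)
  thus False using x(2) islimpt_iff_eventually by blast
 qed
 define Z where "Z = (\<Union>p\<in>\<rat>. \<Union>q\<in>\<rat>. if a < p & q < b then {t\<in>{p..q}. psi t = 0} else {})"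
 have "countable Z" unfolding Z_def
 proof (intro countable_UN countable_rat)
  fix p q
  show "countable (if a < p & q < b then {t\<in>{p..q}. psi t = 0} else {})"
   using countable_finite[OF fin[of p q]] by (cases "a < p & q < b") auto
 qed
 have "r : Z" if r: "r : {a<..<b}" "psi r = 0" for r
 proof -
  obtain p where p: "p : \<rat>" "a < p" "p < r" using Rats_dense_in_real[of a r] r by auto
  obtain q where q: "q : \<rat>" "r < q" "q < b" using Rats_dense_in_real[of r b] r by auto
  have "r : (if a < p & q < b then {t\<in>{p..q}. psi t = 0} else {})" using p q r by simp
  thus ?thesis unfolding Z_def using p(1) q(1) by blast
 qed
 moreover have "AE r in lborel. r ~: Z" using \<open>countable Z\<close> by (intro AE_not_in countable_imp_null_set_lborel)
 ultimately show ?thesis by (auto elim!: eventually_mono)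
qed

context radial_domain
begin

lemma weak_gradient_C1_0:
 assumes F: "F : C1_0 Omega" and phi: "phi : C1_0 Omega"
 shows "(LINT x|leb. F x *\<^sub>R grad phi x) = - (LINT x|leb. phi x *\<^sub>R grad F x)"
proof -
 obtain K where K: "compact K" "K <= Omega" "!!x. x ~: K ==> phi x = 0 & grad phi x = 0" using C1_0_support[OF phi] by blast
 note cg = C1_0_grad[OF phi] C1_0_grad[OF F] and cp = C1_0_continuous[OF phi] C1_0_continuous[OF F]
 have i1: "integrable (leb) (%x. F x *\<^sub>R grad phi x)" by (intro integrable_continuous_Omega continuous_intros cg cp)
 have i2: "integrable (leb) (%x. phi x *\<^sub>R grad F x)" by (intro integrable_continuous_Omega continuous_intros cg cp)
 have "(LINT x|leb. F x *\<^sub>R grad phi x) + (LINT x|leb. phi x *\<^sub>R grad F x) = 0"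
 proof (rule euclidean_eqI)
  fix e :: "real^'n" assume "e : Basis"
  let ?G = "%x. F x *\<^sub>R grad phi x + phi x *\<^sub>R grad F x"
  have G: "GDERIV (%x. F x * phi x) x :> ?G x" for x by (rule GDERIV_mult[OF C1_0_GDERIV[OF F] C1_0_GDERIV[OF phi]])
  have cG: "continuous_on UNIV ?G" by (intro continuous_intros cg cp)
  have z: "F x * phi x = 0" "?G x = 0" if "x ~: K" for x using K(3)[OF that] by auto
  have "(LINT x|lborel. ?G x \<bullet> e) = 0" by (rule integral_gradient_zero(2)[OF G cG K(1)]) (use z in auto)
  moreover have "(LINT x|leb. ?G x \<bullet> e) = (LINT x|lborel. ?G x \<bullet> e)"
   by (rule lebesgue_on_continuous_support(2)[OF sets_Omega _ K(1) _ K(2)]) (use z in "auto intro!: continuous_intros cG")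
  moreover have "(LINT x|leb. ?G x \<bullet> e) = (LINT x|leb. ?G x) \<bullet> e"
   by (rule integral_inner_left) (use i1 i2 in auto)
  ultimately show "((LINT x|leb. F x *\<^sub>R grad phi x) + (LINT x|leb. phi x *\<^sub>R grad F x)) \<bullet> e = 0 \<bullet> e"
   using Bochner_Integration.integral_add[OF i1 i2] by simp
 qed
 thus ?thesis by (simp add: eq_neg_iff_add_eq_0)
qed

definition ext :: "(real => real) => real => real" where "ext psi r = psi (max a (min r b))"

definition exd :: "(real => real) => real => real" where "exd d r = (if r : {a<..<b} then d r else 0)"

text \<open>\<open>eta\<close> removes the values of \<open>psi\<close> below \<open>e\<close> in
  modulus, hence a neighbourhood of the boundary. At the origin of a ball the bound
  \<open>|d r| <= B * r\<close> makes the radial function of class \<open>C1\<close>.\<close>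

lemma approximant:
 assumes psi: "continuous_on {a..b} psi" "!!r. r : {a<..<b} ==> (psi has_real_derivative d r) (at r)" "continuous_on {a<..<b} d"
  and B: "!!r. r : {a<..<b} ==> \<bar>d r\<bar> <= B * r" and bc: "psi b = 0" "a > 0 ==> psi a = 0"
  and eta: "!!t. (eta has_real_derivative eta' t) (at t)" "continuous_on UNIV eta'" "!!t. \<bar>t\<bar> < e ==> eta t = 0 & eta' t = 0" and e: "e > 0"
 shows "(%x. eta (ext psi (norm x))) : C1_0 Omega" "grad (%x. eta (ext psi (norm x))) x = (eta' (ext psi (norm x)) * exd d (norm x)) *\<^sub>R sgn x"
proof -
 define E where "E = ext psi"
 define D where "D = exd d"
 have cE: "continuous_on UNIV E"
  unfolding E_def ext_def by (rule continuous_on_compose2[OF psi(1)]) (use ab in "auto intro!: continuous_intros")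
 have EI: "E r = psi r" "D r = d r" if "r : {a<..<b}" for r using that by (auto simp: E_def ext_def D_def exd_def)
 have D_le: "D s = 0" if "s <= a" for s unfolding D_def exd_def using that by simp
 have Eb: "E r = 0" if "r >= b" for r using that bc ab by (simp add: E_def ext_def max_def min_def)
 have Ea: "E r = 0" if "r <= a" "a > 0" for r using that bc ab by (simp add: E_def ext_def max_def min_def)
 have dE: "(E has_real_derivative D r) (at r)" if r: "r : {a<..<b}" for r
  using has_field_derivative_transform_within_open[OF psi(2)[OF r] open_greaterThanLessThan r, of E] EI r by simp
 define B' where "B' = max B 0"
 have DB: "\<bar>D r\<bar> <= B' * \<bar>r\<bar>" for r
 proof (cases "r : {a<..<b}")
  case True
  hence "\<bar>d r\<bar> <= B * r" "r > 0" using B a0 by auto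
  moreover have "B * r <= B' * r" by (rule mult_right_mono) (use \<open>r > 0\<close> in "auto simp: B'_def")
  ultimately have "\<bar>d r\<bar> <= B' * \<bar>r\<bar>" by linarith
  thus ?thesis using EI(2)[OF True] by simp
 next
  case False
  hence "D r = 0" unfolding D_def exd_def by (rule if_not_P)
  thus ?thesis by (simp add: B'_def)
 qed
 have dE0: "(E has_real_derivative D r) (at r)" if r: "r <= 0" "a = 0" for r
 proof -
  have D0: "D r = 0" unfolding D_def exd_def using r by simp
  have En: "E s = psi 0" if "s <= 0" for s unfolding E_def ext_def using that \<open>a = 0\<close> b0 by (simp add: max_def min_def)
  show ?thesis
  proof (cases "r = 0")
   case False
   hence r': "r : {..<0}" using r by auto
   have "((%_. psi 0) has_real_derivative 0) (at r)" by simp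
   from has_field_derivative_transform_within_open[OF this open_lessThan r', of E] En D0 show ?thesis by simp
  next
   case True
   \<comment> \<open>By the mean value theorem the bound on \<open>d\<close> makes
     \<open>E s - E 0\<close> quadratic for positive \<open>s\<close>, and for negative
     \<open>s\<close> it is 0; so the derivative at the origin exists and is 0.\<close>
   have bd: "\<bar>E s - E 0\<bar> <= B' * s^2" if "\<bar>s\<bar> < b" for s
   proof (cases "s <= 0")
    case True
    thus ?thesis using En[of s] En[of 0] by (simp add: B'_def)
   next
    case False
    hence s: "0 < s" "s < b" using that by auto
    have "EX l z. 0 < z & z < s & (E has_real_derivative l) (at z) & E s - E 0 = (s - 0) * l"
    proof (rule MVT[OF s(1)])
     show "continuous_on {0..s} E" by (rule continuous_on_subset[OF cE]) simp
     show "E differentiable (at x)" if "0 < x" "x < s" for x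
     proof -
      have "x : {a<..<b}" using that s \<open>a = 0\<close> by simp
      thus ?thesis using dE[of x] real_differentiable_def by blast
     qed
    qed
    then obtain l z where z: "0 < z" "z < s" "(E has_real_derivative l) (at z)" "E s - E 0 = s * l" by auto
    have "l = D z" by (rule DERIV_unique[OF z(3) dE]) (use z s \<open>a = 0\<close> in auto)
    hence "\<bar>E s - E 0\<bar> <= s * (B' * z)" using z s DB[of z] by (simp add: abs_mult)
    also have "... <= s * (B' * s)" using z s by (intro mult_left_mono) (auto simp: B'_def)
    finally show ?thesis by (simp add: power2_eq_square ac_simps)
   qed
   have "((%h. (E (0 + h) - E 0) / h) \<longlongrightarrow> 0) (at 0)"
   proof (rule Lim_null_comparison)
    show "((%h. B' * \<bar>h\<bar>) \<longlongrightarrow> 0) (at 0)" by (intro tendsto_eq_intros | simp)+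
    have "\<forall>\<^sub>F h in at (0::real). \<bar>h\<bar> < b" using b0 by (auto simp: eventually_at dist_real_def)
    thus "\<forall>\<^sub>F h in at 0. norm ((E (0 + h) - E 0) / h) <= B' * \<bar>h\<bar>"
    proof eventually_elim
     case (elim h)
     have "\<bar>E h - E 0\<bar> / \<bar>h\<bar> <= B' * h^2 / \<bar>h\<bar>" by (intro divide_right_mono bd elim) simp
     also have "... = B' * \<bar>h\<bar>" by (cases "h = 0") (auto simp: power2_eq_square abs_if)
     finally show ?case by simp
    qed
   qed
   thus ?thesis using True D0 by (simp add: DERIV_def)
  qed
 qed
 define P where "P = (%r. eta (E r))"
 define P' where "P' = (%r. eta' (E r) * D r)"
 \<comment> \<open>The composition vanishes on this open set, which contains all
   \<open>r >= b\<close> and, for an annulus, all \<open>r <= a\<close>. Only points where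
   \<open>E\<close> is differentiable remain.\<close>
 define U where "U = {r. \<bar>E r\<bar> < e}"
 have opU: "open U" unfolding U_def using cE by (intro open_Collect_less continuous_intros)
 have U0: "P r = 0" "P' r = 0" if "r : U" for r using eta(3)[of "E r"] that by (auto simp: U_def P_def P'_def)
 have Ub: "r : U" if "r >= b" for r using Eb[OF that] e by (simp add: U_def)
 have Ua: "r : U" if "r <= a" "a > 0" for r using Ea[OF that] e by (simp add: U_def)
 have dP: "(P has_real_derivative P' r) (at r)" for r
 proof (cases "r : U")
  case True
  have "((%_. 0) has_real_derivative P' r) (at r)" using U0[OF True] by simp
  thus ?thesis by (rule has_field_derivative_transform_within_open[OF _ opU True]) (use U0 in auto)
 next
  case False
  have "r < b" using Ub[of r] False by (cases "r < b") auto
  have "(E has_real_derivative D r) (at r)"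
  proof (cases "r : {a<..<b}")
   case True thus ?thesis by (rule dE)
  next
   case nin: False
   hence "r <= a" using \<open>r < b\<close> by auto
   moreover have "a = 0" using Ua[of r] False \<open>r <= a\<close> a0 by (cases "a > 0") auto
   ultimately show ?thesis using dE0[of r] by simp
  qed
  thus ?thesis unfolding P_def P'_def by (rule DERIV_chain2[OF eta(1)])
 qed
 have D_ab: "continuous_on {a<..<b} D" by (rule continuous_on_eq[OF psi(3)]) (use EI in auto)
 have cetaE: "continuous_on S (%r. eta' (E r))" for S
  by (rule continuous_on_compose2[OF eta(2)]) (use continuous_on_subset[OF cE] in auto)
 have cP': "continuous_on UNIV P'"
 proof -
  have cU: "continuous_on U P'" by (rule continuous_on_eq[of _ "%_. 0"]) (use U0 in auto)
  show ?thesis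
  proof (cases "a = 0")
   case False
   have "continuous_on (U \<union> {a<..<b}) P'"
    using cU by (rule continuous_on_open_Un[OF opU open_greaterThanLessThan]) (auto simp: P'_def intro!: continuous_intros cetaE D_ab)
   moreover have "U \<union> {a<..<b} = UNIV"
   proof (rule UNIV_eq_I[symmetric])
    fix r show "r : U \<union> {a<..<b}" using Ua[of r] Ub[of r] False a0 by (cases "r <= a"; cases "r >= b") auto
   qed
   ultimately show ?thesis by simp
  next
   case True
   have "continuous_on {..<b} D"
    unfolding continuous_on_eq_continuous_at[OF open_lessThan]
   proof
    fix r assume r: "r : {..<b}"
    consider "r > 0" | "r < 0" | "r = 0" by linarith
    thus "isCont D r"
    proof cases
     case 1
     thus ?thesis using D_ab r True by (simp add: continuous_on_eq_continuous_at)
    next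
     case 2
     have "continuous_on {..<0} D" by (rule continuous_on_eq[of _ "%_. 0"]) (use True D_le in auto)
     thus ?thesis using 2 by (simp add: continuous_on_eq_continuous_at)
    next
     case 3
     have "(D \<longlongrightarrow> 0) (at 0)"
     proof (rule Lim_null_comparison)
      show "((%h. B' * \<bar>h\<bar>) \<longlongrightarrow> 0) (at 0)" by (intro tendsto_eq_intros | simp)+
      show "\<forall>\<^sub>F h in at 0. norm (D h) <= B' * \<bar>h\<bar>" using DB by (intro always_eventually) auto
     qed
     moreover have "D 0 = 0" using D_le a0 by simp
     ultimately show ?thesis using 3 by (simp add: isCont_def)
    qed
   qed
   hence "continuous_on {..<b} P'" unfolding P'_def by (intro continuous_intros cetaE)
   with cU have "continuous_on (U \<union> {..<b}) P'" by (rule continuous_on_open_Un[OF opU open_lessThan])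
   moreover have "U \<union> {..<b} = UNIV"
   proof (rule UNIV_eq_I[symmetric])
    fix r show "r : U \<union> {..<b}" using Ub[of r] by (cases "r >= b") auto
   qed
   ultimately show ?thesis by simp
  qed
 qed
 have P'0: "P' 0 = 0" using a0 by (simp add: P'_def D_def exd_def)
 have bU: "b : U" and aU: "a > 0 ==> a : U" using Ub[of b] Ua[of a] by auto
 obtain epsilon where epsilon: "epsilon > 0" "!!r. dist r b < epsilon ==> r : U" using opU bU unfolding open_dist by blast
 have MU: "r : U" if "r > b - epsilon" for r using that epsilon(2)[of r] Ub[of r] by (cases "r >= b") (auto simp: dist_real_def)
 have "EX m. a > 0 --> a < m & (ALL r<m. r : U)"
 proof (cases "a > 0")
  case True
  obtain delta where delta: "delta > 0" "!!r. dist r a < delta ==> r : U" using opU aU[OF True] unfolding open_dist by blast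
  have "r : U" if "r < a + delta" for r using that delta(2)[of r] Ua[of r] True by (cases "r <= a") (auto simp: dist_real_def)
  thus ?thesis using delta by (intro exI[of _ "a + delta"]) auto
 qed auto
 then obtain m where m: "a > 0 ==> a < m & (ALL r<m. r : U)" by blast
 have "(%x. P (norm x)) : C1_0 Omega"
 proof (rule C1_0_radial[OF dP cP' P'0])
  show "b - epsilon < b" using epsilon by simp
  show "P r = 0 & P' r = 0" if "r > b - epsilon" for r using U0[OF MU[OF that]] by simp
  show "a < m & (ALL r<m. P r = 0 & P' r = 0)" if "a > 0" using m[OF that] U0 by blast
 qed
 thus "(%x. eta (ext psi (norm x))) : C1_0 Omega" by (simp add: P_def E_def)
 have "grad (%x. P (norm x)) x = P' (norm x) *\<^sub>R sgn x" by (rule grad_eqI[OF radial_GDERIV[OF dP P'0]])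
 thus "grad (%x. eta (ext psi (norm x))) x = (eta' (ext psi (norm x)) * exd d (norm x)) *\<^sub>R sgn x"
  by (simp add: P_def P'_def E_def D_def)
qed

definition radial_grad :: "(real => real) => real^'n => real^'n" where "radial_grad d x = exd d (norm x) *\<^sub>R sgn x"

lemma radial_grad_measurable:
 assumes "continuous_on {a<..<b} d"
 shows "radial_grad d : borel_measurable (leb)"
proof -
 have "(%r. indicator {a<..<b} r *\<^sub>R d r) : borel_measurable borel"
  by (rule borel_measurable_continuous_on_indicator[OF _ assms]) simp
 moreover have "exd d = (%r. indicator {a<..<b} r *\<^sub>R d r)" by (auto simp: exd_def fun_eq_iff)
 ultimately have e [measurable]: "exd d : borel_measurable borel" by simp
 have "(%x::real^'n. exd d (norm x) *\<^sub>R (inverse (norm x) *\<^sub>R x)) : borel_measurable lborel" by measurable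
 thus ?thesis
  unfolding radial_grad_def[abs_def] sgn_div_norm by (intro measurable_restrict_space1 measurable_completion)
qed

text \<open>The thresholded functions \<open>Phi k\<close> are test functions. Their gradients stay
  bounded and converge wherever \<open>psi\<close> is nonzero, which is almost everywhere because
  the zeros of \<open>psi\<close> are simple; dominated convergence does the rest.\<close>

lemma profile_H1_0:
 assumes psi: "continuous_on {a..b} psi" "!!r. r : {a<..<b} ==> (psi has_real_derivative d r) (at r)" "continuous_on {a<..<b} d"
  and B: "!!r. r : {a<..<b} ==> \<bar>d r\<bar> <= B * r" and bc: "psi b = 0" "a > 0 ==> psi a = 0"
  and nz: "!!r. r : {a<..<b} ==> psi r = 0 ==> d r ~= 0"
 shows "(%x. ext psi (norm x)) : H1_0_rad Omega"
  and "AE x in leb. weak_grad Omega (%x. ext psi (norm x)) x = radial_grad d x"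
  and "AE x in leb. ext psi (norm x) ~= 0"
proof -
 let ?M = "leb"
 define Psi where "Psi = (%x::real^'n. ext psi (norm x))"
 define g where "g = (radial_grad d :: real^'n => real^'n)"
 have "continuous_on UNIV (ext psi)"
  unfolding ext_def[abs_def] by (rule continuous_on_compose2[OF psi(1)]) (use ab in "auto intro!: continuous_intros")
 hence cPsi: "continuous_on UNIV Psi" unfolding Psi_def by (rule continuous_on_compose2[OF _ continuous_on_norm_id]) simp
 obtain B0 where B0: "!!x. x : Omega ==> norm (Psi x) <= B0" using continuous_bounded_Omega[OF cPsi] by blast
 have mPsi: "Psi : borel_measurable ?M" by (rule continuous_measurable_Omega[OF cPsi])
 have mg: "g : borel_measurable ?M" unfolding g_def by (rule radial_grad_measurable[OF psi(3)])
 define B1 where "B1 = \<bar>B\<bar> * b"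
 have B1: "norm (g x) <= B1" for x
 proof -
  have "\<bar>exd d r\<bar> <= B1" for r
  proof (cases "r : {a<..<b}")
   case True
   hence "\<bar>d r\<bar> <= B * r" "0 < r" "r < b" using B a0 by auto
   moreover have "B * r <= \<bar>B\<bar> * b" using \<open>0 < r\<close> \<open>r < b\<close> by (intro mult_mono) auto
   ultimately show ?thesis using True by (simp add: exd_def B1_def)
  next
   case False
   hence "exd d r = 0" unfolding exd_def by (rule if_not_P)
   thus ?thesis using b0 by (simp add: B1_def)
  qed
  thus ?thesis using b0 by (auto simp: g_def radial_grad_def norm_sgn B1_def)
 qed
 have B1_0: "B1 >= 0" using b0 by (simp add: B1_def)
 define e where "e = (%k::nat. 1 / real (Suc k))"
 have e: "e k > 0" "e k <= 1" for k by (auto simp: e_def)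
 have e_lim: "e \<longlonglongrightarrow> 0" unfolding e_def using LIMSEQ_inverse_real_of_nat by (simp add: inverse_eq_divide)
 have "ALL k. EX eta eta'. (ALL t. (eta has_real_derivative eta' t) (at t)) & continuous_on UNIV eta' & (ALL t. 0 <= eta' t & eta' t <= 1) &
  (ALL t. \<bar>t\<bar> < e k --> eta t = 0 & eta' t = 0) & (ALL t. 2 * e k <= \<bar>t\<bar> --> eta' t = 1) & (ALL t. \<bar>eta t - t\<bar> <= 2 * e k)"
  using cutoff_exists[OF e(1)] by blast
 then obtain eta eta' where eta: "!!k t. (eta k has_real_derivative eta' k t) (at t)" "!!k. continuous_on UNIV (eta' k)"
  "!!k t. 0 <= eta' k t & eta' k t <= 1" "!!k t. \<bar>t\<bar> < e k ==> eta k t = 0 & eta' k t = 0"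
  "!!k t. 2 * e k <= \<bar>t\<bar> ==> eta' k t = 1" "!!k t. \<bar>eta k t - t\<bar> <= 2 * e k" by metis
 define Phi where "Phi = (%k x. eta k (Psi x))"
 have PhiC: "Phi k : C1_0 Omega" and gr: "grad (Phi k) x = eta' k (Psi x) *\<^sub>R g x" for k x
 proof -
  note A = approximant[where d=d and B=B and eta="eta k" and eta'="eta' k" and e="e k" and psi=psi]
  show "Phi k : C1_0 Omega" unfolding Phi_def Psi_def
   by (rule A(1)) (rule psi B bc eta(1) eta(2) eta(4) e(1) | assumption)+
  have "grad (%x. eta k (ext psi (norm x))) x = (eta' k (ext psi (norm x)) * exd d (norm x)) *\<^sub>R sgn x"
   by (rule A(2)) (rule psi B bc eta(1) eta(2) eta(4) e(1) | assumption)+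
  thus "grad (Phi k) x = eta' k (Psi x) *\<^sub>R g x" by (simp add: Phi_def Psi_def g_def radial_grad_def)
 qed
 have Phib: "\<bar>Phi k x - Psi x\<bar> <= 2 * e k" for k x unfolding Phi_def by (rule eta(6))
 have Phil: "(%k. Phi k x - Psi x) \<longlonglongrightarrow> 0" for x
  by (rule Lim_null_comparison[where g="%k. 2 * e k"]) (use Phib tendsto_mult_right_zero[OF e_lim, of 2] in auto)
 have grb: "norm (grad (Phi k) x) <= B1" for k x
  using B1[of x] eta(3)[of k "Psi x"] mult_mono[of "eta' k (Psi x)" 1 "norm (g x)" B1] by (simp add: gr)
 have ne: "AE x in ?M. Psi x ~= 0"
 proof -
  have "AE r in lborel. r : {a<..<b} --> psi r ~= 0"
   by (rule AE_zero_deriv_zero[where d=d]) (rule psi nz | assumption)+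
  hence "AE r in lborel. r > 0 --> (r : {a<..<b} --> psi r ~= 0)" by eventually_elim auto
  from radial_AE[OF _ this, where 'a="real^'n"] have "AE x::real^'n in lborel. norm x : {a<..<b} --> psi (norm x) ~= 0"
   using dim by simp
  hence "AE x::real^'n in lebesgue. norm x : {a<..<b} --> psi (norm x) ~= 0" by (rule AE_completion)
  thus ?thesis unfolding AE_lebesgue_on[OF sets_Omega] using AE_nonzero
  proof eventually_elim
   case (elim x)
   thus ?case using mem_Omega[of x] by (auto simp: Psi_def ext_def)
  qed
 qed
 thus "AE x in ?M. ext psi (norm x) ~= 0" unfolding Psi_def .
 have grl: "(%k. grad (Phi k) x) \<longlonglongrightarrow> g x" if "Psi x ~= 0" for x
 proof (rule tendsto_eventually)
  have "\<forall>\<^sub>F k in sequentially. e k < \<bar>Psi x\<bar> / 2" by (rule order_tendstoD(2)[OF e_lim]) (use that in simp)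
  thus "\<forall>\<^sub>F k in sequentially. grad (Phi k) x = g x" by eventually_elim (use eta(5) in "simp add: gr")
 qed
 have mgr: "grad (Phi k) : borel_measurable ?M" and mPhi: "Phi k : borel_measurable ?M" for k
  using C1_0_square_integrable(3,4)[OF sets_Omega PhiC] by auto
 have wg: "has_weak_gradient Omega Psi g"
  unfolding has_weak_gradient_def
 proof (intro ballI conjI)
  fix phi assume phi: "phi : C1_0 Omega"
  note cg = C1_0_grad[OF phi] and cp = C1_0_continuous[OF phi]
  obtain B2 where B2: "!!x. x : Omega ==> norm (phi x) <= B2" using continuous_bounded_Omega[OF cp] by blast
  note mp = continuous_measurable_Omega[OF cp] and mgp = continuous_measurable_Omega[OF cg]
  show "integrable ?M (%x. Psi x *\<^sub>R grad phi x)" by (intro integrable_continuous_Omega continuous_intros cPsi cg)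
  show "integrable ?M (%x. phi x *\<^sub>R g x)"
  proof (rule integrable_bounded_Omega)
   show "norm (phi x *\<^sub>R g x) <= B2 * B1" if "x : Omega" for x
    using mult_mono[OF B2[OF that] B1[of x]] B2[OF that] by (simp add: order_trans[OF norm_ge_zero])
  qed (use mp mg in simp)
  have L1: "(%k. LINT x|?M. Phi k x *\<^sub>R grad phi x) \<longlonglongrightarrow> (LINT x|?M. Psi x *\<^sub>R grad phi x)"
  proof (rule integral_dominated_convergence[where w="%x. (B0 + 2) * norm (grad phi x)"])
   show "integrable ?M (%x. (B0 + 2) * norm (grad phi x))" by (intro integrable_continuous_Omega continuous_intros cg)
   show "AE x in ?M. (%k. Phi k x *\<^sub>R grad phi x) \<longlonglongrightarrow> Psi x *\<^sub>R grad phi x"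
    using Phil by (intro AE_I2 tendsto_intros) (simp add: LIM_zero_iff)
   show "AE x in ?M. norm (Phi k x *\<^sub>R grad phi x) <= (B0 + 2) * norm (grad phi x)" for k
   proof (rule AE_I2)
    fix x assume "x : space ?M"
    hence "\<bar>Phi k x\<bar> <= B0 + 2" using B0[of x] Phib[of k x] e(2)[of k] by auto
    thus "norm (Phi k x *\<^sub>R grad phi x) <= (B0 + 2) * norm (grad phi x)" by (simp add: mult_right_mono)
   qed
  qed (use mPsi mPhi mgp in auto)
  have L2: "(%k. LINT x|?M. phi x *\<^sub>R grad (Phi k) x) \<longlonglongrightarrow> (LINT x|?M. phi x *\<^sub>R g x)"
  proof (rule integral_dominated_convergence[where w="%x. norm (phi x) * B1"])
   show "integrable ?M (%x. norm (phi x) * B1)" by (intro integrable_continuous_Omega continuous_intros cp)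
   show "AE x in ?M. (%k. phi x *\<^sub>R grad (Phi k) x) \<longlonglongrightarrow> phi x *\<^sub>R g x"
    using ne by eventually_elim (intro tendsto_intros grl)
   show "AE x in ?M. norm (phi x *\<^sub>R grad (Phi k) x) <= norm (phi x) * B1" for k
    using grb by (intro AE_I2) (simp add: mult_left_mono)
  qed (use mp mg mgr in auto)
  have "(%k. LINT x|?M. Phi k x *\<^sub>R grad phi x) \<longlonglongrightarrow> - (LINT x|?M. phi x *\<^sub>R g x)"
   using tendsto_minus[OF L2] by (simp only: weak_gradient_C1_0[OF PhiC phi])
  with L1 show "(LINT x|?M. Psi x *\<^sub>R grad phi x) = - (LINT x|?M. phi x *\<^sub>R g x)" by (rule LIMSEQ_unique)
 qed
 have wgw: "has_weak_gradient Omega Psi (weak_grad Omega Psi)" unfolding weak_grad_def by (rule someI[of _ g]) (rule wg)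
 have ae: "AE x in ?M. weak_grad Omega Psi x = g x" by (rule weak_gradient_unique[OF open_Omega wgw wg])
 thus "AE x in ?M. weak_grad Omega (%x. ext psi (norm x)) x = radial_grad d x" unfolding Psi_def g_def .
 have mw: "weak_grad Omega Psi : borel_measurable ?M"
 proof -
  have "AE x in lebesgue. (if x : Omega then g x else 0) = (if x : Omega then weak_grad Omega Psi x else 0)"
   using ae unfolding AE_lebesgue_on[OF sets_Omega] by eventually_elim auto
  moreover have "(%x. if x : Omega then g x else 0) : borel_measurable lebesgue"
   using mg sets_Omega by (simp add: borel_measurable_if_I)
  ultimately have "(%x. if x : Omega then weak_grad Omega Psi x else 0) : borel_measurable lebesgue" by (rule borel_measurable_AE[rotated])
  thus ?thesis by (rule borel_measurable_if_D)
 qed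
 have "Psi : L2 Omega" unfolding L2_def using mPsi by (auto intro!: integrable_continuous_Omega continuous_intros cPsi)
 moreover have "g : L2 Omega"
 proof -
  have "integrable ?M (%x. (norm (g x))^2)"
   by (rule integrable_bounded_Omega[where B="B1^2"]) (use mg B1 in "auto intro: power_mono")
  thus ?thesis using mg by (simp add: L2_def)
 qed
 ultimately have "Psi : H1 Omega" using wg unfolding H1_def by blast
 moreover have "(%k. LINT x|?M. (Phi k x - Psi x)^2) \<longlonglongrightarrow> (LINT x|?M. 0)"
 proof (rule integral_dominated_convergence[where w="%_. 4"])
  show "integrable ?M (%_. 4::real)" by (rule integrable_continuous_Omega) simp
  show "AE x in ?M. (%k. (Phi k x - Psi x)^2) \<longlonglongrightarrow> 0" using Phil by (intro AE_I2) (simp add: tendsto_null_power)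
  show "AE x in ?M. norm ((Phi k x - Psi x)^2) <= 4" for k
  proof (rule AE_I2)
   fix x
   have "\<bar>Phi k x - Psi x\<bar> <= 2" using Phib[of k x] e(2)[of k] by simp
   hence "\<bar>Phi k x - Psi x\<bar>^2 <= 2^2" by (intro power_mono) auto
   thus "norm ((Phi k x - Psi x)^2) <= 4" by simp
  qed
 qed (use mPsi mPhi in auto)
 moreover have "(%k. LINT x|?M. (norm (grad (Phi k) x - weak_grad Omega Psi x))^2) \<longlonglongrightarrow> (LINT x|?M. 0)"
 proof (rule integral_dominated_convergence[where w="%_. (2 * B1)^2"])
  show "integrable ?M (%_. (2 * B1)^2)" by (rule integrable_continuous_Omega) simp
  show "AE x in ?M. (%k. (norm (grad (Phi k) x - weak_grad Omega Psi x))^2) \<longlonglongrightarrow> 0"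
   using ae ne
  proof eventually_elim
   case (elim x)
   have "(%k. grad (Phi k) x - weak_grad Omega Psi x) \<longlonglongrightarrow> 0" using grl[OF elim(2)] elim(1) by (simp add: LIM_zero_iff)
   thus ?case by (intro tendsto_null_power tendsto_norm_zero) auto
  qed
  show "AE x in ?M. norm ((norm (grad (Phi k) x - weak_grad Omega Psi x))^2) <= (2 * B1)^2" for k
   using ae
  proof eventually_elim
   case (elim x)
   have "norm (grad (Phi k) x - weak_grad Omega Psi x) <= 2 * B1"
    using norm_triangle_ineq4[of "grad (Phi k) x" "g x"] grb[of k x] B1[of x] elim by simp
   thus ?case using power_mono[of "norm (grad (Phi k) x - weak_grad Omega Psi x)" "2 * B1" 2] by simp
  qed
 qed (use mw mgr in auto)
 ultimately have "Psi : H1_0 Omega" unfolding H1_0_def using PhiC by auto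
 thus "(%x. ext psi (norm x)) : H1_0_rad Omega" unfolding H1_0_rad_def Psi_def by auto
qed

end


context radial_domain
begin

lemma compact_radii:
 assumes K: "compact K" "K <= Omega"
 shows "EX c d. a < c & c < d & d < b & (ALL x:K. norm x <= d & (a > 0 --> c <= norm x))"
proof (cases "K = {}")
 case True
 thus ?thesis using ab by (intro exI[of _ "(3 * a + b) / 4"] exI[of _ "(a + b) / 2"]) auto
next
 case False
 have cn: "continuous_on K norm" by (intro continuous_intros)
 obtain x1 where x1: "x1 : K" "!!y. y : K ==> norm y <= norm x1" using continuous_attains_sup[OF K(1) False cn] by blast
 obtain x2 where x2: "x2 : K" "!!y. y : K ==> norm x2 <= norm y" using continuous_attains_inf[OF K(1) False cn] by blast
 define d where "d = max (norm x1) ((a + b) / 2)"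
 define c where "c = (if a > 0 then min (norm x2) ((3 * a + b) / 4) else (3 * a + b) / 4)"
 have "d < b" using x1(1) K(2) Omega ab by (auto simp: d_def)
 moreover have "a < c" using x2(1) K(2) Omega ab a0 by (auto simp: c_def)
 moreover have "c < d"
 proof -
  have "c <= (3 * a + b) / 4"
  proof (cases "a > 0")
   case True
   show ?thesis unfolding c_def if_P[OF True] by (rule min.cobounded2)
  next
   case False
   show ?thesis unfolding c_def if_not_P[OF False] by (rule order_refl)
  qed
  also have "... < (a + b) / 2" using ab by simp
  also have "... <= d" by (simp add: d_def)
  finally show ?thesis .
 qed
 moreover have "norm x <= d & (a > 0 --> c <= norm x)" if "x : K" for x
  using x1(2)[OF that] x2(2)[OF that] by (auto simp: d_def c_def)
 ultimately show ?thesis by blast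
qed

lemma cutoff_profile:
 assumes cd: "a < c" "c < d" "d < b"
 shows "EX xi xi' m M. a < m & m < c & d < M & M < b & (ALL r. (xi has_real_derivative xi' r) (at r)) & continuous_on UNIV xi' & (ALL r. \<bar>xi r\<bar> <= 1) &
  (ALL r. r <= d & (a > 0 --> c <= r) --> xi r = 1 & xi' r = 0) & (ALL r. M <= r | a > 0 & r <= m --> xi r = 0 & xi' r = 0)"
proof -
 define m where "m = (a + c) / 2"
 define M where "M = (d + b) / 2"
 have mM: "a < m" "m < c" "d < M" "M < b" using cd by (auto simp: m_def M_def)
 obtain xi2 omega2 where R: "continuous_on UNIV omega2" "!!r. (xi2 has_real_derivative omega2 r) (at r)" "!!r. 0 <= xi2 r & xi2 r <= 1"
  "!!r. r <= d ==> xi2 r = 0 & omega2 r = 0" "!!r. r >= M ==> xi2 r = 1 & omega2 r = 0" using ramp_exists[of d M] mM by blast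
 have d2: "((%r. 1 - xi2 r) has_real_derivative - omega2 r) (at r)" for r by (rule derivative_eq_intros R(2) refl)+ simp
 have c2: "continuous_on UNIV xi2" using R(2) by (meson deriv_cont)
 show ?thesis
 proof (cases "a > 0")
  case False
  show ?thesis
   by (rule exI[of _ "%r. 1 - xi2 r"], rule exI[of _ "%r. - omega2 r"], rule exI[of _ m], rule exI[of _ M])
    (use False mM R d2 in "auto intro!: continuous_intros")
 next
  case True
  obtain xi omega where Q: "continuous_on UNIV omega" "!!r. (xi has_real_derivative omega r) (at r)" "!!r. 0 <= xi r & xi r <= 1"
   "!!r. r <= m ==> xi r = 0 & omega r = 0" "!!r. r >= c ==> xi r = 1 & omega r = 0" using ramp_exists[of m c] mM by blast
  have c1: "continuous_on UNIV xi" using Q(2) by (meson deriv_cont)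
  show ?thesis
  proof (rule exI[of _ "%r. xi r * (1 - xi2 r)"], rule exI[of _ "%r. omega r * (1 - xi2 r) + - omega2 r * xi r"], rule exI[of _ m], rule exI[of _ M], intro conjI allI impI)
   fix r
   show "((%r. xi r * (1 - xi2 r)) has_real_derivative omega r * (1 - xi2 r) + - omega2 r * xi r) (at r)" by (rule DERIV_mult[OF Q(2) d2])
   show "\<bar>xi r * (1 - xi2 r)\<bar> <= 1" using Q(3)[of r] R(3)[of r] by (simp add: abs_mult mult_le_one)
   show "continuous_on UNIV (%r. omega r * (1 - xi2 r) + - omega2 r * xi r)" by (intro continuous_intros Q R c1 c2)
   assume "r <= d & (a > 0 --> c <= r)"
   thus "xi r * (1 - xi2 r) = 1" "omega r * (1 - xi2 r) + - omega2 r * xi r = 0" using True Q(5)[of r] R(4)[of r] by auto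
  next
   fix r assume "M <= r | a > 0 & r <= m"
   thus "xi r * (1 - xi2 r) = 0" "omega r * (1 - xi2 r) + - omega2 r * xi r = 0" using Q(4)[of r] R(5)[of r] by auto
  qed (use mM in auto)
 qed
qed

text \<open>The radial field \<open>J r / r ^ n\<close> need not be of class \<open>C1\<close> at the origin. It is cut off
 near the origin; the error tends to zero since \<open>J r = O(r ^ Suc n)\<close>.\<close>

lemma profile_weak_equation:
 assumes J: "!!r. r : {a<..<b} ==> (J has_real_derivative - (r ^ n * Q r * psi r)) (at r)" and cQ: "continuous_on {a<..<b} Q"
  and psi: "continuous_on {a..b} psi" and D: "!!r. r : {a<..<b} ==> \<bar>J r\<bar> <= D * r ^ Suc n"
  and q: "!!r. r : {a<..<b} ==> \<bar>Q r\<bar> <= q" and phi: "phi : C1_0 Omega"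
 shows "integrable (leb) (%x. exd Q (norm x) * ext psi (norm x) * phi x)"
  and "(LINT x|leb. radial_grad (%r. J r / r ^ n) x \<bullet> grad phi x) = (LINT x|leb. exd Q (norm x) * ext psi (norm x) * phi x)"
proof -
 let ?M = "leb"
 note cg = C1_0_grad[OF phi] and cp = C1_0_continuous[OF phi]
 obtain K where K: "compact K" "K <= Omega" "!!x. x ~: K ==> phi x = 0 & grad phi x = 0" using C1_0_support[OF phi] by blast
 obtain c d where cd: "a < c" "c < d" "d < b" and Kcd: "!!x. x : K ==> norm x <= d & (a > 0 --> c <= norm x)"
  using compact_radii[OF K(1,2)] by blast
 obtain xi xi' m M where mM: "a < m" "m < c" "d < M" "M < b" and xi: "!!r. (xi has_real_derivative xi' r) (at r)" "continuous_on UNIV xi'"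
  "!!r. \<bar>xi r\<bar> <= 1" "!!r. r <= d & (a > 0 --> c <= r) ==> xi r = 1 & xi' r = 0" "!!r. M <= r | a > 0 & r <= m ==> xi r = 0 & xi' r = 0"
  using cutoff_profile[OF cd] by metis
 \<comment> \<open>Rescaled to \<open>R (k j * r)\<close> with \<open>k j\<close> tending to
   infinity, this ramp cuts off the origin on the scale \<open>1 / k j\<close>.\<close>
 obtain R R' where R: "continuous_on UNIV R'" "!!r. (R has_real_derivative R' r) (at r)" "!!r. 0 <= R' r & 0 <= R r & R r <= 1"
  "!!r. r <= 1 ==> R r = 0 & R' r = 0" "!!r. r >= 2 ==> R r = 1 & R' r = 0" using ramp_exists[of 1 2] by auto
 have "bounded (R' ` {1..2})" using R(1) by (intro compact_imp_bounded compact_continuous_image) (auto elim: continuous_on_subset)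
 then obtain BR where "ALL y:R' ` {1..2}. norm y <= BR" unfolding bounded_iff by blast
 hence BR': "!!r. r : {1..2} ==> \<bar>R' r\<bar> <= BR" by auto
 have BR0: "BR >= 0" using BR'[of 1] by simp
 have BR: "R' r <= BR" for r using BR'[of r] R(4)[of r] R(5)[of r] BR0 by (cases "r <= 1"; cases "r >= 2") auto
 have D0: "D >= 0"
 proof -
  have m': "m : {a<..<b}" "m > 0" using mM cd a0 by auto
  hence "0 <= D * m ^ Suc n" using D[OF m'(1)] by linarith
  moreover have "0 < m ^ Suc n" using m'(2) by (rule zero_less_power)
  ultimately show ?thesis using mult_neg_pos[of D "m ^ Suc n"] by linarith
 qed
 have cont: "continuous_on S xi" "continuous_on S R" for S using xi(1) R(2) by (meson deriv_cont)+
 have cJ: "continuous_on {a<..<b} J" using J by (meson deriv_cont)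
 have cpsi: "continuous_on {a<..<b} psi" by (rule continuous_on_subset[OF psi]) auto
 have cJ': "continuous_on {a<..<b} (%r. - (r ^ n * Q r * psi r))" by (intro continuous_intros cQ cpsi)
 define k where "k = (%j::nat. real (Suc j))"
 have k: "k j >= 1" "k j > 0" for j by (auto simp: k_def)
 define zeta where "zeta = (%j r. if r : {a<..<b} then J r * (xi r * R (k j * r)) else 0)"
 define theta where "theta = (%j r. if r : {a<..<b} then - (r ^ n * Q r * psi r) * (xi r * R (k j * r)) + (xi' r * R (k j * r) + xi r * (R' (k j * r) * k j)) * J r else 0)"
 have "EX kappa kappa'. (ALL r. (kappa has_real_derivative kappa' r) (at r)) & continuous_on UNIV kappa' & kappa' 0 = 0 &
  (ALL r>0. r ^ n * dvg kappa kappa' r = theta j r) & (ALL r>0. r ^ n * (r * kappa r)^2 = (zeta j r)^2 / r ^ n) &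
  (ALL r. kappa r = zeta j r / r ^ Suc n) & (ALL r. zeta j r = 0 & theta j r = 0 --> kappa' r = 0)" for j
 proof -
  define mk where "mk = (if a > 0 then m else 1 / k j)"
  have mk: "mk > 0" "mk > a" using mM a0 k[of j] by (auto simp: mk_def)
  have zero: "zeta j r = 0 & theta j r = 0" if r: "r < mk | M < r" for r
  proof (cases "M < r")
   case True thus ?thesis using xi(5)[of r] by (simp add: zeta_def theta_def)
  next
   case False
   hence rm: "r < mk" using r by blast
   show ?thesis
   proof (cases "a > 0")
    case True thus ?thesis using xi(5)[of r] rm by (simp add: zeta_def theta_def mk_def)
   next
    case False
    hence "k j * r <= 1" using rm k(2)[of j] by (simp add: mk_def field_simps)
    thus ?thesis using R(4)[of "k j * r"] by (simp add: zeta_def theta_def)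
   qed
  qed
  have op: "open ({..<mk} \<union> {M<..})" by auto
  have cov: "r : {a<..<b} | r : {..<mk} \<union> {M<..}" for r using mk mM by auto
  have dR: "((%r. R (k j * r)) has_real_derivative R' (k j * r) * k j) (at r)" for r
   by (rule DERIV_chain2[OF R(2)]) (auto intro!: derivative_eq_intros)
  have dzeta: "(zeta j has_real_derivative theta j r) (at r)" for r
  proof (cases "r : {a<..<b}")
   case True
   have "((%r. J r * (xi r * R (k j * r))) has_real_derivative - (r ^ n * Q r * psi r) * (xi r * R (k j * r)) + (xi' r * R (k j * r) + R' (k j * r) * k j * xi r) * J r) (at r)"
    by (rule DERIV_mult[OF J[OF True] DERIV_mult[OF xi(1) dR]])
   hence "((%r. J r * (xi r * R (k j * r))) has_real_derivative theta j r) (at r)" using True by (simp add: theta_def mult.commute)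
   thus ?thesis by (rule has_field_derivative_transform_within_open[OF _ open_greaterThanLessThan True]) (simp add: zeta_def)
  next
   case False
   hence r: "r : {..<mk} \<union> {M<..}" using cov by blast
   have "((%_. 0) has_real_derivative theta j r) (at r)" using zero[of r] r by auto
   thus ?thesis by (rule has_field_derivative_transform_within_open[OF _ op r]) (use zero in auto)
  qed
  have ckR: "continuous_on S (%r. R (k j * r))" "continuous_on S (%r. R' (k j * r))" for S
   by (rule continuous_on_compose2[OF cont(2)] continuous_on_compose2[OF R(1)]; auto intro!: continuous_intros)+
  have ctheta: "continuous_on UNIV (theta j)"
  proof -
   have c1: "continuous_on {a<..<b} (theta j)"
    by (rule continuous_on_eq[of _ "%r. - (r ^ n * Q r * psi r) * (xi r * R (k j * r)) + (xi' r * R (k j * r) + xi r * (R' (k j * r) * k j)) * J r"])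
     (auto simp: theta_def intro!: continuous_intros cJ' cJ cont ckR continuous_on_subset[OF xi(2)] cQ cpsi)
   have c2: "continuous_on ({..<mk} \<union> {M<..}) (theta j)"
    by (rule continuous_on_eq[of _ "%_. 0"]) (use zero in auto)
   have "{a<..<b} \<union> ({..<mk} \<union> {M<..}) = UNIV" by (rule UNIV_eq_I[symmetric]) (use cov in blast)
   thus ?thesis using continuous_on_open_Un[OF open_greaterThanLessThan op c1 c2] by simp
  qed
  show ?thesis by (rule field_of_profile_exists[OF dzeta ctheta, of "mk / 2"]) (use mk zero in auto)
 qed
 then obtain kappa kappa' where kappa: "!!j r. (kappa j has_real_derivative kappa' j r) (at r)" "!!j. continuous_on UNIV (kappa' j)" "!!j. kappa' j 0 = 0"
  "!!j r. r > 0 ==> r ^ n * dvg (kappa j) (kappa' j) r = theta j r" "!!j r. kappa j r = zeta j r / r ^ Suc n" by metis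
 note parts = divergence_by_parts[OF phi kappa(1-3)]
 have "continuous_on UNIV (ext psi)"
  unfolding ext_def[abs_def] by (rule continuous_on_compose2[OF psi]) (use ab in "auto intro!: continuous_intros")
 hence cPsi: "continuous_on UNIV (%x::real^'n. ext psi (norm x))" by (rule continuous_on_compose2[OF _ continuous_on_norm_id]) simp
 obtain B0 where B0: "!!x. x : Omega ==> norm (ext psi (norm x)) <= B0" using continuous_bounded_Omega[OF cPsi] by blast
 obtain B2 where B2: "!!x. x : Omega ==> norm (phi x) <= B2" using continuous_bounded_Omega[OF cp] by blast
 have "(%r. indicator {a<..<b} r *\<^sub>R Q r) : borel_measurable borel"
  by (rule borel_measurable_continuous_on_indicator[OF _ cQ]) simp
 moreover have "exd Q = (%r. indicator {a<..<b} r *\<^sub>R Q r)" by (auto simp: exd_def fun_eq_iff)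
 ultimately have [measurable]: "exd Q : borel_measurable borel" by simp
 have "(%x::real^'n. exd Q (norm x)) : borel_measurable lborel" by measurable
 hence mQ: "(%x. exd Q (norm x)) : borel_measurable ?M" by (intro measurable_restrict_space1 measurable_completion)
 define F where "F = (%x. exd Q (norm x) * ext psi (norm x) * phi x)"
 have mF: "F : borel_measurable ?M" unfolding F_def
  using mQ continuous_measurable_Omega[OF cPsi] continuous_measurable_Omega[OF cp] by simp
 have q0: "q >= 0" using q[of m] mM cd by fastforce
 have exdq: "\<bar>exd Q r\<bar> <= q" for r using q[of r] q0 by (simp add: exd_def)
 show "integrable ?M (%x. exd Q (norm x) * ext psi (norm x) * phi x)"
 proof (rule integrable_bounded_Omega[OF mF[unfolded F_def]])
  fix x assume x: "x : Omega"
  have "\<bar>exd Q (norm x)\<bar> * \<bar>ext psi (norm x)\<bar> * \<bar>phi x\<bar> <= q * B0 * B2"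
   using exdq B0[OF x] B2[OF x] q0 order_trans[OF norm_ge_zero B0[OF x]] by (intro mult_mono) auto
  thus "norm (exd Q (norm x) * ext psi (norm x) * phi x) <= q * B0 * B2" by (simp add: abs_mult)
 qed
 have AEr: "AE x in ?M. norm x : {a<..<b} & x : Omega"
  unfolding AE_lebesgue_on[OF sets_Omega] using AE_nonzero by eventually_elim (auto simp: mem_Omega)
 have mg: "radial_grad (%r. J r / r ^ n) : borel_measurable ?M"
  by (rule radial_grad_measurable) (use a0 in "auto intro!: continuous_intros cJ")
 have ev: "\<forall>\<^sub>F j in sequentially. 2 <= k j * r" if "r > 0" for r
 proof -
  obtain N :: nat where N: "2 / r <= real N" using real_arch_simple by blast
  have "2 <= k j * r" if "j >= N" for j
  proof -
   have "2 / r <= k j" using N that by (simp add: k_def)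
   thus ?thesis using \<open>r > 0\<close> by (simp add: field_simps)
  qed
  thus ?thesis by (auto simp: eventually_sequentially)
 qed
 have L1: "(%j. LINT x|?M. phi x * dvg (kappa j) (kappa' j) (norm x)) \<longlonglongrightarrow> (LINT x|?M. - F x)"
 proof (rule integral_dominated_convergence[where w="%x. B2 * (q * B0 + 2 * BR * D)"])
  show "integrable ?M (%x. B2 * (q * B0 + 2 * BR * D))" by (rule integrable_continuous_Omega) simp
  show "AE x in ?M. (%j. phi x * dvg (kappa j) (kappa' j) (norm x)) \<longlonglongrightarrow> - F x"
   using AEr
  proof eventually_elim
   case (elim x)
   show ?case
   proof (cases "x : K")
    case False thus ?thesis using K(3) by (simp add: F_def)
   next
    case True
    have r: "norm x > 0" using elim a0 by auto
    note x1 = xi(4)[OF Kcd[OF True]]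
    show ?thesis
    proof (rule tendsto_eventually)
     show "\<forall>\<^sub>F j in sequentially. phi x * dvg (kappa j) (kappa' j) (norm x) = - F x"
      using ev[OF r]
     proof eventually_elim
      case (elim j)
      have "norm x ^ n * dvg (kappa j) (kappa' j) (norm x) = norm x ^ n * - (Q (norm x) * psi (norm x))"
       unfolding kappa(4)[OF r] theta_def using \<open>norm x : {a<..<b} & x : Omega\<close> x1 R(5)[OF elim] by simp
      hence "dvg (kappa j) (kappa' j) (norm x) = - (Q (norm x) * psi (norm x))"
       using r by (subst (asm) mult_left_cancel) auto
      thus ?case using \<open>norm x : {a<..<b} & x : Omega\<close> by (simp add: F_def exd_def ext_def)
     qed
    qed
   qed
  qed
  show "AE x in ?M. norm (phi x * dvg (kappa j) (kappa' j) (norm x)) <= B2 * (q * B0 + 2 * BR * D)" for j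
   using AEr
  proof eventually_elim
   case (elim x)
   define r where "r = norm x"
   have r: "r > 0" "r : {a<..<b}" using elim a0 by (auto simp: r_def)
   have B: "0 <= B2" "0 <= B0" using B2[of x] B0[of x] elim order_trans[OF norm_ge_zero] by blast+
   show ?case
   proof (cases "x : K")
    case False
    hence "phi x = 0" using K(3) by blast
    thus ?thesis using B q0 BR0 D0 by simp
   next
    case True
    note x1 = xi(4)[OF Kcd[OF True]]
    \<comment> \<open>The derivative of the cutoff lives where \<open>k j * r <= 2\<close>, so its
      factor \<open>k j\<close> costs at most \<open>2 / r\<close>, which the bound
      \<open>|J r / r ^ n| <= D * r\<close> compensates. The resulting dominating constant does not
      depend on \<open>j\<close>.\<close>
    have kR: "R' (k j * r) * k j <= 2 * BR / r"
    proof (cases "k j * r >= 2")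
     case True thus ?thesis using R(5)[of "k j * r"] BR0 r by simp
    next
     case False
     hence "k j <= 2 / r" using r by (simp add: field_simps)
     hence "R' (k j * r) * k j <= BR * (2 / r)" using BR R(3) k(2)[of j] BR0 by (intro mult_mono) auto
     thus ?thesis by (simp add: mult.commute)
    qed
    have "r ^ n * dvg (kappa j) (kappa' j) r = - (r ^ n * Q r * psi r) * R (k j * r) + (R' (k j * r) * k j) * J r"
     unfolding kappa(4)[OF r(1)] theta_def using r(2) x1 by (simp add: r_def)
    hence "dvg (kappa j) (kappa' j) r = - (Q r * psi r) * R (k j * r) + (R' (k j * r) * k j) * (J r / r ^ n)"
     using r by (simp add: field_simps)
    also have "\<bar>...\<bar> <= \<bar>- (Q r * psi r) * R (k j * r)\<bar> + \<bar>(R' (k j * r) * k j) * (J r / r ^ n)\<bar>" by (rule abs_triangle_ineq)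
    also have "\<bar>- (Q r * psi r) * R (k j * r)\<bar> <= q * B0 * 1"
    proof -
     have "\<bar>Q r\<bar> * \<bar>psi r\<bar> * \<bar>R (k j * r)\<bar> <= q * B0 * 1"
     proof (intro mult_mono)
      show "\<bar>psi r\<bar> <= B0" using B0[of x] elim r by (simp add: r_def ext_def)
     qed (use q r R(3) q0 B in auto)
     thus ?thesis by (simp add: abs_mult)
    qed
    also have "\<bar>(R' (k j * r) * k j) * (J r / r ^ n)\<bar> <= (2 * BR / r) * (D * r)"
    proof -
     have "\<bar>J r / r ^ n\<bar> <= D * r" using D[OF r(2)] r by (simp add: field_simps)
     moreover have "\<bar>R' (k j * r) * k j\<bar> <= 2 * BR / r" using kR R(3)[of "k j * r"] k(2)[of j] by simp
     ultimately have "\<bar>R' (k j * r) * k j\<bar> * \<bar>J r / r ^ n\<bar> <= (2 * BR / r) * (D * r)" using BR0 r by (intro mult_mono) auto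
     thus ?thesis by (simp only: abs_mult)
    qed
    also have "q * B0 * 1 + (2 * BR / r) * (D * r) = q * B0 + 2 * BR * D" using r by simp
    finally have "\<bar>dvg (kappa j) (kappa' j) r\<bar> <= q * B0 + 2 * BR * D" by simp
    hence "\<bar>phi x\<bar> * \<bar>dvg (kappa j) (kappa' j) r\<bar> <= B2 * (q * B0 + 2 * BR * D)"
     using B2[of x] elim B by (intro mult_mono) auto
    thus ?thesis by (simp add: r_def abs_mult)
   qed
  qed
 qed (use mF borel_measurable_integrable[OF parts(3)] in auto)
 have L2: "(%j. LINT x|?M. kappa j (norm x) * (grad phi x \<bullet> x)) \<longlonglongrightarrow> (LINT x|?M. radial_grad (%r. J r / r ^ n) x \<bullet> grad phi x)"
 proof (rule integral_dominated_convergence[where w="%x. D * b * norm (grad phi x)"])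
  show "integrable ?M (%x. D * b * norm (grad phi x))" by (intro integrable_continuous_Omega continuous_intros cg)
  show "AE x in ?M. (%j. kappa j (norm x) * (grad phi x \<bullet> x)) \<longlonglongrightarrow> radial_grad (%r. J r / r ^ n) x \<bullet> grad phi x"
   using AEr
  proof eventually_elim
   case (elim x)
   show ?case
   proof (cases "x : K")
    case False thus ?thesis using K(3) by simp
   next
    case True
    have r: "norm x > 0" using elim a0 by auto
    note x1 = xi(4)[OF Kcd[OF True]]
    show ?thesis
    proof (rule tendsto_eventually)
     show "\<forall>\<^sub>F j in sequentially. kappa j (norm x) * (grad phi x \<bullet> x) = radial_grad (%r. J r / r ^ n) x \<bullet> grad phi x"
      using ev[OF r]
     proof eventually_elim
      case (elim j)
      have "kappa j (norm x) = J (norm x) / norm x ^ Suc n"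
       unfolding kappa(5) zeta_def using \<open>norm x : {a<..<b} & x : Omega\<close> x1 R(5)[OF elim] by simp
      thus ?case using \<open>norm x : {a<..<b} & x : Omega\<close>
       by (simp add: radial_grad_def exd_def sgn_div_norm inner_commute divide_inverse ac_simps)
     qed
    qed
   qed
  qed
  show "AE x in ?M. norm (kappa j (norm x) * (grad phi x \<bullet> x)) <= D * b * norm (grad phi x)" for j
   using AEr
  proof eventually_elim
   case (elim x)
   define r where "r = norm x"
   have r: "r > 0" "r : {a<..<b}" using elim a0 by (auto simp: r_def)
   have "\<bar>zeta j r\<bar> <= D * r ^ Suc n * (1 * 1)"
   proof -
    have "\<bar>J r\<bar> * (\<bar>xi r\<bar> * \<bar>R (k j * r)\<bar>) <= D * r ^ Suc n * (1 * 1)"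
     using D[OF r(2)] xi(3)[of r] R(3)[of "k j * r"] D0 r by (intro mult_mono) auto
    thus ?thesis using r by (simp add: zeta_def abs_mult)
   qed
   hence k1: "\<bar>kappa j r\<bar> <= D" using r unfolding kappa(5) by (simp add: divide_le_eq del: power_Suc)
   have "\<bar>grad phi x \<bullet> x\<bar> <= norm (grad phi x) * r" unfolding r_def by (rule Cauchy_Schwarz_ineq2)
   also have "... <= norm (grad phi x) * b" using r by (intro mult_left_mono) auto
   finally have "\<bar>kappa j r\<bar> * \<bar>grad phi x \<bullet> x\<bar> <= D * (norm (grad phi x) * b)" using k1 D0 by (intro mult_mono) auto
   thus ?case by (simp add: r_def abs_mult ac_simps)
  qed
 qed (use mg continuous_measurable_Omega[OF cg] borel_measurable_integrable[OF parts(2)] in auto)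
 have "(LINT x|?M. - F x) = - (LINT x|?M. radial_grad (%r. J r / r ^ n) x \<bullet> grad phi x)"
  using LIMSEQ_unique[OF L1] tendsto_minus[OF L2] unfolding parts(1) by blast
 thus "(LINT x|?M. radial_grad (%r. J r / r ^ n) x \<bullet> grad phi x) = (LINT x|?M. exd Q (norm x) * ext psi (norm x) * phi x)"
  by (simp add: F_def)
qed

end


section \<open>Nodal zones\<close>

text \<open>Near \<open>x\<close> the function is almost everywhere within \<open>e / 2\<close> of
  \<open>v x\<close>, and so are its averages over small balls.\<close>

lemma precise_rep_eq:
 fixes u :: "real^'n => real"
 assumes S: "open S" "x : S" and u: "u : borel_measurable (lebesgue_on S)"
  and ae: "AE y in lebesgue_on S. u y = v y" and v: "isCont v x"
 shows "precise_rep u x = v x"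
proof -
 have Sm: "S : sets lebesgue" using S by auto
 have lim: "(ball_average u x \<longlongrightarrow> v x) (at_right 0)"
 proof (rule tendstoI)
  fix e :: real assume e: "e > 0"
  obtain d1 where d1: "d1 > 0" "!!y. dist y x < d1 ==> dist (v y) (v x) < e / 2"
   using v[unfolded continuous_at_eps_delta] e by (metis half_gt_zero)
  obtain d2 where d2: "d2 > 0" "ball x d2 <= S" using S open_contains_ball by blast
  have "dist (ball_average u x r) (v x) < e" if r: "0 < r" "r < min d1 d2" for r
  proof -
   let ?B = "ball x r"
   let ?M = "lebesgue_on ?B"
   have BS: "?B <= S" using d2 r by auto
   have Bm: "?B : sets lebesgue" by simp
   define m where "m = measure lebesgue ?B"
   have m: "m > 0" unfolding m_def using content_ball_pos[OF r(1), of x] by (simp add: measure_completion)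
   have um: "u : borel_measurable ?M" by (rule measurable_restrict_mono[OF u BS])
   have "AE y in lebesgue. y : ?B --> \<bar>u y - v x\<bar> <= e / 2"
    using ae[unfolded AE_lebesgue_on[OF Sm]]
   proof eventually_elim
    case (elim y)
    show ?case
    proof
     assume y: "y : ?B"
     hence "dist y x < d1" using r by (simp add: dist_commute)
     from d1(2)[OF this] show "\<bar>u y - v x\<bar> <= e / 2" using elim y BS by (auto simp: dist_real_def)
    qed
   qed
   hence ae': "AE y in ?M. \<bar>u y - v x\<bar> <= e / 2" unfolding AE_lebesgue_on[OF Bm] .
   have fin: "emeasure ?M (space ?M) < \<infinity>"
    using emeasure_bounded_finite[OF bounded_ball, of x r] by (simp add: emeasure_restrict_space space_restrict_space)
   interpret finite_measure ?M by (rule finite_measureI) (use fin in auto)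
   have diff: "integrable ?M (%y. u y - v x)"
    by (rule integrable_const_bound[of _ "e / 2"]) (use ae' um in auto)
   have "integrable ?M (%y. (u y - v x) + v x)" by (intro Bochner_Integration.integrable_add diff) simp
   hence ui: "integrable ?M u" by simp
   have ms: "measure ?M (space ?M) = m" using Bm by (simp add: m_def measure_restrict_space space_restrict_space)
   have "(LINT y|?M. u y) - v x * m = (LINT y|?M. u y - v x)"
    using ui ms by (simp add: Bochner_Integration.integral_diff mult.commute)
   also have "\<bar>...\<bar> <= (LINT y|?M. \<bar>u y - v x\<bar>)" by (rule integral_abs_bound)
   also have "... <= (LINT y|?M. e / 2)" by (rule integral_mono_AE) (use diff ae' in auto)
   also have "... = e / 2 * m" using ms by (simp add: mult.commute)
   finally have "\<bar>(LINT y|?M. u y) - v x * m\<bar> / m <= e / 2" using m by (simp add: divide_le_eq)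
   moreover have "ball_average u x r - v x = ((LINT y|?M. u y) - v x * m) / m"
    unfolding ball_average_def m_def[symmetric] using m by (simp add: diff_divide_distrib)
   ultimately have "dist (ball_average u x r) (v x) <= e / 2" using m by (simp add: dist_real_def)
   thus ?thesis using e by linarith
  qed
  thus "\<forall>\<^sub>F r in at_right 0. dist (ball_average u x r) (v x) < e"
   unfolding eventually_at_right_field using d1 d2 by (intro exI[of _ "min d1 d2"]) auto
 qed
 hence "Lim (at_right 0) (ball_average u x) = v x" by (rule tendsto_Lim[rotated]) simp
 thus ?thesis using lim unfolding precise_rep_def by auto
qed

context radial_domain
begin

text \<open>The quantification over \<open>beta\<close> serves the induction: when a largest zero
  \<open>z\<close> is added, it becomes the bound \<open>beta\<close> for the old counts, and the
  one new count is reached between \<open>z\<close> and the given bound.\<close>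

lemma zones_reach:
 fixes w :: "real => real"
 assumes dense: "!!s t. a <= s ==> s < t ==> t <= b ==> EX r:{s<..<t}. w r ~= 0" and Z: "finite Z" "Z <= {a<..<b}"
 shows "ALL beta. beta <= b & a < beta & (ALL z:Z. z < beta) --> (ALL j<=card Z. EX t:{a<..<beta}. w t ~= 0 & card {z\<in>Z. z < t} = j)"
 using Z
proof (induction Z rule: finite_linorder_max_induct)
 case empty
 thus ?case using dense[of a] by auto
next
 case (insert z Z)
 show ?case
 proof (intro allI impI)
  fix beta j assume beta: "beta <= b & a < beta & (ALL z:insert z Z. z < beta)" and j: "j <= card (insert z Z)"
  have z: "a < z" "z < b" "z < beta" using insert.prems beta by auto
  have nin: "z ~: Z" using insert.hyps by auto
  show "EX t:{a<..<beta}. w t ~= 0 & card {y\<in>insert z Z. y < t} = j"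
  proof (cases "j <= card Z")
   case True
   have "ALL j<=card Z. EX t:{a<..<z}. w t ~= 0 & card {y\<in>Z. y < t} = j"
    using insert.IH insert.prems insert.hyps(2) z by auto
   then obtain t where t: "t : {a<..<z}" "w t ~= 0" "card {y\<in>Z. y < t} = j" using True by blast
   moreover have "{y\<in>insert z Z. y < t} = {y\<in>Z. y < t}" using t(1) by auto
   ultimately show ?thesis using z by (intro bexI[of _ t]) auto
  next
   case False
   hence j': "j = Suc (card Z)" using j nin insert.hyps(1) by simp
   obtain t where t: "t : {z<..<beta}" "w t ~= 0" using dense[of z beta] z beta by auto
   have "{y\<in>insert z Z. y < t} = insert z Z" using t(1) insert.hyps(2) by force
   thus ?thesis using t z j' nin insert.hyps(1) by (intro bexI[of _ t]) auto
  qed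
 qed
qed

text \<open>The index of a point, the number of zero radii below its norm, is constant on connected
  subsets of \<open>S\<close>, takes every value from 0 to the number of zeros, and separates
  components: two points of equal index lie in a spherical shell on which the solution does not
  vanish, and shells are connected as the dimension is at least 2.\<close>

theorem nodal_zones_card:
 assumes w: "continuous_on ({a..b} - {0}) w" and u: "u : borel_measurable (leb)"
  and ae: "AE x in leb. u x = w (norm x)"
  and dense: "!!s t. a <= s ==> s < t ==> t <= b ==> EX r:{s<..<t}. w r ~= 0"
  and fin: "finite (nodal_zones Omega u)"
 shows "finite {t\<in>{a<..<b}. w t = 0}" "card (nodal_zones Omega u) = Suc (card {t\<in>{a<..<b}. w t = 0})"
proof -
 define S where "S = {x\<in>Omega. precise_rep u x ~= 0}"
 define Z where "Z = {t\<in>{a<..<b}. w t = 0}"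
 have comp: "nodal_zones Omega u = components S" by (simp add: nodal_zones_def S_def)
 have rep: "precise_rep u x = w (norm x)" if x: "x : Omega" "x ~= 0" for x
 proof (rule precise_rep_eq[OF open_Omega x(1) u ae])
  have r: "norm x : {a<..<b}" using mem_Omega[OF x(2)] x(1) by simp
  have "continuous_on {a<..<b} w" by (rule continuous_on_subset[OF w]) (use a0 in auto)
  hence "isCont w (norm x)" using r by (simp add: continuous_on_eq_continuous_at)
  moreover have "isCont norm x" by (intro continuous_intros)
  ultimately show "isCont (%x. w (norm x)) x" by (rule isCont_o2[rotated])
 qed
 \<comment> \<open>The origin is set aside, since \<open>w\<close> is not assumed continuous
   there.\<close>
 have S0: "x : S \<longleftrightarrow> norm x : {a<..<b} & w (norm x) ~= 0" if "x ~= 0" for x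
  using rep[of x] mem_Omega[OF that] that by (auto simp: S_def)
 define idx where "idx = (%Z (x::real^'n). card {z\<in>Z. z < norm x})"
 have same: "idx Z0 x = idx Z0 y" if T: "connected T" "T <= S" "x : T" "y : T" and Z0: "Z0 <= Z" for Z0 T x y
 proof -
  have *: "{z\<in>Z0. z < norm x} = {z\<in>Z0. z < norm y}" if xy: "x : T" "y : T" "norm x <= norm y" for x y
  proof -
   have False if z: "z : Z0" "z < norm y" "norm x <= z" for z
   proof -
    have "connected (norm ` T)" by (intro connected_continuous_image T continuous_intros)
    from connected_contains_Icc[OF this] have "{norm x..norm y} <= norm ` T" using xy by blast
    hence "z : norm ` T" using z by auto
    then obtain q where q: "q : T" "norm q = z" by auto
    have zZ: "z : {a<..<b}" "w z = 0" using Z0 z(1) by (auto simp: Z_def)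
    hence "q ~= 0" using q a0 by auto
    thus False using S0[of q] q T(2) zZ by auto
   qed
   thus ?thesis using xy(3) by force
  qed
  show ?thesis
  proof (cases "norm x <= norm y")
   case True
   show ?thesis unfolding idx_def by (rule arg_cong[OF *[OF T(3,4) True]])
  next
   case False
   hence "norm y <= norm x" by simp
   show ?thesis unfolding idx_def by (rule arg_cong[OF *[OF T(4,3) \<open>norm y <= norm x\<close>], symmetric])
  qed
 qed
 define f where "f = (%Z0 T. idx Z0 (SOME x. x : T))"
 have f: "f Z0 T = idx Z0 x" if T: "T : components S" "x : T" and Z0: "Z0 <= Z" for Z0 T x
  unfolding f_def by (rule same[OF in_components_connected[OF T(1)] in_components_subset[OF T(1)] _ T(2) Z0]) (rule someI[of "%x. x : T", OF T(2)])
 obtain e :: "real^'n" where e: "norm e = 1" using vector_choose_size[of 1] by auto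
 have onto: "{..card Z0} <= f Z0 ` components S" if Z0: "finite Z0" "Z0 <= Z" for Z0
 proof
  fix j assume j: "j : {..card Z0}"
  have sub: "Z0 <= {a<..<b}" using Z0 by (auto simp: Z_def)
  have reach: "ALL beta. beta <= b & a < beta & (ALL z:Z0. z < beta) --> (ALL j<=card Z0. EX t:{a<..<beta}. w t ~= 0 & card {z\<in>Z0. z < t} = j)"
   by (rule zones_reach[OF _ Z0(1) sub]) (rule dense)
  have "EX t:{a<..<b}. w t ~= 0 & card {z\<in>Z0. z < t} = j"
   by (rule reach[rule_format]) (use sub ab j in auto)
  then obtain t where t: "t : {a<..<b}" "w t ~= 0" "card {z\<in>Z0. z < t} = j" by blast
  define x where "x = t *\<^sub>R e"
  have x: "norm x = t" using e t a0 by (simp add: x_def)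
  hence "x ~= 0" using t a0 by auto
  hence xS: "x : S" using S0[of x] x t by simp
  let ?T = "connected_component_set S x"
  have T: "?T : components S" using xS by (simp add: components_def)
  moreover have "x : ?T" using xS by simp
  ultimately have "f Z0 ?T = j" using f[OF T _ Z0(2), of x] t(3) x by (simp add: idx_def)
  thus "j : f Z0 ` components S" using T by blast
 qed
 have ge: "Suc (card Z0) <= card (components S)" if Z0: "finite Z0" "Z0 <= Z" for Z0
 proof -
  have "card {..card Z0} <= card (f Z0 ` components S)" using fin comp by (intro card_mono onto Z0) auto
  also have "... <= card (components S)" using fin comp by (intro card_image_le) simp
  finally show ?thesis by simp
 qed
 \<comment> \<open>Finite subsets of the zero set already give lower bounds for the number of
   components; since this number is finite, so is the zero set.\<close>
 have finZ: "finite Z"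
 proof (rule ccontr)
  assume "infinite Z"
  then obtain Z0 where "Z0 <= Z" "finite Z0" "card Z0 = card (components S)" using infinite_arbitrarily_large by blast
  thus False using ge[of Z0] by simp
 qed
 thus "finite {t\<in>{a<..<b}. w t = 0}" by (simp add: Z_def)
 have inj: "inj_on (f Z) (components S)"
 proof (rule inj_onI)
  fix T1 T2 assume T: "T1 : components S" "T2 : components S" and eq: "f Z T1 = f Z T2"
  obtain x where x: "x : T1" using in_components_nonempty[OF T(1)] by blast
  obtain y where y: "y : T2" using in_components_nonempty[OF T(2)] by blast
  have xyS: "x : S" "y : S" using in_components_subset[OF T(1)] in_components_subset[OF T(2)] x y by auto
  have ixy: "idx Z x = idx Z y" using f[OF T(1) x] f[OF T(2) y] eq by simp
  have no: "z ~: Z" if z: "norm p <= z" "z < norm q" and pq: "idx Z p = idx Z q" for p q :: "real^'n" and z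
  proof
   assume "z : Z"
   hence "{z\<in>Z. z < norm p} <= {z\<in>Z. z < norm q}" "z : {z\<in>Z. z < norm q}" "z ~: {z\<in>Z. z < norm p}"
    using z by auto
   hence "{z\<in>Z. z < norm p} \<subset> {z\<in>Z. z < norm q}" by blast
   hence "idx Z p < idx Z q" unfolding idx_def using finZ by (intro psubset_card_mono) auto
   thus False using pq by simp
  qed
  define r1 where "r1 = min (norm x) (norm y)"
  define r2 where "r2 = max (norm x) (norm y)"
  define A where "A = {q::real^'n. r1 <= norm (q - 0) & norm (q - 0) <= r2}"
  have cA: "connected A" unfolding A_def by (rule connected_annulus(4)) (use dim in simp)
  have "A <= S"
  proof
   fix q assume q: "q : A"
   show "q : S"
   proof (cases "q = 0")
    \<comment> \<open>The shell contains the origin only if \<open>x\<close> or \<open>y\<close> is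
      the origin, which then lies in \<open>S\<close> as a point of a component.\<close>
    case True
    hence "r1 <= 0" using q by (simp add: A_def)
    hence "x = 0 | y = 0" by (auto simp: r1_def min_def split: if_splits)
    thus ?thesis using True xyS by auto
   next
    case False
    have le: "norm x < b" "norm y < b" "a = 0 | a < norm x & a < norm y"
     using xyS Omega by (auto simp: S_def)
    have qb: "norm q : {a<..<b}"
     using q le False a0 by (auto simp: A_def r1_def r2_def min_def max_def split: if_splits)
    have "w (norm q) ~= 0"
    proof
     assume "w (norm q) = 0"
     hence qZ: "norm q : Z" using qb by (simp add: Z_def)
     have neq: "norm q ~= norm p" if "p : S" for p
      using S0[of p] that \<open>w (norm q) = 0\<close> False by (cases "p = 0") auto
     show False
     proof (cases "norm x <= norm y")
      case True
      hence "norm x <= norm q" "norm q < norm y" using q neq[OF xyS(2)] by (auto simp: A_def r1_def r2_def)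
      from no[OF this ixy] qZ show False by simp
     next
      case False
      hence "norm y <= norm q" "norm q < norm x" using q neq[OF xyS(1)] by (auto simp: A_def r1_def r2_def)
      from no[OF this ixy[symmetric]] qZ show False by simp
     qed
    qed
    thus ?thesis using S0[OF False] qb by simp
   qed
  qed
  moreover have "x : A" "y : A" by (auto simp: A_def r1_def r2_def)
  ultimately show "T1 = T2" using joinable_components_eq[of A S T1 T2] cA T x y by blast
 qed
 have "f Z ` components S <= {..card Z}"
 proof
  fix j assume "j : f Z ` components S"
  thus "j : {..card Z}" using finZ by (auto simp: f_def idx_def intro!: card_mono)
 qed
 hence "card (components S) <= Suc (card Z)"
  using card_mono[of "{..card Z}" "f Z ` components S"] card_image[OF inj] by simp
 thus "card (nodal_zones Omega u) = Suc (card {t\<in>{a<..<b}. w t = 0})"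
  using ge[OF finZ] comp by (simp add: Z_def)
qed

end


section \<open>Solutions and eigenfunctions as profiles\<close>

lemma powr_half_Suc: "r > 0 ==> r powr (real (Suc n) / 2) = sqrt (r ^ n) * sqrt r" for r :: real
proof -
 assume r: "r > 0"
 have "r powr (real (Suc n) / 2) = (r powr real (Suc n)) powr (1 / 2)" by (simp add: powr_powr)
 also have "... = sqrt (r ^ Suc n)" using r by (simp add: powr_realpow powr_half_sqrt del: power_Suc of_nat_Suc)
 also have "... = sqrt (r ^ n) * sqrt r" by (simp add: real_sqrt_mult)
 finally show ?thesis .
qed

text \<open>The decay of order \<open>r powr (- n / 2)\<close> of \<open>y\<close> and a bounded
  potential give \<open>K'\<close> the order \<open>r powr (n / 2)\<close>. With the limit 0 at the
  origin, \<open>K\<close> has the order \<open>r powr (n / 2 + 1)\<close>, better by a factor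
  \<open>sqrt r\<close> than the comparison power \<open>r powr ((n + 1) / 2)\<close>.\<close>

lemma origin_decayI:
 fixes y K :: "real => real"
 assumes b: "b > 0" and y: "!!r. r : {0<..b} ==> \<bar>y r\<bar> * sqrt (r ^ n) <= D" and K: "(K \<longlongrightarrow> 0) (at_right 0)"
  and dK: "!!r. r : {0<..<b} ==> (K has_real_derivative - (r ^ n * (Q r * y r))) (at r)" and Q: "!!r. r : {0<..<b} ==> \<bar>Q r\<bar> <= B"
 shows "origin_decay b n y K"
proof -
 have B0: "B >= 0" using Q[of "b / 2"] b by fastforce
 have D0: "D >= 0" using order_trans[OF _ y[of b]] b by simp
 have "\<bar>y r * r powr (real (Suc n) / 2)\<bar> <= D * sqrt b" if r: "r : {0<..b}" for r
 proof -
  have "\<bar>y r * r powr (real (Suc n) / 2)\<bar> = (\<bar>y r\<bar> * sqrt (r ^ n)) * sqrt r"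
   using powr_half_Suc[of r n] r by (simp add: abs_mult mult.assoc del: of_nat_Suc)
  also have "... <= D * sqrt b" using y[OF r] r D0 by (intro mult_mono) auto
  finally show ?thesis .
 qed
 moreover have "((%r. K r / r powr (real (Suc n) / 2)) \<longlongrightarrow> 0) (at_right 0)"
 proof (rule Lim_null_comparison)
  show "((%r. B * D * sqrt r) \<longlongrightarrow> 0) (at_right 0)" by (rule tendsto_eq_intros | simp)+
  have "norm (K r / r powr (real (Suc n) / 2)) <= B * D * sqrt r" if r: "0 < r" "r < b" for r
  proof -
   define L where "L = B * D * sqrt (r ^ n)"
   have L0: "L >= 0" using B0 D0 r by (simp add: L_def)
   have diff: "\<bar>K r - K s\<bar> <= L * r" if s: "0 < s" "s < r" for s
   proof -
    have "EX x>s. x < r & K r - K s = (r - s) * - (x ^ n * (Q x * y x))" by (rule MVT2[OF s(2)]) (use dK s r in auto)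
    then obtain x where x: "s < x" "x < r" "K r - K s = (r - s) * - (x ^ n * (Q x * y x))" by blast
    have xn: "x ^ n = sqrt (x ^ n) * sqrt (x ^ n)" using x s by simp
    have "\<bar>x ^ n * (Q x * y x)\<bar> = (\<bar>Q x\<bar> * (\<bar>y x\<bar> * sqrt (x ^ n))) * sqrt (x ^ n)"
     using x s by (subst xn) (simp add: abs_mult ac_simps)
    also have "... <= (B * D) * sqrt (r ^ n)"
    proof (intro mult_mono)
     show "sqrt (x ^ n) <= sqrt (r ^ n)" using x s by (simp add: power_mono)
    qed (use Q[of x] y[of x] x s r B0 D0 in auto)
    finally have le: "\<bar>x ^ n * (Q x * y x)\<bar> <= L" by (simp add: L_def)
    have "\<bar>K r - K s\<bar> = (r - s) * \<bar>x ^ n * (Q x * y x)\<bar>" unfolding x(3) using s by (simp add: abs_mult)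
    also have "... <= r * L" using le s by (intro mult_mono) auto
    finally show ?thesis by (simp add: mult.commute)
   qed
   have "((%s. \<bar>K r - K s\<bar>) \<longlongrightarrow> \<bar>K r - 0\<bar>) (at_right 0)" by (intro tendsto_intros K)
   moreover have "\<forall>\<^sub>F s in at_right 0. \<bar>K r - K s\<bar> <= L * r"
    unfolding eventually_at_right_field using diff r by (intro exI[of _ r]) auto
   ultimately have "\<bar>K r - 0\<bar> <= L * r" by (rule tendsto_upperbound) simp
   hence "\<bar>K r\<bar> / (sqrt (r ^ n) * sqrt r) <= L * r / (sqrt (r ^ n) * sqrt r)" using r by (intro divide_right_mono) auto
   also have "L * r / (sqrt (r ^ n) * sqrt r) = B * D * (r / sqrt r)" using r by (simp add: L_def)
   also have "r / sqrt r = sqrt r" using r by (simp add: real_div_sqrt)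
   finally show ?thesis using powr_half_Suc[of r n] r by (simp del: of_nat_Suc)
  qed
  thus "\<forall>\<^sub>F r in at_right 0. norm (K r / r powr (real (Suc n) / 2)) <= B * D * sqrt r"
   unfolding eventually_at_right_field using b by (intro exI[of _ b]) auto
 qed
 ultimately show ?thesis unfolding origin_decay_def by blast
qed

context radial_domain
begin

lemma AE_radius: "AE x in leb. norm x : {a<..<b}"
 unfolding AE_lebesgue_on[OF sets_Omega] using AE_nonzero by eventually_elim (auto simp: mem_Omega)

lemma AE_profile:
 assumes "AE r in lborel. r : {a<..<b} --> P r"
 shows "AE x in leb. P (norm x)"
proof -
 have "AE r in lborel. r > 0 --> (r : {a<..<b} --> P r)" using assms by eventually_elim auto
 from radial_AE[OF _ this, where 'a="real^'n"] have "AE x::real^'n in lborel. norm x : {a<..<b} --> P (norm x)"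
  using dim by simp
 hence "AE x::real^'n in lebesgue. norm x : {a<..<b} --> P (norm x)" by (rule AE_completion)
 thus ?thesis unfolding AE_lebesgue_on[OF sets_Omega] using AE_nonzero
 proof eventually_elim
  case (elim x)
  thus ?case using mem_Omega[of x] by auto
 qed
qed

lemma H1_0_test_integrable:
 assumes u: "u : H1_0 Omega" and phi: "phi : C1_0 Omega"
 shows "integrable (leb) (%x. u x * phi x)"
proof -
 note um = H1_0_integrable[OF u] and cp = C1_0_continuous[OF phi]
 obtain B2 where B2: "!!x. x : Omega ==> norm (phi x) <= B2" using continuous_bounded_Omega[OF cp] by blast
 show ?thesis
 proof (rule Bochner_Integration.integrable_bound[of _ "%x. B2 * u x"])
  show "integrable (leb) (%x. B2 * u x)" using um(2) by simp
  show "(%x. u x * phi x) : borel_measurable (leb)" using um(1) continuous_measurable_Omega[OF cp] by simp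
  show "AE x in leb. norm (u x * phi x) <= norm (B2 * u x)"
  proof (rule AE_I2)
   fix x assume "x : space (leb)"
   hence "\<bar>phi x\<bar> <= \<bar>B2\<bar>" using B2[of x] by auto
   thus "norm (u x * phi x) <= norm (B2 * u x)"
    using mult_right_mono[of "\<bar>phi x\<bar>" "\<bar>B2\<bar>" "\<bar>u x\<bar>"] by (simp add: abs_mult mult.commute)
  qed
 qed
qed

lemma not_AE_False: "\<not> (AE x in leb. False)"
proof
 assume "AE x in leb. False"
 hence "AE x in lebesgue. x ~: Omega" unfolding AE_lebesgue_on[OF sets_Omega] by simp
 hence "Omega : null_sets lebesgue" using sets_Omega by (simp add: AE_iff_null_sets)
 hence "negligible Omega" by (simp add: negligible_iff_null_sets)
 moreover have "Omega ~= {}"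
 proof -
  obtain e :: "real^'n" where e: "norm e = 1" using vector_choose_size[of 1] by auto
  have "((a + b) / 2) *\<^sub>R e : Omega" by (rule mem_OmegaI) (use e a0 ab in auto)
  thus ?thesis by blast
 qed
 ultimately show False using open_not_negligible[OF open_Omega] by blast
qed

text \<open>The nonlinear equation is put into the form of \<open>representative\<close> with a
  continuous right-hand side \<open>hh\<close>; the count of nodal zones then supplies the
  finiteness of the zero set that the profile requires.\<close>

theorem solution_profile:
 assumes p: "p > 1" and alpha: "alpha >= 0" and u: "u : H1_0_rad Omega" "weak_henon_solution Omega alpha p u"
  and fin: "finite (nodal_zones Omega u)" "card (nodal_zones Omega u) = m" "m >= 1"
 shows "EX w J. henon_profile a b alpha p n w J & (AE x in leb. u x = w (norm x)) & m = Suc (card {t\<in>{a<..<b}. w t = 0})"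
proof -
 have uH: "u : H1_0 Omega" using u(1) unfolding H1_0_rad_def by blast
 obtain f where f: "f : borel_measurable borel" "AE x in leb. u x = f (norm x)"
  using radial_borel_representative_Omega[OF u(1)] by blast
 define h where "h = (%r. r powr alpha * \<bar>f r\<bar> powr (p - 1) * f r)"
 define g where "g = (%x::real^'n. norm x powr alpha * \<bar>u x\<bar> powr (p - 1) * u x)"
 have "EX C. radial_weak a b C n f h"
 proof (rule radial_weak_equation[OF uH f, of h g])
  show "h : borel_measurable borel" unfolding h_def using f(1) by measurable
  show "AE x in leb. g x = h (norm x)" using f(2) by eventually_elim (simp add: g_def h_def)
 qed (use u(2) in "auto simp: weak_henon_solution_def g_def")
 then obtain C where C: "radial_weak a b C n f h" by blast
 define hh where "hh = (%r y :: real. r powr alpha * \<bar>y\<bar> powr (p - 1) * y)"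
 have chh: "continuous_on (({a..b} - {0}) \<times> UNIV) (%(r, y). hh r y)"
 proof -
  have 1: "continuous_on (({a..b} - {0}) \<times> (UNIV :: real set)) (%x. fst x powr alpha)"
   by (rule continuous_on_powr'[OF continuous_on_fst[OF continuous_on_id] continuous_on_const]) (use a0 in auto)
  have 2: "continuous_on (({a..b} - {0}) \<times> (UNIV :: real set)) (%x. \<bar>snd x\<bar> powr (p - 1))"
   by (rule continuous_on_powr'[OF continuous_on_rabs[OF continuous_on_snd[OF continuous_on_id]] continuous_on_const]) (use p in auto)
  have 3: "continuous_on (({a..b} - {0}) \<times> (UNIV :: real set)) snd" by (rule continuous_on_snd[OF continuous_on_id])
  show ?thesis unfolding hh_def case_prod_beta by (rule continuous_on_mult[OF continuous_on_mult[OF 1 2] 3])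
 qed
 have "AE r in lborel. r : {a<..<b} --> h r = hh r (f r)" by (simp add: h_def hh_def)
 from radial_weak.representative[OF C chh this] obtain w J where
  fw: "AE r in lborel. r : {a<..<b} --> f r = w r" and cw: "continuous_on ({a..b} - {0}) w" and cJ: "continuous_on ({a..b} - {0}) J"
  and der: "ALL r:{a<..<b}. (w has_real_derivative J r / r ^ n) (at r) & (J has_real_derivative - (r ^ n * hh r (w r))) (at r)"
  and bc: "w b = 0" "a > 0 --> w a = 0"
  and orig: "a = 0 --> (J \<longlongrightarrow> 0) (at_right 0) &
   (EX e M. ALL r:{0<..<b}. (e has_real_derivative (J r)^2 / r ^ n) (at r) & \<bar>e r\<bar> <= M) &
   (EX D. ALL r:{0<..b}. \<bar>w r\<bar> * sqrt (r ^ n) <= D)"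
  by blast
 have uw: "AE x in leb. u x = w (norm x)"
  using f(2) AE_profile[OF fw] by eventually_elim simp
 have cQ: "continuous_on ({a..b} - {0}) (%r. r powr alpha * \<bar>w r\<bar> powr (p - 1))"
 proof -
  have 1: "continuous_on ({a..b} - {0}) (%r. r powr alpha)"
   by (rule continuous_on_powr'[OF continuous_on_id continuous_on_const]) (use a0 in auto)
  have 2: "continuous_on ({a..b} - {0}) (%r. \<bar>w r\<bar> powr (p - 1))"
   by (rule continuous_on_powr'[OF continuous_on_rabs[OF cw] continuous_on_const]) (use p in auto)
  show ?thesis by (rule continuous_on_mult[OF 1 2])
 qed
 have sl: "sl a b n (%r. r powr alpha * \<bar>w r\<bar> powr (p - 1)) w J"
  unfolding sl_def using a0 ab cQ cw cJ der by (auto simp: hh_def mult.assoc)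
 have um: "u : borel_measurable (leb)" by (rule H1_0_integrable(1)[OF uH])
 \<comment> \<open>For the zero solution the set of nodal zones is empty, contrary to
   \<open>m >= 1\<close>.\<close>
 have nontriv: "EX t:{a<..<b}. w t ~= 0"
 proof (rule ccontr)
  assume w0: "\<not> ?thesis"
  have "AE x in leb. u x = 0" using uw AE_radius by eventually_elim (use w0 in auto)
  hence "precise_rep u x = 0" if "x : Omega" for x
   using precise_rep_eq[OF open_Omega that um, of "%_. 0"] by simp
  hence "nodal_zones Omega u = components {}" unfolding nodal_zones_def by (metis (mono_tags, lifting) Collect_empty_eq)
  thus False using fin by simp
 qed
 have dense: "EX r:{s<..<t}. w r ~= 0" if st: "a <= s" "s < t" "t <= b" for s t
 proof (rule ccontr)
  assume "\<not> ?thesis"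
  hence z: "!!r. s < r ==> r < t ==> w r = 0" by auto
  obtain t0 where t0: "t0 : {a<..<b}" "w t0 ~= 0" using nontriv by blast
  have "w t0 = 0" by (rule sl_zero_interval[OF sl st(1,2,3) z]) (use t0 a0 in auto)
  thus False using t0 by simp
 qed
 have Z: "finite {t\<in>{a<..<b}. w t = 0} & card (nodal_zones Omega u) = Suc (card {t\<in>{a<..<b}. w t = 0})"
  by (intro conjI nodal_zones_card[OF cw um uw _ fin(1)]) (rule dense; assumption)+
 have "henon_profile a b alpha p n w J"
  by unfold_locales (use n p alpha sl bc nontriv Z orig in auto)
 thus ?thesis using uw Z fin by blast
qed

end

section \<open>Eigenvalues of the linearized operator and their multiplicities\<close>

locale henon_solution = radial_domain Omega a b for Omega :: "(real^'n) set" and a b :: real +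
 fixes alpha p :: real and u :: "real^'n => real" and w J :: "real => real"
 assumes prof: "henon_profile a b alpha p n w J" and u: "u : H1_0_rad Omega"
  and uw: "AE x in leb. u x = w (norm x)"
begin

definition q :: "real => real" where "q r = p * (r powr alpha * \<bar>w r\<bar> powr (p - 1))"

lemma q_eq: "q = henon_profile.q alpha p w"
 by (rule ext) (simp add: q_def henon_profile.q_def[OF prof])

lemma cont_q: "continuous_on ({a..b} - {0}) q"
 unfolding q_eq by (rule henon_profile.cont_q[OF prof])

lemma q_bounded: "EX B. ALL r:{a..b} - {0}. \<bar>q r\<bar> <= B"
 unfolding q_eq by (rule henon_profile.q_bounded[OF prof])

definition zones :: nat where "zones = Suc (card {t\<in>{a<..<b}. w t = 0})"

lemma zones_eq: "zones = henon_profile.zones a b w"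
 by (simp add: zones_def henon_profile.zones_def[OF prof])

lemma potential_AE: "AE x in leb. p * norm x powr alpha * \<bar>u x\<bar> powr (p - 1) = exd q (norm x)"
 using uw AE_radius by eventually_elim (simp add: q_def exd_def)

text \<open>The eigenvalue equation is a weak equation with right-hand side
  \<open>(q + mu) * psi\<close>, so \<open>representative\<close> applies. The growth bound it gives
  at the origin is converted by \<open>origin_decayI\<close> into the decay that admissibility asks
  for.\<close>

lemma eigenfunction_profile:
 assumes psi: "psi : radial_eigenspace Omega alpha p u mu"
 shows "EX y K. (AE x in leb. psi x = y (norm x)) & sl a b n (%r. q r + mu) y K & admissible a b n y K & y b = 0"
proof -
 have psir: "psi : H1_0_rad Omega" and psiH: "psi : H1_0 Omega" using psi unfolding radial_eigenspace_def H1_0_rad_def by auto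
 have int: "integrable (leb) (%x. p * norm x powr alpha * \<bar>u x\<bar> powr (p - 1) * psi x * phi x)"
  and eq: "(LINT x|leb. weak_grad Omega psi x \<bullet> grad phi x) -
  (LINT x|leb. p * norm x powr alpha * \<bar>u x\<bar> powr (p - 1) * psi x * phi x) = mu * (LINT x|leb. psi x * phi x)"
  if "phi : C1_0 Omega" for phi using psi that unfolding radial_eigenspace_def by auto
 obtain f where f: "f : borel_measurable borel" "AE x in leb. psi x = f (norm x)"
  using radial_borel_representative_Omega[OF psir] by blast
 have sub: "{a<..<b} <= {a..b} - {0}" using a0 by auto
 have "(%r. indicator {a<..<b} r *\<^sub>R q r) : borel_measurable borel"
  by (rule borel_measurable_continuous_on_indicator[OF _ continuous_on_subset[OF cont_q sub]]) simp
 moreover have "exd q = (%r. indicator {a<..<b} r *\<^sub>R q r)" by (auto simp: exd_def fun_eq_iff)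
 ultimately have em: "exd q : borel_measurable borel" by simp
 define h where "h = (%r. (exd q r + mu) * f r)"
 define g where "g = (%x. p * norm x powr alpha * \<bar>u x\<bar> powr (p - 1) * psi x + mu * psi x)"
 have split: "g x * phi x = p * norm x powr alpha * \<bar>u x\<bar> powr (p - 1) * psi x * phi x + mu * (psi x * phi x)" for phi x
  by (simp add: g_def algebra_simps)
 have "EX C. radial_weak a b C n f h"
 proof (rule radial_weak_equation[OF psiH f, of h g])
  show "h : borel_measurable borel" unfolding h_def using f(1) em by simp
  show "AE x in leb. g x = h (norm x)"
   using f(2) potential_AE by eventually_elim (simp add: g_def h_def distrib_right)
  fix phi assume phi: "phi : C1_0 Omega"
  note i = int[OF phi] and j = H1_0_test_integrable[OF psiH phi]
  show "integrable (leb) (%x. g x * phi x)" unfolding split using i j by simp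
  show "(LINT x|leb. weak_grad Omega psi x \<bullet> grad phi x) = (LINT x|leb. g x * phi x)"
   unfolding split using i j eq[OF phi] by simp
 qed
 then obtain C where C: "radial_weak a b C n f h" by blast
 define hh where "hh = (%r y :: real. (q r + mu) * y)"
 have chh: "continuous_on (({a..b} - {0}) \<times> UNIV) (%(r, y). hh r y)"
 proof -
  have 1: "continuous_on (({a..b} - {0}) \<times> (UNIV :: real set)) (%x. q (fst x))"
   by (rule continuous_on_compose2[OF cont_q continuous_on_fst[OF continuous_on_id]]) auto
  show ?thesis unfolding hh_def case_prod_beta by (intro continuous_intros 1)
 qed
 have "AE r in lborel. r : {a<..<b} --> h r = hh r (f r)" by (simp add: h_def hh_def exd_def)
 from radial_weak.representative[OF C chh this] obtain y K where
  fw: "AE r in lborel. r : {a<..<b} --> f r = y r" and cw: "continuous_on ({a..b} - {0}) y" and cK: "continuous_on ({a..b} - {0}) K"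
  and der: "ALL r:{a<..<b}. (y has_real_derivative K r / r ^ n) (at r) & (K has_real_derivative - (r ^ n * hh r (y r))) (at r)"
  and bc: "y b = 0" "a > 0 --> y a = 0"
  and orig: "a = 0 --> (K \<longlongrightarrow> 0) (at_right 0) &
   (EX e M. ALL r:{0<..<b}. (e has_real_derivative (K r)^2 / r ^ n) (at r) & \<bar>e r\<bar> <= M) &
   (EX D. ALL r:{0<..b}. \<bar>y r\<bar> * sqrt (r ^ n) <= D)"
  by blast
 have psiy: "AE x in leb. psi x = y (norm x)" using f(2) AE_profile[OF fw] by eventually_elim simp
 have sl: "sl a b n (%r. q r + mu) y K"
  unfolding sl_def using a0 ab cont_q cw cK der by (auto simp: hh_def mult.assoc intro!: continuous_intros)
 obtain B where B: "!!r. r : {a..b} - {0} ==> \<bar>q r\<bar> <= B" using q_bounded by blast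
 have "origin_decay b n y K" if a: "a = 0"
 proof -
  obtain D where D: "!!r. r : {0<..b} ==> \<bar>y r\<bar> * sqrt (r ^ n) <= D" using orig a by blast
  show ?thesis
  proof (rule origin_decayI[OF b0 D, where Q="%r. q r + mu" and B="B + \<bar>mu\<bar>"])
   show "(K \<longlongrightarrow> 0) (at_right 0)" using orig a by blast
   show "(K has_real_derivative - (r ^ n * ((q r + mu) * y r))) (at r)" if "r : {0<..<b}" for r
    using der that a by (auto simp: hh_def)
   show "\<bar>q r + mu\<bar> <= B + \<bar>mu\<bar>" if "r : {0<..<b}" for r using B[of r] that a by auto
  qed
 qed
 hence "admissible a b n y K" using bc by (simp add: admissible_def)
 thus ?thesis using psiy sl bc by blast
qed

text \<open>Conversely, a regular profile lies in \<open>H1_0_rad\<close> by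
  \<open>profile_H1_0\<close>, and its radial gradient satisfies the weak equation by
  \<open>profile_weak_equation\<close>.\<close>

lemma eigenfunction_exists:
 assumes sl: "sl a b n (%r. q r + mu) psi K" and reg: "regular_left a b n psi K" and bc: "psi b = 0" "K b ~= 0" and cpsi: "continuous_on {a..b} psi"
 shows "radial_eigenvalue Omega alpha p u mu"
proof -
 let ?M = "leb"
 let ?Psi = "%x::real^'n. ext psi (norm x)"
 have cK: "continuous_on ({a..b} - {0}) K" using sl by (simp add: sl_def)
 have sub: "{a<..<b} <= {a..b} - {0}" using a0 by auto
 have dpsi: "(psi has_real_derivative K r / r ^ n) (at r)" and dK: "(K has_real_derivative - (r ^ n * (q r + mu) * psi r)) (at r)"
  if "r : {a<..<b}" for r using sl that by (auto simp: sl_def)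
 have "EX D. ALL r:{a<..<b}. \<bar>K r\<bar> <= D * r ^ Suc n"
 proof (cases "a = 0")
  case True
  thus ?thesis using reg unfolding regular_left_def by (metis greaterThanAtMost_iff greaterThanLessThan_iff less_imp_le)
 next
  case False
  hence a: "a > 0" using a0 by simp
  have "continuous_on {a..b} (%r. K r / r ^ Suc n)"
   using a by (intro continuous_intros continuous_on_subset[OF cK]) auto
  hence "bounded ((%r. K r / r ^ Suc n) ` {a..b})" by (intro compact_imp_bounded compact_continuous_image) auto
  then obtain D where "ALL y:(%r. K r / r ^ Suc n) ` {a..b}. norm y <= D" unfolding bounded_iff by blast
  hence D: "\<bar>K r / r ^ Suc n\<bar> <= D" if "r : {a..b}" for r using that by auto
  have "\<bar>K r\<bar> <= D * r ^ Suc n" if "r : {a<..<b}" for r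
  proof -
   have "r ^ Suc n > 0" using that a by simp
   thus ?thesis using D[of r] that by (simp add: divide_le_eq del: power_Suc)
  qed
  thus ?thesis by blast
 qed
 then obtain D where D: "!!r. r : {a<..<b} ==> \<bar>K r\<bar> <= D * r ^ Suc n" by blast
 have dB: "\<bar>K r / r ^ n\<bar> <= D * r" if "r : {a<..<b}" for r
 proof -
  have "r ^ n > 0" using that a0 by simp
  thus ?thesis using D[OF that] by (simp add: divide_le_eq ac_simps)
 qed
 \<comment> \<open>A zero of \<open>psi\<close> with zero flux would propagate to \<open>b\<close>
   by uniqueness, against \<open>K b ~= 0\<close>.\<close>
 have nz: "K r / r ^ n ~= 0" if r: "r : {a<..<b}" "psi r = 0" for r
 proof
  assume "K r / r ^ n = 0"
  hence "K r = 0" using r a0 by auto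
  hence "K b = 0" using sl_zero_data[OF sl _ r(2), of b] r a0 ab by auto
  thus False using bc by simp
 qed
 have cd: "continuous_on {a<..<b} (%r. K r / r ^ n)"
  by (intro continuous_intros continuous_on_subset[OF cK sub]) (use a0 in auto)
 have psia: "a > 0 ==> psi a = 0" using reg by (simp add: regular_left_def)
 have Psi: "?Psi : H1_0_rad Omega" and wg: "AE x in ?M. weak_grad Omega ?Psi x = radial_grad (%r. K r / r ^ n) x"
  and ne: "AE x in ?M. ?Psi x ~= 0"
  by (rule profile_H1_0[where d="%r. K r / r ^ n" and B=D]; (rule cpsi dpsi cd dB bc(1) psia nz; assumption?))+
 have PsiH: "?Psi : H1_0 Omega" using Psi by (simp add: H1_0_rad_def)
 obtain B where B: "!!r. r : {a..b} - {0} ==> \<bar>q r\<bar> <= B" using q_bounded by blast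
 have um: "u : borel_measurable ?M" using u H1_0_integrable(1) by (simp add: H1_0_rad_def)
 have cq: "continuous_on {a<..<b} (%r. q r + mu)" by (intro continuous_intros continuous_on_subset[OF cont_q sub])
 have qb: "\<bar>q r + mu\<bar> <= B + \<bar>mu\<bar>" if "r : {a<..<b}" for r using B[of r] that a0 by auto
 have mem: "?Psi : radial_eigenspace Omega alpha p u mu"
  unfolding radial_eigenspace_def
 proof (intro CollectI conjI ballI Psi)
  fix phi assume phi: "phi : C1_0 Omega"
  note cg = C1_0_grad[OF phi] and cp = C1_0_continuous[OF phi]
  let ?G = "%x. p * norm x powr alpha * \<bar>u x\<bar> powr (p - 1) * ?Psi x * phi x"
  let ?F = "%x. exd (%r. q r + mu) (norm x) * ?Psi x * phi x"
  note W = profile_weak_equation[where J=K and Q="%r. q r + mu" and psi=psi and D=D and q="B + \<bar>mu\<bar>" and phi=phi]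
  have Fi: "integrable ?M ?F" by (rule W(1); (rule dK cq cpsi D qb phi; assumption?))
  have FW: "(LINT x|?M. radial_grad (%r. K r / r ^ n) x \<bullet> grad phi x) = (LINT x|?M. ?F x)"
   by (rule W(2); (rule dK cq cpsi D qb phi; assumption?))
  note Psiphi = H1_0_test_integrable[OF PsiH phi]
  have "norm : borel_measurable ?M" by (rule continuous_measurable_Omega) (rule continuous_on_norm_id)
  hence Gm: "?G : borel_measurable ?M"
   using um H1_0_integrable(1)[OF PsiH] continuous_measurable_Omega[OF cp] by measurable
  have ae: "AE x in ?M. ?F x - mu * (?Psi x * phi x) = ?G x"
   using potential_AE AE_radius by eventually_elim (simp add: exd_def algebra_simps)
  have di: "integrable ?M (%x. ?F x - mu * (?Psi x * phi x))" using Fi Psiphi by simp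
  show "integrable ?M ?G" by (rule integrable_cong_AE[THEN iffD1, OF _ Gm ae di]) (rule borel_measurable_integrable[OF di])
  have "(LINT x|?M. ?G x) = (LINT x|?M. ?F x - mu * (?Psi x * phi x))"
   by (rule integral_cong_AE[OF Gm borel_measurable_integrable[OF di]]) (use ae in "auto elim: eventually_mono")
  also have "... = (LINT x|?M. ?F x) - mu * (LINT x|?M. ?Psi x * phi x)" using Fi Psiphi by simp
  finally have G: "(LINT x|?M. ?G x) = (LINT x|?M. ?F x) - mu * (LINT x|?M. ?Psi x * phi x)" .
  have "(LINT x|?M. weak_grad Omega ?Psi x \<bullet> grad phi x) = (LINT x|?M. radial_grad (%r. K r / r ^ n) x \<bullet> grad phi x)"
  proof (rule integral_cong_AE)
   have mgp: "grad phi : borel_measurable ?M" by (rule continuous_measurable_Omega[OF cg])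
   show "(%x. weak_grad Omega ?Psi x \<bullet> grad phi x) : borel_measurable ?M"
    using H1_0_weak_grad(3)[OF open_Omega PsiH] mgp by (rule borel_measurable_inner)
   show "(%x. radial_grad (%r. K r / r ^ n) x \<bullet> grad phi x) : borel_measurable ?M"
    using radial_grad_measurable[OF cd] mgp by (rule borel_measurable_inner)
   show "AE x in ?M. weak_grad Omega ?Psi x \<bullet> grad phi x = radial_grad (%r. K r / r ^ n) x \<bullet> grad phi x"
    using wg by eventually_elim simp
  qed
  thus "(LINT x|?M. weak_grad Omega ?Psi x \<bullet> grad phi x) - (LINT x|?M. ?G x) = mu * (LINT x|?M. ?Psi x * phi x)"
   using G FW by simp
 qed
 have nonzero: "\<not> (AE x in ?M. ?Psi x = 0)"
 proof
  assume "AE x in ?M. ?Psi x = 0"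
  hence "AE x in ?M. False" using ne by eventually_elim simp
  thus False using not_AE_False by blast
 qed
 show ?thesis unfolding radial_eigenvalue_def
  by (rule bexI[where P="%psi. \<not> (AE x in ?M. psi x = 0)", OF nonzero mem])
qed

lemma profile_nonzero:
 assumes "\<not> (AE x in leb. psi x = 0)" "AE x in leb. psi x = y (norm x)"
 shows "EX t:{a..b} - {0}. y t ~= 0"
proof (rule ccontr)
 assume n0: "\<not> ?thesis"
 have "AE x in leb. psi x = 0" using assms(2) AE_radius
 proof eventually_elim
  case (elim x)
  hence "norm x : {a..b} - {0}" using a0 by auto
  thus ?case using elim n0 by auto
 qed
 thus False using assms(1) by blast
qed

text \<open>Two eigenfunctions both vanish at \<open>b\<close>; some nontrivial combination of them
  also has zero flux there and vanishes identically by \<open>sl_zero_data\<close>.\<close>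

lemma multiplicity_one:
 assumes ev: "radial_eigenvalue Omega alpha p u mu"
 shows "radial_multiplicity Omega alpha p u mu = 1"
proof (rule antisym)
 let ?M = "leb"
 show "radial_multiplicity Omega alpha p u mu <= 1"
  unfolding radial_multiplicity_def
 proof (rule Sup_least, clarify)
  fix k and psi :: "nat => real^'n => real"
  assume psi: "ALL i<k. psi i : radial_eigenspace Omega alpha p u mu" and ind: "independent_AE Omega k psi"
  have "\<not> 2 <= k"
  proof
   assume k: "2 <= k"
   obtain y0 K0 where y0: "AE x in ?M. psi 0 x = y0 (norm x)" "sl a b n (%r. q r + mu) y0 K0" "y0 b = 0"
    using eigenfunction_profile[of "psi 0" mu] psi k by auto
   obtain y1 K1 where y1: "AE x in ?M. psi 1 x = y1 (norm x)" "sl a b n (%r. q r + mu) y1 K1" "y1 b = 0"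
    using eigenfunction_profile[of "psi 1" mu] psi k by auto
   \<comment> \<open>Coefficients that cancel the flux at \<open>b\<close>; if both fluxes vanish
     there, any nontrivial choice works.\<close>
   define c where "c = (if K0 b = 0 & K1 b = 0 then 1 else K1 b)"
   define d where "d = (if K0 b = 0 & K1 b = 0 then 0 else - K0 b)"
   have cd: "c ~= 0 | d ~= 0" "c * K0 b + d * K1 b = 0" by (auto simp: c_def d_def)
   have z: "c * y0 r + d * y1 r = 0" if "r : {a..b} - {0}" for r
    using sl_zero_data[OF sl_lincomb[OF y0(2) y1(2), of c d], of b r] that y0(3) y1(3) cd(2) ab b0 by auto
   define e where "e = (%i::nat. if i = 0 then c else if i = 1 then d else 0)"
   have sum: "(\<Sum>i<k. e i * psi i x) = c * psi 0 x + d * psi 1 x" for x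
   proof -
    have "(\<Sum>i<k. e i * psi i x) = (\<Sum>i\<in>{0, 1}. e i * psi i x)"
     by (rule sum.mono_neutral_right) (use k in "auto simp: e_def")
    thus ?thesis by (simp add: e_def)
   qed
   have "AE x in ?M. (\<Sum>i<k. e i * psi i x) = 0"
    using y0(1) y1(1) AE_radius
   proof eventually_elim
    case (elim x)
    hence "norm x : {a..b} - {0}" using a0 by auto
    thus ?case unfolding sum using z elim by simp
   qed
   hence "ALL i<k. e i = 0" using ind unfolding independent_AE_def by blast
   hence "e 0 = 0" "e 1 = 0" using k by auto
   thus False using cd(1) by (simp add: e_def)
  qed
  thus "enat k <= 1" by (simp add: one_enat_def)
 qed
 obtain psi where psi: "psi : radial_eigenspace Omega alpha p u mu" "\<not> (AE x in ?M. psi x = 0)" using ev unfolding radial_eigenvalue_def by blast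
 have ind: "independent_AE Omega 1 (%_. psi)"
  unfolding independent_AE_def
 proof (intro allI impI)
  fix c :: "nat => real" and i :: nat
  assume ae: "AE x in ?M. (\<Sum>i<1. c i * psi x) = 0" and i: "i < 1"
  have "c 0 = 0"
  proof (rule ccontr)
   assume c0: "c 0 ~= 0"
   have "AE x in ?M. psi x = 0" using ae by eventually_elim (use c0 in simp)
   thus False using psi(2) by blast
  qed
  thus "c i = 0" using i by simp
 qed
 have "enat 1 <= radial_multiplicity Omega alpha p u mu"
  unfolding radial_multiplicity_def
 proof (intro Sup_upper CollectI exI conjI)
  show "enat 1 = enat 1" ..
  show "ALL i<1. psi : radial_eigenspace Omega alpha p u mu" using psi(1) by simp
  show "independent_AE Omega 1 (%_. psi)" by (rule ind)
 qed
 thus "1 <= radial_multiplicity Omega alpha p u mu" by (simp add: one_enat_def)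
qed

lemma sum_multiplicity:
 assumes "finite Lambda" "Lambda <= {mu. mu < 0 & radial_eigenvalue Omega alpha p u mu}"
 shows "(\<Sum>mu\<in>Lambda. radial_multiplicity Omega alpha p u mu) = enat (card Lambda)"
proof -
 have "(\<Sum>mu\<in>Lambda. radial_multiplicity Omega alpha p u mu) = (\<Sum>mu\<in>Lambda. 1)" by (rule sum.cong) (use assms multiplicity_one in auto)
 thus ?thesis by (simp add: of_nat_eq_enat)
qed

theorem Morse_index: "radial_Morse_index Omega alpha p u = enat zones"
 unfolding radial_Morse_index_def
proof (rule antisym)
 show "(SUP Lambda\<in>{Lambda. finite Lambda & Lambda <= {mu. mu < 0 & radial_eigenvalue Omega alpha p u mu}}. \<Sum>mu\<in>Lambda. radial_multiplicity Omega alpha p u mu) <= enat zones"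
 proof (rule SUP_least, clarify)
  fix Lambda assume Lambda: "finite Lambda" "Lambda <= {mu. mu < 0 & radial_eigenvalue Omega alpha p u mu}"
  have "card Lambda <= henon_profile.zones a b w"
  proof (rule henon_profile.negative_eigenvalues_le[OF prof Lambda(1)])
   fix mu assume "mu : Lambda"
   hence "mu < 0" "radial_eigenvalue Omega alpha p u mu" using Lambda(2) by auto
   then obtain psi where psi: "psi : radial_eigenspace Omega alpha p u mu" "\<not> (AE x in leb. psi x = 0)"
    unfolding radial_eigenvalue_def by blast
   obtain y K where y: "AE x in leb. psi x = y (norm x)" "sl a b n (%r. q r + mu) y K" "admissible a b n y K" "y b = 0"
    using eigenfunction_profile[OF psi(1)] by blast
   from profile_nonzero[OF psi(2) y(1)] y(2-) \<open>mu < 0\<close>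
   show "mu < 0 & (EX psi K. sl a b n (%r. henon_profile.q alpha p w r + mu) psi K & admissible a b n psi K & psi b = 0 & (EX t:{a..b} - {0}. psi t ~= 0))"
    unfolding q_eq by blast
  qed
  thus "(\<Sum>mu\<in>Lambda. radial_multiplicity Omega alpha p u mu) <= enat zones"
   unfolding sum_multiplicity[OF Lambda] zones_eq by simp
 qed
 obtain Lambda where Lambda: "finite Lambda" "card Lambda = henon_profile.zones a b w"
  "!!mu. mu : Lambda ==> mu < 0 & (EX psi K. sl a b n (%r. henon_profile.q alpha p w r + mu) psi K & regular_left a b n psi K & psi b = 0 & K b ~= 0
    & continuous_on {a..b} psi)"
  using henon_profile.negative_eigenvalues_ge[OF prof] by blast
 have sub: "Lambda <= {mu. mu < 0 & radial_eigenvalue Omega alpha p u mu}"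
 proof
  fix mu assume "mu : Lambda"
  from Lambda(3)[OF this] show "mu : {mu. mu < 0 & radial_eigenvalue Omega alpha p u mu}"
   unfolding q_eq[symmetric] using eigenfunction_exists by blast
 qed
 have "enat zones = (\<Sum>mu\<in>Lambda. radial_multiplicity Omega alpha p u mu)" unfolding sum_multiplicity[OF Lambda(1) sub] Lambda(2) zones_eq by simp
 also have "... <= (SUP Lambda\<in>{Lambda. finite Lambda & Lambda <= {mu. mu < 0 & radial_eigenvalue Omega alpha p u mu}}. \<Sum>mu\<in>Lambda. radial_multiplicity Omega alpha p u mu)"
  by (rule SUP_upper) (use Lambda(1) sub in blast)
 finally show "enat zones <= (SUP Lambda\<in>{Lambda. finite Lambda & Lambda <= {mu. mu < 0 & radial_eigenvalue Omega alpha p u mu}}. \<Sum>mu\<in>Lambda. radial_multiplicity Omega alpha p u mu)" .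
qed

theorem nondegenerate: "\<not> radially_degenerate Omega alpha p u"
proof
 assume "radially_degenerate Omega alpha p u"
 then obtain psi where psi: "psi : radial_eigenspace Omega alpha p u 0" "\<not> (AE x in leb. psi x = 0)"
  unfolding radially_degenerate_def by blast
 obtain y K where y: "AE x in leb. psi x = y (norm x)" "sl a b n (%r. q r + 0) y K" "admissible a b n y K" "y b = 0"
  using eigenfunction_profile[OF psi(1)] by blast
 have "sl a b n (henon_profile.q alpha p w) y K" using y(2) unfolding q_eq by simp
 from henon_profile.nondegenerate[OF prof this y(3,4)] profile_nonzero[OF psi(2) y(1)] show False by blast
qed

end

theorem theorem1p3:
  fixes \<Omega> :: "(real^'n) set" and \<alpha> p :: real and u :: "real^'n \<Rightarrow> real" and m :: nat
  assumes "CARD('n) \<ge> 2"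
    and "bounded_radial_domain \<Omega>"
    and "p > 1" and "\<alpha> \<ge> 0"
    and "u \<in> H1_0_rad \<Omega>"
    and "weak_henon_solution \<Omega> \<alpha> p u"
    and "m \<ge> 1"
    and "finite (nodal_zones \<Omega> u)" and "card (nodal_zones \<Omega> u) = m"
  shows "radial_Morse_index \<Omega> \<alpha> p u = enat m \<and> \<not> radially_degenerate \<Omega> \<alpha> p u"
proof -
  have "\<exists>a b. radial_domain \<Omega> a b"
    using assms(2) unfolding bounded_radial_domain_def
  proof (elim disjE exE conjE)
    fix R :: real assume "R > 0" "\<Omega> = ball 0 R"
    \<comment> \<open>The ball is the case \<open>a = 0\<close>, in which the inner condition is
      void.\<close>
    then have "radial_domain \<Omega> 0 R" by unfold_locales (use assms(1) in auto)
    then show ?thesis by blast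
  next
    fix a b :: real assume "0 < a" "a < b" "\<Omega> = {x. a < norm x \<and> norm x < b}"
    then have "radial_domain \<Omega> a b" by unfold_locales (use assms(1) in auto)
    then show ?thesis by blast
  qed
  then obtain a b where D: "radial_domain \<Omega> a b" by blast
  interpret radial_domain \<Omega> a b by (rule D)
  obtain w J where w: "henon_profile a b \<alpha> p n w J" "AE x in lebesgue_on \<Omega>. u x = w (norm x)"
    "m = Suc (card {t\<in>{a<..<b}. w t = 0})"
    using solution_profile[OF assms(3,4,5,6,8,9,7)] by blast
  interpret henon_solution \<Omega> a b \<alpha> p u w J 
    by (rule henon_solution.intro[OF D henon_solution_axioms.intro[OF w(1) assms(5) w(2)]])
  show ?thesis using Morse_index nondegenerate w(3) by (simp add: zones_def)
qed

end
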